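(* Let $f:[0,\infty)\to\mathbb R$ be $C^3$, $\ell>0$, $\beta_0\in\mathbb R$, and let $\phi_0$ be a nontrivial real-valued solution of $\phi_{xx}+f(\phi^2)\phi+\beta\phi=0$ on $[0,\ell]$ with $\beta=\beta_0$ and $\phi_0(0)=\phi_0(\ell)=0$. Let $L_+=-\partial_{xx}-2f'(\phi_0^2)\phi_0^2-f(\phi_0^2)-\beta_0$, $L_-=-\partial_{xx}-f(\phi_0^2)-\beta_0$ with Dirichlet boundary conditions, and assume $0\notin\operatorname{Spec}(L_-)\cap\operatorname{Spec}(L_+)$. Then there exists a unique one-parameter family of solutions $\beta\mapsto\hat\phi(\cdot;\beta)$ of $\phi_{xx}+f(\phi^2)\phi+\beta\phi=0$, defined in a neighbourhood of $\beta_0$, such that $\hat\phi(0;\beta)=\hat\phi(\ell;\beta)=0$ for all $\beta$ near $\beta_0$ and $\hat\phi(\cdot;\beta_0)=\phi_0$. Let $v=\phi_0\in\ker(L_-)$ and let $\widehat u\in H^2(0,\ell)\cap H^1_0(0,\ell)$ be the unique solution of $L_+\widehat u=v$. Then $$\int_0^\ell\widehat u\,v\,dx=\frac12\,\frac{\partial}{\partial\beta}\bigg|_{\beta=\beta_0}\int_0^\ell\hat\phi(x;\beta)^2\,dx. \tag{A}$$ More generally, if $\beta\mapsto\phi(\cdot;\beta)$ is any $C^1$ family of solutions of $\phi_{xx}+f(\phi^2)\phi+\beta\phi=0$ satisfying $\phi(\cdot;\beta_0)=\phi_0$, then $$\int_0^\ell\widehat u\,v\,dx=\frac12\frac{\partial}{\partial\beta}\bigg|_{\beta=\beta_0}\int_0^\ell\phi(x;\beta)^2\,dx+\big((-1)^Q\partial_\beta\phi(0;\beta_0)+\partial_\beta\phi(\ell;\beta_0)\big)\left(\frac{\partial_\beta\phi(0;\beta_0)+(-1)^Q\partial_\beta\phi(\ell;\beta_0)}{q(\ell)}+\partial_\beta\phi'(\ell;\beta_0)\right).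 \tag{B}$$ Furthermore, if $P=1$, $Q=0$ and the right-hand side of (A) or (B) is positive (resp. negative), then the standing wave $\widehat\psi(x,t)=e^{i\beta_0t}\phi_0(x)$ is spectrally unstable (resp. spectrally stable).
   Context: $L_\pm$ have domain $H^2(0,\ell)\cap H^1_0(0,\ell)\subset L^2(0,\ell)$; $P$ and $Q$ are the numbers of negative eigenvalues of $L_+$ and $L_-$. $q$ denotes the solution of the differential equation $L_+q=0$ with $q(0)=0$, $q'(0)=1$. Families are $C^1$ in $\beta$: $\hat\phi$ as a map from a neighbourhood of $\beta_0$ into $H^2(0,\ell)\cap H^1_0(0,\ell)$ (unique up to shrinking the neighbourhood), and $\phi(\cdot;\beta)$ as a map into $H^2(0,\ell)$. Prime is $d/dx$. $\widehat\psi$ is a standing wave of $i\psi_t=\psi_{xx}+f(|\psi|^2)\psi$; it is spectrally unstable if $N=\begin{pmatrix}0&-L_-\\L_+&0\end{pmatrix}$, with domain $(H^2(0,\ell)\cap H^1_0(0,\ell))^2$, has spectrum in the open right half plane, and spectrally stable otherwise. *)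

theory Defs
  imports "HOL-Analysis.Analysis"
begin

section \<open>Classical derivatives on a set\<close>

text \<open>On \<open>S = {0..l}\<close> or \<open>S = {0..}\<close> the derivative at a boundary point is the one-sided one.\<close>

definition deriv_on :: "real set \<Rightarrow> (real \<Rightarrow> 'v::real_normed_vector) \<Rightarrow> real \<Rightarrow> 'v" where
  "deriv_on S u = (\<lambda>x. vector_derivative u (at x within S))"

primrec C_on :: "nat \<Rightarrow> real set \<Rightarrow> (real \<Rightarrow> 'v::real_normed_vector) \<Rightarrow> bool" where
  "C_on 0 S u \<longleftrightarrow> continuous_on S u"
| "C_on (Suc k) S u \<longleftrightarrow> u differentiable_on S \<and> C_on k S (deriv_on S u)"


section \<open>Sobolev spaces on the interval (0, l)\<close>

text \<open>Elements of the spaces below are functions on \<open>real\<close> of which only the values in \<open>(0, l)\<close>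
  matter, and functions that agree almost everywhere there represent the same element; there is
  no passage to equivalence classes, so the norms are seminorms. Weak derivatives are tested
  against continuously differentiable functions of compact support, and \<open>H1_0\<close> is the closure of
  these functions in \<open>H1\<close>.\<close>

abbreviation leb :: "real \<Rightarrow> real measure" where
  "leb l \<equiv> lebesgue_on {0<..<l}"

definition L2 :: "real \<Rightarrow> (real \<Rightarrow> 'v::euclidean_space) set" where
  "L2 l = {u \<in> borel_measurable (leb l). integrable (leb l) (\<lambda>x. (norm (u x))\<^sup>2)}"

definition L2_norm :: "real \<Rightarrow> (real \<Rightarrow> 'v::euclidean_space) \<Rightarrow> real" where
  "L2_norm l u = sqrt (\<integral>x. (norm (u x))\<^sup>2 \<partial>leb l)"

definition test_functions :: "real \<Rightarrow> (real \<Rightarrow> 'v::euclidean_space) set" where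
  "test_functions l =
     {\<theta>. C_on 1 UNIV \<theta> \<and> (\<exists>a b. 0 < a \<and> b < l \<and> (\<forall>x. x \<notin> {a..b} \<longrightarrow> \<theta> x = 0))}"

definition is_weak_deriv ::
  "real \<Rightarrow> (real \<Rightarrow> 'v::euclidean_space) \<Rightarrow> (real \<Rightarrow> 'v) \<Rightarrow> bool" where
  "is_weak_deriv l u w \<longleftrightarrow>
     (\<forall>\<theta>\<in>test_functions l.
        (\<integral>x. deriv_on UNIV \<theta> x *\<^sub>R u x \<partial>leb l) = - (\<integral>x. (\<theta> x :: real) *\<^sub>R w x \<partial>leb l))"

definition H1 :: "real \<Rightarrow> (real \<Rightarrow> 'v::euclidean_space) set" where
  "H1 l = {u \<in> L2 l. \<exists>w\<in>L2 l. is_weak_deriv l u w}"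

text \<open>Meaningful for elements of \<open>H1\<close>, and then determined up to a null set.\<close>

definition weak_deriv ::
  "real \<Rightarrow> (real \<Rightarrow> 'v::euclidean_space) \<Rightarrow> real \<Rightarrow> 'v" where
  "weak_deriv l u = (SOME w. w \<in> L2 l \<and> is_weak_deriv l u w)"

definition H2 :: "real \<Rightarrow> (real \<Rightarrow> 'v::euclidean_space) set" where
  "H2 l = {u \<in> H1 l. weak_deriv l u \<in> H1 l}"

definition H1_norm :: "real \<Rightarrow> (real \<Rightarrow> 'v::euclidean_space) \<Rightarrow> real" where
  "H1_norm l u = sqrt ((L2_norm l u)\<^sup>2 + (L2_norm l (weak_deriv l u))\<^sup>2)"

definition H2_norm :: "real \<Rightarrow> (real \<Rightarrow> 'v::euclidean_space) \<Rightarrow> real" where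
  "H2_norm l u = sqrt ((L2_norm l u)\<^sup>2 + (L2_norm l (weak_deriv l u))\<^sup>2
                     + (L2_norm l (weak_deriv l (weak_deriv l u)))\<^sup>2)"

definition H1_0 :: "real \<Rightarrow> (real \<Rightarrow> 'v::euclidean_space) set" where
  "H1_0 l = {u \<in> H1 l. \<forall>e>0. \<exists>\<theta>\<in>test_functions l. H1_norm l (\<lambda>x. u x - \<theta> x) < e}"

text \<open>\<open>F\<close> is continuously differentiable on the open set \<open>I\<close>, as a map into the space \<open>X\<close> of
  functions with (semi)norm \<open>N\<close>.\<close>

definition C1_map_into ::
  "(real \<Rightarrow> 'v::euclidean_space) set \<Rightarrow> ((real \<Rightarrow> 'v) \<Rightarrow> real) \<Rightarrow> real set
     \<Rightarrow> (real \<Rightarrow> real \<Rightarrow> 'v) \<Rightarrow> bool" where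
  "C1_map_into X N I F \<longleftrightarrow>
     (\<forall>b\<in>I. F b \<in> X) \<and>
     (\<exists>G. (\<forall>b\<in>I. G b \<in> X) \<and>
          (\<forall>b\<in>I. ((\<lambda>c. N (\<lambda>x. (1 / (c - b)) *\<^sub>R (F c x - F b x) - G b x)) \<longlongrightarrow> 0) (at b)) \<and>
          (\<forall>b\<in>I. ((\<lambda>c. N (\<lambda>x. G c x - G b x)) \<longlongrightarrow> 0) (at b)))"


section \<open>The Dirichlet operators and their spectra\<close>

definition Dir_dom :: "real \<Rightarrow> (real \<Rightarrow> 'v::euclidean_space) set" where
  "Dir_dom l = H2 l \<inter> H1_0 l"

text \<open>The expression \<open>- u'' - W u\<close>; it serves both for real-valued and for complex-valued \<open>u\<close>.\<close>

definition schr :: "real \<Rightarrow> (real \<Rightarrow> real) \<Rightarrow> (real \<Rightarrow> 'v::euclidean_space) \<Rightarrow> real \<Rightarrow> 'v" where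
  "schr l W u = (\<lambda>x. - weak_deriv l (weak_deriv l u) x - W x *\<^sub>R u x)"

definition W_plus :: "(real \<Rightarrow> real) \<Rightarrow> real \<Rightarrow> (real \<Rightarrow> real) \<Rightarrow> real \<Rightarrow> real" where
  "W_plus f \<beta> \<phi> = (\<lambda>x. 2 * deriv_on {0..} f ((\<phi> x)\<^sup>2) * (\<phi> x)\<^sup>2 + f ((\<phi> x)\<^sup>2) + \<beta>)"

definition W_minus :: "(real \<Rightarrow> real) \<Rightarrow> real \<Rightarrow> (real \<Rightarrow> real) \<Rightarrow> real \<Rightarrow> real" where
  "W_minus f \<beta> \<phi> = (\<lambda>x. f ((\<phi> x)\<^sup>2) + \<beta>)"

abbreviation L_plus ::
  "(real \<Rightarrow> real) \<Rightarrow> real \<Rightarrow> real \<Rightarrow> (real \<Rightarrow> real) \<Rightarrow> (real \<Rightarrow> 'v::euclidean_space) \<Rightarrow> real \<Rightarrow> 'v" where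
  "L_plus f l \<beta> \<phi> \<equiv> schr l (W_plus f \<beta> \<phi>)"

abbreviation L_minus ::
  "(real \<Rightarrow> real) \<Rightarrow> real \<Rightarrow> real \<Rightarrow> (real \<Rightarrow> real) \<Rightarrow> (real \<Rightarrow> 'v::euclidean_space) \<Rightarrow> real \<Rightarrow> 'v" where
  "L_minus f l \<beta> \<phi> \<equiv> schr l (W_minus f \<beta> \<phi>)"

text \<open>For a linear map \<open>T\<close> from the subspace \<open>D\<close> of \<open>L2\<close> into \<open>L2\<close>: the map \<open>T\<close> is onto, and the
  estimate says that it is injective with bounded inverse (all modulo null sets).\<close>

definition boundedly_invertible ::
  "real \<Rightarrow> (real \<Rightarrow> 'v::euclidean_space) set \<Rightarrow> ((real \<Rightarrow> 'v) \<Rightarrow> real \<Rightarrow> 'v) \<Rightarrow> bool" where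
  "boundedly_invertible l D T \<longleftrightarrow>
     (\<forall>g\<in>L2 l. \<exists>u\<in>D. AE x in leb l. T u x = g x) \<and>
     (\<exists>C. \<forall>u\<in>D. L2_norm l u \<le> C * L2_norm l (T u))"

text \<open>Spectra and eigenvalues refer to complex-valued functions.\<close>

definition Spec ::
  "real \<Rightarrow> ((real \<Rightarrow> complex) \<Rightarrow> real \<Rightarrow> complex) \<Rightarrow> complex set" where
  "Spec l A = {\<mu>. \<not> boundedly_invertible l (Dir_dom l) (\<lambda>u x. A u x - \<mu> * u x)}"

definition eigenvalue ::
  "real \<Rightarrow> ((real \<Rightarrow> complex) \<Rightarrow> real \<Rightarrow> complex) \<Rightarrow> complex \<Rightarrow> bool" where
  "eigenvalue l A \<mu> \<longleftrightarrow>
     (\<exists>u\<in>Dir_dom l. \<not> (AE x in leb l. u x = 0) \<and> (AE x in leb l. A u x = \<mu> * u x))"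

text \<open>All Dirichlet eigenvalues of \<open>L_plus\<close> and \<open>L_minus\<close> are simple and only finitely many are
  negative, so counting them as elements of a set loses nothing.\<close>

definition num_neg_eigenvalues ::
  "real \<Rightarrow> ((real \<Rightarrow> complex) \<Rightarrow> real \<Rightarrow> complex) \<Rightarrow> nat" where
  "num_neg_eigenvalues l A = card {\<mu>::real. \<mu> < 0 \<and> eigenvalue l A (complex_of_real \<mu>)}"

abbreviation num_P :: "(real \<Rightarrow> real) \<Rightarrow> real \<Rightarrow> real \<Rightarrow> (real \<Rightarrow> real) \<Rightarrow> nat" where
  "num_P f l \<beta> \<phi> \<equiv> num_neg_eigenvalues l (L_plus f l \<beta> \<phi>)"

abbreviation num_Q :: "(real \<Rightarrow> real) \<Rightarrow> real \<Rightarrow> real \<Rightarrow> (real \<Rightarrow> real) \<Rightarrow> nat" where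
  "num_Q f l \<beta> \<phi> \<equiv> num_neg_eigenvalues l (L_minus f l \<beta> \<phi>)"

text \<open>The operator \<open>N (u, v) = (- L_minus v, L_plus u)\<close>. The space \<open>L2 \<times> L2\<close> is represented as the
  space of \<open>L2\<close> functions with values in \<open>complex \<times> complex\<close>.\<close>

definition N_dom :: "real \<Rightarrow> (real \<Rightarrow> complex \<times> complex) set" where
  "N_dom l = {w. (\<lambda>x. fst (w x)) \<in> Dir_dom l \<and> (\<lambda>x. snd (w x)) \<in> Dir_dom l}"

definition N_op ::
  "(real \<Rightarrow> real) \<Rightarrow> real \<Rightarrow> real \<Rightarrow> (real \<Rightarrow> real)
     \<Rightarrow> (real \<Rightarrow> complex \<times> complex) \<Rightarrow> real \<Rightarrow> complex \<times> complex" where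
  "N_op f l \<beta> \<phi> w =
     (\<lambda>x. (- L_minus f l \<beta> \<phi> (\<lambda>y. snd (w y)) x, L_plus f l \<beta> \<phi> (\<lambda>y. fst (w y)) x))"

definition Spec_N :: "(real \<Rightarrow> real) \<Rightarrow> real \<Rightarrow> real \<Rightarrow> (real \<Rightarrow> real) \<Rightarrow> complex set" where
  "Spec_N f l \<beta> \<phi> =
     {\<mu>. \<not> boundedly_invertible l (N_dom l)
           (\<lambda>w x. N_op f l \<beta> \<phi> w x - (\<mu> * fst (w x), \<mu> * snd (w x)))}"

text \<open>These are properties of the standing wave \<open>exp (i \<beta> t) \<phi>(x)\<close> of
  \<open>i \<psi>_t = \<psi>_xx + f(|\<psi>|^2) \<psi>\<close>, which is given by \<open>\<beta>\<close> and the real profile \<open>\<phi>\<close>.\<close>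

definition spectrally_unstable ::
  "(real \<Rightarrow> real) \<Rightarrow> real \<Rightarrow> real \<Rightarrow> (real \<Rightarrow> real) \<Rightarrow> bool" where
  "spectrally_unstable f l \<beta> \<phi> \<longleftrightarrow> (\<exists>\<mu>\<in>Spec_N f l \<beta> \<phi>. Re \<mu> > 0)"

definition spectrally_stable ::
  "(real \<Rightarrow> real) \<Rightarrow> real \<Rightarrow> real \<Rightarrow> (real \<Rightarrow> real) \<Rightarrow> bool" where
  "spectrally_stable f l \<beta> \<phi> \<longleftrightarrow> \<not> spectrally_unstable f l \<beta> \<phi>"


section \<open>Solutions and families of solutions\<close>

definition is_solution ::
  "(real \<Rightarrow> real) \<Rightarrow> real \<Rightarrow> real \<Rightarrow> (real \<Rightarrow> real) \<Rightarrow> bool" where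
  "is_solution f l \<beta> \<phi> \<longleftrightarrow>
     C_on 2 {0..l} \<phi> \<and>
     (\<forall>x\<in>{0..l}. deriv_on {0..l} (deriv_on {0..l} \<phi>) x + f ((\<phi> x)\<^sup>2) * \<phi> x + \<beta> * \<phi> x = 0)"

text \<open>The solution \<open>q\<close> of \<open>L_plus q = 0\<close>, \<open>q(0) = 0\<close>, \<open>q'(0) = 1\<close>; it need not satisfy the
  boundary condition at \<open>l\<close>.\<close>

definition is_q ::
  "(real \<Rightarrow> real) \<Rightarrow> real \<Rightarrow> real \<Rightarrow> (real \<Rightarrow> real) \<Rightarrow> (real \<Rightarrow> real) \<Rightarrow> bool" where
  "is_q f l \<beta> \<phi> q \<longleftrightarrow>
     C_on 2 {0..l} q \<and>
     (\<forall>x\<in>{0..l}. - deriv_on {0..l} (deriv_on {0..l} q) x - W_plus f \<beta> \<phi> x * q x = 0) \<and>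
     q 0 = 0 \<and> deriv_on {0..l} q 0 = 1"

text \<open>\<open>\<phi> \<beta>\<close> is the member of the family at the parameter \<open>\<beta>\<close>; the family is defined on
  \<open>ball \<beta>0 e\<close>. The members being classical solutions, their boundary values are the values at
  the end points.\<close>

definition family ::
  "(real \<Rightarrow> real) \<Rightarrow> real \<Rightarrow> real \<Rightarrow> (real \<Rightarrow> real) \<Rightarrow> real \<Rightarrow> (real \<Rightarrow> real \<Rightarrow> real) \<Rightarrow> bool" where
  "family f l \<beta>0 \<phi>0 e \<phi> \<longleftrightarrow>
     0 < e \<and>
     C1_map_into (H2 l) (H2_norm l) (ball \<beta>0 e) \<phi> \<and>
     (\<forall>\<beta>\<in>ball \<beta>0 e. is_solution f l \<beta> (\<phi> \<beta>)) \<and>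
     (\<forall>x\<in>{0..l}. \<phi> \<beta>0 x = \<phi>0 x)"

definition Dirichlet_family ::
  "(real \<Rightarrow> real) \<Rightarrow> real \<Rightarrow> real \<Rightarrow> (real \<Rightarrow> real) \<Rightarrow> real \<Rightarrow> (real \<Rightarrow> real \<Rightarrow> real) \<Rightarrow> bool" where
  "Dirichlet_family f l \<beta>0 \<phi>0 e \<phi> \<longleftrightarrow>
     0 < e \<and>
     C1_map_into (Dir_dom l) (H2_norm l) (ball \<beta>0 e) \<phi> \<and>
     (\<forall>\<beta>\<in>ball \<beta>0 e. is_solution f l \<beta> (\<phi> \<beta>) \<and> \<phi> \<beta> 0 = 0 \<and> \<phi> \<beta> l = 0) \<and>
     (\<forall>x\<in>{0..l}. \<phi> \<beta>0 x = \<phi>0 x)"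

definition mass :: "real \<Rightarrow> (real \<Rightarrow> real) \<Rightarrow> real" where
  "mass l \<phi> = (\<integral>x. (\<phi> x)\<^sup>2 \<partial>leb l)"

definition rhs_A :: "real \<Rightarrow> real \<Rightarrow> (real \<Rightarrow> real \<Rightarrow> real) \<Rightarrow> real" where
  "rhs_A l \<beta>0 \<phi> = 1 / 2 * deriv (\<lambda>\<beta>. mass l (\<phi> \<beta>)) \<beta>0"

definition rhs_B ::
  "real \<Rightarrow> real \<Rightarrow> nat \<Rightarrow> (real \<Rightarrow> real) \<Rightarrow> (real \<Rightarrow> real \<Rightarrow> real) \<Rightarrow> real" where
  "rhs_B l \<beta>0 Q q \<phi> =
     1 / 2 * deriv (\<lambda>\<beta>. mass l (\<phi> \<beta>)) \<beta>0
     + ((-1) ^ Q * deriv (\<lambda>\<beta>. \<phi> \<beta> 0) \<beta>0 + deriv (\<lambda>\<beta>. \<phi> \<beta> l) \<beta>0)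
       * ((deriv (\<lambda>\<beta>. \<phi> \<beta> 0) \<beta>0 + (-1) ^ Q * deriv (\<lambda>\<beta>. \<phi> \<beta> l) \<beta>0) / q l
          + deriv (\<lambda>\<beta>. deriv_on {0..l} (\<phi> \<beta>) l) \<beta>0)"

end

theory Submission
  imports Defs
begin

text \<open>The linearization of the profile equation at \<open>\<phi>0\<close> is \<open>L_+\<close>. For a family \<open>\<phi>\<close> of solutions
through \<open>\<phi>0\<close> the derivative \<open>G = \<partial>_\<beta> \<phi>\<close> at \<open>\<beta>0\<close> satisfies the
differential equation \<open>L_+ G = \<phi>0\<close>, and half the derivative of the mass is the integral of \<open>G \<phi>0\<close>
(\<open>family_derivative\<close>). The function \<open>u\<close> with \<open>L_+ u = \<phi>0\<close> solves the same differential
equation with Dirichlet conditions. If the family satisfies the Dirichlet conditions, then so does \<open>G\<close>, hence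
\<open>G = u\<close>, which is (A). In general \<open>G - u\<close> solves \<open>L_+ y = 0\<close> as a differential equation. The
solutions of the latter are the combinations of \<open>q\<close> and \<open>\<phi>0'\<close>, because the profile equation is autonomous,
and Green's identity expresses the integral of \<open>(u - G) \<phi>0\<close> by boundary values (\<open>boundary_correction\<close>).
The sign \<open>(-1)^Q\<close> is that of \<open>- \<phi>0'(l) / \<phi>0'(0)\<close>: conservation of energy makes this quotient
\<open>1\<close> or \<open>-1\<close>, and its sign is given by the parity of the number of interior zeros of \<open>\<phi>0\<close>, which
by Sturm oscillation is the number of negative eigenvalues of \<open>L_-\<close>, as the kernel of \<open>L_-\<close> contains
\<open>\<phi>0\<close> (\<open>profile_end_slopes\<close>, \<open>sturm_oscillation\<close>). Since \<open>0\<close> lies in the spectrum of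
\<open>L_-\<close>, the spectral hypothesis says that \<open>L_+\<close> is invertible, that is, \<open>q(l) \<noteq> 0\<close>.

Invertibility of \<open>L_+\<close> also yields the Dirichlet family. Solutions near \<open>\<phi>0\<close> come from shooting and the
intermediate value theorem (\<open>shooting_family\<close>). The a priori estimate for \<open>L_+\<close> (\<open>dirichlet_bound\<close>)
absorbs the nonlinear remainder; this makes them unique and continuously differentiable in \<open>\<beta>\<close>
(\<open>dirichlet_family_exists\<close>).

Now let \<open>P = 1\<close> and \<open>Q = 0\<close>, and let \<open>I\<close> be the integral of \<open>u \<phi>0\<close>. For
\<open>I < 0\<close> the form of \<open>L_+\<close> is nonnegative on the orthogonal complement of \<open>\<phi>0\<close>, as
\<open>u\<close> uses up its one negative direction (\<open>form_nonneg_on_complement\<close>), while the form of \<open>L_-\<close> is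
nonnegative everywhere, as \<open>\<phi>0\<close> has no interior zero. Both statements follow from Jacobi's identity for positive solutions
(\<open>jacobi_nonneg\<close>), and they exclude eigenfunctions of \<open>N\<close> for \<open>Re \<mu> > 0\<close>
(\<open>no_unstable_eigenfunction\<close>). For \<open>I > 0\<close> the determinant \<open>D(\<mu>)\<close> that detects real eigenvalues
\<open>\<mu>\<close> of \<open>N\<close> is positive for large \<open>\<mu>\<close> and, by second order perturbation, has the sign of
\<open>- I\<close> for small \<open>\<mu> > 0\<close>, so that it vanishes in between (\<open>unstable_eigenfunction_exists\<close>).

The hypotheses and conclusions speak of weak derivatives, almost everywhere equality and resolvent sets. A function in \<open>H2\<close> has
a continuously differentiable representative whose end point values decide membership in \<open>H1_0\<close> (\<open>H2_rep_exists\<close>,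
\<open>Dir_dom_iff\<close>), so that equations with continuous data become classical boundary value problems
(\<open>schr_regularity\<close>). For the resolvent of \<open>N\<close>, shooting is a linear map of a finite dimensional space, so that
uniqueness for the homogeneous boundary value problem gives a bounded inverse (\<open>N_boundedly_invertible\<close>).\<close>

section \<open>Ordinary differential equations\<close>

lemma nondecreasing_within:
  fixes h :: "real \<Rightarrow> real"
  assumes d: "\<And>x. x \<in> {a..b} \<Longrightarrow> (h has_real_derivative h' x) (at x within {a..b})"
    and n: "\<And>x. x \<in> {a..b} \<Longrightarrow> 0 \<le> h' x"
    and "a \<le> s" "s \<le> t" "t \<le> b"
  shows "h s \<le> h t"
proof (rule DERIV_nonneg_imp_increasing_open[OF \<open>s \<le> t\<close>])
  fix x assume x: "s < x" "x < t"
  then have "(h has_real_derivative h' x) (at x within {a..b})"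
    using d assms by auto
  moreover have "at x within {a..b} = at x"
    using x assms by (intro at_within_interior) auto
  ultimately show "\<exists>y. (h has_real_derivative y) (at x) \<and> 0 \<le> y"
    using n[of x] x assms by auto
next
  have "continuous_on {a..b} h"
    using d by (meson continuous_on_eq_continuous_within DERIV_continuous)
  then show "continuous_on {s..t} h"
    by (rule continuous_on_subset) (use assms in auto)
qed

text \<open>The Picard iteration is a contraction on the whole interval in the weighted norm \<open>sup exp (- k x) |Y x|\<close> with
  \<open>k\<close> more than twice the Lipschitz constant, so that a global solution comes from one fixed point. Substituting
  \<open>Y x = exp (k x) z x\<close> turns the weighted norm into the supremum norm of \<open>z\<close>.\<close>

lemma ode_exists:
  fixes F :: "real \<Rightarrow> 'a::euclidean_space \<Rightarrow> 'a"
  assumes l: "0 \<le> l"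
    and cont: "continuous_on ({0..l} \<times> UNIV) (\<lambda>(x,y). F x y)"
    and lip: "\<And>x y z. x \<in> {0..l} \<Longrightarrow> norm (F x y - F x z) \<le> K * norm (y - z)"
  shows "\<exists>Y. Y 0 = y0 \<and> (\<forall>x\<in>{0..l}. (Y has_vector_derivative F x (Y x)) (at x within {0..l}))"
proof -
  define k where "k = 2 * (\<bar>K\<bar> + 1)"
  have k: "k > 0" "\<bar>K\<bar> / k \<le> 1/2" by (auto simp: k_def field_simps)
  \<comment> \<open>clamping makes the iterates bounded continuous functions on the whole line\<close>
  define c where "c x = max 0 (min x l)" for x
  have c: "c x \<in> {0..l}" for x using l by (auto simp: c_def)
  have cid: "c x = x" if "x \<in> {0..l}" for x using that by (auto simp: c_def)
  have contF: "continuous_on {0..l} (\<lambda>s. F s (w s))" if "continuous_on {0..l} w" for w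
  proof -
    have "continuous_on {0..l} (\<lambda>s. (\<lambda>(x,y). F x y) (s, w s))"
      by (rule continuous_on_compose2[OF cont]) (auto intro!: continuous_intros that)
    then show ?thesis by simp
  qed
  define h where "h z x = exp (- k * x) *\<^sub>R (y0 + integral {0..x} (\<lambda>s. F s (exp (k * s) *\<^sub>R z s)))" for z x
  have contz: "continuous_on {0..l} (\<lambda>s. F s (exp (k * s) *\<^sub>R apply_bcontfun z s))" for z
    by (intro contF continuous_intros continuous_on_apply_bcontfun)
  have conth: "continuous_on {0..l} (h (apply_bcontfun z))" for z
  proof -
    have "continuous_on {0..l} (\<lambda>x. integral {0..x} (\<lambda>s. F s (exp (k * s) *\<^sub>R z s)))"
      by (intro indefinite_integral_continuous_1 integrable_continuous_interval contz)
    then show ?thesis unfolding h_def by (intro continuous_intros)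
  qed
  define S where "S z = Bcontfun (\<lambda>x. h (apply_bcontfun z) (c x))" for z
  have Sapp: "apply_bcontfun (S z) x = h z (c x)" for z x
  proof -
    have "continuous_on UNIV (\<lambda>x. h z (c x))"
      by (rule continuous_on_compose2[OF conth]) (use c in \<open>auto simp: c_def intro!: continuous_intros\<close>)
    moreover have "bounded (range (\<lambda>x. h z (c x)))"
    proof (rule bounded_subset)
      show "bounded (h z ` {0..l})"
        by (intro compact_imp_bounded compact_continuous_image conth) auto
    qed (use c in auto)
    ultimately have "(\<lambda>x. h z (c x)) \<in> bcontfun" by (simp add: bcontfun_def)
    then show ?thesis by (simp add: S_def Bcontfun_inverse)
  qed
  have contr: "dist (S z1) (S z2) \<le> 1/2 * dist z1 z2" for z1 z2
  proof (rule dist_bound)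
    fix x
    define t where "t = c x"
    have t: "t \<in> {0..l}" unfolding t_def by (rule c)
    define d where "d = dist z1 z2"
    have int: "(\<lambda>s. F s (exp (k * s) *\<^sub>R apply_bcontfun z s)) integrable_on {0..t}" for z
      using contz[of z] t by (intro integrable_continuous_interval) (auto elim: continuous_on_subset)
    have hi: "((\<lambda>s. \<bar>K\<bar> * d * exp (k * s)) has_integral \<bar>K\<bar> * d * exp (k*t) / k - \<bar>K\<bar> * d * exp (k*0) / k) {0..t}"
      using t k by (intro fundamental_theorem_of_calculus)
        (auto intro!: derivative_eq_intros simp: has_real_derivative_iff_has_vector_derivative[symmetric])
    have "norm (integral {0..t} (\<lambda>s. F s (exp (k * s) *\<^sub>R z1 s) - F s (exp (k * s) *\<^sub>R z2 s)))
          \<le> integral {0..t} (\<lambda>s. \<bar>K\<bar> * d * exp (k * s))"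
    proof (rule integral_norm_bound_integral)
      fix s assume s: "s \<in> {0..t}"
      have "norm (F s (exp (k * s) *\<^sub>R z1 s) - F s (exp (k * s) *\<^sub>R z2 s)) \<le> K * norm (exp (k * s) *\<^sub>R z1 s - exp (k * s) *\<^sub>R z2 s)"
        using s t by (intro lip) auto
      also have "\<dots> \<le> \<bar>K\<bar> * norm (exp (k * s) *\<^sub>R z1 s - exp (k * s) *\<^sub>R z2 s)"
        by (intro mult_right_mono) auto
      also have "norm (exp (k * s) *\<^sub>R z1 s - exp (k * s) *\<^sub>R z2 s) = exp (k * s) * dist (z1 s) (z2 s)"
        by (simp add: dist_norm flip: scaleR_diff_right)
      also have "\<bar>K\<bar> * (exp (k * s) * dist (z1 s) (z2 s)) \<le> \<bar>K\<bar> * (exp (k * s) * d)"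
        unfolding d_def by (intro mult_left_mono dist_bounded) auto
      finally show "norm (F s (exp (k * s) *\<^sub>R z1 s) - F s (exp (k * s) *\<^sub>R z2 s)) \<le> \<bar>K\<bar> * d * exp (k * s)"
        by (simp add: mult_ac)
    qed (use int hi in \<open>auto intro!: integrable_diff\<close>)
    also have "integral {0..t} (\<lambda>s. \<bar>K\<bar> * d * exp (k * s)) = \<bar>K\<bar> * d * exp (k*t) / k - \<bar>K\<bar> * d / k"
      using integral_unique[OF hi] by simp
    also have "\<dots> \<le> \<bar>K\<bar> * d * exp (k*t) / k" using k by (simp add: d_def)
    finally have *: "norm (integral {0..t} (\<lambda>s. F s (exp (k * s) *\<^sub>R z1 s) - F s (exp (k * s) *\<^sub>R z2 s))) \<le> \<bar>K\<bar> * d * exp (k*t) / k" .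
    have "dist (S z1 x) (S z2 x) = exp (-k*t) * norm (integral {0..t} (\<lambda>s. F s (exp (k * s) *\<^sub>R z1 s)) - integral {0..t} (\<lambda>s. F s (exp (k * s) *\<^sub>R z2 s)))"
      by (simp add: Sapp h_def dist_norm t_def flip: scaleR_diff_right)
    also have "\<dots> = exp (-k*t) * norm (integral {0..t} (\<lambda>s. F s (exp (k * s) *\<^sub>R z1 s) - F s (exp (k * s) *\<^sub>R z2 s)))"
      using int by (simp add: integral_diff)
    also have "\<dots> \<le> exp (-k*t) * (\<bar>K\<bar> * d * exp (k*t) / k)"
      by (intro mult_left_mono *) auto
    also have "\<dots> = \<bar>K\<bar> / k * d" by (simp add: exp_minus field_simps)
    also have "\<dots> \<le> 1/2 * d" using k by (intro mult_right_mono) (auto simp: d_def)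
    finally show "dist (S z1 x) (S z2 x) \<le> 1/2 * dist z1 z2" by (simp add: d_def)
  qed
  obtain z where z: "S z = z"
    using banach_fix_type[of "1/2" S] contr by auto
  define Y where "Y x = exp (k*x) *\<^sub>R apply_bcontfun z x" for x
  have contY: "continuous_on {0..l} Y"
    unfolding Y_def by (intro continuous_intros continuous_on_apply_bcontfun)
  have Yint: "Y x = y0 + integral {0..x} (\<lambda>s. F s (Y s))" if "x \<in> {0..l}" for x
  proof -
    have "apply_bcontfun z x = h z (c x)" using Sapp[of z x] z by simp
    then have "Y x = exp (k*x) *\<^sub>R h z x" using cid[OF that] by (simp add: Y_def)
    also have "\<dots> = (exp (k*x) * exp (-k*x)) *\<^sub>R (y0 + integral {0..x} (\<lambda>s. F s (Y s)))"
      unfolding h_def Y_def scaleR_scaleR ..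
    also have "exp (k*x) * exp (-k*x) = 1" using exp_minus_inverse[of "k*x"] by simp
    finally show ?thesis by simp
  qed
  show ?thesis
  proof (intro exI conjI ballI)
    show "Y 0 = y0" using Yint[of 0] l by simp
    fix x assume x: "x \<in> {0..l}"
    have "((\<lambda>x. y0 + integral {0..x} (\<lambda>s. F s (Y s))) has_vector_derivative F x (Y x)) (at x within {0..l})"
      using integral_has_vector_derivative[OF contF[OF contY] x]
      by (auto intro!: derivative_eq_intros)
    then show "(Y has_vector_derivative F x (Y x)) (at x within {0..l})"
      by (rule has_vector_derivative_transform[OF x, rotated]) (simp add: Yint)
  qed
qed

text \<open>Differentiating \<open>|Y|\<^sup>2 + e\<^sup>2\<close> instead of \<open>|Y|\<close> avoids the zeros of \<open>Y\<close>; the cross term \<open>2 e |Y|\<close> is absorbed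
  by \<open>|Y|\<^sup>2 + e\<^sup>2\<close>, which is the origin of the summand \<open>1\<close> in the exponent.\<close>

lemma gronwall:
  fixes Y :: "real \<Rightarrow> 'a::euclidean_space"
  assumes d: "\<And>x. x \<in> {0..l} \<Longrightarrow> (Y has_vector_derivative Y' x) (at x within {0..l})"
    and b: "\<And>x. x \<in> {0..l} \<Longrightarrow> norm (Y' x) \<le> K * norm (Y x) + e"
    and K: "0 \<le> K" and e: "0 \<le> e" and x: "x \<in> {0..l}"
  shows "(norm (Y x))\<^sup>2 + e\<^sup>2 \<le> ((norm (Y 0))\<^sup>2 + e\<^sup>2) * exp ((2*K+1)*x)"
proof -
  define H where "H x = - ((Y x \<bullet> Y x + e\<^sup>2) * exp (- (2*K+1)*x))" for x
  define H' where "H' x = - ((2 * (Y x \<bullet> Y' x)) * exp (- (2*K+1)*x) - (Y x \<bullet> Y x + e\<^sup>2) * ((2*K+1) * exp (- (2*K+1)*x)))" for x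
  have "H 0 \<le> H x"
  proof (rule nondecreasing_within[of 0 l H H'])
    fix x assume x: "x \<in> {0..l}"
    have "((\<lambda>x. Y x \<bullet> Y x) has_vector_derivative (Y x \<bullet> Y' x + Y' x \<bullet> Y x)) (at x within {0..l})"
      using bounded_bilinear.has_vector_derivative[OF bounded_bilinear_inner d[OF x] d[OF x]] .
    then have "((\<lambda>x. Y x \<bullet> Y x) has_real_derivative (2 * (Y x \<bullet> Y' x))) (at x within {0..l})"
      by (simp add: has_real_derivative_iff_has_vector_derivative inner_commute)
    then show "(H has_real_derivative H' x) (at x within {0..l})"
      unfolding H_def H'_def by (auto intro!: derivative_eq_intros simp: algebra_simps)
    have "2 * (Y x \<bullet> Y' x) \<le> 2 * (norm (Y x) * norm (Y' x))"
      by (intro mult_left_mono Cauchy_Schwarz_ineq2[THEN order_trans[OF abs_ge_self]]) auto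
    also have "\<dots> \<le> 2 * (norm (Y x) * (K * norm (Y x) + e))"
      by (intro mult_left_mono b x) auto
    also have "\<dots> \<le> 2*K*(norm (Y x))\<^sup>2 + (norm (Y x))\<^sup>2 + e\<^sup>2"
      using sum_squares_bound[of "norm (Y x)" e] by (simp add: algebra_simps power2_eq_square)
    also have "\<dots> \<le> (2*K+1) * ((norm (Y x))\<^sup>2 + e\<^sup>2)"
      using K by (simp add: algebra_simps)
    finally have "2 * (Y x \<bullet> Y' x) \<le> (2*K+1) * (Y x \<bullet> Y x + e\<^sup>2)"
      by (simp add: power2_norm_eq_inner)
    then have "0 \<le> ((2*K+1) * (Y x \<bullet> Y x + e\<^sup>2) - 2 * (Y x \<bullet> Y' x)) * exp (- (2*K+1)*x)"
      by (intro mult_nonneg_nonneg) auto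
    then show "0 \<le> H' x" by (simp add: H'_def algebra_simps)
  qed (use x in auto)
  then have "(Y x \<bullet> Y x + e\<^sup>2) * exp (- (2*K+1)*x) \<le> Y 0 \<bullet> Y 0 + e\<^sup>2" by (simp add: H_def)
  then have "(Y x \<bullet> Y x + e\<^sup>2) * exp (- (2*K+1)*x) * exp ((2*K+1)*x) \<le> (Y 0 \<bullet> Y 0 + e\<^sup>2) * exp ((2*K+1)*x)"
    by (intro mult_right_mono) auto
  moreover have "exp (- (2*K+1)*x) * exp ((2*K+1)*x) = 1"
    by (simp add: algebra_simps flip: exp_add)
  ultimately show ?thesis by (simp only: power2_norm_eq_inner mult.assoc mult_1_right)
qed

text \<open>The derivatives are carried as explicit functions, so that an equation \<open>u'' = F(x, u)\<close> is a statement about the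
  last argument, and boundary slopes are values of \<open>p\<close>.\<close>

definition twice_deriv :: "real \<Rightarrow> (real \<Rightarrow> 'v::real_normed_vector) \<Rightarrow> (real \<Rightarrow> 'v) \<Rightarrow> (real \<Rightarrow> 'v) \<Rightarrow> bool" where
  "twice_deriv l u p s \<longleftrightarrow>
     (\<forall>x\<in>{0..l}. (u has_vector_derivative p x) (at x within {0..l}) \<and>
                 (p has_vector_derivative s x) (at x within {0..l}))"

lemma twice_derivD:
  assumes "twice_deriv l u p s" "x \<in> {0..l}"
  shows "(u has_vector_derivative p x) (at x within {0..l})"
    and "(p has_vector_derivative s x) (at x within {0..l})"
  using assms by (auto simp: twice_deriv_def)

lemma twice_deriv_continuous:
  assumes "twice_deriv l u p s"
  shows "continuous_on {0..l} u" "continuous_on {0..l} p"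
  by (rule continuous_on_vector_derivative, erule twice_derivD[OF assms])+

lemma twice_deriv_cong:
  assumes "twice_deriv l u p s" "\<And>x. x \<in> {0..l} \<Longrightarrow> s x = s' x"
  shows "twice_deriv l u p s'"
  using assms by (auto simp: twice_deriv_def)

lemma twice_deriv_lincomb:
  assumes "twice_deriv l u p s" "twice_deriv l u' p' s'"
  shows "twice_deriv l (\<lambda>x. a *\<^sub>R u x + b *\<^sub>R u' x) (\<lambda>x. a *\<^sub>R p x + b *\<^sub>R p' x) (\<lambda>x. a *\<^sub>R s x + b *\<^sub>R s' x)"
  using assms unfolding twice_deriv_def
  by (auto intro!: has_vector_derivative_add bounded_linear.has_vector_derivative[OF bounded_linear_scaleR_right])

lemma twice_deriv_diff:
  assumes "twice_deriv l u p s" "twice_deriv l u' p' s'"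
  shows "twice_deriv l (\<lambda>x. u x - u' x) (\<lambda>x. p x - p' x) (\<lambda>x. s x - s' x)"
  using assms unfolding twice_deriv_def by (auto intro!: has_vector_derivative_diff)

lemma twice_deriv_bounded_linear:
  assumes "twice_deriv l u p s" "bounded_linear f"
  shows "twice_deriv l (\<lambda>x. f (u x)) (\<lambda>x. f (p x)) (\<lambda>x. f (s x))"
  using assms(1) bounded_linear.has_vector_derivative[OF assms(2)] unfolding twice_deriv_def by blast

lemma ode2_exists:
  fixes G :: "real \<Rightarrow> 'v::euclidean_space \<Rightarrow> 'v"
  assumes l: "0 \<le> l"
    and cont: "continuous_on ({0..l} \<times> UNIV) (\<lambda>(x,y). G x y)"
    and lip: "\<And>x y z. x \<in> {0..l} \<Longrightarrow> norm (G x y - G x z) \<le> K * norm (y - z)"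
  shows "\<exists>u p. u 0 = a \<and> p 0 = b \<and> twice_deriv l u p (\<lambda>x. G x (u x))"
proof -
  define F where "F x Y = (snd Y, G x (fst Y))" for x and Y :: "'v \<times> 'v"
  have "\<exists>Y. Y 0 = (a,b) \<and> (\<forall>x\<in>{0..l}. (Y has_vector_derivative F x (Y x)) (at x within {0..l}))"
  proof (rule ode_exists[OF l])
    have "continuous_on ({0..l} \<times> (UNIV :: ('v \<times> 'v) set)) (\<lambda>z. (\<lambda>(x,y). G x y) (fst z, fst (snd z)))"
      by (rule continuous_on_compose2[OF cont]) (auto intro!: continuous_intros)
    then show "continuous_on ({0..l} \<times> UNIV) (\<lambda>(x,y). F x y)"
      unfolding F_def case_prod_unfold by (intro continuous_intros) simp_all
    fix x and Y Z :: "'v \<times> 'v" assume x: "x \<in> {0..l}"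
    have "norm (F x Y - F x Z) \<le> norm (snd Y - snd Z) + norm (G x (fst Y) - G x (fst Z))"
      unfolding F_def by (simp add: norm_Pair_le)
    also have "norm (snd Y - snd Z) \<le> norm (Y - Z)" using norm_snd_le[where x="fst Y - fst Z" and y="snd Y - snd Z"]
      by (simp add: minus_prod_def)
    also have "norm (G x (fst Y) - G x (fst Z)) \<le> \<bar>K\<bar> * norm (fst Y - fst Z)"
      using lip[OF x, of "fst Y" "fst Z"] by (meson abs_ge_self dual_order.trans mult_right_mono norm_ge_zero)
    also have "\<bar>K\<bar> * norm (fst Y - fst Z) \<le> \<bar>K\<bar> * norm (Y - Z)"
      by (rule mult_left_mono) (use norm_fst_le[where x="fst Y - fst Z" and y="snd Y - snd Z"] in
        \<open>simp_all add: minus_prod_def\<close>)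
    finally show "norm (F x Y - F x Z) \<le> (1 + \<bar>K\<bar>) * norm (Y - Z)"
      by (simp add: distrib_right)
  qed
  then obtain Y where Y: "Y 0 = (a,b)" "\<And>x. x\<in>{0..l} \<Longrightarrow> (Y has_vector_derivative F x (Y x)) (at x within {0..l})"
    by blast
  have "twice_deriv l (\<lambda>x. fst (Y x)) (\<lambda>x. snd (Y x)) (\<lambda>x. G x (fst (Y x)))"
    unfolding twice_deriv_def
  proof (intro ballI conjI)
    fix x assume "x \<in> {0..l}"
    from bounded_linear.has_vector_derivative[OF bounded_linear_fst Y(2)[OF this]]
      bounded_linear.has_vector_derivative[OF bounded_linear_snd Y(2)[OF this]]
    show "((\<lambda>x. fst (Y x)) has_vector_derivative snd (Y x)) (at x within {0..l})"
      "((\<lambda>x. snd (Y x)) has_vector_derivative G x (fst (Y x))) (at x within {0..l})"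
      by (auto simp: F_def)
  qed
  then show ?thesis using Y(1) by (intro exI[of _ "\<lambda>x. fst (Y x)"] exI[of _ "\<lambda>x. snd (Y x)"]) auto
qed

text \<open>The factor by which a second order equation with Lipschitz constant \<open>K\<close> can amplify data on an interval of
  length \<open>l\<close>.\<close>

definition growth_const :: "real \<Rightarrow> real \<Rightarrow> real" where
  "growth_const K l = exp ((2*K+3)*l)"

lemma gronwall2:
  fixes u :: "real \<Rightarrow> 'v::euclidean_space"
  assumes t: "twice_deriv l u p s"
    and b: "\<And>x. x \<in> {0..l} \<Longrightarrow> norm (s x) \<le> K * norm (u x) + e"
    and K: "0 \<le> K" and e: "0 \<le> e" and x: "x \<in> {0..l}"
  shows "norm (u x) \<le> growth_const K l * (norm (u 0) + norm (p 0) + e)"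
    and "norm (p x) \<le> growth_const K l * (norm (u 0) + norm (p 0) + e)"
proof -
  define N where "N = norm (u 0) + norm (p 0) + e"
  have N: "0 \<le> N" using e by (simp add: N_def)
  define Y where "Y x = (u x, p x)" for x
  have "(norm (Y x))\<^sup>2 + e\<^sup>2 \<le> ((norm (Y 0))\<^sup>2 + e\<^sup>2) * exp ((2*(1+K)+1)*x)"
  proof (rule gronwall[where Y' = "\<lambda>x. (p x, s x)" and l = l])
    fix x assume x: "x \<in> {0..l}"
    show "(Y has_vector_derivative (p x, s x)) (at x within {0..l})"
      unfolding Y_def using twice_derivD[OF t x] by (intro has_vector_derivative_Pair)
    have "norm (p x, s x) \<le> norm (p x) + norm (s x)" by (rule norm_Pair_le)
    also have "norm (p x) \<le> norm (Y x)" unfolding Y_def by (rule norm_snd_le)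
    also have "norm (s x) \<le> K * norm (u x) + e" by (rule b[OF x])
    also have "K * norm (u x) \<le> K * norm (Y x)" unfolding Y_def by (rule mult_left_mono[OF norm_fst_le K])
    finally show "norm (p x, s x) \<le> (1+K) * norm (Y x) + e"
      by (simp add: distrib_right)
  qed (use x K e in auto)
  also have "\<dots> \<le> N\<^sup>2 * (growth_const K l)\<^sup>2"
  proof (rule mult_mono)
    show "(norm (Y 0))\<^sup>2 + e\<^sup>2 \<le> N\<^sup>2"
      unfolding Y_def N_def using e by (simp add: norm_Pair power2_sum)
    have "exp ((2*(1+K)+1)*x) \<le> growth_const K l"
      unfolding growth_const_def using x K by (auto intro!: mult_mono)
    also have "\<dots> \<le> (growth_const K l)\<^sup>2"
      using x K by (simp add: growth_const_def power2_eq_square)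
    finally show "exp ((2*(1+K)+1)*x) \<le> (growth_const K l)\<^sup>2" .
  qed auto
  finally have "(norm (Y x))\<^sup>2 \<le> (growth_const K l * N)\<^sup>2"
    using zero_le_power2[of e] unfolding power_mult_distrib mult.commute[of "N\<^sup>2"] by linarith
  then have "norm (Y x) \<le> growth_const K l * N"
    by (rule power2_le_imp_le) (simp add: N growth_const_def)
  moreover have "norm (u x) \<le> norm (Y x)" "norm (p x) \<le> norm (Y x)"
    unfolding Y_def by (rule norm_fst_le norm_snd_le)+
  ultimately show "norm (u x) \<le> growth_const K l * (norm (u 0) + norm (p 0) + e)"
    and "norm (p x) \<le> growth_const K l * (norm (u 0) + norm (p 0) + e)" by (auto simp: N_def)
qed

lemma AE_leb_iff_negligible: "(AE x in leb l. P x) \<longleftrightarrow> negligible {x \<in> {0<..<l}. \<not> P x}"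
proof -
  have "(AE x in leb l. P x) \<longleftrightarrow> (AE x in lebesgue. x \<in> {0<..<l} \<longrightarrow> P x)"
    by (rule AE_restrict_space_iff) auto
  also have "\<dots> \<longleftrightarrow> negligible {x \<in> {0<..<l}. \<not> P x}"
  proof
    assume "AE x in lebesgue. x \<in> {0<..<l} \<longrightarrow> P x"
    then obtain N where N: "negligible N" "{x \<in> space lebesgue. \<not> (x \<in> {0<..<l} \<longrightarrow> P x)} \<subseteq> N"
      unfolding eventually_ae_filter negligible_iff_null_sets by blast
    have "{x \<in> {0<..<l}. \<not> P x} \<subseteq> N" using N(2) by (simp add: subset_iff)
    with N(1) show "negligible {x \<in> {0<..<l}. \<not> P x}" by (rule negligible_subset)
  next
    assume "negligible {x \<in> {0<..<l}. \<not> P x}"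
    then show "AE x in lebesgue. x \<in> {0<..<l} \<longrightarrow> P x"
      unfolding eventually_ae_filter negligible_iff_null_sets by auto
  qed
  finally show ?thesis .
qed

lemma AE_lebI: "(\<And>x. x \<in> {0<..<l} \<Longrightarrow> P x) \<Longrightarrow> AE x in leb l. P x"
  by (rule AE_I2) (simp add: space_restrict_space)

lemma finite_measure_leb: "finite_measure (leb l)"
  by (rule finite_measure_lebesgue_on) (simp add: fmeasurableI)

lemma measure_leb: "0 \<le> l \<Longrightarrow> measure (leb l) (space (leb l)) = l"
  by (simp add: measure_restrict_space space_restrict_space)

lemma integrable_leb_iff:
  fixes w :: "real \<Rightarrow> 'v::euclidean_space"
  shows "integrable (leb l) w \<longleftrightarrow> w absolutely_integrable_on {0..l}"
  unfolding absolutely_integrable_on_Icc_iff_Ioo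
  unfolding set_integrable_def by (rule integrable_restrict_space) auto

lemma integral_leb:
  fixes w :: "real \<Rightarrow> 'v::euclidean_space"
  shows "integrable (leb l) w \<Longrightarrow> integral\<^sup>L (leb l) w = integral {0..l} w"
  unfolding integral_open_interval_real by (rule lebesgue_integral_eq_integral) auto

lemma integrable_leb_continuous:
  fixes u :: "real \<Rightarrow> 'v::euclidean_space"
  shows "continuous_on {0..l} u \<Longrightarrow> integrable (leb l) u"
  unfolding integrable_leb_iff by (rule absolutely_integrable_continuous_real)

lemma measurable_leb_continuous:
  fixes u :: "real \<Rightarrow> 'v::euclidean_space"
  shows "continuous_on {0..l} u \<Longrightarrow> u \<in> borel_measurable (leb l)"
  by (drule integrable_leb_continuous) auto

lemma integrable_leb_subinterval:
  fixes w :: "real \<Rightarrow> 'v::euclidean_space"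
  assumes "integrable (leb l) w" "0 \<le> a" "b \<le> l"
  shows "w absolutely_integrable_on {a..b}" "w integrable_on {a..b}"
proof -
  show "w absolutely_integrable_on {a..b}"
    by (rule absolutely_integrable_on_subinterval[where S = "{0..l}"])
      (use assms in \<open>auto simp: integrable_leb_iff\<close>)
  then show "w integrable_on {a..b}" by (rule set_lebesgue_integral_eq_integral(1))
qed

section \<open>Square integrable functions\<close>

lemma L2_integrable:
  assumes "u \<in> L2 l"
  shows "integrable (leb l) u"
proof -
  interpret finite_measure "leb l" by (rule finite_measure_leb)
  show ?thesis
  proof (rule Bochner_Integration.integrable_bound)
    show "integrable (leb l) (\<lambda>x. 1 + (norm (u x))\<^sup>2)"
      using assms by (auto simp: L2_def)
    have "norm (u x) \<le> 1 + (norm (u x))\<^sup>2" for x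
      using sum_squares_bound[of "norm (u x)" 1] norm_ge_zero[of "u x"] unfolding power2_eq_square by linarith
    then show "AE x in leb l. norm (u x) \<le> norm (1 + (norm (u x))\<^sup>2)"
      by (intro AE_I2) (auto intro: order_trans[OF _ abs_ge_self])
  qed (use assms in \<open>auto simp: L2_def\<close>)
qed

lemma L2_bounded_comb:
  fixes u v :: "real \<Rightarrow> 'v::euclidean_space" and w :: "real \<Rightarrow> 'w::euclidean_space"
  assumes "u \<in> L2 l" "v \<in> L2 l" "w \<in> borel_measurable (leb l)"
    and "\<And>x. x \<in> {0<..<l} \<Longrightarrow> norm (w x) \<le> K * (norm (u x) + norm (v x))"
  shows "w \<in> L2 l"
proof -
  have "integrable (leb l) (\<lambda>x. (norm (w x))\<^sup>2)"
  proof (rule Bochner_Integration.integrable_bound)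
    show "integrable (leb l) (\<lambda>x. 2 * K\<^sup>2 * ((norm (u x))\<^sup>2 + (norm (v x))\<^sup>2))"
      using assms by (auto simp: L2_def)
    show "AE x in leb l. norm ((norm (w x))\<^sup>2) \<le> norm (2 * K\<^sup>2 * ((norm (u x))\<^sup>2 + (norm (v x))\<^sup>2))"
    proof (rule AE_lebI)
      fix x assume x: "x \<in> {0<..<l}"
      have "(norm (w x))\<^sup>2 \<le> (K * (norm (u x) + norm (v x)))\<^sup>2"
        using assms(4)[OF x] by (intro power_mono) auto
      also have "\<dots> = K\<^sup>2 * (norm (u x) + norm (v x))\<^sup>2" by (simp add: power_mult_distrib)
      also have "\<dots> \<le> K\<^sup>2 * (2 * ((norm (u x))\<^sup>2 + (norm (v x))\<^sup>2))"
        using sum_squares_bound[of "norm (u x)" "norm (v x)"]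
        by (intro mult_left_mono) (auto simp: power2_sum)
      finally show "norm ((norm (w x))\<^sup>2) \<le> norm (2 * K\<^sup>2 * ((norm (u x))\<^sup>2 + (norm (v x))\<^sup>2))"
        by (simp add: algebra_simps)
    qed
  qed (use assms in auto)
  then show ?thesis using assms by (simp add: L2_def)
qed

lemma L2_measurable: "u \<in> L2 l \<Longrightarrow> u \<in> borel_measurable (leb l)"
  by (simp add: L2_def)

lemma L2_lincomb:
  assumes "u \<in> L2 l" "v \<in> L2 l"
  shows "(\<lambda>x. a *\<^sub>R u x + b *\<^sub>R v x) \<in> L2 l"
proof (rule L2_bounded_comb[OF assms, where K = "\<bar>a\<bar> + \<bar>b\<bar>"])
  show "(\<lambda>x. a *\<^sub>R u x + b *\<^sub>R v x) \<in> borel_measurable (leb l)"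
    using assms[THEN L2_measurable] by simp
  fix x
  have "norm (a *\<^sub>R u x + b *\<^sub>R v x) \<le> \<bar>a\<bar> * norm (u x) + \<bar>b\<bar> * norm (v x)"
    by (metis norm_scaleR norm_triangle_ineq)
  also have "\<dots> \<le> (\<bar>a\<bar> + \<bar>b\<bar>) * (norm (u x) + norm (v x))"
    by (simp add: algebra_simps add_increasing2)
  finally show "norm (a *\<^sub>R u x + b *\<^sub>R v x) \<le> (\<bar>a\<bar> + \<bar>b\<bar>) * (norm (u x) + norm (v x))" .
qed

lemma L2_diff: "u \<in> L2 l \<Longrightarrow> v \<in> L2 l \<Longrightarrow> (\<lambda>x. u x - v x) \<in> L2 l"
  using L2_lincomb[of u l v 1 "-1"] by simp

lemma L2_continuous:
  fixes u :: "real \<Rightarrow> 'v::euclidean_space"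
  assumes "continuous_on {0..l} u"
  shows "u \<in> L2 l"
  unfolding L2_def using assms
  by (auto intro!: measurable_leb_continuous integrable_leb_continuous continuous_intros)

lemma L2_bounded_linear:
  fixes f :: "'v::euclidean_space \<Rightarrow> 'w::euclidean_space"
  assumes f: "bounded_linear f" and u: "u \<in> L2 l"
  shows "(\<lambda>x. f (u x)) \<in> L2 l"
proof -
  obtain K where K: "\<And>x. norm (f x) \<le> norm x * K"
    using bounded_linear.bounded[OF f] by blast
  show ?thesis
  proof (rule L2_bounded_comb[OF u u, where K = "\<bar>K\<bar>"])
    have "f \<in> borel_measurable borel"
      by (intro borel_measurable_continuous_onI linear_continuous_on f)
    then show "(\<lambda>x. f (u x)) \<in> borel_measurable (leb l)"
      using L2_measurable[OF u] by measurable
    fix x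
    have "norm (f (u x)) \<le> norm (u x) * \<bar>K\<bar>"
      using K[of "u x"] by (meson abs_ge_self dual_order.trans mult_left_mono norm_ge_zero)
    also have "\<dots> \<le> \<bar>K\<bar> * (norm (u x) + norm (u x))" by (simp add: algebra_simps)
    finally show "norm (f (u x)) \<le> \<bar>K\<bar> * (norm (u x) + norm (u x))" .
  qed
qed

lemma L2_norm_nonneg [simp]: "0 \<le> L2_norm l u"
  by (simp add: L2_norm_def integral_nonneg_AE)

lemma L2_norm_cong:
  assumes "AE x in leb l. u x = v x" "u \<in> borel_measurable (leb l)" "v \<in> borel_measurable (leb l)"
  shows "L2_norm l u = L2_norm l v"
proof -
  have "(\<integral>x. (norm (u x))\<^sup>2 \<partial>leb l) = (\<integral>x. (norm (v x))\<^sup>2 \<partial>leb l)"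
    using assms by (intro integral_cong_AE) auto
  then show ?thesis by (simp add: L2_norm_def)
qed

lemma L2_norm_le_sup:
  assumes l: "0 \<le> l" and "u \<in> L2 l" and b: "AE x in leb l. norm (u x) \<le> B" and B: "0 \<le> B"
  shows "L2_norm l u \<le> sqrt l * B"
proof -
  interpret finite_measure "leb l" by (rule finite_measure_leb)
  have "(\<integral>x. (norm (u x))\<^sup>2 \<partial>leb l) \<le> (\<integral>x. B\<^sup>2 \<partial>leb l)"
    using assms by (intro integral_mono_AE) (auto simp: L2_def intro: power_mono)
  also have "\<dots> = l * B\<^sup>2" using measure_leb[OF l] by simp
  finally show ?thesis
    unfolding L2_norm_def using B l by (auto intro!: real_le_lsqrt simp: power_mult_distrib)
qed

lemma L1_le_L2:
  assumes l: "0 < l" and u: "u \<in> L2 l"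
  shows "(\<integral>x. norm (u x) \<partial>leb l) \<le> sqrt l * L2_norm l u"
proof -
  interpret finite_measure "leb l" by (rule finite_measure_leb)
  define I where "I = (\<integral>x. norm (u x) \<partial>leb l)"
  define J where "J = (\<integral>x. (norm (u x))\<^sup>2 \<partial>leb l)"
  have i1: "integrable (leb l) (\<lambda>x. norm (u x))" using L2_integrable[OF u] by simp
  have i2: "integrable (leb l) (\<lambda>x. (norm (u x))\<^sup>2)" using u by (simp add: L2_def)
  have "0 \<le> (\<integral>x. (norm (u x) - I / l)\<^sup>2 \<partial>leb l)" by simp
  also have "(\<lambda>x. (norm (u x) - I / l)\<^sup>2) = (\<lambda>x. (norm (u x))\<^sup>2 - (2 * I / l) * norm (u x) + (I / l)\<^sup>2)"
    by (simp add: power2_diff fun_eq_iff)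
  also have "(\<integral>x. (norm (u x))\<^sup>2 - (2 * I / l) * norm (u x) + (I / l)\<^sup>2 \<partial>leb l) = J - (2 * I / l) * I + l * (I / l)\<^sup>2"
    using i1 i2 measure_leb[of l] l by (simp add: I_def J_def)
  also have "\<dots> = J - I\<^sup>2 / l" using l by (simp add: power2_eq_square field_simps)
  finally have "I\<^sup>2 \<le> l * J" using l by (simp add: field_simps)
  then have "I \<le> sqrt (l * J)" by (simp add: real_le_rsqrt)
  then show ?thesis by (simp add: I_def J_def L2_norm_def real_sqrt_mult)
qed

section \<open>The fundamental lemma of the calculus of variations\<close>

text \<open>Lebesgue differentiation: at almost every point \<open>v\<close> is the limit of its averages over small intervals.\<close>

lemma AE_zero_if_integrals_zero:
  fixes v :: "real \<Rightarrow> 'v::euclidean_space"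
  assumes v: "integrable (leb l) v"
    and z: "\<And>a b. 0 < a \<Longrightarrow> a < b \<Longrightarrow> b < l \<Longrightarrow> integral {a..b} v = 0"
  shows "AE x in leb l. v x = 0"
proof -
  define f where "f x = (if x \<in> {0..l} then v x else 0)" for x
  have "f integrable_on cbox a b" for a b
  proof -
    have "f integrable_on UNIV"
      unfolding f_def using integrable_leb_subinterval(2)[OF v, of 0 l]
      by (subst integrable_restrict_UNIV) simp
    then show ?thesis by (rule integrable_on_subcbox) auto
  qed
  from integrable_ccontinuous_explicit[of f, OF this] obtain N where N: "negligible N"
    and lim: "\<And>x e. \<lbrakk>x \<notin> N; 0 < e\<rbrakk> \<Longrightarrow> \<exists>d>0. \<forall>h. 0 < h \<and> h < d \<longrightarrow>
       norm (integral (cbox x (x + h *\<^sub>R One)) f /\<^sub>R h ^ DIM(real) - f x) < e" by metis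
  have "v x = 0" if x: "x \<in> {0<..<l}" "x \<notin> N" for x
  proof (rule ccontr)
    assume nz: "v x \<noteq> 0"
    then obtain d where d: "d > 0" "\<And>h. 0 < h \<Longrightarrow> h < d \<Longrightarrow>
       norm (integral (cbox x (x + h *\<^sub>R One)) f /\<^sub>R h ^ DIM(real) - f x) < norm (v x)"
      using lim[OF x(2), of "norm (v x)"] by auto
    define h where "h = min (d / 2) ((l - x) / 2)"
    have h: "0 < h" "h < d" "x + h < l" using d x by (auto simp: h_def min_def field_simps)
    have "integral (cbox x (x + h *\<^sub>R One)) f = integral {x..x+h} v"
      using x h by (auto intro!: integral_cong simp: f_def)
    also have "\<dots> = 0" using x h by (intro z) auto
    finally show False using d(2)[OF h(1,2)] x by (simp add: f_def)
  qed
  then have "{x \<in> {0<..<l}. v x \<noteq> 0} \<subseteq> N" by auto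
  then show ?thesis unfolding AE_leb_iff_negligible using N negligible_subset by blast
qed

text \<open>Trapezoidal bump: \<open>0\<close> outside \<open>[a, b]\<close>, \<open>1\<close> on \<open>[a + 1/n, b - 1/n]\<close>, affine in between.\<close>

definition trap :: "real \<Rightarrow> real \<Rightarrow> real \<Rightarrow> real \<Rightarrow> real" where
  "trap a b n x = max 0 (min 1 (n * min (x - a) (b - x)))"

lemma continuous_trap: "continuous_on S (trap a b n)"
  unfolding trap_def by (intro continuous_intros)

lemma trap_range: "0 \<le> trap a b n x" "trap a b n x \<le> 1"
  by (auto simp: trap_def)

lemma trap_outside: "0 \<le> n \<Longrightarrow> x \<notin> {a..b} \<Longrightarrow> trap a b n x = 0"
  unfolding trap_def
  by (rule max_absorb1, rule min.coboundedI2, rule mult_nonneg_nonpos) auto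

lemma trap_inside: "0 < n \<Longrightarrow> a + 1/n \<le> x \<Longrightarrow> x \<le> b - 1/n \<Longrightarrow> trap a b n x = 1"
  by (auto simp: trap_def min_def max_def field_simps)

lemma trap_tendsto:
  "(\<lambda>n. trap a b (real (Suc n)) x) \<longlonglongrightarrow> indicat_real {a<..<b} x"
proof (cases "x \<in> {a<..<b}")
  case True
  define m where "m = min (x - a) (b - x)"
  have m: "m > 0" using True by (auto simp: m_def)
  have "eventually (\<lambda>n. trap a b (real (Suc n)) x = 1) sequentially"
  proof (rule eventually_mono[OF eventually_gt_at_top[of "nat \<lceil>1 / m\<rceil>"]])
    fix n assume "n > nat \<lceil>1 / m\<rceil>"
    then have "1 / m \<le> real (Suc n)" by linarith
    then have "1 \<le> real (Suc n) * m" using m by (simp add: field_simps)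
    then show "trap a b (real (Suc n)) x = 1" by (simp add: trap_def m_def)
  qed
  then show ?thesis using True by (simp add: tendsto_eventually)
next
  case False
  then have "min (x - a) (b - x) \<le> 0" by auto
  then have "real (Suc n) * min (x - a) (b - x) \<le> 0" for n by (intro mult_nonneg_nonpos) auto
  then have "trap a b (real (Suc n)) x = 0" for n unfolding trap_def by (meson max_absorb1 min.coboundedI2)
  then show ?thesis using False by simp
qed

text \<open>Trapezoidal bumps converge boundedly to the indicator of an interval, so testing against them gives the integral
  of \<open>v\<close> over that interval.\<close>

lemma fundamental_lemma:
  fixes v :: "real \<Rightarrow> 'v::euclidean_space"
  assumes v: "integrable (leb l) v"
    and z: "\<And>\<eta>. continuous_on UNIV \<eta> \<Longrightarrow> (\<exists>a b. 0 < a \<and> b < l \<and> (\<forall>x. x \<notin> {a..b} \<longrightarrow> \<eta> x = 0))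
              \<Longrightarrow> (\<integral>x. \<eta> x *\<^sub>R v x \<partial>leb l) = 0"
  shows "AE x in leb l. v x = 0"
proof (rule AE_zero_if_integrals_zero[OF v])
  fix a b assume ab: "0 < a" "a < b" "b < l"
  have "(\<lambda>n. \<integral>x. trap a b (real (Suc n)) x *\<^sub>R v x \<partial>leb l) \<longlonglongrightarrow> (\<integral>x. indicat_real {a<..<b} x *\<^sub>R v x \<partial>leb l)"
  proof (rule integral_dominated_convergence[where w = "\<lambda>x. norm (v x)"])
    show "(\<lambda>x. indicat_real {a<..<b} x *\<^sub>R v x) \<in> borel_measurable (leb l)"
    proof -
      have "{a<..<b} \<in> sets (leb l)" 
        using ab by (auto simp: sets_restrict_space_iff)
      then show ?thesis using v by (intro borel_measurable_scaleR borel_measurable_indicator) auto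
    qed
    show "(\<lambda>x. trap a b (real (Suc n)) x *\<^sub>R v x) \<in> borel_measurable (leb l)" for n
      by (intro borel_measurable_scaleR measurable_leb_continuous[OF continuous_trap] borel_measurable_integrable[OF v])
    show "AE x in leb l. (\<lambda>n. trap a b (real (Suc n)) x *\<^sub>R v x) \<longlonglongrightarrow> indicat_real {a<..<b} x *\<^sub>R v x"
      by (intro AE_I2 tendsto_scaleR trap_tendsto) auto
    show "AE x in leb l. norm (trap a b (real (Suc n)) x *\<^sub>R v x) \<le> norm (v x)" for n
      using trap_range by (intro AE_I2) (auto simp: mult_left_le_one_le)
  qed (use v in auto)
  moreover have "(\<integral>x. trap a b (real (Suc n)) x *\<^sub>R v x \<partial>leb l) = 0" for n
    using ab by (intro z continuous_trap exI[of _ a] exI[of _ b]) (auto intro!: trap_outside)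
  ultimately have "(\<integral>x. indicat_real {a<..<b} x *\<^sub>R v x \<partial>leb l) = 0"
    by (simp add: LIMSEQ_const_iff)
  also have "(\<integral>x. indicat_real {a<..<b} x *\<^sub>R v x \<partial>leb l) = (\<integral>x. indicat_real {a<..<b} x *\<^sub>R v x \<partial>lebesgue)"
  proof (subst integral_restrict_space)
    show "(\<integral>x. indicat_real {0<..<l} x *\<^sub>R indicat_real {a<..<b} x *\<^sub>R v x \<partial>lebesgue) = (\<integral>x. indicat_real {a<..<b} x *\<^sub>R v x \<partial>lebesgue)"
      using ab by (intro Bochner_Integration.integral_cong) (auto simp: indicator_def)
  qed auto
  also have "\<dots> = integral {a<..<b} v"
    using integrable_leb_subinterval(1)[OF v, of a b] ab
      set_lebesgue_integral_eq_integral(2)[where f = v and S = "{a<..<b}"]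
    by (simp add: set_lebesgue_integral_def absolutely_integrable_on_Icc_iff_Ioo)
  finally show "integral {a..b} v = 0" by (simp add: integral_open_interval_real)
qed

text \<open>Absolutely continuous functions with square integrable derivative, in integral form. This is the shape in which
  the continuous representatives of \<open>H1\<close> functions appear.\<close>

definition primitive :: "real \<Rightarrow> (real \<Rightarrow> 'v::euclidean_space) \<Rightarrow> (real \<Rightarrow> 'v) \<Rightarrow> bool" where
  "primitive l U w \<longleftrightarrow> w \<in> L2 l \<and> (\<forall>x\<in>{0..l}. U x = U 0 + integral {0..x} w)"

lemma primitiveD:
  assumes "primitive l U w"
  shows "w \<in> L2 l" "x \<in> {0..l} \<Longrightarrow> U x = U 0 + integral {0..x} w"
  using assms unfolding primitive_def by blast+

lemma primitive_continuous:
  assumes "primitive l U w"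
  shows "continuous_on {0..l} U"
proof -
  have "continuous_on {0..l} (\<lambda>x. U 0 + integral {0..x} w)"
    using integrable_leb_subinterval(2)[OF L2_integrable[OF primitiveD(1)[OF assms]], of 0 l]
    by (intro continuous_intros indefinite_integral_continuous_1) auto
  then show ?thesis
    by (rule continuous_on_eq) (simp add: primitiveD(2)[OF assms, symmetric])
qed

lemma primitive_L2: "primitive l U w \<Longrightarrow> U \<in> L2 l"
  by (intro L2_continuous primitive_continuous)

lemma primitive_lincomb:
  assumes "primitive l U w" "primitive l U' w'"
  shows "primitive l (\<lambda>x. a *\<^sub>R U x + b *\<^sub>R U' x) (\<lambda>x. a *\<^sub>R w x + b *\<^sub>R w' x)"
  unfolding primitive_def
proof (intro conjI ballI)
  show "(\<lambda>x. a *\<^sub>R w x + b *\<^sub>R w' x) \<in> L2 l"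
    by (intro L2_lincomb primitiveD(1)[OF assms(1)] primitiveD(1)[OF assms(2)])
  fix x assume x: "x \<in> {0..l}"
  have i: "w integrable_on {0..x}" "w' integrable_on {0..x}"
    using assms x by (auto intro!: integrable_leb_subinterval L2_integrable primitiveD(1))
  have "integral {0..x} (\<lambda>x. a *\<^sub>R w x + b *\<^sub>R w' x) = a *\<^sub>R integral {0..x} w + b *\<^sub>R integral {0..x} w'"
    using i by (simp add: Henstock_Kurzweil_Integration.integral_add integrable_cmul)
  then show "a *\<^sub>R U x + b *\<^sub>R U' x = a *\<^sub>R U 0 + b *\<^sub>R U' 0 + integral {0..x} (\<lambda>x. a *\<^sub>R w x + b *\<^sub>R w' x)"
    using primitiveD(2)[OF assms(1) x] primitiveD(2)[OF assms(2) x]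
    by (simp add: scaleR_add_right)
qed

lemma primitive_diff:
  assumes "primitive l U w" "primitive l U' w'"
  shows "primitive l (\<lambda>x. U x - U' x) (\<lambda>x. w x - w' x)"
  using primitive_lincomb[OF assms, of 1 "-1"] by simp

lemma primitive_bounded_linear:
  fixes f :: "'v::euclidean_space \<Rightarrow> 'w::euclidean_space"
  assumes f: "bounded_linear f" and p: "primitive l U w"
  shows "primitive l (\<lambda>x. f (U x)) (\<lambda>x. f (w x))"
  unfolding primitive_def
proof (intro conjI ballI)
  show "(\<lambda>x. f (w x)) \<in> L2 l" using L2_bounded_linear[OF f primitiveD(1)[OF p]] .
  fix x assume x: "x \<in> {0..l}"
  have "w integrable_on {0..x}"
    using p x by (auto intro!: integrable_leb_subinterval L2_integrable primitiveD(1))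
  from integral_linear[OF this f] have "integral {0..x} (\<lambda>x. f (w x)) = f (integral {0..x} w)"
    by (simp add: o_def)
  then show "f (U x) = f (U 0) + integral {0..x} (\<lambda>x. f (w x))"
    using primitiveD(2)[OF p x] by (simp add: linear_add[OF bounded_linear.linear[OF f]])
qed

lemma primitive_cong:
  assumes "primitive l U w" "\<And>x. x \<in> {0..l} \<Longrightarrow> U x = U' x" "\<And>x. x \<in> {0..l} \<Longrightarrow> w x = w' x" "w' \<in> L2 l" "0 \<le> l"
  shows "primitive l U' w'"
  unfolding primitive_def
proof (intro conjI ballI)
  fix x assume x: "x \<in> {0..l}"
  have "integral {0..x} w = integral {0..x} w'"
    using x by (intro integral_cong assms(3)) auto
  then show "U' x = U' 0 + integral {0..x} w'"
    using primitiveD(2)[OF assms(1) x] assms(2)[OF x] assms(2)[of 0] assms(5) by simp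
qed fact

lemma primitive_of_derivative:
  fixes U :: "real \<Rightarrow> 'v::euclidean_space"
  assumes d: "\<And>x. x \<in> {0..l} \<Longrightarrow> (U has_vector_derivative w x) (at x within {0..l})"
    and c: "continuous_on {0..l} w"
  shows "primitive l U w"
  unfolding primitive_def
proof (intro conjI ballI)
  show "w \<in> L2 l" by (rule L2_continuous[OF c])
  fix x assume x: "x \<in> {0..l}"
  have "(w has_integral (U x - U 0)) {0..x}"
    using x by (intro fundamental_theorem_of_calculus has_vector_derivative_within_subset[OF d]) auto
  then show "U x = U 0 + integral {0..x} w" by (simp add: integral_unique)
qed

lemma derivative_of_primitive:
  fixes U :: "real \<Rightarrow> 'v::euclidean_space"
  assumes p: "primitive l U w" and c: "continuous_on {0..l} w" and x: "x \<in> {0..l}"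
  shows "(U has_vector_derivative w x) (at x within {0..l})"
proof -
  have "((\<lambda>x. U 0 + integral {0..x} w) has_vector_derivative w x) (at x within {0..l})"
    using integral_has_vector_derivative[OF c x] by (auto intro!: derivative_eq_intros)
  then show ?thesis
    by (rule has_vector_derivative_transform[OF x, rotated]) (simp add: primitiveD(2)[OF p, symmetric])
qed

lemma continuous_on_interval_bound:
  fixes f :: "real \<Rightarrow> 'v::real_normed_vector"
  assumes "continuous_on {a..b} f"
  shows "\<exists>B\<ge>0. \<forall>x\<in>{a..b}. norm (f x) \<le> B"
proof -
  have "bounded (f ` {a..b})" by (intro compact_imp_bounded compact_continuous_image assms) auto
  then obtain B where "0 < B" "\<forall>y\<in>f ` {a..b}. norm y \<le> B" unfolding bounded_pos by blast
  then show ?thesis by (intro exI[of _ B]) auto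
qed

lemma norm_scaleR_le: "\<bar>a\<bar> \<le> D \<Longrightarrow> norm (a *\<^sub>R v) \<le> norm (D *\<^sub>R v)"
  by (auto intro!: mult_right_mono)

lemma measurable_leb_id [measurable]: "(\<lambda>x. x) \<in> borel_measurable (leb l)"
  by (rule measurable_leb_continuous) (rule continuous_on_id)

lemma integral_leb_cut:
  fixes w :: "real \<Rightarrow> 'v::euclidean_space"
  assumes w: "integrable (leb l) w" and x: "x \<in> {0..l}"
  shows "(\<integral>s. (if s \<le> x then w s else 0) \<partial>leb l) = integral {0..x} w"
    and "(\<integral>s. (if x \<le> s then w s else 0) \<partial>leb l) = integral {x..l} w"
proof -
  have m: "{s\<in>space (leb l). s \<le> x} \<in> sets (leb l)" "{s\<in>space (leb l). x \<le> s} \<in> sets (leb l)"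
    by measurable
  have i: "integrable (leb l) (\<lambda>s. if s \<le> x then w s else 0)" "integrable (leb l) (\<lambda>s. if x \<le> s then w s else 0)"
    by (rule Bochner_Integration.integrable_bound[OF w]; use w m in \<open>auto intro!: measurable_If\<close>)+
  have "integral {0..l} (\<lambda>s. if s \<le> x then w s else 0) = integral {0..l} (\<lambda>s. if s \<in> {0..x} then w s else 0)"
    by (rule integral_cong) auto
  also have "\<dots> = integral {0..x} w"
    using integrable_leb_subinterval(2)[OF w, of 0 x] x
      has_integral_restrict_closed_subinterval[of w "integral {0..x} w" 0 x 0 l]
    by (intro integral_unique) (simp add: integrable_integral)
  finally show "(\<integral>s. (if s \<le> x then w s else 0) \<partial>leb l) = integral {0..x} w"
    using integral_leb[OF i(1)] by simp
  have "integral {0..l} (\<lambda>s. if x \<le> s then w s else 0) = integral {0..l} (\<lambda>s. if s \<in> {x..l} then w s else 0)"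
    by (rule integral_cong) auto
  also have "\<dots> = integral {x..l} w"
    using integrable_leb_subinterval(2)[OF w, of x l] x
      has_integral_restrict_closed_subinterval[of w "integral {x..l} w" x l 0 l]
    by (intro integral_unique) (simp add: integrable_integral)
  finally show "(\<integral>s. (if x \<le> s then w s else 0) \<partial>leb l) = integral {x..l} w"
    using integral_leb[OF i(2)] by simp
qed

text \<open>As \<open>w\<close> is merely integrable, the identity is Fubini's theorem on the triangle \<open>s \<le> x\<close>.\<close>

lemma integration_by_parts_primitive:
  fixes w :: "real \<Rightarrow> 'v::euclidean_space" and d :: "real \<Rightarrow> real"
  assumes l: "0 < l" and w: "integrable (leb l) w" and d: "continuous_on {0..l} d"
    and d0: "integral {0..l} d = 0" and th: "\<And>x. x \<in> {0..l} \<Longrightarrow> \<theta> x = integral {0..x} d"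
  shows "(\<integral>x. d x *\<^sub>R integral {0..x} w \<partial>leb l) = - (\<integral>x. \<theta> x *\<^sub>R w x \<partial>leb l)"
proof -
  interpret M: finite_measure "leb l" by (rule finite_measure_leb)
  interpret MM: pair_sigma_finite "leb l" "leb l" ..
  have md [measurable]: "d \<in> borel_measurable (leb l)" by (rule measurable_leb_continuous[OF d])
  have mw [measurable]: "w \<in> borel_measurable (leb l)" using w by auto
  obtain D where D: "\<And>x. x \<in> {0..l} \<Longrightarrow> norm (d x) \<le> D" "0 \<le> D"
    using continuous_on_interval_bound[OF d] by blast
  define k where "k s x = (if s \<le> x then d x *\<^sub>R w s else 0)" for s x
  have iw: "integrable (leb l \<Otimes>\<^sub>M leb l) (\<lambda>(s, x). w s)"
  proof (rule MM.Fubini_integrable)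
    show "integrable (leb l) (\<lambda>s. \<integral>x. norm (case (s, x) of (s, x) \<Rightarrow> w s) \<partial>leb l)"
      using w by simp
  qed (auto intro!: AE_I2)
  have ik: "integrable (leb l \<Otimes>\<^sub>M leb l) (\<lambda>(s, x). k s x)"
  proof (rule Bochner_Integration.integrable_bound)
    show "integrable (leb l \<Otimes>\<^sub>M leb l) (\<lambda>z. D *\<^sub>R (\<lambda>(s, x). w s) z)"
      by (intro integrable_scaleR_right iw)
    show "(\<lambda>(s, x). k s x) \<in> borel_measurable (leb l \<Otimes>\<^sub>M leb l)"
      unfolding k_def by measurable
    show "AE z in leb l \<Otimes>\<^sub>M leb l. norm (case z of (s, x) \<Rightarrow> k s x) \<le> norm (D *\<^sub>R (case z of (s, x) \<Rightarrow> w s))"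
    proof (rule AE_I2)
      fix z assume "z \<in> space (leb l \<Otimes>\<^sub>M leb l)"
      then obtain s x where z: "z = (s, x)" "x \<in> {0..l}" 
        by (cases z) (auto simp: space_pair_measure space_restrict_space)
      have "\<bar>d x\<bar> * norm (w s) \<le> D * norm (w s)" using D(1)[OF z(2)] by (intro mult_right_mono) auto
      then show "norm (case z of (s, x) \<Rightarrow> k s x) \<le> norm (D *\<^sub>R (case z of (s, x) \<Rightarrow> w s))"
        using D(2) by (simp add: z k_def)
    qed
  qed
  have "(\<integral>x. \<integral>s. k s x \<partial>leb l \<partial>leb l) = (\<integral>s. \<integral>x. k s x \<partial>leb l \<partial>leb l)"
    by (rule MM.Fubini_integral[OF ik])
  also have "(\<integral>x. \<integral>s. k s x \<partial>leb l \<partial>leb l) = (\<integral>x. d x *\<^sub>R integral {0..x} w \<partial>leb l)"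
  proof (rule Bochner_Integration.integral_cong[OF refl])
    fix x assume "x \<in> space (leb l)"
    then have x: "x \<in> {0..l}" by (auto simp: space_restrict_space)
    have "(\<integral>s. k s x \<partial>leb l) = (\<integral>s. d x *\<^sub>R (if s \<le> x then w s else 0) \<partial>leb l)"
      unfolding k_def by (rule Bochner_Integration.integral_cong) auto
    then show "(\<integral>s. k s x \<partial>leb l) = d x *\<^sub>R integral {0..x} w"
      using integral_leb_cut(1)[OF w x] by simp
  qed
  also have "(\<integral>s. \<integral>x. k s x \<partial>leb l \<partial>leb l) = (\<integral>s. - (\<theta> s *\<^sub>R w s) \<partial>leb l)"
  proof (rule Bochner_Integration.integral_cong[OF refl])
    fix s assume "s \<in> space (leb l)"
    then have s: "s \<in> {0..l}" by (auto simp: space_restrict_space)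
    have "(\<integral>x. k s x \<partial>leb l) = (\<integral>x. (if s \<le> x then d x else 0) *\<^sub>R w s \<partial>leb l)"
      unfolding k_def by (rule Bochner_Integration.integral_cong) auto
    also have "\<dots> = (\<integral>x. (if s \<le> x then d x else 0) \<partial>leb l) *\<^sub>R w s"
    proof (rule integral_scaleR_left)
      show "integrable (leb l) (\<lambda>x. if s \<le> x then d x else 0)"
        by (rule Bochner_Integration.integrable_bound[OF integrable_leb_continuous[OF d]]) (auto intro!: AE_I2)
    qed
    also have "(\<integral>x. (if s \<le> x then d x else 0) \<partial>leb l) = integral {s..l} d"
      by (rule integral_leb_cut(2)[OF integrable_leb_continuous[OF d] s])
    also have "\<dots> = - \<theta> s"
      using Henstock_Kurzweil_Integration.integral_combine[of 0 s l d] s d0 th[OF s] integrable_continuous_interval[OF d]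
      by auto
    finally show "(\<integral>x. k s x \<partial>leb l) = - (\<theta> s *\<^sub>R w s)" by simp
  qed
  finally show ?thesis by simp
qed

lemma test_functionE:
  fixes \<theta> :: "real \<Rightarrow> 'v::euclidean_space"
  assumes "\<theta> \<in> test_functions l" and l: "0 < l"
  obtains "continuous_on UNIV (deriv_on UNIV \<theta>)" "\<And>x. (\<theta> has_vector_derivative deriv_on UNIV \<theta> x) (at x)"
    "\<And>x. x \<in> {0..l} \<Longrightarrow> \<theta> x = integral {0..x} (deriv_on UNIV \<theta>)"
    "\<theta> 0 = 0" "\<theta> l = 0" "primitive l \<theta> (deriv_on UNIV \<theta>)"
proof
  obtain a b where ab: "0 < a" "b < l" "\<And>x. x \<notin> {a..b} \<Longrightarrow> \<theta> x = 0"
    and C: "\<theta> differentiable_on UNIV" and c: "continuous_on UNIV (deriv_on UNIV \<theta>)"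
    using assms unfolding test_functions_def by auto
  show "continuous_on UNIV (deriv_on UNIV \<theta>)" by fact
  show d: "(\<theta> has_vector_derivative deriv_on UNIV \<theta> x) (at x)" for x
    using C unfolding differentiable_on_def deriv_on_def vector_derivative_works[symmetric] by auto
  show z: "\<theta> 0 = 0" "\<theta> l = 0" using ab by auto
  show p: "primitive l \<theta> (deriv_on UNIV \<theta>)"
    by (rule primitive_of_derivative[OF has_vector_derivative_at_within[OF d] continuous_on_subset[OF c]]) auto
  show "\<theta> x = integral {0..x} (deriv_on UNIV \<theta>)" if "x \<in> {0..l}" for x
    using primitiveD(2)[OF p that] z by simp
qed

text \<open>The test functions are the primitives of continuous functions of compact support and mean zero.\<close>

lemma test_function_with_derivative:
  fixes d :: "real \<Rightarrow> 'v::euclidean_space"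
  assumes c: "continuous_on UNIV d" and ab: "0 < a" "a \<le> b" "b < l" and s: "\<And>x. x \<notin> {a<..<b} \<Longrightarrow> d x = 0"
    and z: "integral {0..l} d = 0"
  shows "\<exists>\<theta>\<in>test_functions l. deriv_on UNIV \<theta> = d"
proof -
  define \<theta> where "\<theta> x = integral {a..x} d" for x
  have int: "d integrable_on {u..v}" for u v
    by (intro integrable_continuous_interval continuous_on_subset[OF c]) auto
  have shift: "\<theta> x = integral {r..x} d" if "r \<le> a" "r \<le> x" for r x
  proof (cases "x \<le> a")
    case True
    have "integral {r..x} d = integral {r..x} (\<lambda>x. 0)"
      using True by (intro integral_cong s) auto
    moreover have "integral {a..x} d = 0" using True by (cases "x = a") auto
    ultimately show ?thesis by (simp add: \<theta>_def)
  next
    case False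
    have "integral {r..a} d = integral {r..a} (\<lambda>x. 0)"
      by (intro integral_cong s) auto
    then show ?thesis
      using Henstock_Kurzweil_Integration.integral_combine[of r a x d] that False int by (simp add: \<theta>_def)
  qed
  have deriv: "(\<theta> has_vector_derivative d x) (at x)" for x
  proof -
    define r where "r = min a x - 1"
    have "((\<lambda>x. integral {r..x} d) has_vector_derivative d x) (at x within {r..x+1})"
      by (rule integral_has_vector_derivative) (auto intro: continuous_on_subset[OF c] simp: r_def)
    then have "(\<theta> has_vector_derivative d x) (at x within {r..x+1})"
      by (rule has_vector_derivative_transform[rotated 2]) (auto simp: r_def intro!: shift)
    moreover have "at x within {r..x+1} = at x"
      by (rule at_within_interior) (auto simp: r_def)
    ultimately show ?thesis by simp
  qed
  have d\<theta>: "deriv_on UNIV \<theta> = d"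
    unfolding deriv_on_def using deriv by (auto intro!: vector_derivative_at)
  have tail: "\<theta> x = \<theta> b" if "b \<le> x" for x
  proof -
    have "integral {b..x} d = integral {b..x} (\<lambda>x. 0)"
      using that by (intro integral_cong s) auto
    then show ?thesis
      using Henstock_Kurzweil_Integration.integral_combine[of a b x d] ab that int by (simp add: \<theta>_def)
  qed
  have "\<theta> l = 0" using shift[of 0 l] z ab by simp
  then have tail0: "\<theta> x = 0" if "b \<le> x" for x using tail[OF that] tail[of l] ab by simp
  have "\<theta> x = 0" if "x \<notin> {a..b}" for x
    using that tail0[of x] by (cases "x < a") (auto simp: \<theta>_def)
  moreover have "\<theta> differentiable_on UNIV"
    unfolding differentiable_on_def using deriv by (auto simp: differentiable_def has_vector_derivative_def)
  moreover have "\<exists>a b. 0 < a \<and> b < l \<and> (\<forall>x. x \<notin> {a..b} \<longrightarrow> \<theta> x = 0)"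
    using ab calculation(1) by blast
  ultimately have "\<theta> \<in> test_functions l"
    using d\<theta> c by (simp add: test_functions_def del: atLeastAtMost_iff)
  with d\<theta> show ?thesis by blast
qed

section \<open>Weak derivatives\<close>

lemma is_weak_derivI:
  assumes l: "0 < l" and p: "primitive l U w" and u: "u \<in> borel_measurable (leb l)" "AE x in leb l. u x = U x"
  shows "u \<in> L2 l" "is_weak_deriv l u w"
proof -
  have U: "U \<in> L2 l" by (rule primitive_L2[OF p])
  have "integrable (leb l) (\<lambda>x. (norm (u x))\<^sup>2) \<longleftrightarrow> integrable (leb l) (\<lambda>x. (norm (U x))\<^sup>2)"
    using u L2_measurable[OF U] by (intro integrable_cong_AE) auto
  then show "u \<in> L2 l" using U u by (simp add: L2_def)
  have w: "integrable (leb l) w" using L2_integrable[OF primitiveD(1)[OF p]] .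
  show "is_weak_deriv l u w"
    unfolding is_weak_deriv_def
  proof
    fix \<theta> :: "real \<Rightarrow> real" assume "\<theta> \<in> test_functions l"
    from test_functionE[OF this l] have c: "continuous_on UNIV (deriv_on UNIV \<theta>)"
      and t: "\<And>x. x \<in> {0..l} \<Longrightarrow> \<theta> x = integral {0..x} (deriv_on UNIV \<theta>)" and "\<theta> l = 0" by blast+
    define d where "d = deriv_on UNIV \<theta>"
    have cd: "continuous_on {0..l} d" using c continuous_on_subset unfolding d_def by blast
    have d0: "integral {0..l} d = 0" using t[of l] \<open>\<theta> l = 0\<close> l by (simp add: d_def)
    have mU: "U \<in> borel_measurable (leb l)" "d \<in> borel_measurable (leb l)"
      using L2_measurable[OF U] measurable_leb_continuous[OF cd] by auto
    have cI: "continuous_on {0..l} (\<lambda>x. integral {0..x} w)"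
      by (intro indefinite_integral_continuous_1 integrable_leb_subinterval(2)[OF w]) auto
    have "(\<integral>x. d x *\<^sub>R u x \<partial>leb l) = (\<integral>x. d x *\<^sub>R U x \<partial>leb l)"
      using u mU by (intro integral_cong_AE) auto
    also have "\<dots> = (\<integral>x. d x *\<^sub>R U 0 + d x *\<^sub>R integral {0..x} w \<partial>leb l)"
    proof (rule Bochner_Integration.integral_cong[OF refl])
      fix x assume "x \<in> space (leb l)"
      then have "U x = U 0 + integral {0..x} w"
        by (intro primitiveD(2)[OF p]) (simp add: space_restrict_space)
      then show "d x *\<^sub>R U x = d x *\<^sub>R U 0 + d x *\<^sub>R integral {0..x} w"
        by (metis scaleR_add_right)
    qed
    also have "\<dots> = (\<integral>x. d x *\<^sub>R U 0 \<partial>leb l) + (\<integral>x. d x *\<^sub>R integral {0..x} w \<partial>leb l)"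
      by (intro Bochner_Integration.integral_add integrable_leb_continuous continuous_intros cd cI)
    also have "(\<integral>x. d x *\<^sub>R U 0 \<partial>leb l) = 0"
      using integral_leb[OF integrable_leb_continuous[OF cd]] d0 integrable_leb_continuous[OF cd] by simp
    also have "(\<integral>x. d x *\<^sub>R integral {0..x} w \<partial>leb l) = - (\<integral>x. \<theta> x *\<^sub>R w x \<partial>leb l)"
      by (rule integration_by_parts_primitive[OF l w cd d0]) (simp add: t d_def)
    finally show "(\<integral>x. deriv_on UNIV \<theta> x *\<^sub>R u x \<partial>leb l) = - (\<integral>x. \<theta> x *\<^sub>R w x \<partial>leb l)"
      by (simp add: d_def)
  qed
qed

text \<open>Subtracting from a continuous \<open>\<eta>\<close> a multiple of a fixed bump \<open>\<rho>\<close> of integral one gives the derivative of a test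
  function. Hence \<open>v - c\<close> annihilates every \<open>\<eta>\<close>, where \<open>c\<close> is the integral of \<open>\<rho> v\<close>.\<close>

lemma du_Bois_Reymond:
  fixes v :: "real \<Rightarrow> 'v::euclidean_space"
  assumes l: "0 < l" and v: "integrable (leb l) v"
    and z: "\<And>\<theta>. \<theta> \<in> test_functions l \<Longrightarrow> (\<integral>x. deriv_on UNIV \<theta> x *\<^sub>R v x \<partial>leb l) = 0"
  shows "\<exists>c. AE x in leb l. v x = c"
proof -
  interpret finite_measure "leb l" by (rule finite_measure_leb)
  define \<rho>0 where "\<rho>0 = trap (l/4) (3*l/4) (8/l)"
  have c0: "continuous_on S \<rho>0" for S unfolding \<rho>0_def by (rule continuous_trap)
  have i0: "\<rho>0 integrable_on {a..b}" for a b by (rule integrable_continuous_interval[OF c0])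
  have "integral {3*l/8..5*l/8} (\<lambda>x. 1) = integral {3*l/8..5*l/8} \<rho>0"
  proof (rule integral_cong)
    fix x assume "x \<in> {3*l/8..5*l/8}"
    then have "trap (l/4) (3*l/4) (8/l) x = 1"
      using l by (intro trap_inside) auto
    then show "1 = \<rho>0 x" by (simp add: \<rho>0_def)
  qed
  also have "\<dots> \<le> integral {0..l} \<rho>0"
    using l by (intro integral_subset_le i0) (auto simp: \<rho>0_def trap_range)
  finally have J: "integral {0..l} \<rho>0 \<noteq> 0" using l by simp
  define \<rho> where "\<rho> x = \<rho>0 x / integral {0..l} \<rho>0" for x
  have c\<rho>: "continuous_on S \<rho>" for S unfolding \<rho>_def
    by (intro continuous_on_divide c0 continuous_on_const) (simp add: J)
  have \<rho>1: "integral {0..l} \<rho> = 1"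
    unfolding \<rho>_def using J by (simp add: divide_inverse)
  define c where "c = (\<integral>x. \<rho> x *\<^sub>R v x \<partial>leb l)"
  have mv: "v \<in> borel_measurable (leb l)" using v by auto
  have iv: "integrable (leb l) (\<lambda>x. \<eta> x *\<^sub>R v x)" if c\<eta>: "continuous_on {0..l} \<eta>" for \<eta> :: "real \<Rightarrow> real"
  proof -
    obtain D where D: "\<And>x. x \<in> {0..l} \<Longrightarrow> norm (\<eta> x) \<le> D"
      using continuous_on_interval_bound[OF c\<eta>] by blast
    show ?thesis
    proof (rule Bochner_Integration.integrable_bound)
      show "integrable (leb l) (\<lambda>x. D *\<^sub>R v x)" using v by simp
      show "AE x in leb l. norm (\<eta> x *\<^sub>R v x) \<le> norm (D *\<^sub>R v x)"
        using D by (intro AE_lebI norm_scaleR_le) auto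
    qed (use measurable_leb_continuous[OF c\<eta>] mv in auto)
  qed
  have "AE x in leb l. v x - c = 0"
  proof (rule fundamental_lemma)
    show "integrable (leb l) (\<lambda>x. v x - c)" using v by simp
    fix \<eta> :: "real \<Rightarrow> real" assume c\<eta>: "continuous_on UNIV \<eta>"
      and "\<exists>a b. 0 < a \<and> b < l \<and> (\<forall>x. x \<notin> {a..b} \<longrightarrow> \<eta> x = 0)"
    then obtain a b where ab: "0 < a" "b < l" "\<And>x. x \<notin> {a..b} \<Longrightarrow> \<eta> x = 0" by blast
    define m where "m = integral {0..l} \<eta>"
    define d where "d x = \<eta> x - m * \<rho> x" for x
    have c\<eta>': "continuous_on {0..l} \<eta>" using c\<eta> continuous_on_subset by blast
    have "\<exists>\<theta>\<in>test_functions l. deriv_on UNIV \<theta> = d"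
    proof (rule test_function_with_derivative)
      show "continuous_on UNIV d" unfolding d_def by (intro continuous_intros c\<eta> c\<rho>)
      define a' where "a' = min (a/2) (l/8)"
      define b' where "b' = max ((b+l)/2) (7*l/8)"
      show "0 < a'" "a' \<le> b'" "b' < l" using ab l by (auto simp: a'_def b'_def)
      show "d x = 0" if "x \<notin> {a'<..<b'}" for x
      proof -
        have "x \<notin> {a..b}" "x \<notin> {l/4..3*l/4}" using that ab l by (auto simp: a'_def b'_def min_def max_def split: if_splits)
        then show ?thesis using l by (simp add: d_def ab \<rho>_def \<rho>0_def trap_outside del: atLeastAtMost_iff)
      qed
      have "integral {0..l} d = m - m * integral {0..l} \<rho>"
        unfolding d_def m_def
        by (subst Henstock_Kurzweil_Integration.integral_diff)
          (auto intro!: integrable_continuous_interval continuous_intros c\<rho> c\<eta>')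
      then show "integral {0..l} d = 0" using \<rho>1 by simp
    qed
    then have "(\<integral>x. d x *\<^sub>R v x \<partial>leb l) = 0" using z by metis
    moreover have "(\<integral>x. d x *\<^sub>R v x \<partial>leb l) = (\<integral>x. \<eta> x *\<^sub>R v x \<partial>leb l) - m *\<^sub>R c"
      unfolding d_def scaleR_diff_left c_def using iv[OF c\<eta>'] iv[OF c\<rho>]
      by (simp add: scaleR_scaleR[symmetric] del: scaleR_scaleR)
    moreover have "(\<integral>x. \<eta> x *\<^sub>R c \<partial>leb l) = m *\<^sub>R c"
      using integral_leb[OF integrable_leb_continuous[OF c\<eta>']] integrable_leb_continuous[OF c\<eta>'] by (simp add: m_def)
    ultimately show "(\<integral>x. \<eta> x *\<^sub>R (v x - c) \<partial>leb l) = 0"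
      using iv[OF c\<eta>'] integrable_leb_continuous[OF c\<eta>'] by (auto simp: scaleR_diff_right)
  qed
  then show ?thesis by (intro exI[of _ c]) (simp add: AE_leb_iff_negligible)
qed

text \<open>The difference of \<open>u\<close> and a primitive of \<open>w\<close> has weak derivative zero, so it is constant.\<close>

lemma weak_deriv_primitive:
  assumes l: "0 < l" and u: "u \<in> L2 l" and w: "w \<in> L2 l" and wd: "is_weak_deriv l u w"
  shows "\<exists>U. primitive l U w \<and> (AE x in leb l. u x = U x)"
proof -
  define I where "I x = integral {0..x} w" for x
  have pI: "primitive l I w" using w by (auto simp: primitive_def I_def)
  have I: "I \<in> L2 l" "is_weak_deriv l I w"
    using is_weak_derivI[OF l pI L2_measurable[OF primitive_L2[OF pI]]] by auto
  have "\<exists>c. AE x in leb l. u x - I x = c"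
  proof (rule du_Bois_Reymond[OF l])
    show "integrable (leb l) (\<lambda>x. u x - I x)" using L2_integrable u I by auto
    fix \<theta> :: "real \<Rightarrow> real" assume t: "\<theta> \<in> test_functions l"
    from test_functionE[OF t l] have c: "continuous_on {0..l} (deriv_on UNIV \<theta>)"
      using continuous_on_subset by (metis subset_UNIV)
    obtain D where D: "\<And>x. x \<in> {0..l} \<Longrightarrow> norm (deriv_on UNIV \<theta> x) \<le> D"
      using continuous_on_interval_bound[OF c] by blast
    have int: "integrable (leb l) (\<lambda>x. deriv_on UNIV \<theta> x *\<^sub>R f x)" if "f \<in> L2 l" for f :: "real \<Rightarrow> 'a"
    proof (rule Bochner_Integration.integrable_bound)
      show "integrable (leb l) (\<lambda>x. D *\<^sub>R f x)" using L2_integrable[OF that] by simp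
      show "AE x in leb l. norm (deriv_on UNIV \<theta> x *\<^sub>R f x) \<le> norm (D *\<^sub>R f x)"
        using D by (intro AE_lebI norm_scaleR_le) auto
    qed (use measurable_leb_continuous[OF c] L2_measurable[OF that] in auto)
    have "(\<integral>x. deriv_on UNIV \<theta> x *\<^sub>R (u x - I x) \<partial>leb l) =
      (\<integral>x. deriv_on UNIV \<theta> x *\<^sub>R u x \<partial>leb l) - (\<integral>x. deriv_on UNIV \<theta> x *\<^sub>R I x \<partial>leb l)"
      unfolding scaleR_diff_right by (rule Bochner_Integration.integral_diff[OF int[OF u] int[OF I(1)]])
    also have "\<dots> = 0" using wd I(2) t by (simp add: is_weak_deriv_def)
    finally show "(\<integral>x. deriv_on UNIV \<theta> x *\<^sub>R (u x - I x) \<partial>leb l) = 0" .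
  qed
  then obtain c where c: "AE x in leb l. u x - I x = c" by blast
  have "primitive l (\<lambda>x. c + I x) w" using pI by (auto simp: primitive_def I_def)
  moreover have "AE x in leb l. u x = c + I x" using c by eventually_elim (simp add: algebra_simps)
  ultimately show ?thesis by blast
qed

lemma AE_eq_continuous:
  fixes U V :: "real \<Rightarrow> 'v::euclidean_space"
  assumes l: "0 < l" and c: "continuous_on {0..l} U" "continuous_on {0..l} V" and ae: "AE x in leb l. U x = V x"
    and x: "x \<in> {0..l}"
  shows "U x = V x"
proof -
  have cd: "continuous_on {0..l} (\<lambda>x. U x - V x)" by (intro continuous_intros c)
  have "open ({0<..<l} \<inter> (\<lambda>x. U x - V x) -` (- {0}))"
    by (rule continuous_open_preimage) (auto intro: continuous_on_subset[OF cd])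
  moreover have "{0<..<l} \<inter> (\<lambda>x. U x - V x) -` (- {0}) = {x \<in> {0<..<l}. \<not> U x = V x}" by auto
  ultimately have "{x \<in> {0<..<l}. \<not> U x = V x} = {}"
    using ae open_not_negligible unfolding AE_leb_iff_negligible by metis
  then have eq: "U x - V x = 0" if "x \<in> {0<..<l}" for x using that by auto
  have "U x - V x = 0"
  proof (rule continuous_constant_on_closure[where S = "{0<..<l}"])
    show "continuous_on (closure {0<..<l}) (\<lambda>x. U x - V x)" using cd l by simp
    show "x \<in> closure {0<..<l}" using x l by simp
  qed (use eq in auto)
  then show ?thesis by simp
qed

lemma primitive_unique:
  assumes l: "0 < l" and p: "primitive l U w" "primitive l U' w'" and ae: "AE x in leb l. U x = U' x"
  shows "\<And>x. x \<in> {0..l} \<Longrightarrow> U x = U' x" "AE x in leb l. w x = w' x"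
proof -
  show eq: "U x = U' x" if "x \<in> {0..l}" for x
    by (rule AE_eq_continuous[OF l primitive_continuous[OF p(1)] primitive_continuous[OF p(2)] ae that])
  have "AE x in leb l. w x - w' x = 0"
  proof (rule AE_zero_if_integrals_zero)
    have wi: "integrable (leb l) w" "integrable (leb l) w'"
      using p by (auto intro!: L2_integrable primitiveD(1))
    then show i: "integrable (leb l) (\<lambda>x. w x - w' x)" by simp
    have z: "integral {0..x} (\<lambda>x. w x - w' x) = 0" if x: "x \<in> {0..l}" for x
      using primitiveD(2)[OF p(1) x] primitiveD(2)[OF p(2) x] eq[OF x] eq[of 0] l x
        integrable_leb_subinterval(2)[OF wi(1), of 0 x] integrable_leb_subinterval(2)[OF wi(2), of 0 x]
      by (simp add: Henstock_Kurzweil_Integration.integral_diff)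
    fix a b assume ab: "0 < a" "a < b" "b < l"
    show "integral {a..b} (\<lambda>x. w x - w' x) = 0"
      using Henstock_Kurzweil_Integration.integral_combine[of 0 a b "\<lambda>x. w x - w' x"] z[of a] z[of b] ab
        integrable_leb_subinterval(2)[OF i, of 0 b] by simp
  qed
  then show "AE x in leb l. w x = w' x" by simp
qed

lemma H1_weak_deriv:
  assumes "u \<in> H1 l"
  shows "u \<in> L2 l" "weak_deriv l u \<in> L2 l" "is_weak_deriv l u (weak_deriv l u)"
proof -
  show "u \<in> L2 l" using assms by (simp add: H1_def)
  have "\<exists>w. w \<in> L2 l \<and> is_weak_deriv l u w" using assms by (auto simp: H1_def)
  from someI_ex[OF this] show "weak_deriv l u \<in> L2 l" "is_weak_deriv l u (weak_deriv l u)"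
    by (auto simp: weak_deriv_def)
qed

lemma weak_deriv_eq:
  assumes l: "0 < l" and p: "primitive l U w" and u: "u \<in> borel_measurable (leb l)" "AE x in leb l. u x = U x"
  shows "u \<in> H1 l" "AE x in leb l. weak_deriv l u x = w x"
proof -
  show H: "u \<in> H1 l"
    using is_weak_derivI[OF assms] primitiveD(1)[OF p] by (auto simp: H1_def)
  obtain U' where U': "primitive l U' (weak_deriv l u)" "AE x in leb l. u x = U' x"
    using weak_deriv_primitive[OF l H1_weak_deriv[OF H]] by blast
  have "AE x in leb l. U' x = U x" using U'(2) u(2) by eventually_elim simp
  from primitive_unique(2)[OF l U'(1) p this] show "AE x in leb l. weak_deriv l u x = w x" .
qed

section \<open>Boundary values of Sobolev functions\<close>

text \<open>Somewhere \<open>|U|\<close> is at most its quadratic mean, and from there \<open>U\<close> varies by at most the \<open>L1\<close> norm of \<open>w\<close>.\<close>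

lemma primitive_sup_bound:
  fixes U :: "real \<Rightarrow> 'v::euclidean_space"
  assumes l: "0 < l" and p: "primitive l U w" and x: "x \<in> {0..l}"
  shows "norm (U x) \<le> L2_norm l U / sqrt l + sqrt l * L2_norm l w"
proof -
  interpret finite_measure "leb l" by (rule finite_measure_leb)
  have w: "w \<in> L2 l" and U: "U \<in> L2 l" using p primitiveD(1) primitive_L2 by blast+
  have wi: "integrable (leb l) w" by (rule L2_integrable[OF w])
  have ni: "(\<lambda>x. norm (w x)) integrable_on {0..l}"
    using integrable_leb_subinterval(2)[of l "\<lambda>x. norm (w x)" 0 l] wi by simp
  define A where "A = (\<integral>x. norm (w x) \<partial>leb l)"
  have A: "A = integral {0..l} (\<lambda>x. norm (w x))"
    unfolding A_def using wi by (intro integral_leb) auto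
  have diff: "norm (integral {a..b} w) \<le> A" if "0 \<le> a" "b \<le> l" for a b
  proof -
    have n: "(\<lambda>x. norm (w x)) integrable_on {a..b}"
      using integrable_leb_subinterval(2)[of l "\<lambda>x. norm (w x)" a b] wi that by simp
    have "norm (integral {a..b} w) \<le> integral {a..b} (\<lambda>x. norm (w x))"
      using integrable_leb_subinterval(2)[OF wi that] n by (intro integral_norm_bound_integral) auto
    also have "\<dots> \<le> integral {0..l} (\<lambda>x. norm (w x))"
      using that by (intro integral_subset_le n ni) auto
    finally show ?thesis by (simp add: A)
  qed
  have osc: "norm (U x) \<le> norm (U y) + A" if y: "y \<in> {0..l}" for y
  proof -
    have eq: "U b = U a + integral {a..b} w" if "0 \<le> a" "a \<le> b" "b \<le> l" for a b
    proof -
      have "U a = U 0 + integral {0..a} w" "U b = U 0 + integral {0..b} w"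
        using that by (auto intro!: primitiveD(2)[OF p])
      then show ?thesis
        using Henstock_Kurzweil_Integration.integral_combine[of 0 a b w] that integrable_leb_subinterval(2)[OF wi, of 0 b]
        by (simp add: algebra_simps)
    qed
    show ?thesis
    proof (cases "x \<le> y")
      case True
      then have "U x = U y - integral {x..y} w" using eq[of x y] x y by simp
      then have "norm (U x) \<le> norm (U y) + norm (integral {x..y} w)" by (simp add: norm_triangle_ineq4)
      then show ?thesis using diff[of x y] x y by simp
    next
      case False
      then have "U x = U y + integral {y..x} w" using eq[of y x] x y by simp
      then have "norm (U x) \<le> norm (U y) + norm (integral {y..x} w)" by (simp add: norm_triangle_ineq)
      then show ?thesis using diff[of y x] x y by simp
    qed
  qed
  have iU: "integrable (leb l) (\<lambda>y. norm (U y))" using L2_integrable[OF U] by simp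
  have "(\<integral>y. norm (U x) \<partial>leb l) \<le> (\<integral>y. norm (U y) + A \<partial>leb l)"
    using iU osc by (intro integral_mono) (auto simp: space_restrict_space)
  then have "l * norm (U x) \<le> (\<integral>y. norm (U y) \<partial>leb l) + l * A"
    using iU measure_leb[of l] l by simp
  also have "\<dots> \<le> sqrt l * L2_norm l U + l * (sqrt l * L2_norm l w)"
    unfolding A_def using l L1_le_L2[OF l U] L1_le_L2[OF l w] by (intro add_mono mult_left_mono) auto
  finally have "norm (U x) \<le> (sqrt l * L2_norm l U + l * (sqrt l * L2_norm l w)) / l"
    using l by (simp add: field_simps)
  also have "\<dots> = L2_norm l U * (sqrt l / l) + sqrt l * L2_norm l w"
    using l by (simp add: field_simps)
  also have "sqrt l / l = 1 / sqrt l" using l by (simp add: real_div_sqrt divide_eq_eq)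
  finally show ?thesis by simp
qed

text \<open>Test functions vanish at the end points, and point values are continuous in the \<open>H1\<close> norm.\<close>

lemma H1_0_boundary:
  fixes u :: "real \<Rightarrow> 'v::euclidean_space"
  assumes l: "0 < l" and p: "primitive l U w" and u: "u \<in> H1_0 l" "AE x in leb l. u x = U x"
    and x: "x \<in> {0, l}"
  shows "U x = 0"
proof -
  have "norm (U x) \<le> (1 / sqrt l + sqrt l) * e" if e: "e > 0" for e
  proof -
    obtain \<theta> where \<theta>: "\<theta> \<in> test_functions l" "H1_norm l (\<lambda>x. u x - \<theta> x) < e"
      using u e by (auto simp: H1_0_def)
    have mu: "u \<in> borel_measurable (leb l)"
      using u by (auto simp: H1_0_def dest: H1_weak_deriv(1) L2_measurable)
    have p\<theta>: "primitive l \<theta> (deriv_on UNIV \<theta>)" and z: "\<theta> 0 = 0" "\<theta> l = 0"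
      using test_functionE[OF \<theta>(1) l] by blast+
    have pd: "primitive l (\<lambda>x. U x - \<theta> x) (\<lambda>x. w x - deriv_on UNIV \<theta> x)"
      by (rule primitive_diff[OF p p\<theta>])
    have md: "(\<lambda>x. u x - \<theta> x) \<in> borel_measurable (leb l)"
      using mu L2_measurable[OF primitive_L2[OF p\<theta>]] by simp
    have ae: "AE x in leb l. u x - \<theta> x = U x - \<theta> x" using u(2) by eventually_elim simp
    note wd = weak_deriv_eq[OF l pd md ae]
    have "L2_norm l (\<lambda>x. U x - \<theta> x) = L2_norm l (\<lambda>x. u x - \<theta> x)"
      using ae md L2_measurable[OF primitive_L2[OF pd]] by (intro L2_norm_cong) auto
    also have "\<dots> \<le> H1_norm l (\<lambda>x. u x - \<theta> x)" unfolding H1_norm_def by (simp add: real_le_rsqrt)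
    finally have 1: "L2_norm l (\<lambda>x. U x - \<theta> x) \<le> e" using \<theta>(2) by simp
    have "L2_norm l (\<lambda>x. w x - deriv_on UNIV \<theta> x) = L2_norm l (weak_deriv l (\<lambda>x. u x - \<theta> x))"
      using wd(2) H1_weak_deriv(2)[OF wd(1)] primitiveD(1)[OF pd]
      by (intro L2_norm_cong) (auto dest: L2_measurable)
    also have "\<dots> \<le> H1_norm l (\<lambda>x. u x - \<theta> x)" unfolding H1_norm_def by (simp add: real_le_rsqrt)
    finally have 2: "L2_norm l (\<lambda>x. w x - deriv_on UNIV \<theta> x) \<le> e" using \<theta>(2) by simp
    have "norm (U x - \<theta> x) \<le> L2_norm l (\<lambda>x. U x - \<theta> x) / sqrt l + sqrt l * L2_norm l (\<lambda>x. w x - deriv_on UNIV \<theta> x)"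
      using x l by (intro primitive_sup_bound[OF l pd]) auto
    also have "\<dots> \<le> e / sqrt l + sqrt l * e"
      using 1 2 l by (intro add_mono divide_right_mono mult_left_mono) auto
    finally show ?thesis using x z by (auto simp: algebra_simps)
  qed
  then have *: "norm (U x) \<le> (1 / sqrt l + sqrt l) * e" if "e > 0" for e using that .
  show ?thesis
  proof (rule ccontr)
    assume "U x \<noteq> 0"
    define K where "K = 1 / sqrt l + sqrt l"
    have K: "K > 0" using l by (simp add: K_def add_pos_pos)
    have "norm (U x) \<le> K * (norm (U x) / (2 * K))" unfolding K_def
      by (rule *) (use \<open>U x \<noteq> 0\<close> K in \<open>simp add: K_def\<close>)
    then show False using K \<open>U x \<noteq> 0\<close> by simp
  qed
qed

text \<open>Cutting \<open>w\<close> off near the end points with \<open>\<kappa>\<close> leaves a small mean \<open>z\<close>, because \<open>w\<close> itself has mean zero; removing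
  that mean with a fixed bump gives the derivative of a test function close to \<open>U\<close> in \<open>H1\<close>.\<close>

lemma H1_0_if_zero_boundary:
  fixes u :: "real \<Rightarrow> 'v::euclidean_space"
  assumes l: "0 < l" and p: "primitive l U w" and c: "continuous_on {0..l} w"
    and bc: "U 0 = 0" "U l = 0" and u: "u \<in> borel_measurable (leb l)" "AE x in leb l. u x = U x"
  shows "u \<in> H1_0 l"
  unfolding H1_0_def
proof (intro CollectI conjI allI impI)
  interpret finite_measure "leb l" by (rule finite_measure_leb)
  show "u \<in> H1 l" by (rule weak_deriv_eq(1)[OF l p u])
  fix e :: real assume e: "e > 0"
  obtain K where K: "K \<ge> 0" "\<And>x. x \<in> {0..l} \<Longrightarrow> norm (w x) \<le> K"
    using continuous_on_interval_bound[OF c] by blast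
  \<comment> \<open>\<open>C / n\<close> bounds the squared \<open>L2\<close> distance of \<open>w\<close> and the derivative of the test function\<close>
  define C where "C = 8 * K\<^sup>2 + 512 * K\<^sup>2 / l"
  have C: "C \<ge> 0" using l by (simp add: C_def)
  define n where "n = max 1 (8 / l) + C * ((l + 1) / e)\<^sup>2"
  have n1: "1 \<le> n" "8 / l \<le> n" using C by (auto simp: n_def add_increasing2)
  have n8: "1 / n \<le> l / 8" using n1 l by (simp add: field_simps)
  have Cn: "C / n < (e / (l + 1))\<^sup>2"
  proof -
    define m where "m = ((l + 1) / e)\<^sup>2"
    have m: "m > 0" "(e / (l + 1))\<^sup>2 = 1 / m" using l e by (auto simp: m_def power_divide)
    have "C * m < n" by (simp add: n_def m_def)
    then show ?thesis using n1 m(1) unfolding m(2) by (simp add: field_simps)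
  qed
  define \<kappa> where "\<kappa> = trap (1/n) (l - 1/n) n"
  have c\<kappa>: "continuous_on S \<kappa>" for S unfolding \<kappa>_def by (rule continuous_trap)
  define \<rho>0 where "\<rho>0 = trap (l/4) (3*l/4) (8/l)"
  have c0: "continuous_on S \<rho>0" for S unfolding \<rho>0_def by (rule continuous_trap)
  have i0: "\<rho>0 integrable_on {a..b}" for a b by (rule integrable_continuous_interval[OF c0])
  define J where "J = integral {0..l} \<rho>0"
  have "integral {3*l/8..5*l/8} (\<lambda>x. 1) = integral {3*l/8..5*l/8} \<rho>0"
  proof (rule integral_cong)
    fix x assume "x \<in> {3*l/8..5*l/8}"
    then have "trap (l/4) (3*l/4) (8/l) x = 1"
      using l by (intro trap_inside) auto
    then show "1 = \<rho>0 x" by (simp add: \<rho>0_def)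
  qed
  also have "\<dots> \<le> J" unfolding J_def
    using l by (intro integral_subset_le i0) (auto simp: \<rho>0_def trap_range)
  finally have J: "J \<ge> l / 4" using l by simp
  \<comment> \<open>a continuous extension of \<open>w\<close> to the line\<close>
  define w' where "w' x = w (max 0 (min x l))" for x
  have cw': "continuous_on S w'" for S unfolding w'_def
    by (rule continuous_on_compose2[OF c]) (use l in \<open>auto intro!: continuous_intros\<close>)
  have w': "w' x = w x" if "x \<in> {0..l}" for x using that by (simp add: w'_def)
  define z where "z = integral {0..l} (\<lambda>x. \<kappa> x *\<^sub>R w x)"
  define d where "d x = \<kappa> x *\<^sub>R w' x - (\<rho>0 x / J) *\<^sub>R z" for x
  have cd: "continuous_on S d" for S unfolding d_def
    by (intro continuous_intros c\<kappa> c0 cw') (use J l in auto)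
  have int0: "integral {0..l} w = 0"
    using primitiveD(2)[OF p, of l] bc l by simp
  have tail: "integral {0..l} (\<lambda>x. 1 - \<kappa> x) \<le> 4 / n"
  proof -
    have "integral {2/n..l-2/n} (\<lambda>x. 1) = integral {2/n..l-2/n} \<kappa>"
    proof (rule integral_cong)
      fix x assume x: "x \<in> {2/n..l-2/n}"
      have "1/n + 1/n = 2/n" by simp
      then have "trap (1/n) (l - 1/n) n x = 1" using x n1 by (intro trap_inside) auto
      then show "1 = \<kappa> x" by (simp add: \<kappa>_def)
    qed
    also have "\<dots> \<le> integral {0..l} \<kappa>"
      using n1 by (intro integral_subset_le integrable_continuous_interval c\<kappa>) (auto simp: \<kappa>_def trap_range)
    finally have le: "integral {2/n..l-2/n} (\<lambda>x. 1::real) \<le> integral {0..l} \<kappa>" .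
    have "4 / n \<le> l" using n1 l n8 by (simp add: field_simps)
    moreover have "l - 2 / n - 2 / n = l - 4 / n" by simp
    ultimately have "l - 4 / n \<le> integral {0..l} \<kappa>" using le by simp
    moreover have "integral {0..l} (\<lambda>x. 1 - \<kappa> x) = l - integral {0..l} \<kappa>"
      using l by (subst Henstock_Kurzweil_Integration.integral_diff) (auto intro!: integrable_continuous_interval c\<kappa>)
    ultimately show ?thesis by simp
  qed
  have zb: "norm z \<le> 4 * K / n"
  proof -
    have "z = - integral {0..l} (\<lambda>x. (1 - \<kappa> x) *\<^sub>R w x)"
    proof -
      have "integral {0..l} (\<lambda>x. (1 - \<kappa> x) *\<^sub>R w x) = integral {0..l} w - z"
        unfolding z_def scaleR_diff_left
        by (subst Henstock_Kurzweil_Integration.integral_diff)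
          (auto intro!: integrable_continuous_interval continuous_intros c\<kappa> c)
      then show ?thesis by (simp add: int0)
    qed
    then have "norm z = norm (integral {0..l} (\<lambda>x. (1 - \<kappa> x) *\<^sub>R w x))" by simp
    also have "\<dots> \<le> integral {0..l} (\<lambda>x. K * (1 - \<kappa> x))"
    proof (rule integral_norm_bound_integral)
      fix x assume "x \<in> {0..l}"
      then show "norm ((1 - \<kappa> x) *\<^sub>R w x) \<le> K * (1 - \<kappa> x)"
        using K(2)[of x] trap_range[of "1/n" "l - 1/n" n x]
        by (simp add: \<kappa>_def mult.commute mult_right_mono)
    qed (auto intro!: integrable_continuous_interval continuous_intros c\<kappa> c)
    also have "\<dots> = K * integral {0..l} (\<lambda>x. 1 - \<kappa> x)" by simp
    also have "\<dots> \<le> K * (4 / n)" by (intro mult_left_mono tail K)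
    finally show ?thesis by (simp add: mult.commute)
  qed
  have "\<exists>\<theta>\<in>test_functions l. deriv_on UNIV \<theta> = d"
  proof (rule test_function_with_derivative)
    show "continuous_on UNIV d" by (rule cd)
    show "0 < 1/(2*n)" "1/(2*n) \<le> l - 1/(2*n)" "l - 1/(2*n) < l" using n1 n8 l by (auto simp: field_simps)
    show "d x = 0" if "x \<notin> {1/(2*n)<..<l - 1/(2*n)}" for x
    proof -
      have "1/(2*n) < 1/n" using n1 by (simp add: field_simps)
      then have "x \<notin> {1/n..l - 1/n}" "x \<notin> {l/4..3*l/4}" using that n8 l by auto
      then show ?thesis using l n1 by (simp add: d_def \<kappa>_def \<rho>0_def trap_outside del: atLeastAtMost_iff)
    qed
    have "integral {0..l} d = integral {0..l} (\<lambda>x. \<kappa> x *\<^sub>R w' x) - integral {0..l} (\<lambda>x. (\<rho>0 x / J) *\<^sub>R z)"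
      unfolding d_def using J l
      by (intro Henstock_Kurzweil_Integration.integral_diff integrable_continuous_interval continuous_intros c\<kappa> c0 cw') auto
    also have "integral {0..l} (\<lambda>x. \<kappa> x *\<^sub>R w' x) = z"
      unfolding z_def by (rule integral_cong) (simp add: w')
    also have "integral {0..l} (\<lambda>x. (\<rho>0 x / J) *\<^sub>R z) = (integral {0..l} \<rho>0 / J) *\<^sub>R z"
    proof -
      have "((\<lambda>x. (\<rho>0 x / J) *\<^sub>R z) has_integral (integral {0..l} \<rho>0 / J) *\<^sub>R z) {0..l}"
        by (intro has_integral_scaleR_left has_integral_divide integrable_integral i0)
      then show ?thesis by (rule integral_unique)
    qed
    also have "integral {0..l} \<rho>0 / J = 1" using J l by (simp add: J_def)
    finally show "integral {0..l} d = 0" by simp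
  qed
  then obtain \<theta> where \<theta>: "\<theta> \<in> test_functions l" and d\<theta>: "deriv_on UNIV \<theta> = d" by blast
  have p\<theta>: "primitive l \<theta> d" and z\<theta>: "\<theta> 0 = 0"
    using test_functionE[OF \<theta> l] d\<theta> by metis+
  have pd: "primitive l (\<lambda>x. U x - \<theta> x) (\<lambda>x. w x - d x)" by (rule primitive_diff[OF p p\<theta>])
  define \<delta> where "\<delta> = L2_norm l (\<lambda>x. w x - d x)"
  have wdL: "(\<lambda>x. w x - d x) \<in> L2 l" using primitiveD(1)[OF pd] .
  have "\<delta>\<^sup>2 \<le> C / n"
  proof -
    have ptw: "(norm (w x - d x))\<^sup>2 \<le> 2 * K\<^sup>2 * (1 - \<kappa> x) + 2 * (16 * K / (l * n))\<^sup>2" if x: "x \<in> {0..l}" for x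
    proof -
      have r: "0 \<le> \<kappa> x" "\<kappa> x \<le> 1" "0 \<le> \<rho>0 x" "\<rho>0 x \<le> 1" by (simp_all add: \<kappa>_def \<rho>0_def trap_range)
      have "w x - d x = (1 - \<kappa> x) *\<^sub>R w x + (\<rho>0 x / J) *\<^sub>R z"
        using w'[OF x] by (simp add: d_def algebra_simps)
      then have "norm (w x - d x) \<le> norm ((1 - \<kappa> x) *\<^sub>R w x) + norm ((\<rho>0 x / J) *\<^sub>R z)"
        by (simp only: norm_triangle_ineq)
      also have "norm ((1 - \<kappa> x) *\<^sub>R w x) \<le> (1 - \<kappa> x) * K"
        using r K(2)[OF x] by (simp add: mult_left_mono)
      also have "norm ((\<rho>0 x / J) *\<^sub>R z) \<le> (1 / (l/4)) * (4 * K / n)"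
      proof -
        have "\<rho>0 x / J \<le> 1 / (l/4)" using r J l by (intro frac_le) auto
        then have "(\<rho>0 x / J) * norm z \<le> (1 / (l/4)) * (4 * K / n)"
          using zb l by (intro mult_mono) auto
        moreover have "norm ((\<rho>0 x / J) *\<^sub>R z) = (\<rho>0 x / J) * norm z"
          using r J l by simp
        ultimately show ?thesis by simp
      qed
      also have "(1 / (l/4)) * (4 * K / n) = 16 * K / (l * n)" by (simp add: field_simps)
      finally have "norm (w x - d x) \<le> (1 - \<kappa> x) * K + 16 * K / (l * n)" by simp
      then have "(norm (w x - d x))\<^sup>2 \<le> ((1 - \<kappa> x) * K + 16 * K / (l * n))\<^sup>2"
        by (intro power_mono) auto
      also have "\<dots> \<le> 2 * ((1 - \<kappa> x) * K)\<^sup>2 + 2 * (16 * K / (l * n))\<^sup>2"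
        using sum_squares_bound[of "(1 - \<kappa> x) * K" "16 * K / (l * n)"] by (simp add: power2_sum)
      also have "((1 - \<kappa> x) * K)\<^sup>2 \<le> K\<^sup>2 * (1 - \<kappa> x)"
      proof -
        have "(1 - \<kappa> x)\<^sup>2 \<le> 1 - \<kappa> x"
          using r mult_left_le[of "1 - \<kappa> x" "1 - \<kappa> x"] by (simp add: power2_eq_square)
        then have "K\<^sup>2 * (1 - \<kappa> x)\<^sup>2 \<le> K\<^sup>2 * (1 - \<kappa> x)" by (rule mult_left_mono) simp
        then show ?thesis by (simp add: power_mult_distrib mult.commute)
      qed
      finally show ?thesis by simp
    qed
    have ic: "integrable (leb l) (\<lambda>x. 2 * K\<^sup>2 * (1 - \<kappa> x) + 2 * (16 * K / (l * n))\<^sup>2)"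
      by (intro integrable_leb_continuous continuous_intros c\<kappa>)
    have "\<delta>\<^sup>2 = (\<integral>x. (norm (w x - d x))\<^sup>2 \<partial>leb l)"
      by (simp add: \<delta>_def L2_norm_def integral_nonneg_AE)
    also have "\<dots> \<le> (\<integral>x. 2 * K\<^sup>2 * (1 - \<kappa> x) + 2 * (16 * K / (l * n))\<^sup>2 \<partial>leb l)"
      using wdL ic ptw by (intro integral_mono) (auto simp: L2_def space_restrict_space)
    also have "\<dots> = integral {0..l} (\<lambda>x. 2 * K\<^sup>2 * (1 - \<kappa> x) + 2 * (16 * K / (l * n))\<^sup>2)"
      by (rule integral_leb[OF ic])
    also have "\<dots> = 2 * K\<^sup>2 * integral {0..l} (\<lambda>x. 1 - \<kappa> x) + 2 * (16 * K / (l * n))\<^sup>2 * l"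
      using l by (subst Henstock_Kurzweil_Integration.integral_add)
        (auto intro!: integrable_continuous_interval continuous_intros c\<kappa>)
    also have "\<dots> \<le> 2 * K\<^sup>2 * (4 / n) + 2 * (16 * K / (l * n))\<^sup>2 * l"
      by (intro add_right_mono mult_left_mono tail) auto
    also have "2 * (16 * K / (l * n))\<^sup>2 * l = (512 * K\<^sup>2 / l / n) * (1 / n)"
      using l n1 by (simp add: field_simps power2_eq_square)
    also have "\<dots> \<le> (512 * K\<^sup>2 / l / n) * 1"
      using l n1 by (intro mult_left_mono) (auto simp: field_simps)
    finally show ?thesis by (simp add: C_def add_divide_distrib)
  qed
  then have "\<delta>\<^sup>2 < (e / (l + 1))\<^sup>2" using Cn by simp
  then have \<delta>: "\<delta> < e / (l + 1)" by (rule power2_less_imp_less) (use e l in auto)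
  have \<delta>0: "0 \<le> \<delta>" by (simp add: \<delta>_def)
  have supb: "norm (U x - \<theta> x) \<le> sqrt l * \<delta>" if x: "x \<in> {0..l}" for x
  proof -
    have i: "integrable (leb l) (\<lambda>x. w x - d x)" by (rule L2_integrable[OF wdL])
    have "U x - \<theta> x = integral {0..x} (\<lambda>x. w x - d x)"
      using primitiveD(2)[OF pd x] bc z\<theta> by simp
    also have "norm \<dots> \<le> integral {0..x} (\<lambda>x. norm (w x - d x))"
      using integrable_leb_subinterval(2)[OF i, of 0 x] integrable_leb_subinterval(2)[of l "\<lambda>x. norm (w x - d x)" 0 x] i x
      by (intro integral_norm_bound_integral) auto
    also have "\<dots> \<le> integral {0..l} (\<lambda>x. norm (w x - d x))"
      using integrable_leb_subinterval(2)[of l "\<lambda>x. norm (w x - d x)" 0 l] integrable_leb_subinterval(2)[of l "\<lambda>x. norm (w x - d x)" 0 x] i x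
      by (intro integral_subset_le) auto
    also have "\<dots> = (\<integral>x. norm (w x - d x) \<partial>leb l)"
      using i by (intro integral_leb[symmetric]) auto
    also have "\<dots> \<le> sqrt l * \<delta>" unfolding \<delta>_def by (rule L1_le_L2[OF l wdL])
    finally show ?thesis .
  qed
  have pm: "(\<lambda>x. u x - \<theta> x) \<in> borel_measurable (leb l)"
    using u(1) L2_measurable[OF primitive_L2[OF p\<theta>]] by simp
  have ae: "AE x in leb l. u x - \<theta> x = U x - \<theta> x" using u(2) by eventually_elim simp
  note wd = weak_deriv_eq[OF l pd pm ae]
  have "L2_norm l (\<lambda>x. u x - \<theta> x) = L2_norm l (\<lambda>x. U x - \<theta> x)"
    using ae pm L2_measurable[OF primitive_L2[OF pd]] by (intro L2_norm_cong) auto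
  also have "\<dots> \<le> sqrt l * (sqrt l * \<delta>)"
    using l primitive_L2[OF pd] supb \<delta>0 by (intro L2_norm_le_sup AE_lebI) auto
  finally have 1: "L2_norm l (\<lambda>x. u x - \<theta> x) \<le> l * \<delta>" using l by (simp flip: mult.assoc)
  have 2: "L2_norm l (weak_deriv l (\<lambda>x. u x - \<theta> x)) = \<delta>"
    unfolding \<delta>_def using wd(2) H1_weak_deriv(2)[OF wd(1)] wdL
    by (intro L2_norm_cong) (auto dest: L2_measurable)
  have "H1_norm l (\<lambda>x. u x - \<theta> x) \<le> L2_norm l (\<lambda>x. u x - \<theta> x) + \<delta>"
    unfolding H1_norm_def 2 using \<delta>0 by (intro sqrt_sum_squares_le_sum) auto
  also have "\<dots> \<le> (l + 1) * \<delta>" using 1 by (simp add: algebra_simps)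
  also have "\<dots> < e" using \<delta> l by (simp add: field_simps)
  finally show "\<exists>\<theta>\<in>test_functions l. H1_norm l (\<lambda>x. u x - \<theta> x) < e" using \<theta> by blast
qed

section \<open>Representatives of functions in H2\<close>

text \<open>\<open>U\<close> and \<open>V\<close> are the continuous representatives of \<open>u\<close> and of its weak derivative, and \<open>g\<close> represents the second weak
  derivative.\<close>

definition H2_rep ::
  "real \<Rightarrow> (real \<Rightarrow> 'v::euclidean_space) \<Rightarrow> (real \<Rightarrow> 'v) \<Rightarrow> (real \<Rightarrow> 'v) \<Rightarrow> (real \<Rightarrow> 'v) \<Rightarrow> bool" where
  "H2_rep l u U V g \<longleftrightarrow>
     u \<in> borel_measurable (leb l) \<and> (AE x in leb l. u x = U x) \<and> primitive l U V \<and> primitive l V g"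

lemma H2_repD:
  assumes "H2_rep l u U V g"
  shows "u \<in> borel_measurable (leb l)" "AE x in leb l. u x = U x" "primitive l U V" "primitive l V g"
    "g \<in> L2 l" "continuous_on {0..l} U" "continuous_on {0..l} V"
  using assms by (auto simp: H2_rep_def intro: primitiveD(1) primitive_continuous)

lemma H2_rep_weak_derivs:
  assumes l: "0 < l" and r: "H2_rep l u U V g"
  shows "u \<in> H2 l" "AE x in leb l. weak_deriv l u x = V x" "AE x in leb l. weak_deriv l (weak_deriv l u) x = g x"
    "weak_deriv l u \<in> L2 l" "weak_deriv l (weak_deriv l u) \<in> L2 l" "u \<in> L2 l"
proof -
  note H = H2_repD[OF r]
  note 1 = weak_deriv_eq[OF l H(3) H(1,2)]
  have m: "weak_deriv l u \<in> L2 l" by (rule H1_weak_deriv(2)[OF 1(1)])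
  note 2 = weak_deriv_eq[OF l H(4) L2_measurable[OF m] 1(2)]
  show "u \<in> H2 l" "AE x in leb l. weak_deriv l u x = V x" "AE x in leb l. weak_deriv l (weak_deriv l u) x = g x"
    "weak_deriv l u \<in> L2 l" "weak_deriv l (weak_deriv l u) \<in> L2 l" "u \<in> L2 l"
    using 1 2 m H1_weak_deriv[OF 1(1)] H1_weak_deriv[OF 2(1)] by (auto simp: H2_def)
qed

lemma H2_rep_exists:
  assumes l: "0 < l" and u: "u \<in> H2 l"
  shows "\<exists>U V g. H2_rep l u U V g"
proof -
  have u1: "u \<in> H1 l" and w1: "weak_deriv l u \<in> H1 l" using u by (auto simp: H2_def)
  obtain V where V: "primitive l V (weak_deriv l (weak_deriv l u))" "AE x in leb l. weak_deriv l u x = V x"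
    using weak_deriv_primitive[OF l H1_weak_deriv[OF w1]] by blast
  obtain U where U: "primitive l U (weak_deriv l u)" "AE x in leb l. u x = U x"
    using weak_deriv_primitive[OF l H1_weak_deriv[OF u1]] by blast
  have "primitive l U V"
    unfolding primitive_def
  proof (intro conjI ballI)
    show "V \<in> L2 l" by (rule primitive_L2[OF V(1)])
    fix x assume x: "x \<in> {0..l}"
    obtain N where N: "negligible N" "\<And>y. y \<in> {0<..<l} - N \<Longrightarrow> weak_deriv l u y = V y"
      using V(2) unfolding AE_leb_iff_negligible by (metis (mono_tags, lifting) DiffE mem_Collect_eq)
    have "integral {0..x} (weak_deriv l u) = integral {0..x} V"
    proof (rule integral_spike)
      show "negligible (N \<union> {0, l})" using N(1) by simp
      show "V y = weak_deriv l u y" if "y \<in> {0..x} - (N \<union> {0, l})" for y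
        using that x N(2)[of y] by auto
    qed
    then show "U x = U 0 + integral {0..x} V" using primitiveD(2)[OF U(1) x] by simp
  qed
  then show ?thesis
    using U V H1_weak_deriv(1)[OF u1] by (auto simp: H2_rep_def L2_measurable)
qed

lemma H2_norm_rep:
  assumes l: "0 < l" and r: "H2_rep l u U V g"
  shows "H2_norm l u = sqrt ((L2_norm l U)\<^sup>2 + (L2_norm l V)\<^sup>2 + (L2_norm l g)\<^sup>2)"
proof -
  note H = H2_repD[OF r] and W = H2_rep_weak_derivs[OF l r]
  have m: "U \<in> borel_measurable (leb l)" "V \<in> borel_measurable (leb l)" "g \<in> borel_measurable (leb l)"
    using H by (auto intro: L2_measurable measurable_leb_continuous)
  have "L2_norm l u = L2_norm l U" "L2_norm l (weak_deriv l u) = L2_norm l V"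
    "L2_norm l (weak_deriv l (weak_deriv l u)) = L2_norm l g"
    using H(1,2) W m by (auto intro!: L2_norm_cong L2_measurable)
  then show ?thesis by (simp add: H2_norm_def)
qed

lemma sobolev_embedding:
  fixes u :: "real \<Rightarrow> 'v::euclidean_space"
  assumes l: "0 < l" and r: "H2_rep l u U V g" and x: "x \<in> {0..l}"
  shows "norm (U x) \<le> (1 / sqrt l + sqrt l) * H2_norm l u" "norm (V x) \<le> (1 / sqrt l + sqrt l) * H2_norm l u"
proof -
  have le: "L2_norm l U \<le> H2_norm l u" "L2_norm l V \<le> H2_norm l u" "L2_norm l g \<le> H2_norm l u"
    unfolding H2_norm_rep[OF l r] by (auto intro!: real_le_rsqrt)
  have "norm (U x) \<le> L2_norm l U / sqrt l + sqrt l * L2_norm l V"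
    by (rule primitive_sup_bound[OF l H2_repD(3)[OF r] x])
  also have "\<dots> \<le> H2_norm l u / sqrt l + sqrt l * H2_norm l u"
    using le l by (intro add_mono divide_right_mono mult_left_mono) auto
  finally show "norm (U x) \<le> (1 / sqrt l + sqrt l) * H2_norm l u" by (simp add: algebra_simps)
  have "norm (V x) \<le> L2_norm l V / sqrt l + sqrt l * L2_norm l g"
    by (rule primitive_sup_bound[OF l H2_repD(4)[OF r] x])
  also have "\<dots> \<le> H2_norm l u / sqrt l + sqrt l * H2_norm l u"
    using le l by (intro add_mono divide_right_mono mult_left_mono) auto
  finally show "norm (V x) \<le> (1 / sqrt l + sqrt l) * H2_norm l u" by (simp add: algebra_simps)
qed

text \<open>The factor \<open>3\<close> is a crude bound for the square root of three.\<close>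

lemma H2_norm_le_sup:
  fixes u :: "real \<Rightarrow> 'v::euclidean_space"
  assumes l: "0 < l" and r: "H2_rep l u U V g"
    and b: "\<And>x. x \<in> {0..l} \<Longrightarrow> norm (U x) \<le> B" "\<And>x. x \<in> {0..l} \<Longrightarrow> norm (V x) \<le> B" "\<And>x. x \<in> {0..l} \<Longrightarrow> norm (g x) \<le> B"
  shows "H2_norm l u \<le> 3 * sqrt l * B"
proof -
  have B: "0 \<le> B" using b(1)[of 0] l by (auto intro: order_trans[OF norm_ge_zero])
  have "L2_norm l U \<le> sqrt l * B" "L2_norm l V \<le> sqrt l * B" "L2_norm l g \<le> sqrt l * B"
    using l B b H2_repD[OF r] by (auto intro!: L2_norm_le_sup AE_lebI L2_continuous)
  moreover have "H2_norm l u \<le> L2_norm l U + L2_norm l V + L2_norm l g"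
    unfolding H2_norm_rep[OF l r] by (intro real_le_lsqrt) (auto simp: power2_sum algebra_simps)
  ultimately show ?thesis by simp
qed

lemma H2_rep_diff:
  assumes "H2_rep l u U V g" "H2_rep l u' U' V' g'"
  shows "H2_rep l (\<lambda>x. a *\<^sub>R (u x - u' x)) (\<lambda>x. a *\<^sub>R (U x - U' x)) (\<lambda>x. a *\<^sub>R (V x - V' x)) (\<lambda>x. a *\<^sub>R (g x - g' x))"
proof -
  have ae: "AE x in leb l. a *\<^sub>R (u x - u' x) = a *\<^sub>R (U x - U' x)"
    using H2_repD(2)[OF assms(1)] H2_repD(2)[OF assms(2)] by eventually_elim simp
  show ?thesis
    unfolding H2_rep_def
    using ae H2_repD(1)[OF assms(1)] H2_repD(1)[OF assms(2)]
      primitive_lincomb[OF H2_repD(3)[OF assms(1)] H2_repD(3)[OF assms(2)], of a "-a"]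
      primitive_lincomb[OF H2_repD(4)[OF assms(1)] H2_repD(4)[OF assms(2)], of a "-a"]
    by (simp add: scaleR_diff_right)
qed

lemma H2_rep_bounded_linear:
  fixes f :: "'v::euclidean_space \<Rightarrow> 'w::euclidean_space"
  assumes f: "bounded_linear f" and r: "H2_rep l u U V g"
  shows "H2_rep l (\<lambda>x. f (u x)) (\<lambda>x. f (U x)) (\<lambda>x. f (V x)) (\<lambda>x. f (g x))"
proof -
  have "f \<in> borel_measurable borel"
    by (intro borel_measurable_continuous_onI linear_continuous_on f)
  then have "(\<lambda>x. f (u x)) \<in> borel_measurable (leb l)"
    using H2_repD(1)[OF r] by measurable
  moreover have "AE x in leb l. f (u x) = f (U x)" using H2_repD(2)[OF r] by eventually_elim simp
  ultimately show ?thesis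
    unfolding H2_rep_def using primitive_bounded_linear[OF f] H2_repD[OF r] by blast
qed

lemma H2_rep_twice_deriv:
  fixes U :: "real \<Rightarrow> 'v::euclidean_space"
  assumes t: "twice_deriv l U p s" and c: "continuous_on {0..l} s" and u: "\<And>x. x \<in> {0..l} \<Longrightarrow> u x = U x"
  shows "H2_rep l u U p s"
proof -
  have cU: "continuous_on {0..l} U" by (rule twice_deriv_continuous[OF t])
  then have "continuous_on {0..l} u" by (rule continuous_on_eq) (simp add: u)
  then show ?thesis
    unfolding H2_rep_def using u twice_deriv_continuous[OF t]
    by (auto intro!: measurable_leb_continuous AE_lebI primitive_of_derivative c dest: twice_derivD[OF t])
qed

text \<open>The Dirichlet domain is characterized by the end point values of the continuous representative.\<close>

lemma Dir_dom_iff: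
  assumes l: "0 < l" and r: "H2_rep l u U V g"
  shows "u \<in> Dir_dom l \<longleftrightarrow> U 0 = 0 \<and> U l = 0"
proof -
  note H = H2_repD[OF r]
  have "u \<in> H2 l" by (rule H2_rep_weak_derivs[OF l r])
  moreover have "u \<in> H1_0 l \<longleftrightarrow> U 0 = 0 \<and> U l = 0"
    using H1_0_boundary[OF l H(3) _ H(2)] H1_0_if_zero_boundary[OF l H(3) H(7) _ _ H(1,2)] by auto
  ultimately show ?thesis by (simp add: Dir_dom_def)
qed

lemma H2_rep_AE:
  assumes l: "0 < l" and r: "H2_rep l u U V g" and g: "AE x in leb l. g x = h x" and c: "h \<in> L2 l"
  shows "H2_rep l u U V h"
proof -
  note H = H2_repD[OF r]
  have "primitive l V h"
    unfolding primitive_def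
  proof (intro conjI ballI c)
    fix x assume x: "x \<in> {0..l}"
    obtain N where N: "negligible N" "\<And>y. y \<in> {0<..<l} - N \<Longrightarrow> g y = h y"
      using g unfolding AE_leb_iff_negligible by (metis (mono_tags, lifting) DiffE mem_Collect_eq)
    have "integral {0..x} g = integral {0..x} h"
    proof (rule integral_spike)
      show "negligible (N \<union> {0, l})" using N(1) by simp
      show "h y = g y" if "y \<in> {0..x} - (N \<union> {0, l})" for y
        using that x N(2)[of y] by auto
    qed
    then show "V x = V 0 + integral {0..x} h" using primitiveD(2)[OF H(4) x] by simp
  qed
  then show ?thesis using H by (simp add: H2_rep_def)
qed

lemma H2_rep_classical:
  fixes u :: "real \<Rightarrow> 'v::euclidean_space"
  assumes r: "H2_rep l u U V h" and c: "continuous_on {0..l} h"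
  shows "twice_deriv l U V h"
  unfolding twice_deriv_def
  using derivative_of_primitive[OF H2_repD(3)[OF r] H2_repD(7)[OF r]] derivative_of_primitive[OF H2_repD(4)[OF r] c]
  by blast

section \<open>Linear boundary value problems\<close>

text \<open>The data of a linear second order system \<open>u'' = A(x) u\<close> with continuous coefficients and operator bound \<open>K\<close>. The
  values lie in any Euclidean space, so that scalar equations and coupled systems are treated alike.\<close>

definition linsys :: "real \<Rightarrow> (real \<Rightarrow> 'v::euclidean_space \<Rightarrow> 'v) \<Rightarrow> real \<Rightarrow> bool" where
  "linsys l A K \<longleftrightarrow> 0 < l \<and> 0 \<le> K \<and> (\<forall>x\<in>{0..l}. linear (A x) \<and> (\<forall>v. norm (A x v) \<le> K * norm v)) \<and>
     continuous_on ({0..l} \<times> UNIV) (\<lambda>(x, v). A x v)"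

lemma linsysD:
  assumes "linsys l A K"
  shows "0 < l" "0 \<le> K" "x \<in> {0..l} \<Longrightarrow> linear (A x)" "x \<in> {0..l} \<Longrightarrow> norm (A x v) \<le> K * norm v"
    "continuous_on ({0..l} \<times> UNIV) (\<lambda>(x, v). A x v)"
  using assms unfolding linsys_def by blast+

lemma linsys_continuous:
  assumes "linsys l A K" "continuous_on {0..l} u"
  shows "continuous_on {0..l} (\<lambda>x. A x (u x))"
proof -
  have "continuous_on {0..l} (\<lambda>x. (\<lambda>(x, v). A x v) (x, u x))"
    by (rule continuous_on_compose2[OF linsysD(5)[OF assms(1)]]) (auto intro!: continuous_intros assms(2))
  then show ?thesis by simp
qed

lemma linsys_scaleR:
  fixes W :: "real \<Rightarrow> real"
  assumes "0 < l" "continuous_on {0..l} W"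
  shows "\<exists>K. linsys l (\<lambda>x v :: 'v::euclidean_space. - (W x *\<^sub>R v)) K"
proof -
  obtain K where K: "K \<ge> 0" "\<And>x. x \<in> {0..l} \<Longrightarrow> norm (W x) \<le> K"
    using continuous_on_interval_bound[OF assms(2)] by blast
  have "continuous_on ({0..l} \<times> (UNIV :: 'v set)) (\<lambda>z. W (fst z))"
    by (rule continuous_on_compose2[OF assms(2)]) (auto intro!: continuous_intros)
  then have "continuous_on ({0..l} \<times> (UNIV :: 'v set)) (\<lambda>(x, v). - (W x *\<^sub>R v))"
    unfolding case_prod_unfold by (intro continuous_intros)
  moreover have "linear (\<lambda>v :: 'v. - (W x *\<^sub>R v))" for x
    by (intro linearI) (auto simp: algebra_simps)
  ultimately show ?thesis
    using assms K unfolding linsys_def by (intro exI[of _ K]) (auto intro!: mult_right_mono)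
qed

lemma linsys_exists:
  assumes A: "linsys l A K" and r: "continuous_on {0..l} r"
  shows "\<exists>u p. u 0 = a \<and> p 0 = b \<and> twice_deriv l u p (\<lambda>x. A x (u x) + r x)"
proof (rule ode2_exists)
  show "0 \<le> l" using linsysD(1)[OF A] by simp
  have "continuous_on ({0..l} \<times> (UNIV :: 'a set)) (\<lambda>z. r (fst z))"
    by (rule continuous_on_compose2[OF r]) (auto intro!: continuous_intros)
  moreover have "continuous_on ({0..l} \<times> UNIV) (\<lambda>z. A (fst z) (snd z))"
    using linsysD(5)[OF A] by (simp add: case_prod_unfold)
  ultimately show "continuous_on ({0..l} \<times> UNIV) (\<lambda>(x, y). A x y + r x)"
    unfolding case_prod_unfold by (intro continuous_intros)
  fix x y z assume x: "x \<in> {0..l}"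
  show "norm (A x y + r x - (A x z + r x)) \<le> K * norm (y - z)"
    using linsysD(4)[OF A x, of "y - z"] linear_diff[OF linsysD(3)[OF A x]] by simp
qed

lemma linsys_bound:
  assumes A: "linsys l A K" and t: "twice_deriv l u p s"
    and e: "\<And>x. x \<in> {0..l} \<Longrightarrow> norm (s x - A x (u x)) \<le> e" and x: "x \<in> {0..l}"
  shows "norm (u x) \<le> growth_const K l * (norm (u 0) + norm (p 0) + e)"
    and "norm (p x) \<le> growth_const K l * (norm (u 0) + norm (p 0) + e)"
proof -
  have e0: "0 \<le> e" using e[OF x] norm_ge_zero order_trans by blast
  have "norm (s x) \<le> K * norm (u x) + e" if x: "x \<in> {0..l}" for x
    using norm_triangle_sub[of "s x" "A x (u x)"] e[OF x] linsysD(4)[OF A x, of "u x"] by simp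
  note g = gronwall2[OF t this linsysD(2)[OF A] e0 x]
  show "norm (u x) \<le> growth_const K l * (norm (u 0) + norm (p 0) + e)" by (rule g(1))
  show "norm (p x) \<le> growth_const K l * (norm (u 0) + norm (p 0) + e)" by (rule g(2))
qed

lemma linsys_unique:
  assumes A: "linsys l A K" and t: "twice_deriv l u p s" "twice_deriv l u' p' s'"
    and s: "\<And>x. x \<in> {0..l} \<Longrightarrow> s x = A x (u x) + r x" "\<And>x. x \<in> {0..l} \<Longrightarrow> s' x = A x (u' x) + r x"
    and i: "u 0 = u' 0" "p 0 = p' 0" and x: "x \<in> {0..l}"
  shows "u x = u' x" "p x = p' x"
proof -
  have 0: "norm ((s x - s' x) - A x (u x - u' x)) \<le> 0" if "x \<in> {0..l}" for x
    using s[OF that] linear_diff[OF linsysD(3)[OF A that]] by simp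
  from linsys_bound[OF A twice_deriv_diff[OF t] 0 x] i
  show "u x = u' x" "p x = p' x" by simp_all
qed

text \<open>The homogeneous Dirichlet problem has only the zero solution.\<close>

definition nondeg :: "real \<Rightarrow> (real \<Rightarrow> 'v::euclidean_space \<Rightarrow> 'v) \<Rightarrow> bool" where
  "nondeg l A \<longleftrightarrow> (\<forall>u p. twice_deriv l u p (\<lambda>x. A x (u x)) \<longrightarrow> u 0 = 0 \<longrightarrow> u l = 0 \<longrightarrow> (\<forall>x\<in>{0..l}. u x = 0))"

text \<open>Solutions with \<open>u(0) = 0\<close> depend linearly on the initial slope \<open>b\<close>, and so does the end value.\<close>

lemma shooting_map:
  assumes A: "linsys l A K"
  obtains Y Y' :: "'v::euclidean_space \<Rightarrow> real \<Rightarrow> 'v"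
  where "\<And>b. Y b 0 = 0" "\<And>b. Y' b 0 = b" "\<And>b. twice_deriv l (Y b) (Y' b) (\<lambda>x. A x (Y b x))"
    "linear (\<lambda>b. Y b l)"
proof -
  have "\<exists>u p. u 0 = 0 \<and> p 0 = b \<and> twice_deriv l u p (\<lambda>x. A x (u x))" for b
    using linsys_exists[OF A, of "\<lambda>x. 0" 0 b] by simp
  then obtain Y Y' where Y: "\<And>b. Y b 0 = 0 \<and> Y' b 0 = b \<and> twice_deriv l (Y b) (Y' b) (\<lambda>x. A x (Y b x))"
    by metis
  then have Y0: "\<And>b. Y b 0 = 0" "\<And>b. Y' b 0 = b" and T: "\<And>b. twice_deriv l (Y b) (Y' b) (\<lambda>x. A x (Y b x))"
    by auto
  have l: "l \<in> {0..l}" using linsysD(1)[OF A] by simp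
  have comb: "Y (a *\<^sub>R b + c *\<^sub>R d) l = a *\<^sub>R Y b l + c *\<^sub>R Y d l" for a b c d
  proof (rule linsys_unique(1)[OF A T twice_deriv_lincomb[OF T T] _ _ _ _ l, where r = "\<lambda>x. 0"])
    fix x assume x: "x \<in> {0..l}"
    note lin = linsysD(3)[OF A x]
    show "a *\<^sub>R A x (Y b x) + c *\<^sub>R A x (Y d x) = A x (a *\<^sub>R Y b x + c *\<^sub>R Y d x) + 0"
      by (simp add: linear_add[OF lin] linear_cmul[OF lin])
  qed (simp_all add: Y0)
  have "linear (\<lambda>b. Y b l)"
    using comb[of 1 _ 1] comb[of _ _ 0] by (intro linearI) simp_all
  then show ?thesis using that Y0 T by blast
qed

lemma shooting_inj:
  assumes A: "linsys l A K" and nd: "nondeg l A"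
    and Y: "\<And>b. Y b 0 = 0" "\<And>b. Y' b 0 = b" "\<And>b. twice_deriv l (Y b) (Y' b) (\<lambda>x. A x (Y b x))"
    and lin: "linear (\<lambda>b. Y b l)"
  shows "inj (\<lambda>b. Y b l)"
  unfolding linear_injective_0[OF lin]
proof (intro allI impI)
  fix b assume b: "Y b l = 0"
  have z: "Y b x = 0" if "x \<in> {0..l}" for x
    using nd Y b that unfolding nondeg_def by blast
  have l: "0 < l" by (rule linsysD(1)[OF A])
  have "(Y b has_vector_derivative b) (at 0 within {0..l})"
    using twice_derivD(1)[OF Y(3)[of b], of 0] l by (simp add: Y)
  moreover have "(Y b has_vector_derivative 0) (at 0 within {0..l})"
    by (rule has_vector_derivative_transform[where f = "\<lambda>x. 0"]) (use l z in \<open>auto intro: has_vector_derivative_const\<close>)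
  ultimately show "b = 0"
    using vector_derivative_unique_within[of 0 "{0..l}"] l
    by (metis at_within_Icc_at_right atLeastAtMost_iff less_imp_le order_refl trivial_limit_at_right_real)
qed

text \<open>The shooting map is an injective linear map between spaces of equal finite dimension, hence onto.\<close>

lemma dirichlet_solve:
  assumes A: "linsys l A K" and nd: "nondeg l A" and r: "continuous_on {0..l} r"
  shows "\<exists>u p. twice_deriv l u p (\<lambda>x. A x (u x) + r x) \<and> u 0 = a \<and> u l = b"
proof -
  obtain Y Y' where Y: "\<And>b. Y b 0 = 0" "\<And>b. Y' b 0 = b" "\<And>b. twice_deriv l (Y b) (Y' b) (\<lambda>x. A x (Y b x))"
    and lin: "linear (\<lambda>b. Y b l)"
    using shooting_map[OF A] by blast
  have "surj (\<lambda>b. Y b l)"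
    using lin shooting_inj[OF A nd Y lin] by (rule linear_injective_imp_surjective) simp
  obtain z q where z: "z 0 = a" "twice_deriv l z q (\<lambda>x. A x (z x) + r x)"
    using linsys_exists[OF A r, of a 0] by blast
  obtain c where c: "Y c l = b - z l" using \<open>surj (\<lambda>b. Y b l)\<close> by (metis surjD)
  have "twice_deriv l (\<lambda>x. z x + Y c x) (\<lambda>x. q x + Y' c x) (\<lambda>x. A x (z x + Y c x) + r x)"
    using twice_deriv_lincomb[OF z(2) Y(3)[of c], of 1 1]
    by (simp, elim twice_deriv_cong) (simp add: linear_add[OF linsysD(3)[OF A]])
  then show ?thesis using z(1) Y(1) c by (intro exI[of _ "\<lambda>x. z x + Y c x"] exI[of _ "\<lambda>x. q x + Y' c x"]) simp
qed

text \<open>The shooting map is bounded below, so the initial slope, and with it the solution, is controlled by the data.\<close>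

lemma dirichlet_bound:
  fixes A :: "real \<Rightarrow> 'v::euclidean_space \<Rightarrow> 'v"
  assumes A: "linsys l A K" and nd: "nondeg l A"
  shows "\<exists>C>0. \<forall>u p s e. twice_deriv l u p s \<longrightarrow> (\<forall>x\<in>{0..l}. norm (s x - A x (u x)) \<le> e) \<longrightarrow>
     norm (u 0) \<le> e \<longrightarrow> norm (u l) \<le> e \<longrightarrow> (\<forall>x\<in>{0..l}. norm (u x) \<le> C * e \<and> norm (p x) \<le> C * e)"
proof -
  obtain Y Y' where Y: "\<And>b. Y b 0 = 0" "\<And>b. Y' b 0 = b" "\<And>b. twice_deriv l (Y b) (Y' b) (\<lambda>x. A x (Y b x))"
    and lin: "linear (\<lambda>b. Y b l)"
    using shooting_map[OF A] by blast
  obtain B where B: "B > 0" "\<And>b. B * norm b \<le> norm (Y b l)"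
    using linear_inj_bounded_below_pos[OF lin shooting_inj[OF A nd Y lin]] by blast
  have l: "0 < l" by (rule linsysD(1)[OF A])
  define G where "G = growth_const K l"
  have G: "G > 0" by (simp add: G_def growth_const_def)
  define D where "D = (1 + 2 * G) / B"
  have D: "D > 0" using G B by (simp add: D_def)
  define C where "C = G * (2 + D)"
  show ?thesis
  proof (intro exI conjI allI impI ballI)
    show "C > 0" using G D by (simp add: C_def)
    fix u p :: "real \<Rightarrow> 'v" and s e x
    assume t: "twice_deriv l u p s" and e: "\<forall>x\<in>{0..l}. norm (s x - A x (u x)) \<le> e"
      and b: "norm (u 0) \<le> e" "norm (u l) \<le> e" and x: "x \<in> {0..l}"
    have e0: "0 \<le> e" using b norm_ge_zero order_trans by blast
    define c where "c = p 0"
    have "norm ((s x - A x (Y c x)) - A x (u x - Y c x)) \<le> e" if "x \<in> {0..l}" for x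
      using e that linear_diff[OF linsysD(3)[OF A that]] by simp
    from linsys_bound(1)[OF A twice_deriv_diff[OF t Y(3)[of c]] this, of l] l
    have "norm (u l - Y c l) \<le> G * (norm (u 0) + e)"
      by (simp add: Y G_def c_def)
    also have "\<dots> \<le> G * (2 * e)" using G b by (intro mult_left_mono) auto
    finally have "norm (Y c l) \<le> e + G * (2 * e)"
      using b(2) norm_triangle_sub[of "Y c l" "u l"] by (simp add: norm_minus_commute)
    then have "B * norm c \<le> e + G * (2 * e)" using B(2)[of c] by linarith
    then have "norm c \<le> D * e" using B(1) by (simp add: D_def field_simps)
    then have *: "norm (u 0) + norm (p 0) + e \<le> (2 + D) * e" using b by (simp add: c_def algebra_simps)
    have "norm (u x) \<le> G * (norm (u 0) + norm (p 0) + e)" "norm (p x) \<le> G * (norm (u 0) + norm (p 0) + e)"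
      unfolding G_def using e by (auto intro!: linsys_bound[OF A t _ x])
    moreover have "G * (norm (u 0) + norm (p 0) + e) \<le> C * e"
      unfolding C_def mult.assoc using * G by (intro mult_left_mono) auto
    ultimately show "norm (u x) \<le> C * e" "norm (p x) \<le> C * e" by linarith+
  qed
qed

section \<open>Pruefer angles and the number of negative eigenvalues\<close>

text \<open>The continuous factor that makes the difference of two Pruefer equations linear in the difference of the angles.\<close>

definition sinc :: "real \<Rightarrow> real" where
  "sinc d = (if d = 0 then 1 else sin d / d)"

lemma sinc_mult: "sinc d * d = sin d"
  by (simp add: sinc_def)

lemma continuous_sinc: "continuous_on UNIV sinc"
  unfolding continuous_on_def
proof (intro ballI)
  fix x :: real
  show "(sinc \<longlongrightarrow> sinc x) (at x within UNIV)"
  proof (cases "x = 0")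
    case True
    have "((\<lambda>h. (sin h - sin 0) / (h - 0)) \<longlongrightarrow> cos 0) (at (0::real))"
      using DERIV_sin[of "0::real"] unfolding has_field_derivative_iff .
    then have "((\<lambda>h. sin h / h) \<longlongrightarrow> 1) (at (0::real))" by simp
    then have "(sinc \<longlongrightarrow> 1) (at 0)"
      by (rule Lim_transform_eventually) (auto simp: sinc_def eventually_at_filter)
    then show ?thesis using True by (simp add: sinc_def)
  next
    case False
    have "((\<lambda>h. sin h / h) \<longlongrightarrow> sin x / x) (at x)" using False by (intro tendsto_intros)
    moreover have "eventually (\<lambda>h. h \<noteq> 0) (at x)" using False
      by (metis eventually_at_ball' eventually_neq_at_within)
    ultimately have "(sinc \<longlongrightarrow> sin x / x) (at x)"
      by (elim Lim_transform_eventually eventually_mono) (auto simp: sinc_def)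
    then show ?thesis using False by (simp add: sinc_def)
  qed
qed

text \<open>With the integrating factor \<open>exp (- \<integral> a)\<close> the function \<open>\<delta>\<close> becomes nondecreasing.\<close>

lemma linear_comparison:
  fixes \<delta> :: "real \<Rightarrow> real"
  assumes d: "\<And>x. x \<in> {0..l} \<Longrightarrow> (\<delta> has_real_derivative a x * \<delta> x + r x) (at x within {0..l})"
    and a: "continuous_on {0..l} a" and r: "\<And>x. x \<in> {0..l} \<Longrightarrow> 0 \<le> r x"
    and st: "0 \<le> s" "s \<le> t" "t \<le> l" and s: "0 \<le> \<delta> s"
  shows "0 \<le> \<delta> t" "s \<le> c \<Longrightarrow> c < t \<Longrightarrow> 0 < r c \<Longrightarrow> 0 < \<delta> t"
proof -
  define I where "I x = integral {0..x} a" for x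
  have dI: "(I has_real_derivative a x) (at x within {0..l})" if "x \<in> {0..l}" for x
    using integral_has_vector_derivative[OF a that]
    by (simp add: I_def[abs_def] has_real_derivative_iff_has_vector_derivative)
  define E where "E x = \<delta> x * exp (- I x)" for x
  have dE: "(E has_real_derivative r x * exp (- I x)) (at x within {0..l})" if "x \<in> {0..l}" for x
    unfolding E_def using d[OF that] dI[OF that]
    by (auto intro!: derivative_eq_intros simp: algebra_simps)
  have mono: "E x \<le> E y" if "0 \<le> x" "x \<le> y" "y \<le> l" for x y
    using nondecreasing_within[of 0 l E, OF dE] r that by simp
  have "0 \<le> E s" using s by (simp add: E_def)
  then have Et: "0 \<le> E t" using mono[of s t] st by simp
  then show t0: "0 \<le> \<delta> t" by (simp add: E_def zero_le_mult_iff)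
  show "0 < \<delta> t" if c: "s \<le> c" "c < t" "0 < r c"
  proof (rule ccontr)
    assume "\<not> 0 < \<delta> t"
    with t0 have "E t = 0" by (simp add: E_def)
    then have E0: "E x = 0" if "x \<in> {s..t}" for x
      using mono[of s x] mono[of x t] \<open>0 \<le> E s\<close> that st by fastforce
    have "(E has_real_derivative r c * exp (- I c)) (at c within {c..t})"
      using dE[of c] c st by (auto elim: has_field_derivative_subset)
    moreover have "(E has_real_derivative 0) (at c within {c..t})"
      by (rule has_field_derivative_transform_within[where f = "\<lambda>x. 0" and d = 1]) (use c E0 in auto)
    ultimately have "r c * exp (- I c) = 0"
      using c unfolding has_real_derivative_iff_has_vector_derivative
      by (metis at_within_Icc_at_right trivial_limit_at_right_real vector_derivative_unique_within)
    then show False using c by simp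
  qed
qed

text \<open>For a solution of \<open>y'' = - W y\<close> with \<open>y(0) = 0\<close>, \<open>y'(0) = 1\<close> write \<open>y = r sin \<theta>\<close> and \<open>y' = r cos \<theta>\<close> with \<open>r > 0\<close>; this is
  the equation of the angle.\<close>

definition prufer :: "real \<Rightarrow> (real \<Rightarrow> real) \<Rightarrow> (real \<Rightarrow> real) \<Rightarrow> bool" where
  "prufer l W \<theta> \<longleftrightarrow> \<theta> 0 = 0 \<and>
     (\<forall>x\<in>{0..l}. (\<theta> has_real_derivative (cos (\<theta> x))\<^sup>2 + W x * (sin (\<theta> x))\<^sup>2) (at x within {0..l}))"

lemma sin_sq_diff: "(sin a)\<^sup>2 - (sin b)\<^sup>2 = sin (a - b) * sin (a + b :: real)"
proof -
  have "sin (a - b) * sin (a + b) = (sin a)\<^sup>2 * (cos b)\<^sup>2 - (cos a)\<^sup>2 * (sin b)\<^sup>2"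
    by (simp add: sin_diff sin_add power2_eq_square algebra_simps)
  also have "\<dots> = (sin a)\<^sup>2 - (sin b)\<^sup>2" by (simp add: cos_squared_eq algebra_simps)
  finally show ?thesis ..
qed

lemma prufer_rhs_diff:
  fixes a b W V :: real
  shows "((cos a)\<^sup>2 + W * (sin a)\<^sup>2) - ((cos b)\<^sup>2 + V * (sin b)\<^sup>2)
    = ((W - 1) * sin (a + b) * sinc (a - b)) * (a - b) + (W - V) * (sin b)\<^sup>2"
proof -
  have "((W - 1) * sin (a + b) * sinc (a - b)) * (a - b) = (W - 1) * ((sin a)\<^sup>2 - (sin b)\<^sup>2)"
    unfolding sin_sq_diff mult.assoc sinc_mult by simp
  then show ?thesis by (simp add: cos_squared_eq algebra_simps)
qed

lemma prufer_rhs_lipschitz: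
  fixes a b W :: real
  shows "\<bar>((cos a)\<^sup>2 + W * (sin a)\<^sup>2) - ((cos b)\<^sup>2 + W * (sin b)\<^sup>2)\<bar> \<le> (\<bar>W\<bar> + 1) * \<bar>a - b\<bar>"
proof -
  have "((cos a)\<^sup>2 + W * (sin a)\<^sup>2) - ((cos b)\<^sup>2 + W * (sin b)\<^sup>2) = (W - 1) * (sin (a - b) * sin (a + b))"
    unfolding sin_sq_diff[symmetric] by (simp add: cos_squared_eq algebra_simps)
  also have "\<bar>\<dots>\<bar> = \<bar>W - 1\<bar> * (\<bar>sin (a - b)\<bar> * \<bar>sin (a + b)\<bar>)" by (simp add: abs_mult)
  also have "\<dots> \<le> (\<bar>W\<bar> + 1) * (\<bar>a - b\<bar> * 1)"
    by (intro mult_mono abs_sin_x_le_abs_x) auto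
  finally show ?thesis by simp
qed

lemma prufer_exists:
  assumes l: "0 < l" and W: "continuous_on {0..l} W"
  shows "\<exists>\<theta>. prufer l W \<theta>"
proof -
  obtain K where K: "K \<ge> 0" "\<And>x. x \<in> {0..l} \<Longrightarrow> norm (W x) \<le> K"
    using continuous_on_interval_bound[OF W] by blast
  have "\<exists>\<theta>. \<theta> 0 = (0::real) \<and> (\<forall>x\<in>{0..l}. (\<theta> has_vector_derivative (cos (\<theta> x))\<^sup>2 + W x * (sin (\<theta> x))\<^sup>2) (at x within {0..l}))"
  proof (rule ode_exists[where F = "\<lambda>x t. (cos t)\<^sup>2 + W x * (sin t)\<^sup>2"])
    have "continuous_on ({0..l} \<times> (UNIV :: real set)) (\<lambda>z. W (fst z))"
      by (rule continuous_on_compose2[OF W]) (auto intro!: continuous_intros)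
    then show "continuous_on ({0..l} \<times> UNIV) (\<lambda>(x, t::real). (cos t)\<^sup>2 + W x * (sin t)\<^sup>2)"
      unfolding case_prod_unfold by (intro continuous_intros)
    fix x y z :: real assume "x \<in> {0..l}"
    then have "(\<bar>W x\<bar> + 1) * \<bar>y - z\<bar> \<le> (K + 1) * \<bar>y - z\<bar>"
      using K by (intro mult_right_mono) auto
    then show "norm ((cos y)\<^sup>2 + W x * (sin y)\<^sup>2 - ((cos z)\<^sup>2 + W x * (sin z)\<^sup>2)) \<le> (K + 1) * norm (y - z)"
      using prufer_rhs_lipschitz[of y "W x" z] by simp
  qed (use l in auto)
  then show ?thesis by (simp add: prufer_def has_real_derivative_iff_has_vector_derivative)
qed

lemma pruferD:
  assumes "prufer l W \<theta>"
  shows "\<theta> 0 = 0"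
    "x \<in> {0..l} \<Longrightarrow> (\<theta> has_real_derivative (cos (\<theta> x))\<^sup>2 + W x * (sin (\<theta> x))\<^sup>2) (at x within {0..l})"
    "continuous_on {0..l} \<theta>"
proof -
  show 1: "x \<in> {0..l} \<Longrightarrow> (\<theta> has_real_derivative (cos (\<theta> x))\<^sup>2 + W x * (sin (\<theta> x))\<^sup>2) (at x within {0..l})" for x
    using assms by (simp add: prufer_def)
  show "\<theta> 0 = 0" using assms by (simp add: prufer_def)
  show "continuous_on {0..l} \<theta>"
    by (rule DERIV_continuous_on) (erule 1)
qed

lemma prufer_solution:
  assumes l: "0 < l" and W: "continuous_on {0..l} W" and p: "prufer l W \<theta>"
  shows "\<exists>r. (\<forall>x. 0 < r x) \<and> r 0 = 1 \<and>
     twice_deriv l (\<lambda>x. r x * sin (\<theta> x)) (\<lambda>x. r x * cos (\<theta> x)) (\<lambda>x. - (W x *\<^sub>R (r x * sin (\<theta> x))))"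
proof -
  define h where "h x = (1 - W x) * sin (\<theta> x) * cos (\<theta> x)" for x
  have ch: "continuous_on {0..l} h" unfolding h_def by (intro continuous_intros W pruferD(3)[OF p])
  define r where "r x = exp (integral {0..x} h)" for x
  have dr: "(r has_real_derivative r x * h x) (at x within {0..l})" if "x \<in> {0..l}" for x
  proof -
    have "((\<lambda>x. integral {0..x} h) has_real_derivative h x) (at x within {0..l})"
      using integral_has_vector_derivative[OF ch that] by (simp add: has_real_derivative_iff_has_vector_derivative)
    then show ?thesis unfolding r_def by (auto intro!: derivative_eq_intros)
  qed
  have 1: "((\<lambda>x. r x * sin (\<theta> x)) has_real_derivative r x * cos (\<theta> x)) (at x within {0..l})" if x: "x \<in> {0..l}" for x
  proof -
    have "((\<lambda>x. r x * sin (\<theta> x)) has_real_derivative r x * h x * sin (\<theta> x) + (cos (\<theta> x) * ((cos (\<theta> x))\<^sup>2 + W x * (sin (\<theta> x))\<^sup>2)) * r x) (at x within {0..l})"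
      using dr[OF x] pruferD(2)[OF p x] by (auto intro!: derivative_eq_intros)
    moreover have "r x * h x * sin (\<theta> x) + (cos (\<theta> x) * ((cos (\<theta> x))\<^sup>2 + W x * (sin (\<theta> x))\<^sup>2)) * r x
      = r x * cos (\<theta> x) * ((sin (\<theta> x))\<^sup>2 + (cos (\<theta> x))\<^sup>2)"
      unfolding h_def by algebra
    ultimately show ?thesis by simp
  qed
  have 2: "((\<lambda>x. r x * cos (\<theta> x)) has_real_derivative - (W x * (r x * sin (\<theta> x)))) (at x within {0..l})" if x: "x \<in> {0..l}" for x
  proof -
    have "((\<lambda>x. r x * cos (\<theta> x)) has_real_derivative r x * h x * cos (\<theta> x) + (- sin (\<theta> x) * ((cos (\<theta> x))\<^sup>2 + W x * (sin (\<theta> x))\<^sup>2)) * r x) (at x within {0..l})"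
      using dr[OF x] pruferD(2)[OF p x] by (auto intro!: derivative_eq_intros)
    moreover have "r x * h x * cos (\<theta> x) + (- sin (\<theta> x) * ((cos (\<theta> x))\<^sup>2 + W x * (sin (\<theta> x))\<^sup>2)) * r x
      = - (W x * (r x * sin (\<theta> x))) * ((sin (\<theta> x))\<^sup>2 + (cos (\<theta> x))\<^sup>2)"
      unfolding h_def by algebra
    ultimately show ?thesis by simp
  qed
  have "twice_deriv l (\<lambda>x. r x * sin (\<theta> x)) (\<lambda>x. r x * cos (\<theta> x)) (\<lambda>x. - (W x *\<^sub>R (r x * sin (\<theta> x))))"
    unfolding twice_deriv_def using 1 2 by (simp add: has_real_derivative_iff_has_vector_derivative)
  then show ?thesis by (intro exI[of _ r]) (simp add: r_def)
qed

lemma sin_minus_npi: "sin (t - real k * pi) = (-1) ^ k * sin t" "cos (t - real k * pi) = (-1) ^ k * cos t"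
  by (simp_all add: sin_diff cos_diff)

text \<open>At a multiple of \<open>\<pi>\<close> the angle has slope \<open>1\<close>, so it passes each multiple once, upwards. The zeros of \<open>y\<close> are these
  passages.\<close>

lemma prufer_crossing:
  assumes l: "0 < l" and W: "continuous_on {0..l} W" and p: "prufer l W \<theta>"
    and st: "0 \<le> s" "s < t" "t \<le> l" and s: "real k * pi \<le> \<theta> s"
  shows "real k * pi < \<theta> t"
proof -
  define \<delta> where "\<delta> x = \<theta> x - real k * pi" for x
  have c: "continuous_on {0..l} (\<lambda>x. (W x - 1) * sin (\<delta> x) * sinc (\<delta> x))"
    unfolding \<delta>_def by (intro continuous_intros W pruferD(3)[OF p] continuous_on_compose2[OF continuous_sinc]) auto
  have "0 < \<delta> t"
  proof (rule linear_comparison(2)[where \<delta> = \<delta> and t = t, OF _ c, where r = "\<lambda>x. 1" and s = s and c = s])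
    fix x assume x: "x \<in> {0..l}"
    have "(\<delta> has_real_derivative (cos (\<theta> x))\<^sup>2 + W x * (sin (\<theta> x))\<^sup>2) (at x within {0..l})"
      unfolding \<delta>_def using pruferD(2)[OF p x] by (auto intro!: derivative_eq_intros)
    moreover have "((-1) ^ k)\<^sup>2 = (1::real)" by (simp add: power2_eq_square flip: power_mult_distrib)
    then have "sin (\<delta> x) * (sinc (\<delta> x) * \<delta> x) = (sin (\<theta> x))\<^sup>2"
      by (simp add: \<delta>_def sinc_mult sin_minus_npi power_mult_distrib flip: power2_eq_square)
    then have "(cos (\<theta> x))\<^sup>2 + W x * (sin (\<theta> x))\<^sup>2 = (W x - 1) * sin (\<delta> x) * sinc (\<delta> x) * \<delta> x + 1"
      by (simp add: mult.assoc cos_squared_eq left_diff_distrib)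
    ultimately show "(\<delta> has_real_derivative (W x - 1) * sin (\<delta> x) * sinc (\<delta> x) * \<delta> x + 1) (at x within {0..l})"
      by simp
  qed (use st s in \<open>auto simp: \<delta>_def\<close>)
  then show ?thesis by (simp add: \<delta>_def)
qed

lemma prufer_pos:
  assumes "0 < l" "continuous_on {0..l} W" "prufer l W \<theta>" "0 < t" "t \<le> l"
  shows "0 < \<theta> t"
  using prufer_crossing[OF assms(1-3), of 0 t 0] assms pruferD(1)[OF assms(3)] by simp

text \<open>The difference of the angles solves a linear equation with inhomogeneity \<open>(W - V) (sin \<eta>)\<^sup>2\<close>, which is positive
  somewhere.\<close>

lemma prufer_strict_mono:
  assumes l: "0 < l" and W: "continuous_on {0..l} W" "continuous_on {0..l} V"
    and p: "prufer l W \<theta>" "prufer l V \<eta>" and less: "\<And>x. x \<in> {0..l} \<Longrightarrow> V x < W x"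
  shows "\<eta> l < \<theta> l"
proof -
  have cc: "continuous_on {0..l} \<theta>" "continuous_on {0..l} \<eta>" using pruferD(3) p by blast+
  have c: "continuous_on {0..l} (\<lambda>x. (W x - 1) * sin (\<theta> x + \<eta> x) * sinc (\<theta> x - \<eta> x))"
    by (intro continuous_intros W cc continuous_on_compose2[OF continuous_sinc]) auto
  have "isCont (\<lambda>x. \<eta> (max 0 (min x l))) 0"
  proof -
    have "continuous_on UNIV (\<lambda>x. \<eta> (max 0 (min x l)))"
      by (rule continuous_on_compose2[OF cc(2)]) (use l in \<open>auto intro!: continuous_intros\<close>)
    then show ?thesis by (simp add: continuous_on_eq_continuous_at)
  qed
  then obtain d where d: "d > 0" "\<And>x. \<bar>x\<bar> < d \<Longrightarrow> \<bar>\<eta> (max 0 (min x l))\<bar> < pi"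
    using pruferD(1)[OF p(2)] l pi_gt_zero spec[of _ pi]
    unfolding continuous_at_eps_delta by (auto simp: dist_real_def min_def dest: spec[of _ pi])
  define c where "c = min (d/2) (l/2)"
  have cl: "0 < c" "c < l" "\<bar>c\<bar> < d" using d l by (auto simp: c_def)
  have "\<eta> c < pi" using d(2)[OF cl(3)] cl by simp
  moreover have "0 < \<eta> c" using prufer_pos[OF l W(2) p(2)] cl by simp
  ultimately have "sin (\<eta> c) > 0" by (rule sin_gt_zero[rotated])
  then have rc: "0 < (W c - V c) * (sin (\<eta> c))\<^sup>2" using less[of c] cl by simp
  have "0 < \<theta> l - \<eta> l"
  proof (rule linear_comparison(2)[where \<delta> = "\<lambda>x. \<theta> x - \<eta> x", OF _ c, where r = "\<lambda>x. (W x - V x) * (sin (\<eta> x))\<^sup>2" and s = 0 and c = c])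
    fix x assume x: "x \<in> {0..l}"
    show "((\<lambda>x. \<theta> x - \<eta> x) has_real_derivative
       (W x - 1) * sin (\<theta> x + \<eta> x) * sinc (\<theta> x - \<eta> x) * (\<theta> x - \<eta> x) + (W x - V x) * (sin (\<eta> x))\<^sup>2) (at x within {0..l})"
      unfolding prufer_rhs_diff[symmetric]
      using pruferD(2)[OF p(1) x] pruferD(2)[OF p(2) x] by (rule DERIV_diff)
    show "0 \<le> (W x - V x) * (sin (\<eta> x))\<^sup>2" using less[OF x] by simp
  qed (use cl l rc pruferD(1)[OF p(1)] pruferD(1)[OF p(2)] in auto)
  then show ?thesis by simp
qed

text \<open>At the angle \<open>\<pi>/2\<close> the slope is \<open>W < 0\<close>, so not even \<open>\<pi>/2\<close> can be exceeded.\<close>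

lemma prufer_less_pi:
  assumes l: "0 < l" and W: "continuous_on {0..l} W" and p: "prufer l W \<theta>"
    and neg: "\<And>x. x \<in> {0..l} \<Longrightarrow> W x < 0"
  shows "\<theta> l < pi"
proof -
  define \<delta> where "\<delta> x = pi / 2 - \<theta> x" for x
  have c: "continuous_on {0..l} (\<lambda>x. - (1 - W x) * sin (\<delta> x) * sinc (\<delta> x))"
    unfolding \<delta>_def by (intro continuous_intros W pruferD(3)[OF p] continuous_on_compose2[OF continuous_sinc]) auto
  have "0 \<le> \<delta> l"
  proof (rule linear_comparison(1)[where \<delta> = \<delta> and t = l, OF _ c, where r = "\<lambda>x. - W x" and s = 0])
    fix x assume x: "x \<in> {0..l}"
    have "(\<delta> has_real_derivative - ((cos (\<theta> x))\<^sup>2 + W x * (sin (\<theta> x))\<^sup>2)) (at x within {0..l})"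
      unfolding \<delta>_def using pruferD(2)[OF p x] by (auto intro!: derivative_eq_intros)
    moreover have "sin (\<delta> x) * (sinc (\<delta> x) * \<delta> x) = (cos (\<theta> x))\<^sup>2"
      by (simp add: \<delta>_def sinc_mult sin_diff flip: power2_eq_square)
    then have "- ((cos (\<theta> x))\<^sup>2 + W x * (sin (\<theta> x))\<^sup>2) = - (1 - W x) * sin (\<delta> x) * sinc (\<delta> x) * \<delta> x + - W x"
      by (simp add: mult.assoc sin_squared_eq left_diff_distrib right_diff_distrib)
    ultimately show "(\<delta> has_real_derivative - (1 - W x) * sin (\<delta> x) * sinc (\<delta> x) * \<delta> x + - W x) (at x within {0..l})"
      by simp
    show "0 \<le> - W x" using neg[OF x] by simp
  qed (use l pruferD(1)[OF p] in \<open>auto simp: \<delta>_def\<close>)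
  then show ?thesis using pi_gt_zero unfolding \<delta>_def by linarith
qed

lemma twice_deriv_derivative_unique:
  fixes u :: "real \<Rightarrow> 'v::euclidean_space"
  assumes l: "0 < l" and t: "twice_deriv l u p s" "twice_deriv l u' p' s'" and eq: "\<And>x. x \<in> {0..l} \<Longrightarrow> u x = u' x"
    and x: "x \<in> {0..l}"
  shows "p x = p' x"
proof -
  have "(u has_vector_derivative p' x) (at x within {0..l})"
    by (rule has_vector_derivative_transform[OF x _ twice_derivD(1)[OF t(2) x]]) (simp add: eq)
  then show ?thesis
    using vector_derivative_unique_within_closed_interval[of 0 l x u "p x" "p' x"] l x twice_derivD(1)[OF t(1) x] by simp
qed

lemma twice_deriv_unique:
  fixes u :: "real \<Rightarrow> 'v::euclidean_space"
  assumes l: "0 < l" and t: "twice_deriv l u p s" "twice_deriv l u' p' s'" and eq: "\<And>x. x \<in> {0..l} \<Longrightarrow> u x = u' x"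
    and x: "x \<in> {0..l}"
  shows "s x = s' x"
proof -
  have p: "p x = p' x" if "x \<in> {0..l}" for x by (rule twice_deriv_derivative_unique[OF l t eq that])
  have "(p has_vector_derivative s' x) (at x within {0..l})"
    by (rule has_vector_derivative_transform[OF x _ twice_derivD(2)[OF t(2) x]]) (simp add: p)
  then show ?thesis
    using vector_derivative_unique_within_closed_interval[of 0 l x p "s x" "s' x"] l x twice_derivD(2)[OF t(1) x] by simp
qed

text \<open>The negative Dirichlet eigenvalues of \<open>- u'' - W u\<close>.\<close>

definition neg_eigs :: "real \<Rightarrow> (real \<Rightarrow> real) \<Rightarrow> real set" where
  "neg_eigs l W = {\<mu>. \<mu> < 0 \<and> (\<exists>u p. twice_deriv l u p (\<lambda>x. - ((W x + \<mu>) *\<^sub>R u x)) \<and>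
      u 0 = (0::real) \<and> u l = 0 \<and> (\<exists>x\<in>{0..l}. u x \<noteq> 0))}"

lemma dirichlet_eigenvalue_iff_prufer:
  assumes l: "0 < l" and W: "continuous_on {0..l} W" and p: "prufer l W \<theta>"
  shows "(\<exists>u p. twice_deriv l u p (\<lambda>x. - (W x *\<^sub>R u x)) \<and> u 0 = (0::real) \<and> u l = 0 \<and> (\<exists>x\<in>{0..l}. u x \<noteq> 0))
    \<longleftrightarrow> sin (\<theta> l) = 0"
proof -
  obtain r where r: "\<And>x. 0 < r x" "r 0 = 1"
    and t: "twice_deriv l (\<lambda>x. r x * sin (\<theta> x)) (\<lambda>x. r x * cos (\<theta> x)) (\<lambda>x. - (W x *\<^sub>R (r x * sin (\<theta> x))))"
    using prufer_solution[OF l W p] by blast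
  obtain K where A: "linsys l (\<lambda>x v :: real. - (W x *\<^sub>R v)) K"
    using linsys_scaleR[OF l W] by blast
  show ?thesis
  proof
    assume "\<exists>u p. twice_deriv l u p (\<lambda>x. - (W x *\<^sub>R u x)) \<and> u 0 = (0::real) \<and> u l = 0 \<and> (\<exists>x\<in>{0..l}. u x \<noteq> 0)"
    then obtain u q z where u: "twice_deriv l u q (\<lambda>x. - (W x *\<^sub>R u x))" "u 0 = (0::real)" "u l = 0" "z \<in> {0..l}" "u z \<noteq> 0" by blast
    have eq: "u x = q 0 * (r x * sin (\<theta> x))" if x: "x \<in> {0..l}" for x
      using linsys_unique(1)[OF A u(1) twice_deriv_lincomb[OF t t, of "q 0" 0], where r = "\<lambda>x. 0", OF _ _ _ _ x] u r pruferD(1)[OF p]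
      by (simp add: algebra_simps)
    have "q 0 \<noteq> 0" using eq[OF u(4)] u(5) by auto
    then show "sin (\<theta> l) = 0" using eq[of l] u(3) l r(1)[of l] by auto
  next
    assume s: "sin (\<theta> l) = 0"
    have "\<exists>x\<in>{0..l}. r x * sin (\<theta> x) \<noteq> 0"
    proof (rule ccontr)
      assume "\<not> (\<exists>x\<in>{0..l}. r x * sin (\<theta> x) \<noteq> 0)"
      then have z: "\<And>x. x \<in> {0..l} \<Longrightarrow> r x * sin (\<theta> x) = 0" by blast
      have t0: "twice_deriv l (\<lambda>x. 0::real) (\<lambda>x. 0) (\<lambda>x. 0)" by (auto simp: twice_deriv_def)
      have "r 0 * cos (\<theta> 0) = 0" using twice_deriv_derivative_unique[OF l t t0 z, of 0] l by simp
      then show False using r pruferD(1)[OF p] by simp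
    qed
    then show "\<exists>u p. twice_deriv l u p (\<lambda>x. - (W x *\<^sub>R u x)) \<and> u 0 = (0::real) \<and> u l = 0 \<and> (\<exists>x\<in>{0..l}. u x \<noteq> 0)"
      using t s pruferD(1)[OF p]
      by (intro exI[of _ "\<lambda>x. r x * sin (\<theta> x)"] exI[of _ "\<lambda>x. r x * cos (\<theta> x)"]) simp
  qed
qed

text \<open>Gronwall's inequality for the difference of two angle equations.\<close>

lemma prufer_continuous_in_parameter:
  assumes l: "0 < l" and W: "continuous_on {0..l} W" and T: "\<And>\<mu>. prufer l (\<lambda>x. W x + \<mu>) (T \<mu>)"
  shows "isCont (\<lambda>\<mu>. T \<mu> l) a"
proof -
  have "continuous_on {0..l} (\<lambda>x. W x + a)" by (intro continuous_intros W)
  from continuous_on_interval_bound[OF this] obtain K where K: "K \<ge> 0" "\<And>x. x \<in> {0..l} \<Longrightarrow> norm (W x + a) \<le> K"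
    by blast
  define M where "M = exp ((2 * (K + 1) + 1) * l)"
  have M: "M \<ge> 1" using K l by (simp add: M_def)
  have le: "\<bar>T b l - T a l\<bar> \<le> \<bar>b - a\<bar> * M" for b
  proof -
    define e where "e = \<bar>b - a\<bar>"
    have "(norm (T b l - T a l))\<^sup>2 + e\<^sup>2 \<le> ((norm (T b 0 - T a 0))\<^sup>2 + e\<^sup>2) * exp ((2 * (K + 1) + 1) * l)"
    proof (rule gronwall[where l = l and Y = "\<lambda>x. T b x - T a x"])
      fix x assume x: "x \<in> {0..l}"
      show "((\<lambda>x. T b x - T a x) has_vector_derivative
          ((cos (T b x))\<^sup>2 + (W x + b) * (sin (T b x))\<^sup>2) - ((cos (T a x))\<^sup>2 + (W x + a) * (sin (T a x))\<^sup>2)) (at x within {0..l})"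
        using pruferD(2)[OF T[of b] x] pruferD(2)[OF T[of a] x]
        by (intro has_vector_derivative_diff) (simp_all add: has_real_derivative_iff_has_vector_derivative)
      have "((cos (T b x))\<^sup>2 + (W x + b) * (sin (T b x))\<^sup>2) - ((cos (T a x))\<^sup>2 + (W x + a) * (sin (T a x))\<^sup>2)
        = (((cos (T b x))\<^sup>2 + (W x + a) * (sin (T b x))\<^sup>2) - ((cos (T a x))\<^sup>2 + (W x + a) * (sin (T a x))\<^sup>2))
          + (b - a) * (sin (T b x))\<^sup>2" by (simp add: algebra_simps)
      also have "\<bar>\<dots>\<bar> \<le> (\<bar>W x + a\<bar> + 1) * \<bar>T b x - T a x\<bar> + \<bar>b - a\<bar> * 1"
        by (rule order_trans[OF abs_triangle_ineq], rule add_mono[OF prufer_rhs_lipschitz])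
          (auto simp: abs_mult abs_square_le_1 intro!: mult_left_le)
      also have "\<dots> \<le> (K + 1) * \<bar>T b x - T a x\<bar> + e"
        using K(2)[OF x] by (auto simp: e_def intro!: mult_right_mono)
      finally show "norm (((cos (T b x))\<^sup>2 + (W x + b) * (sin (T b x))\<^sup>2) - ((cos (T a x))\<^sup>2 + (W x + a) * (sin (T a x))\<^sup>2))
        \<le> (K + 1) * norm (T b x - T a x) + e" by simp
    qed (use K l in \<open>auto simp: e_def\<close>)
    then have "(norm (T b l - T a l))\<^sup>2 + e\<^sup>2 \<le> e\<^sup>2 * M" using pruferD(1)[OF T] by (simp add: M_def)
    also have "\<dots> \<le> e\<^sup>2 * M\<^sup>2" using M by (intro mult_left_mono) (auto simp: power2_eq_square)
    finally have "(norm (T b l - T a l))\<^sup>2 \<le> (e * M)\<^sup>2"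
      unfolding power_mult_distrib using zero_le_power2[of e] by linarith
    then have "norm (T b l - T a l) \<le> e * M" by (rule power2_le_imp_le) (use M in \<open>simp add: e_def\<close>)
    then show ?thesis by (simp add: e_def)
  qed
  show ?thesis
    unfolding isCont_def
  proof (rule Lim_null[THEN iffD2], rule Lim_null_comparison)
    show "eventually (\<lambda>b. norm (T b l - T a l) \<le> \<bar>b - a\<bar> * M) (at a)" using le by simp
    show "((\<lambda>b. \<bar>b - a\<bar> * M) \<longlongrightarrow> 0) (at a)"
      by (auto intro!: tendsto_eq_intros)
  qed
qed

text \<open>The end value \<open>T \<mu>\<close> of the angle of \<open>W + \<mu>\<close> increases strictly and continuously from below \<open>\<pi>\<close> to \<open>\<theta> l\<close> as \<open>\<mu>\<close>
  increases to \<open>0\<close>, and \<open>\<mu>\<close> is an eigenvalue exactly when \<open>T \<mu>\<close> is a multiple of \<open>\<pi>\<close>.\<close>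

lemma card_neg_eigs:
  assumes l: "0 < l" and W: "continuous_on {0..l} W" and p: "prufer l W \<theta>"
    and k: "real k * pi < \<theta> l" "\<theta> l \<le> (real k + 1) * pi"
  shows "card (neg_eigs l W) = k"
proof -
  have W\<mu>: "continuous_on {0..l} (\<lambda>x. W x + \<mu>)" for \<mu> by (intro continuous_intros W)
  define T where "T \<mu> = (if \<mu> = 0 then \<theta> else SOME \<eta>. prufer l (\<lambda>x. W x + \<mu>) \<eta>)" for \<mu>
  have T: "prufer l (\<lambda>x. W x + \<mu>) (T \<mu>)" for \<mu>
    using p someI_ex[OF prufer_exists[OF l W\<mu>[of \<mu>]]] by (auto simp: T_def)
  have T0: "T 0 = \<theta>" by (simp add: T_def)
  have mono: "T a l < T b l" if "a < b" for a b
    by (rule prufer_strict_mono[OF l W\<mu> W\<mu> T T]) (use that in simp)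
  have cont: "isCont (\<lambda>\<mu>. T \<mu> l) a" for a
    by (rule prufer_continuous_in_parameter[OF l W T])
  obtain K where K: "K \<ge> 0" "\<And>x. x \<in> {0..l} \<Longrightarrow> norm (W x) \<le> K"
    using continuous_on_interval_bound[OF W] by blast
  have low: "T (- (K + 1)) l < pi"
  proof (rule prufer_less_pi[OF l W\<mu> T])
    show "W x + - (K + 1) < 0" if "x \<in> {0..l}" for x using K(2)[OF that] by simp
  qed
  have iff: "\<mu> \<in> neg_eigs l W \<longleftrightarrow> \<mu> < 0 \<and> sin (T \<mu> l) = 0" for \<mu>
    unfolding neg_eigs_def using dirichlet_eigenvalue_iff_prufer[OF l W\<mu> T, of \<mu>] by simp
  have "\<exists>\<mu><0. T \<mu> l = real j * pi" if j: "j \<in> {1..k}" for j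
  proof -
    have "real j * pi \<le> real k * pi" using j by (intro mult_right_mono) auto
    then have hi: "real j * pi < T 0 l" unfolding T0 using k(1) by linarith
    have pj: "pi \<le> real j * pi" using j by simp
    have lo: "T (- (K + 1)) l \<le> real j * pi" by (rule less_imp_le[OF less_le_trans[OF low pj]])
    have "\<exists>x. - (K + 1) \<le> x \<and> x \<le> 0 \<and> T x l = real j * pi"
      by (rule IVT) (use lo hi K cont in auto)
    then obtain x where "x \<le> 0" "T x l = real j * pi" by blast
    then show ?thesis using hi by (intro exI[of _ x]) (auto simp: less_le)
  qed
  then obtain h where h: "\<And>j. j \<in> {1..k} \<Longrightarrow> h j < 0 \<and> T (h j) l = real j * pi" by metis
  have "inj_on h {1..k}"
    by (rule inj_onI) (metis h mult_right_cancel of_nat_eq_iff pi_neq_zero)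
  moreover have "h ` {1..k} = neg_eigs l W"
  proof
    show "h ` {1..k} \<subseteq> neg_eigs l W" using h by (auto simp: iff)
    show "neg_eigs l W \<subseteq> h ` {1..k}"
    proof
      fix \<mu> assume "\<mu> \<in> neg_eigs l W"
      then have \<mu>: "\<mu> < 0" "sin (T \<mu> l) = 0" by (auto simp: iff)
      then obtain i :: int where i: "T \<mu> l = of_int i * pi" using sin_zero_iff_int2 by blast
      have "0 < T \<mu> l" using prufer_pos[OF l W\<mu> T, of l] l by simp
      then have "0 < i" using i by (simp add: zero_less_mult_iff)
      have "of_int i * pi < (real k + 1) * pi" using mono[OF \<mu>(1)] k(2) unfolding i T0 by linarith
      then have "of_int i < real k + 1" by (rule mult_right_less_imp_less) simp
      then have "i \<le> int k" by linarith
      define j where "j = nat i"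
      have j: "j \<in> {1..k}" "real j = of_int i" using \<open>0 < i\<close> \<open>i \<le> int k\<close> by (auto simp: j_def)
      have "T (h j) l = T \<mu> l" using h[OF j(1)] j i by simp
      then have "h j = \<mu>" using mono[of "h j" \<mu>] mono[of \<mu> "h j"] by (cases "h j" \<mu> rule: linorder_cases) auto
      then show "\<mu> \<in> h ` {1..k}" using j by blast
    qed
  qed
  ultimately show ?thesis using card_image[of h "{1..k}"] by simp
qed

text \<open>The end value of the angle lies in \<open>(k \<pi>, (k + 1) \<pi>]\<close>, where \<open>k\<close> is the number of negative eigenvalues; this fixes
  the sign of the end value or the end slope, and for small \<open>k\<close> the position of all zeros.\<close>

lemma sturm_oscillation:
  assumes l: "0 < l" and W: "continuous_on {0..l} W"
    and y: "twice_deriv l y p (\<lambda>x. - (W x *\<^sub>R y x))" "y 0 = (0::real)" "p 0 = 1"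
  shows "y l \<noteq> 0 \<Longrightarrow> 0 < (-1) ^ card (neg_eigs l W) * y l"
    and "y l = 0 \<Longrightarrow> 0 < (-1) ^ Suc (card (neg_eigs l W)) * p l"
    and "y l \<noteq> 0 \<Longrightarrow> card (neg_eigs l W) = 1 \<Longrightarrow>
      \<exists>c. 0 < c \<and> c < l \<and> y c = 0 \<and> (\<forall>x. 0 < x \<and> x < c \<longrightarrow> 0 < y x) \<and> (\<forall>x. c < x \<and> x \<le> l \<longrightarrow> y x < 0)"
    and "y l = 0 \<Longrightarrow> card (neg_eigs l W) = 0 \<Longrightarrow> (\<forall>x. 0 < x \<and> x < l \<longrightarrow> 0 < y x)"
proof -
  obtain \<theta> where p\<theta>: "prufer l W \<theta>" using prufer_exists[OF l W] by blast
  obtain r where r: "\<And>x. 0 < r x" "r 0 = 1"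
    and t: "twice_deriv l (\<lambda>x. r x * sin (\<theta> x)) (\<lambda>x. r x * cos (\<theta> x)) (\<lambda>x. - (W x *\<^sub>R (r x * sin (\<theta> x))))"
    using prufer_solution[OF l W p\<theta>] by blast
  obtain K where A: "linsys l (\<lambda>x v :: real. - (W x *\<^sub>R v)) K"
    using linsys_scaleR[OF l W] by blast
  have eq: "y x = r x * sin (\<theta> x)" "p x = r x * cos (\<theta> x)" if x: "x \<in> {0..l}" for x
    using linsys_unique[OF A y(1) t, where r = "\<lambda>x. 0", OF _ _ _ _ x] y r pruferD(1)[OF p\<theta>] by simp_all
  define k where "k = nat (\<lceil>\<theta> l / pi\<rceil> - 1)"
  have pos: "0 < \<theta> l" using prufer_pos[OF l W p\<theta>, of l] l by simp
  then have "0 < \<theta> l / pi" by simp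
  then have k: "real k < \<theta> l / pi" "\<theta> l / pi \<le> real k + 1" unfolding k_def by linarith+
  then have k: "real k * pi < \<theta> l" "\<theta> l \<le> (real k + 1) * pi"
    by (simp_all add: field_simps)
  have c: "card (neg_eigs l W) = k" by (rule card_neg_eigs[OF l W p\<theta> k])
  have ll: "l \<in> {0..l}" using l by simp
  have yl: "y l = 0 \<longleftrightarrow> sin (\<theta> l) = 0" using eq(1)[OF ll] r(1)[of l] by simp
  have end_iff: "sin (\<theta> l) = 0 \<longleftrightarrow> \<theta> l = (real k + 1) * pi"
  proof
    assume "sin (\<theta> l) = 0"
    then obtain i :: int where i: "\<theta> l = of_int i * pi" using sin_zero_iff_int2 by blast
    have "real k < of_int i" "of_int i \<le> real k + 1"
      using k unfolding i by (simp_all only: mult_less_cancel_right_pos[OF pi_gt_zero] mult_le_cancel_right_pos[OF pi_gt_zero])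
    then have "i = int k + 1" by linarith
    then show "\<theta> l = (real k + 1) * pi" using i by simp
  next
    assume "\<theta> l = (real k + 1) * pi"
    then have "\<theta> l = real (Suc k) * pi" by simp
    then show "sin (\<theta> l) = 0" by (metis sin_npi)
  qed
  show "0 < (-1) ^ card (neg_eigs l W) * y l" if "y l \<noteq> 0"
  proof -
    have "\<theta> l \<noteq> (real k + 1) * pi" using that yl end_iff by simp
    then have "0 < sin (\<theta> l - real k * pi)" using k by (intro sin_gt_zero) (auto simp: algebra_simps)
    then have "0 < r l * ((-1) ^ k * sin (\<theta> l))" using r(1)[of l] by (simp add: sin_minus_npi)
    then show ?thesis unfolding c eq(1)[OF ll] by (simp add: mult_ac)
  qed
  show "0 < (-1) ^ Suc (card (neg_eigs l W)) * p l" if "y l = 0"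
  proof -
    have "\<theta> l = real (Suc k) * pi" using that yl end_iff by simp
    then have "cos (\<theta> l - real (Suc k) * pi) = 1" by simp
    then have "(-1) ^ Suc k * cos (\<theta> l) = 1" by (simp only: sin_minus_npi)
    then have "(-1) ^ Suc k * p l = r l" unfolding eq(2)[OF ll] by (simp add: mult.left_commute[of _ "r l"])
    then show ?thesis unfolding c using r(1)[of l] by simp
  qed
  show "\<exists>c. 0 < c \<and> c < l \<and> y c = 0 \<and> (\<forall>x. 0 < x \<and> x < c \<longrightarrow> 0 < y x) \<and> (\<forall>x. c < x \<and> x \<le> l \<longrightarrow> y x < 0)"
    if nz: "y l \<noteq> 0" and one: "card (neg_eigs l W) = 1"
  proof -
    have k1: "k = 1" using c one by simp
    have b: "pi < \<theta> l" "\<theta> l < 2 * pi" using k nz yl end_iff by (auto simp: k1)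
    have "\<exists>x\<ge>0. x \<le> l \<and> \<theta> x = pi"
      using IVT'[of \<theta> 0 pi l] pruferD(1,3)[OF p\<theta>] b l by auto
    then obtain c where cc: "0 \<le> c" "c \<le> l" "\<theta> c = pi" by blast
    have c0: "0 < c" "c < l" using cc b pruferD(1)[OF p\<theta>] by (auto simp: less_le)
    show ?thesis
    proof (intro exI[of _ c] conjI allI impI)
      show "y c = 0" using cc eq(1)[of c] by simp
      fix x assume x: "0 < x \<and> x < c"
      then have "\<theta> x < pi" using prufer_crossing[OF l W p\<theta>, of x c 1] cc by fastforce
      moreover have "0 < \<theta> x" using prufer_pos[OF l W p\<theta>, of x] x cc by simp
      ultimately show "0 < y x" using eq(1)[of x] x cc r(1)[of x] sin_gt_zero[of "\<theta> x"] by simp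
    next
      fix x assume x: "c < x \<and> x \<le> l"
      then have "pi < \<theta> x" using prufer_crossing[OF l W p\<theta>, of c x 1] cc by simp
      moreover have "\<theta> x < 2 * pi"
        using prufer_crossing[OF l W p\<theta>, of x l 2] cc x b by (cases "x = l") fastforce+
      ultimately show "y x < 0" using eq(1)[of x] x cc r(1)[of x] sin_lt_zero[of "\<theta> x"]
        by (simp add: mult_pos_neg)
    qed (use c0 in auto)
  qed
  show "\<forall>x. 0 < x \<and> x < l \<longrightarrow> 0 < y x" if z: "y l = 0" and zero: "card (neg_eigs l W) = 0"
  proof (intro allI impI)
    fix x assume x: "0 < x \<and> x < l"
    have "k = 0" using c zero by simp
    then have "\<theta> l = pi" using z yl end_iff by simp
    then have "\<theta> x < pi" using prufer_crossing[OF l W p\<theta>, of x l 1] x by fastforce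
    moreover have "0 < \<theta> x" using prufer_pos[OF l W p\<theta>, of x] x by simp
    ultimately show "0 < y x" using eq(1)[of x] x r(1)[of x] sin_gt_zero[of "\<theta> x"] by simp
  qed
qed

section \<open>Quadratic forms\<close>

text \<open>The identity \<open>u'\<^sup>2 - W u\<^sup>2 = (u' - u y'/y)\<^sup>2 + (u\<^sup>2 y'/y)'\<close> on the interior. The boundary term \<open>T = u\<^sup>2 y'/y\<close> tends to \<open>0\<close> at
  the ends even where \<open>y\<close> vanishes, because \<open>y\<close> has only simple zeros.\<close>

lemma jacobi_nonneg:
  fixes y p u u' W :: "real \<Rightarrow> real"
  assumes ab: "a < b"
    and y: "\<And>x. x \<in> {a..b} \<Longrightarrow> (y has_real_derivative p x) (at x within {a..b})"
    and p: "\<And>x. x \<in> {a..b} \<Longrightarrow> (p has_real_derivative - (W x * y x)) (at x within {a..b})"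
    and u: "\<And>x. x \<in> {a..b} \<Longrightarrow> (u has_real_derivative u' x) (at x within {a..b})"
    and c: "continuous_on {a..b} u'" "continuous_on {a..b} W"
    and pos: "\<And>x. a < x \<Longrightarrow> x < b \<Longrightarrow> 0 < y x"
    and ends: "y a \<noteq> 0 \<or> p a \<noteq> 0" "y b \<noteq> 0 \<or> p b \<noteq> 0"
    and z: "u a = 0" "u b = 0"
  shows "0 \<le> integral {a..b} (\<lambda>x. (u' x)\<^sup>2 - W x * (u x)\<^sup>2)"
proof -
  define T where "T x = (u x)\<^sup>2 * p x / y x" for x
  define e where "e x = (u' x)\<^sup>2 - W x * (u x)\<^sup>2" for x
  have lim: "(f \<longlongrightarrow> f x) (at x within {a..b})" if "(f has_real_derivative d) (at x within {a..b})" for f d x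
    using DERIV_continuous[OF that] by (simp add: continuous_within)
  have limT: "(T \<longlongrightarrow> 0) (at d within {a..b})" if d: "d \<in> {a..b}" "u d = 0" "y d \<noteq> 0 \<or> p d \<noteq> 0" for d
  proof (cases "y d = 0")
    case False
    have "(T \<longlongrightarrow> (u d)\<^sup>2 * p d / y d) (at d within {a..b})"
      unfolding T_def using False lim[OF u[OF d(1)]] lim[OF p[OF d(1)]] lim[OF y[OF d(1)]]
      by (intro tendsto_intros)
    then show ?thesis using d by simp
  next
    case True
    then have pd: "p d \<noteq> 0" using d by simp
    have 1: "((\<lambda>x. (u x - u d) / (x - d)) \<longlongrightarrow> u' d) (at d within {a..b})"
      using u[OF d(1)] by (simp add: has_field_derivative_iff)
    have 2: "((\<lambda>x. (y x - y d) / (x - d)) \<longlongrightarrow> p d) (at d within {a..b})"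
      using y[OF d(1)] by (simp add: has_field_derivative_iff)
    have "((\<lambda>x. ((u x - u d) / (x - d))\<^sup>2 * p x / ((y x - y d) / (x - d)) * (x - d)) \<longlongrightarrow> (u' d)\<^sup>2 * p d / p d * (d - d)) (at d within {a..b})"
      using pd lim[OF p[OF d(1)]] by (intro tendsto_intros 1 2)
    then have "((\<lambda>x. ((u x - u d) / (x - d))\<^sup>2 * p x / ((y x - y d) / (x - d)) * (x - d)) \<longlongrightarrow> 0) (at d within {a..b})"
      by simp
    moreover have quot: "(U / h)\<^sup>2 * P / (Y / h) * h = U\<^sup>2 * P / Y" if "h \<noteq> 0" for U P Y h :: real
      using that by (cases "Y = 0") (auto simp: field_simps power2_eq_square)
    have "eventually (\<lambda>x. ((u x - u d) / (x - d))\<^sup>2 * p x / ((y x - y d) / (x - d)) * (x - d) = T x) (at d within {a..b})"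
      unfolding eventually_at_filter
      by (intro always_eventually allI impI, subst quot) (simp_all add: T_def d True)
    with calculation(1) show ?thesis by (rule Lim_transform_eventually)
  qed
  have T0: "T a = 0" "T b = 0" using z by (simp_all add: T_def)
  have interior: "at x within {a..b} = at x" if "a < x" "x < b" for x
    using that by (intro at_within_interior) auto
  have cT: "continuous_on {a..b} T"
    unfolding continuous_on_eq_continuous_within continuous_within
  proof
    fix x assume x: "x \<in> {a..b}"
    show "(T \<longlongrightarrow> T x) (at x within {a..b})"
    proof (cases "x = a \<or> x = b")
      case True
      then show ?thesis using limT[of x] T0 z ends x by auto
    next
      case False
      then have "y x \<noteq> 0" using pos[of x] x by auto
      then show ?thesis
        unfolding T_def using lim[OF u[OF x]] lim[OF p[OF x]] lim[OF y[OF x]] by (intro tendsto_intros)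
    qed
  qed
  have cu: "continuous_on {a..b} u" using u by (rule DERIV_continuous_on)
  have ce: "continuous_on {a..b} e" unfolding e_def by (intro continuous_intros c cu)
  have "integral {a..a} e - T a \<le> integral {a..b} e - T b"
  proof (rule DERIV_nonneg_imp_increasing_open[of a b "\<lambda>x. integral {a..x} e - T x"])
    show "continuous_on {a..b} (\<lambda>x. integral {a..x} e - T x)"
      by (intro continuous_intros cT indefinite_integral_continuous_1 integrable_continuous_interval ce)
    fix x assume x: "a < x" "x < b"
    then have xx: "x \<in> {a..b}" by simp
    have y0: "y x \<noteq> 0" using pos[of x] x by simp
    have dI: "((\<lambda>x. integral {a..x} e) has_real_derivative e x) (at x)"
      using integral_has_vector_derivative[OF ce xx] interior[OF x]
      by (simp add: has_real_derivative_iff_has_vector_derivative)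
    have dT: "(T has_real_derivative ((2 * u x * u' x * p x + (u x)\<^sup>2 * (- (W x * y x))) * y x - (u x)\<^sup>2 * p x * p x) / (y x * y x)) (at x)"
      unfolding T_def using u[OF xx] p[OF xx] y[OF xx] interior[OF x] y0
      by (auto intro!: derivative_eq_intros simp: power2_eq_square algebra_simps)
    have "e x - ((2 * u x * u' x * p x + (u x)\<^sup>2 * (- (W x * y x))) * y x - (u x)\<^sup>2 * p x * p x) / (y x * y x)
       = (u' x - u x * p x / y x)\<^sup>2"
      using y0 by (simp add: e_def field_simps power2_eq_square)
    then show "\<exists>z. ((\<lambda>x. integral {a..x} e - T x) has_real_derivative z) (at x) \<and> 0 \<le> z"
      using DERIV_diff[OF dI dT] by (metis zero_le_power2)
  qed (use ab in simp)
  then show ?thesis using T0 by (simp add: e_def[abs_def])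
qed

lemma green_identity:
  fixes u v :: "real \<Rightarrow> real"
  assumes l: "0 < l" and t: "twice_deriv l u p s" "twice_deriv l v q r"
  shows "((\<lambda>x. s x * v x - u x * r x) has_integral (p l * v l - u l * q l) - (p 0 * v 0 - u 0 * q 0)) {0..l}"
proof (rule fundamental_theorem_of_calculus)
  fix x assume x: "x \<in> {0..l}"
  note d = twice_derivD[OF t(1) x] twice_derivD[OF t(2) x]
  show "((\<lambda>x. p x * v x - u x * q x) has_vector_derivative s x * v x - u x * r x) (at x within {0..l})"
    using d unfolding has_real_derivative_iff_has_vector_derivative[symmetric]
    by (auto intro!: derivative_eq_intros simp: algebra_simps)
qed (use l in simp)

lemma form_eq:
  fixes u :: "real \<Rightarrow> real"
  assumes l: "0 < l" and t: "twice_deriv l u p s" and c: "continuous_on {0..l} s" "continuous_on {0..l} W"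
    and z: "u 0 = 0" "u l = 0"
  shows "integral {0..l} (\<lambda>x. (p x)\<^sup>2 - W x * (u x)\<^sup>2) = integral {0..l} (\<lambda>x. - (s x + W x * u x) * u x)"
proof -
  note cu = twice_deriv_continuous[OF t]
  have "((\<lambda>x. p x * p x + u x * s x) has_integral u l * p l - u 0 * p 0) {0..l}"
  proof (rule fundamental_theorem_of_calculus)
    fix x assume x: "x \<in> {0..l}"
    show "((\<lambda>x. u x * p x) has_vector_derivative p x * p x + u x * s x) (at x within {0..l})"
      using twice_derivD[OF t x] unfolding has_real_derivative_iff_has_vector_derivative[symmetric]
      by (auto intro!: derivative_eq_intros)
  qed (use l in simp)
  then have 0: "integral {0..l} (\<lambda>x. p x * p x + u x * s x) = 0" using z by (simp add: integral_unique)
  have "integral {0..l} (\<lambda>x. (p x)\<^sup>2 - W x * (u x)\<^sup>2)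
    = integral {0..l} (\<lambda>x. (p x * p x + u x * s x) + - (s x + W x * u x) * u x)"
    by (rule integral_cong) (simp add: power2_eq_square algebra_simps)
  also have "\<dots> = integral {0..l} (\<lambda>x. p x * p x + u x * s x) + integral {0..l} (\<lambda>x. - (s x + W x * u x) * u x)"
    by (intro Henstock_Kurzweil_Integration.integral_add integrable_continuous_interval continuous_intros cu c)
  finally show ?thesis using 0 by simp
qed

lemma twice_deriv_real:
  fixes u :: "real \<Rightarrow> real"
  assumes t: "twice_deriv l u p s" and x: "x \<in> {a..b}" and ab: "0 \<le> a" "b \<le> l"
  shows "(u has_real_derivative p x) (at x within {a..b})" "(p has_real_derivative s x) (at x within {a..b})"
proof -
  have "x \<in> {0..l}" "{a..b} \<subseteq> {0..l}" using x ab by auto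
  then show "(u has_real_derivative p x) (at x within {a..b})" "(p has_real_derivative s x) (at x within {a..b})"
    using twice_derivD[OF t \<open>x \<in> {0..l}\<close>] unfolding has_real_derivative_iff_has_vector_derivative
    by (auto elim: has_vector_derivative_within_subset)
qed

lemma solution_no_double_zero:
  fixes y :: "real \<Rightarrow> real"
  assumes l: "0 < l" and W: "continuous_on {0..l} W" and y: "twice_deriv l y p (\<lambda>x. - (W x *\<^sub>R y x))"
    and x: "x \<in> {0..l}" and z: "y x = 0" "p x = 0"
  shows "y 0 = 0 \<and> p 0 = 0"
proof -
  \<comment> \<open>run the equation backwards from the double zero\<close>
  have "twice_deriv x (\<lambda>s. y (x - s)) (\<lambda>s. - p (x - s)) (\<lambda>s. - (W (x - s) *\<^sub>R y (x - s)))"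
    unfolding twice_deriv_def
  proof (intro ballI conjI)
    fix s assume s: "s \<in> {0..x}"
    have im: "(\<lambda>s. x - s) ` {0..x} \<subseteq> {0..l}" using x by auto
    have d: "((\<lambda>s. x - s) has_real_derivative -1) (at s within {0..x})" by (auto intro!: derivative_eq_intros)
    have xs: "x - s \<in> {0..l}" using x s by auto
    have "(y has_real_derivative p (x - s)) (at (x - s) within (\<lambda>s. x - s) ` {0..x})"
      using twice_deriv_real(1)[OF y xs order_refl order_refl] im by (rule has_field_derivative_subset)
    from DERIV_image_chain[OF this d] show "((\<lambda>s. y (x - s)) has_vector_derivative - p (x - s)) (at s within {0..x})"
      by (simp add: o_def has_real_derivative_iff_has_vector_derivative)
    have "(p has_real_derivative - (W (x - s) *\<^sub>R y (x - s))) (at (x - s) within (\<lambda>s. x - s) ` {0..x})"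
      using twice_deriv_real(2)[OF y xs order_refl order_refl] im by (rule has_field_derivative_subset)
    from DERIV_minus[OF DERIV_image_chain[OF this d]] show "((\<lambda>s. - p (x - s)) has_vector_derivative - (W (x - s) *\<^sub>R y (x - s))) (at s within {0..x})"
      by (simp add: o_def has_real_derivative_iff_has_vector_derivative)
  qed
  moreover obtain K where K: "K \<ge> 0" "\<And>x. x \<in> {0..l} \<Longrightarrow> norm (W x) \<le> K"
    using continuous_on_interval_bound[OF W] by blast
  have "norm (- (W (x - s) *\<^sub>R y (x - s))) \<le> K * norm (y (x - s)) + 0" if "s \<in> {0..x}" for s
    using K(2)[of "x - s"] that x by (auto simp: abs_mult intro!: mult_right_mono)
  ultimately show ?thesis
    using gronwall2[of x "\<lambda>s. y (x - s)" "\<lambda>s. - p (x - s)" "\<lambda>s. - (W (x - s) *\<^sub>R y (x - s))" K 0 x] z x K(1) by simp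
qed

lemma form_nonneg_positive_solution:
  fixes u y :: "real \<Rightarrow> real"
  assumes l: "0 < l" and W: "continuous_on {0..l} W"
    and y: "twice_deriv l y q (\<lambda>x. - (W x *\<^sub>R y x))" "q 0 = 1" "\<forall>x. 0 < x \<and> x < l \<longrightarrow> 0 < y x"
    and t: "twice_deriv l u p s" and c: "continuous_on {0..l} s" and z: "u 0 = 0" "u l = 0"
  shows "0 \<le> integral {0..l} (\<lambda>x. - (s x + W x * u x) * u x)"
proof -
  have "y l \<noteq> 0 \<or> q l \<noteq> 0" using solution_no_double_zero[OF l W y(1), of l] y(2) l by auto
  then have "0 \<le> integral {0..l} (\<lambda>x. (p x)\<^sup>2 - W x * (u x)\<^sup>2)"
    using y l z twice_deriv_continuous[OF t] W
    by (intro jacobi_nonneg[where y = y and p = q])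
      (auto intro!: twice_deriv_real[OF t] twice_deriv_real[OF y(1), unfolded real_scaleR_def])
  then show ?thesis using form_eq[OF l t c W z] by simp
qed

text \<open>Jacobi's identity on both sides of the zero of \<open>y\<close>: a form with one negative direction is nonnegative under one
  linear constraint, here \<open>u c = 0\<close>.\<close>

lemma form_nonneg_split:
  fixes u y :: "real \<Rightarrow> real"
  assumes l: "0 < l" and W: "continuous_on {0..l} W"
    and y: "twice_deriv l y q (\<lambda>x. - (W x *\<^sub>R y x))" "q 0 = 1"
    and cc: "0 < c" "c < l" "y c = 0" "\<forall>x. 0 < x \<and> x < c \<longrightarrow> 0 < y x" "\<forall>x. c < x \<and> x \<le> l \<longrightarrow> y x < 0"
    and t: "twice_deriv l u p s" and cs: "continuous_on {0..l} s" and z: "u 0 = 0" "u l = 0" "u c = 0"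
  shows "0 \<le> integral {0..l} (\<lambda>x. - (s x + W x * u x) * u x)"
proof -
  have nd: "y x \<noteq> 0 \<or> q x \<noteq> 0" if "x \<in> {0..l}" for x
    using solution_no_double_zero[OF l W y(1), of x] y(2) that by auto
  note cu = twice_deriv_continuous[OF t]
  have sub: "continuous_on {0..c} f" "continuous_on {c..l} f" if "continuous_on {0..l} f" for f :: "real \<Rightarrow> real"
    using cc by (auto intro: continuous_on_subset[OF that])
  have "0 \<le> integral {0..c} (\<lambda>x. (p x)\<^sup>2 - W x * (u x)\<^sup>2)"
    using y cc z nd[of 0] nd[of c] sub[OF cu(2)] sub[OF W]
    by (intro jacobi_nonneg[where y = y and p = q])
      (auto intro!: twice_deriv_real[OF t] twice_deriv_real[OF y(1), unfolded real_scaleR_def])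
  moreover have "0 \<le> integral {c..l} (\<lambda>x. (p x)\<^sup>2 - W x * (u x)\<^sup>2)"
  proof (rule jacobi_nonneg[where y = "\<lambda>x. - y x" and p = "\<lambda>x. - q x"])
    fix x assume x: "x \<in> {c..l}"
    show "((\<lambda>x. - y x) has_real_derivative - q x) (at x within {c..l})"
      using twice_deriv_real(1)[OF y(1) x] cc by (intro DERIV_minus) auto
    show "((\<lambda>x. - q x) has_real_derivative - (W x * - y x)) (at x within {c..l})"
      using DERIV_minus[OF twice_deriv_real(2)[OF y(1) x]] cc by simp
    show "(u has_real_derivative p x) (at x within {c..l})"
      using twice_deriv_real(1)[OF t x] cc by simp
  qed (use cc z nd[of c] nd[of l] sub[OF cu(2)] sub[OF W] in auto)
  ultimately have "0 \<le> integral {0..l} (\<lambda>x. (p x)\<^sup>2 - W x * (u x)\<^sup>2)"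
    using Henstock_Kurzweil_Integration.integral_combine[of 0 c l "\<lambda>x. (p x)\<^sup>2 - W x * (u x)\<^sup>2"] cc
    by (simp add: integrable_continuous_interval continuous_intros cu W)
  then show ?thesis using form_eq[OF l t cs W z(1,2)] by simp
qed

text \<open>With \<open>h\<close> the solution of \<open>L h = \<phi>\<close>, a function \<open>u\<close> orthogonal to \<open>\<phi>\<close> is orthogonal to \<open>h\<close> with respect to the form. The
  combination \<open>a h - b u\<close> with \<open>a = u c\<close> and \<open>b = h c\<close> vanishes at \<open>c\<close>, so its form \<open>a\<^sup>2 J + b\<^sup>2 F\<close> is nonnegative. Now \<open>J < 0\<close> is
  the form at \<open>h\<close>; this forces \<open>b \<noteq> 0\<close> and then \<open>F \<ge> 0\<close>.\<close>

lemma form_nonneg_on_complement: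
  fixes u y h \<phi> :: "real \<Rightarrow> real"
  assumes l: "0 < l" and W: "continuous_on {0..l} W"
    and y: "twice_deriv l y q (\<lambda>x. - (W x *\<^sub>R y x))" "q 0 = 1"
    and cc: "0 < c" "c < l" "y c = 0" "\<forall>x. 0 < x \<and> x < c \<longrightarrow> 0 < y x" "\<forall>x. c < x \<and> x \<le> l \<longrightarrow> y x < 0"
    and h: "twice_deriv l h h' (\<lambda>x. - (W x *\<^sub>R h x) - \<phi> x)" "h 0 = 0" "h l = 0"
    and \<phi>: "continuous_on {0..l} \<phi>" and neg: "integral {0..l} (\<lambda>x. h x * \<phi> x) < 0"
    and t: "twice_deriv l u p s" and cs: "continuous_on {0..l} s" and z: "u 0 = 0" "u l = 0"
    and orth: "integral {0..l} (\<lambda>x. u x * \<phi> x) = 0"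
  shows "0 \<le> integral {0..l} (\<lambda>x. - (s x + W x * u x) * u x)"
proof -
  note cu = twice_deriv_continuous[OF t] and ch = twice_deriv_continuous[OF h(1)]
  have ch2: "continuous_on {0..l} (\<lambda>x. - (W x *\<^sub>R h x) - \<phi> x)" by (intro continuous_intros ch W \<phi>)
  define a b where "a = u c" and "b = h c"
  define F where "F = integral {0..l} (\<lambda>x. - (s x + W x * u x) * u x)"
  define J where "J = integral {0..l} (\<lambda>x. h x * \<phi> x)"
  have cross: "integral {0..l} (\<lambda>x. (s x + W x * u x) * h x) = 0"
  proof -
    have "integral {0..l} (\<lambda>x. s x * h x - u x * (- (W x *\<^sub>R h x) - \<phi> x)) = 0"
      using green_identity[OF l t h(1)] z h by (simp add: integral_unique)
    moreover have "integral {0..l} (\<lambda>x. s x * h x - u x * (- (W x *\<^sub>R h x) - \<phi> x))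
      = integral {0..l} (\<lambda>x. (s x + W x * u x) * h x + u x * \<phi> x)"
      by (rule integral_cong) (simp add: algebra_simps)
    moreover have "\<dots> = integral {0..l} (\<lambda>x. (s x + W x * u x) * h x) + integral {0..l} (\<lambda>x. u x * \<phi> x)"
      by (intro Henstock_Kurzweil_Integration.integral_add integrable_continuous_interval continuous_intros cu ch cs W \<phi>)
    ultimately show ?thesis using orth by simp
  qed
  have split: "0 \<le> a\<^sup>2 * J + b\<^sup>2 * F"
  proof -
    define k where "k x = - ((a *\<^sub>R (- (W x *\<^sub>R h x) - \<phi> x) + (-b) *\<^sub>R s x) + W x * (a *\<^sub>R h x + (-b) *\<^sub>R u x)) * (a *\<^sub>R h x + (-b) *\<^sub>R u x)" for x
    have "0 \<le> integral {0..l} k"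
      unfolding k_def
      by (rule form_nonneg_split[OF l W y cc twice_deriv_lincomb[OF h(1) t]])
        (use z h in \<open>auto simp: a_def b_def intro!: continuous_intros ch2[unfolded real_scaleR_def] cs\<close>)
    also have "integral {0..l} k = integral {0..l} (\<lambda>x. a\<^sup>2 * (h x * \<phi> x) + ((- (a * b)) * (u x * \<phi> x) + ((a * b) * ((s x + W x * u x) * h x) + b\<^sup>2 * (- (s x + W x * u x) * u x))))"
      by (rule integral_cong) (simp add: k_def power2_eq_square algebra_simps)
    also have "\<dots> = a\<^sup>2 * J + ((- (a * b)) * integral {0..l} (\<lambda>x. u x * \<phi> x) +
        ((a * b) * integral {0..l} (\<lambda>x. (s x + W x * u x) * h x) + b\<^sup>2 * F))"
      unfolding J_def F_def
      by (intro integral_unique has_integral_add has_integral_mult_right integrable_integral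
          integrable_continuous_interval continuous_on_add continuous_on_mult continuous_on_minus cu ch cs W \<phi>)
    also have "\<dots> = a\<^sup>2 * J + b\<^sup>2 * F"
      using cross orth by simp
    finally show ?thesis .
  qed
  have b0: "b \<noteq> 0"
  proof
    assume "b = 0"
    then have "0 \<le> integral {0..l} (\<lambda>x. - ((- (W x *\<^sub>R h x) - \<phi> x) + W x * h x) * h x)"
      by (intro form_nonneg_split[OF l W y cc h(1) ch2 h(2,3)]) (simp add: b_def)
    then show False using neg by (simp add: mult.commute)
  qed
  have "a\<^sup>2 * J \<le> 0" using neg by (simp add: J_def mult_nonneg_nonpos)
  then have "0 \<le> b\<^sup>2 * F" using split by simp
  then show ?thesis using b0 by (simp add: F_def zero_le_mult_iff)
qed

section \<open>Absence of unstable eigenfunctions\<close>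

lemma integral_square_zero:
  fixes k :: "real \<Rightarrow> real"
  assumes l: "0 < l" and c: "continuous_on {0..l} k" and z: "integral {0..l} (\<lambda>x. (k x)\<^sup>2) = 0" and x: "x \<in> {0..l}"
  shows "k x = 0"
  using integral_eq_0_iff[of 0 l "\<lambda>x. (k x)\<^sup>2"] assms by (simp add: continuous_intros)

text \<open>A nonnegative form vanishes at \<open>v\<close> only if \<open>v\<close> lies in its kernel: the form along \<open>v + t k\<close> is a quadratic polynomial
  in \<open>t\<close> without constant term, so its linear term, the square norm of \<open>k = - L v\<close> up to the factor \<open>-2\<close>, vanishes.\<close>

lemma form_minimizer_in_kernel:
  fixes v k :: "real \<Rightarrow> real"
  assumes l: "0 < l" and W: "continuous_on {0..l} W"
    and nonneg: "\<And>u p s. twice_deriv l u p s \<Longrightarrow> continuous_on {0..l} s \<Longrightarrow> u 0 = 0 \<Longrightarrow> u l = 0 \<Longrightarrow>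
        0 \<le> integral {0..l} (\<lambda>x. - (s x + W x * u x) * u x)"
    and v: "twice_deriv l v p (\<lambda>x. - (W x * v x) + k x)" "v 0 = 0" "v l = 0"
    and k: "twice_deriv l k q r" "continuous_on {0..l} r" "k 0 = 0" "k l = 0"
    and zero: "integral {0..l} (\<lambda>x. k x * v x) = 0" and x: "x \<in> {0..l}"
  shows "k x = 0"
proof -
  note cv = twice_deriv_continuous[OF v(1)] and ck = twice_deriv_continuous[OF k(1)]
  define S where "S = integral {0..l} (\<lambda>x. (k x)\<^sup>2)"
  define F where "F = integral {0..l} (\<lambda>x. - (r x + W x * k x) * k x)"
  have cross: "integral {0..l} (\<lambda>x. (r x + W x * k x) * v x) = S"
  proof -
    have "integral {0..l} (\<lambda>x. r x * v x - k x * (- (W x * v x) + k x)) = 0"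
      using green_identity[OF l k(1) v(1)] k v by (simp add: integral_unique)
    moreover have "integral {0..l} (\<lambda>x. r x * v x - k x * (- (W x * v x) + k x))
      = integral {0..l} (\<lambda>x. (r x + W x * k x) * v x - (k x)\<^sup>2)"
      by (rule integral_cong) (simp add: algebra_simps power2_eq_square)
    moreover have "\<dots> = integral {0..l} (\<lambda>x. (r x + W x * k x) * v x) - S" unfolding S_def
      by (intro Henstock_Kurzweil_Integration.integral_diff integrable_continuous_interval continuous_intros cv ck W k)
    ultimately show ?thesis by simp
  qed
  have quad: "0 \<le> - 2 * t * S + t\<^sup>2 * F" for t
  proof -
    define g where "g x = - ((1 *\<^sub>R (- (W x * v x) + k x) + t *\<^sub>R r x) + W x * (1 *\<^sub>R v x + t *\<^sub>R k x)) * (1 *\<^sub>R v x + t *\<^sub>R k x)" for x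
    have "0 \<le> integral {0..l} g"
      unfolding g_def
      by (rule nonneg[OF twice_deriv_lincomb[OF v(1) k(1)]])
        (use v k in \<open>auto intro!: continuous_intros cv ck W\<close>)
    also have "integral {0..l} g = integral {0..l} (\<lambda>x. - (k x * v x) + (- t * (k x)\<^sup>2 + (- t * ((r x + W x * k x) * v x) + t\<^sup>2 * (- (r x + W x * k x) * k x))))"
      by (rule integral_cong) (simp add: g_def algebra_simps power2_eq_square)
    also have "\<dots> = - integral {0..l} (\<lambda>x. k x * v x) + (- t * S + (- t * integral {0..l} (\<lambda>x. (r x + W x * k x) * v x) + t\<^sup>2 * F))"
      unfolding S_def F_def
      by (intro integral_unique has_integral_add has_integral_mult_right has_integral_neg integrable_integral
          integrable_continuous_interval continuous_on_add continuous_on_mult continuous_on_minus continuous_on_power cv ck W k)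
    finally show ?thesis unfolding zero cross by (simp add: mult.commute)
  qed
  have "0 \<le> S" unfolding S_def by (rule integral_nonneg) (auto intro!: integrable_continuous_interval continuous_intros ck)
  have "S = 0"
  proof (rule ccontr)
    assume "S \<noteq> 0"
    with \<open>0 \<le> S\<close> have S: "S > 0" by simp
    \<comment> \<open>for this small \<open>t > 0\<close> the linear term dominates the quadratic one\<close>
    define t where "t = S / (\<bar>F\<bar> + 1)"
    have t: "t > 0" using S by (simp add: t_def)
    have "t * F \<le> t * \<bar>F\<bar>" using t by (intro mult_left_mono) auto
    also have "\<dots> \<le> S" using S by (simp add: t_def field_simps)
    finally have "t * (t * F) \<le> t * S" using t by (intro mult_left_mono) auto
    then show False using quad[of t] mult_pos_pos[OF t S] by (simp add: power2_eq_square)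
  qed
  then show ?thesis using integral_square_zero[OF l ck(1) _ x] by (simp add: S_def)
qed

text \<open>The real form of \<open>N w = \<mu> w\<close> with \<open>\<mu> = m + i n\<close> and \<open>w = (a + i b, c + i d)\<close>. Pairing with the kernel
  element \<open>\<phi>\<close> shows that \<open>a\<close> and \<open>b\<close> are orthogonal to \<open>\<phi>\<close>. The symmetry of both operators makes the sum of the forms of
  \<open>L_+\<close> at \<open>a, b\<close> equal to \<open>m X\<close> and that of \<open>L_-\<close> at \<open>c, d\<close> equal to \<open>- m X\<close>. Both are nonnegative, so both vanish,
  and \<open>c\<close>, \<open>d\<close> lie in the kernel of \<open>L_-\<close>; then \<open>\<mu>\<close> times the first component is zero.\<close>

lemma no_unstable_eigenfunction:
  fixes \<phi> a b c d Wp Wm :: "real \<Rightarrow> real"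
  assumes l: "0 < l" and W: "continuous_on {0..l} Wp" "continuous_on {0..l} Wm"
    and nonneg: "\<And>u p s. twice_deriv l u p s \<Longrightarrow> continuous_on {0..l} s \<Longrightarrow> u 0 = 0 \<Longrightarrow> u l = 0 \<Longrightarrow>
        0 \<le> integral {0..l} (\<lambda>x. - (s x + Wm x * u x) * u x)"
    and nonneg_perp: "\<And>u p s. twice_deriv l u p s \<Longrightarrow> continuous_on {0..l} s \<Longrightarrow> u 0 = 0 \<Longrightarrow> u l = 0 \<Longrightarrow>
        integral {0..l} (\<lambda>x. u x * \<phi> x) = 0 \<Longrightarrow> 0 \<le> integral {0..l} (\<lambda>x. - (s x + Wp x * u x) * u x)"
    and \<phi>: "twice_deriv l \<phi> \<phi>' (\<lambda>x. - (Wm x * \<phi> x))" "\<phi> 0 = 0" "\<phi> l = 0"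
    and m: "0 < m"
    and a: "twice_deriv l a a' (\<lambda>x. - (Wp x * a x) - (m * c x - n * d x))" "a 0 = 0" "a l = 0"
    and b: "twice_deriv l b b' (\<lambda>x. - (Wp x * b x) - (m * d x + n * c x))" "b 0 = 0" "b l = 0"
    and c: "twice_deriv l c c' (\<lambda>x. - (Wm x * c x) + (m * a x - n * b x))" "c 0 = 0" "c l = 0"
    and d: "twice_deriv l d d' (\<lambda>x. - (Wm x * d x) + (m * b x + n * a x))" "d 0 = 0" "d l = 0"
    and x: "x \<in> {0..l}"
  shows "a x = 0 \<and> b x = 0 \<and> c x = 0 \<and> d x = 0"
proof -
  note ca = twice_deriv_continuous[OF a(1)] and cb = twice_deriv_continuous[OF b(1)]
    and cc = twice_deriv_continuous[OF c(1)] and cd = twice_deriv_continuous[OF d(1)]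
    and c\<phi> = twice_deriv_continuous[OF \<phi>(1)]
  note cont = continuous_on_add continuous_on_diff continuous_on_mult continuous_on_minus continuous_on_const ca cb cc cd c\<phi> W
  have int: "f integrable_on {0..l}" if "continuous_on {0..l} f" for f :: "real \<Rightarrow> real"
    using that by (rule integrable_continuous_interval)
  define I where "I f = integral {0..l} f" for f :: "real \<Rightarrow> real"
  have lin: "I (\<lambda>x. \<alpha> * f x + \<beta> * g x) = \<alpha> * I f + \<beta> * I g"
    if "continuous_on {0..l} f" "continuous_on {0..l} g" for \<alpha> \<beta> f g
    unfolding I_def by (intro integral_unique has_integral_add has_integral_mult_right integrable_integral int that)
  have green: "I (\<lambda>x. s x * v x - u x * r x) = 0" if "twice_deriv l u p s" "twice_deriv l v q r"
    "u 0 = 0" "u l = 0" "v 0 = 0" "v l = 0" for u p s v q r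
    using green_identity[OF l that(1,2)] that by (simp add: I_def integral_unique)
  have cong: "I f = I g" if "\<And>x. f x = g x" for f g using that by presburger
  \<comment> \<open>\<open>c + i d\<close> paired with \<open>\<phi>\<close>, which solves the homogeneous equation\<close>
  have o1: "m * I (\<lambda>x. a x * \<phi> x) + (- n) * I (\<lambda>x. b x * \<phi> x) = 0"
  proof -
    have "m * I (\<lambda>x. a x * \<phi> x) + (- n) * I (\<lambda>x. b x * \<phi> x) = I (\<lambda>x. m * (a x * \<phi> x) + (- n) * (b x * \<phi> x))"
      by (rule lin[symmetric]) (intro cont)+
    also have "\<dots> = I (\<lambda>x. (- (Wm x * c x) + (m * a x - n * b x)) * \<phi> x - c x * - (Wm x * \<phi> x))"
      by (rule cong) (simp add: algebra_simps)
    also have "\<dots> = 0" by (rule green[OF c(1) \<phi>(1) c(2,3) \<phi>(2,3)])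
    finally show ?thesis .
  qed
  have o2: "m * I (\<lambda>x. b x * \<phi> x) + n * I (\<lambda>x. a x * \<phi> x) = 0"
  proof -
    have "m * I (\<lambda>x. b x * \<phi> x) + n * I (\<lambda>x. a x * \<phi> x) = I (\<lambda>x. m * (b x * \<phi> x) + n * (a x * \<phi> x))"
      by (rule lin[symmetric]) (intro cont)+
    also have "\<dots> = I (\<lambda>x. (- (Wm x * d x) + (m * b x + n * a x)) * \<phi> x - d x * - (Wm x * \<phi> x))"
      by (rule cong) (simp add: algebra_simps)
    also have "\<dots> = 0" by (rule green[OF d(1) \<phi>(1) d(2,3) \<phi>(2,3)])
    finally show ?thesis .
  qed
  have sq: "m\<^sup>2 + n\<^sup>2 > 0" using m by (simp add: add_pos_nonneg)
  have oa: "I (\<lambda>x. a x * \<phi> x) = 0"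
  proof -
    have "(m\<^sup>2 + n\<^sup>2) * A = m * (m * A + (- n) * B) + n * (m * B + n * A)" for A B :: real
      by (simp add: algebra_simps power2_eq_square)
    from this[of "I (\<lambda>x. a x * \<phi> x)" "I (\<lambda>x. b x * \<phi> x)"] show ?thesis
      unfolding o1 o2 using m sq by auto
  qed
  have ob: "I (\<lambda>x. b x * \<phi> x) = 0" using o2 oa m by simp
  \<comment> \<open>symmetry of \<open>L_+\<close> on \<open>a, b\<close> and of \<open>L_-\<close> on \<open>c, d\<close>\<close>
  define Y where "Y = I (\<lambda>x. c x * b x - d x * a x)"
  define X where "X = I (\<lambda>x. c x * a x + d x * b x)"
  have s1: "m * Y + (- n) * X = 0"
  proof -
    have "m * Y + (- n) * X = I (\<lambda>x. m * (c x * b x - d x * a x) + (- n) * (c x * a x + d x * b x))"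
      unfolding X_def Y_def by (rule lin[symmetric]) (intro cont)+
    also have "\<dots> = I (\<lambda>x. (- (Wp x * b x) - (m * d x + n * c x)) * a x - b x * (- (Wp x * a x) - (m * c x - n * d x)))"
      by (rule cong) (simp add: algebra_simps)
    also have "\<dots> = 0" by (rule green[OF b(1) a(1) b(2,3) a(2,3)])
    finally show ?thesis .
  qed
  have s2: "m * Y + n * X = 0"
  proof -
    have "m * Y + n * X = I (\<lambda>x. m * (c x * b x - d x * a x) + n * (c x * a x + d x * b x))"
      unfolding X_def Y_def by (rule lin[symmetric]) (intro cont)+
    also have "\<dots> = I (\<lambda>x. (- (Wm x * d x) + (m * b x + n * a x)) * c x - d x * (- (Wm x * c x) + (m * a x - n * b x)))"
      by (rule cong) (simp add: algebra_simps)
    also have "\<dots> = 0" by (rule green[OF d(1) c(1) d(2,3) c(2,3)])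
    finally show ?thesis .
  qed
  have Y0: "Y = 0" using s1 s2 m by auto
  define A where "A = I (\<lambda>x. - ((- (Wp x * a x) - (m * c x - n * d x)) + Wp x * a x) * a x)"
  define B where "B = I (\<lambda>x. - ((- (Wp x * b x) - (m * d x + n * c x)) + Wp x * b x) * b x)"
  define C where "C = I (\<lambda>x. - ((- (Wm x * c x) + (m * a x - n * b x)) + Wm x * c x) * c x)"
  define D where "D = I (\<lambda>x. - ((- (Wm x * d x) + (m * b x + n * a x)) + Wm x * d x) * d x)"
  have A0: "0 \<le> A" unfolding A_def I_def
    by (rule nonneg_perp[OF a(1) _ a(2,3)]) (use oa in \<open>auto simp: I_def intro!: cont\<close>)
  have B0: "0 \<le> B" unfolding B_def I_def
    by (rule nonneg_perp[OF b(1) _ b(2,3)]) (use ob in \<open>auto simp: I_def intro!: cont\<close>)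
  have C0: "0 \<le> C" unfolding C_def I_def
    by (rule nonneg[OF c(1) _ c(2,3)]) (intro cont)
  have D0: "0 \<le> D" unfolding D_def I_def
    by (rule nonneg[OF d(1) _ d(2,3)]) (intro cont)
  have "1 * A + 1 * B = m * X + n * Y"
  proof -
    have "1 * A + 1 * B = I (\<lambda>x. 1 * (- ((- (Wp x * a x) - (m * c x - n * d x)) + Wp x * a x) * a x)
        + 1 * (- ((- (Wp x * b x) - (m * d x + n * c x)) + Wp x * b x) * b x))"
      unfolding A_def B_def by (rule lin[symmetric]) (intro cont)+
    also have "\<dots> = I (\<lambda>x. m * (c x * a x + d x * b x) + n * (c x * b x - d x * a x))"
      by (rule cong) (simp add: algebra_simps)
    also have "\<dots> = m * X + n * Y" unfolding X_def Y_def by (rule lin) (intro cont)+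
    finally show ?thesis .
  qed
  moreover have "1 * C + 1 * D = (- m) * X + n * Y"
  proof -
    have "1 * C + 1 * D = I (\<lambda>x. 1 * (- ((- (Wm x * c x) + (m * a x - n * b x)) + Wm x * c x) * c x)
        + 1 * (- ((- (Wm x * d x) + (m * b x + n * a x)) + Wm x * d x) * d x))"
      unfolding C_def D_def by (rule lin[symmetric]) (intro cont)+
    also have "\<dots> = I (\<lambda>x. (- m) * (c x * a x + d x * b x) + n * (c x * b x - d x * a x))"
      by (rule cong) (simp add: algebra_simps)
    also have "\<dots> = (- m) * X + n * Y" unfolding X_def Y_def by (rule lin) (intro cont)+
    finally show ?thesis .
  qed
  ultimately have CD: "C = 0" "D = 0" using A0 B0 C0 D0 Y0 by auto
  define ka where "ka x = m * a x - n * b x" for x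
  define kb where "kb x = m * b x + n * a x" for x
  have tka: "twice_deriv l ka (\<lambda>x. m * a' x - n * b' x) (\<lambda>x. m * (- (Wp x * a x) - (m * c x - n * d x)) - n * (- (Wp x * b x) - (m * d x + n * c x)))"
    using twice_deriv_lincomb[OF a(1) b(1), of m "- n"] by (simp add: ka_def[abs_def])
  have tkb: "twice_deriv l kb (\<lambda>x. m * b' x + n * a' x) (\<lambda>x. m * (- (Wp x * b x) - (m * d x + n * c x)) + n * (- (Wp x * a x) - (m * c x - n * d x)))"
    using twice_deriv_lincomb[OF b(1) a(1), of m n] by (simp add: kb_def[abs_def])
  have ka0: "ka x = 0" if x: "x \<in> {0..l}" for x
  proof (rule form_minimizer_in_kernel[OF l W(2) nonneg _ c(2,3) tka _ _ _ _ x])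
    show "twice_deriv l c c' (\<lambda>x. - (Wm x * c x) + ka x)" using c(1) by (simp add: ka_def)
    have "I (\<lambda>x. (-1) * (ka x * c x) + 0 * 0) = (-1) * I (\<lambda>x. ka x * c x) + 0 * I (\<lambda>x. 0)"
      by (rule lin) (auto simp: ka_def intro!: cont)
    moreover have "C = I (\<lambda>x. (-1) * (ka x * c x) + 0 * 0)" unfolding C_def by (rule cong) (simp add: ka_def algebra_simps)
    ultimately show "integral {0..l} (\<lambda>x. ka x * c x) = 0" using CD by (simp add: I_def)
    show "continuous_on {0..l} (\<lambda>x. m * (- (Wp x * a x) - (m * c x - n * d x)) - n * (- (Wp x * b x) - (m * d x + n * c x)))"
      by (intro cont)
  qed (simp_all add: ka_def a b)
  have kb0: "kb x = 0" if x: "x \<in> {0..l}" for x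
  proof (rule form_minimizer_in_kernel[OF l W(2) nonneg _ d(2,3) tkb _ _ _ _ x])
    show "twice_deriv l d d' (\<lambda>x. - (Wm x * d x) + kb x)" using d(1) by (simp add: kb_def)
    have "I (\<lambda>x. (-1) * (kb x * d x) + 0 * 0) = (-1) * I (\<lambda>x. kb x * d x) + 0 * I (\<lambda>x. 0)"
      by (rule lin) (auto simp: kb_def intro!: cont)
    moreover have "D = I (\<lambda>x. (-1) * (kb x * d x) + 0 * 0)" unfolding D_def by (rule cong) (simp add: kb_def algebra_simps)
    ultimately show "integral {0..l} (\<lambda>x. kb x * d x) = 0" using CD by (simp add: I_def)
    show "continuous_on {0..l} (\<lambda>x. m * (- (Wp x * b x) - (m * d x + n * c x)) + n * (- (Wp x * a x) - (m * c x - n * d x)))"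
      by (intro cont)
  qed (simp_all add: kb_def a b)
  have solve: "f = 0 \<and> g = 0" if "m * f - n * g = 0" "m * g + n * f = 0" for f g
  proof -
    have "(m\<^sup>2 + n\<^sup>2) * f = m * (m * f - n * g) + n * (m * g + n * f)"
      "(m\<^sup>2 + n\<^sup>2) * g = m * (m * g + n * f) - n * (m * f - n * g)"
      by (simp_all add: algebra_simps power2_eq_square)
    then show ?thesis using that m by auto
  qed
  have ab0: "a x = 0" "b x = 0" if "x \<in> {0..l}" for x
    using solve[of "a x" "b x"] ka0[OF that] kb0[OF that] by (auto simp: ka_def kb_def)
  have t0: "twice_deriv l (\<lambda>x. 0::real) (\<lambda>x. 0) (\<lambda>x. 0)" by (auto simp: twice_deriv_def)
  have "- (Wp x * a x) - (m * c x - n * d x) = 0" "- (Wp x * b x) - (m * d x + n * c x) = 0"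
    using twice_deriv_unique[OF l a(1) t0 ab0(1) x] twice_deriv_unique[OF l b(1) t0 ab0(2) x] by simp_all
  then show ?thesis using solve[of "c x" "d x"] ab0[OF x] by simp
qed

section \<open>Existence of an unstable eigenfunction\<close>

text \<open>Solutions of linear systems depend in a Lipschitz way on the coefficients.\<close>

lemma linsys_parameter:
  fixes A B :: "real \<Rightarrow> 'v::euclidean_space \<Rightarrow> 'v"
  assumes A: "linsys l A K" and Y: "twice_deriv l Y Y' (\<lambda>x. A x (Y x))" and Z: "twice_deriv l Z Z' (\<lambda>x. B x (Z x))"
    and i: "Y 0 = Z 0" "Y' 0 = Z' 0" and \<eta>: "0 \<le> \<eta>" "\<And>x v. x \<in> {0..l} \<Longrightarrow> norm (A x v - B x v) \<le> \<eta> * norm v"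
    and M: "\<And>x. x \<in> {0..l} \<Longrightarrow> norm (Z x) \<le> M" and x: "x \<in> {0..l}"
  shows "norm (Y x - Z x) \<le> growth_const K l * (\<eta> * M)"
proof -
  have "norm ((A x (Y x) - B x (Z x)) - A x (Y x - Z x)) \<le> \<eta> * M" if x: "x \<in> {0..l}" for x
  proof -
    have "(A x (Y x) - B x (Z x)) - A x (Y x - Z x) = A x (Z x) - B x (Z x)"
      using linear_diff[OF linsysD(3)[OF A x]] by simp
    also have "norm \<dots> \<le> \<eta> * norm (Z x)" by (rule \<eta>(2)[OF x])
    also have "\<dots> \<le> \<eta> * M" by (intro mult_left_mono M x \<eta>)
    finally show ?thesis .
  qed
  from linsys_bound(1)[OF A twice_deriv_diff[OF Y Z] this x] show ?thesis using i by simp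
qed

text \<open>The system \<open>u'' = - s (W_+ u + \<mu> v)\<close>, \<open>v'' = - s (W_- v - \<mu> u)\<close>. For \<open>s = 1\<close> it is the eigenvalue equation of \<open>N\<close>;
  the parameter \<open>s\<close> deforms it to the free equation.\<close>

definition coupled :: "(real \<Rightarrow> real) \<Rightarrow> (real \<Rightarrow> real) \<Rightarrow> real \<Rightarrow> real \<Rightarrow> real \<Rightarrow> real \<times> real \<Rightarrow> real \<times> real" where
  "coupled Wp Wm s \<mu> x z = (- (s * (Wp x * fst z + \<mu> * snd z)), - (s * (Wm x * snd z - \<mu> * fst z)))"

lemma coupled_bound:
  assumes "\<bar>Wp x\<bar> \<le> K" "\<bar>Wm x\<bar> \<le> K"
  shows "norm (coupled Wp Wm s \<mu> x z) \<le> \<bar>s\<bar> * (2 * (K + \<bar>\<mu>\<bar>)) * norm z"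
proof -
  have f: "\<bar>fst z\<bar> \<le> norm z" "\<bar>snd z\<bar> \<le> norm z" 
    using norm_fst_le[of "fst z" "snd z"] norm_snd_le[of "snd z" "fst z"] by simp_all
  have *: "\<bar>W * p + \<nu> * q\<bar> \<le> (K + \<bar>\<nu>\<bar>) * norm z" if "\<bar>W\<bar> \<le> K" "\<bar>p\<bar> \<le> norm z" "\<bar>q\<bar> \<le> norm z" for W p \<nu> q
  proof -
    have "\<bar>W * p + \<nu> * q\<bar> \<le> \<bar>W\<bar> * \<bar>p\<bar> + \<bar>\<nu>\<bar> * \<bar>q\<bar>" by (metis abs_mult abs_triangle_ineq)
    also have "\<dots> \<le> K * norm z + \<bar>\<nu>\<bar> * norm z" using that by (intro add_mono mult_mono) auto
    finally show ?thesis by (simp add: distrib_right)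
  qed
  have "norm (coupled Wp Wm s \<mu> x z) \<le> \<bar>s\<bar> * \<bar>Wp x * fst z + \<mu> * snd z\<bar> + \<bar>s\<bar> * \<bar>Wm x * snd z + (- \<mu>) * fst z\<bar>"
    unfolding coupled_def by (rule order_trans[OF norm_Pair_le]) (simp add: abs_mult)
  also have "\<dots> \<le> \<bar>s\<bar> * ((K + \<bar>\<mu>\<bar>) * norm z) + \<bar>s\<bar> * ((K + \<bar>- \<mu>\<bar>) * norm z)"
    using *[where W = "Wp x" and p = "fst z" and q = "snd z" and \<nu> = \<mu>]
      *[where W = "Wm x" and p = "snd z" and q = "fst z" and \<nu> = "- \<mu>"] f assms
    by (intro add_mono mult_left_mono) simp_all
  finally show ?thesis by (simp add: algebra_simps)
qed

lemma linsys_coupled: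
  assumes l: "0 < l" and W: "continuous_on {0..l} Wp" "continuous_on {0..l} Wm"
    and K: "0 \<le> K" "\<And>x. x \<in> {0..l} \<Longrightarrow> \<bar>Wp x\<bar> \<le> K" "\<And>x. x \<in> {0..l} \<Longrightarrow> \<bar>Wm x\<bar> \<le> K"
    and s: "\<bar>s\<bar> \<le> 1" and \<mu>: "\<bar>\<mu>\<bar> \<le> M"
  shows "linsys l (coupled Wp Wm s \<mu>) (2 * (K + M))"
  unfolding linsys_def
proof (intro conjI ballI allI)
  show "0 < l" by fact
  show "0 \<le> 2 * (K + M)" using K \<mu> by auto
  fix x assume x: "x \<in> {0..l}"
  show "linear (coupled Wp Wm s \<mu> x)"
    by (intro linearI) (auto simp: coupled_def algebra_simps)
  fix v
  have "norm (coupled Wp Wm s \<mu> x v) \<le> \<bar>s\<bar> * (2 * (K + \<bar>\<mu>\<bar>)) * norm v" by (rule coupled_bound) (use K x in auto)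
  also have "\<dots> \<le> 1 * (2 * (K + M)) * norm v"
    using s \<mu> K by (intro mult_right_mono mult_mono) auto
  finally show "norm (coupled Wp Wm s \<mu> x v) \<le> 2 * (K + M) * norm v" by simp
next
  have "continuous_on ({0..l} \<times> (UNIV :: (real \<times> real) set)) (\<lambda>z. Wp (fst z))"
    "continuous_on ({0..l} \<times> (UNIV :: (real \<times> real) set)) (\<lambda>z. Wm (fst z))"
    by (rule continuous_on_compose2[OF W(1)] continuous_on_compose2[OF W(2)]; auto intro!: continuous_intros)+
  then show "continuous_on ({0..l} \<times> UNIV) (\<lambda>(x, v). coupled Wp Wm s \<mu> x v)"
    unfolding coupled_def case_prod_unfold by (intro continuous_intros)
qed

lemma coupled_diff:
  "coupled Wp Wm s \<mu> x v - coupled Wp Wm t \<mu> x v = coupled Wp Wm (s - t) \<mu> x v"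
  "coupled Wp Wm 1 \<mu> x v - coupled Wp Wm 1 \<nu> x v = coupled (\<lambda>_. 0) (\<lambda>_. 0) 1 (\<mu> - \<nu>) x v"
  by (simp_all add: coupled_def algebra_simps)

lemma continuous_within_of_linear_bound:
  fixes f :: "real \<Rightarrow> 'v::real_normed_vector"
  assumes "\<And>s. s \<in> S \<Longrightarrow> norm (f s - f t) \<le> C * \<bar>s - t\<bar>"
  shows "continuous (at t within S) f"
  unfolding continuous_within
proof (rule Lim_null[THEN iffD2], rule Lim_null_comparison)
  show "eventually (\<lambda>s. norm (f s - f t) \<le> C * \<bar>s - t\<bar>) (at t within S)"
    using assms by (auto simp: eventually_at_filter)
  show "((\<lambda>s. C * \<bar>s - t\<bar>) \<longlongrightarrow> 0) (at t within S)"
    by (auto intro!: tendsto_eq_intros)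
qed

text \<open>For scalar potentials every solution vanishing at \<open>0\<close> is a multiple of the single solution \<open>q\<close>.\<close>

lemma nondeg_scaleR:
  fixes q :: "real \<Rightarrow> real"
  assumes l: "0 < l" and W: "continuous_on {0..l} W"
    and q: "twice_deriv l q q' (\<lambda>x. - (W x *\<^sub>R q x))" "q 0 = 0" "q' 0 = 1" "q l \<noteq> 0"
  shows "nondeg l (\<lambda>x v :: 'v::euclidean_space. - (W x *\<^sub>R v))"
  unfolding nondeg_def
proof (intro allI impI ballI)
  fix u p :: "real \<Rightarrow> 'v" and x
  assume u: "twice_deriv l u p (\<lambda>x. - (W x *\<^sub>R u x))" "u 0 = 0" "u l = 0" and x: "x \<in> {0..l}"
  obtain K where A: "linsys l (\<lambda>x v :: 'v. - (W x *\<^sub>R v)) K" using linsys_scaleR[OF l W] by blast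
  have t: "twice_deriv l (\<lambda>x. q x *\<^sub>R p 0) (\<lambda>x. q' x *\<^sub>R p 0) (\<lambda>x. - (W x *\<^sub>R q x) *\<^sub>R p 0)"
    by (rule twice_deriv_bounded_linear[OF q(1) bounded_linear_scaleR_left])
  have eq: "u x = q x *\<^sub>R p 0" if "x \<in> {0..l}" for x
    by (rule linsys_unique(1)[OF A u(1) t, where r = "\<lambda>x. 0", OF _ _ _ _ that]) (use u q in simp_all)
  have "p 0 = 0" using eq[of l] u(3) q(4) l by simp
  then show "u x = 0" using eq[OF x] by simp
qed

text \<open>\<open>D s \<mu>\<close> is the determinant of the end values of the two solutions of the coupled system that vanish at \<open>0\<close>; its zeros for
  \<open>s = 1\<close> are the real eigenvalues. For \<open>\<mu> = \<mu>1\<close> large it has no zero for \<open>0 < s \<le> 1\<close>, hence keeps the sign that it has for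
  \<open>s = 0\<close>, where it is \<open>l\<^sup>2\<close>. For small \<open>\<mu>\<close> it is the product of a number near \<open>q l < 0\<close> and the end value \<open>V l\<close> of the
  perturbed kernel function; Green's identity gives \<open>V l p'(l) = - \<mu>\<^sup>2 \<integral> U p\<close> with \<open>U\<close> near \<open>h\<close>, so that \<open>V l > 0\<close>.\<close>

lemma unstable_eigenfunction_exists:
  fixes Wp Wm q p h :: "real \<Rightarrow> real"
  assumes l: "0 < l" and W: "continuous_on {0..l} Wp" "continuous_on {0..l} Wm"
    and q: "twice_deriv l q q' (\<lambda>x. - (Wp x *\<^sub>R q x))" "q 0 = 0" "q' 0 = 1" "q l < 0"
    and p: "twice_deriv l p p' (\<lambda>x. - (Wm x *\<^sub>R p x))" "p 0 = 0" "p' 0 = 1" "p l = 0" "p' l < 0"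
    and h: "twice_deriv l h h' (\<lambda>x. - (Wp x *\<^sub>R h x) - p x)" "h 0 = 0" "h l = 0"
    and pos: "0 < integral {0..l} (\<lambda>x. h x * p x)"
  shows "\<exists>\<mu>>0. \<exists>u v u' v'. twice_deriv l u u' (\<lambda>x. - (Wp x * u x) - \<mu> * v x) \<and>
    twice_deriv l v v' (\<lambda>x. - (Wm x * v x) + \<mu> * u x) \<and>
    u 0 = 0 \<and> u l = 0 \<and> v 0 = 0 \<and> v l = 0 \<and> (\<exists>x\<in>{0..l}. u x \<noteq> 0 \<or> v x \<noteq> 0)"
proof -
  obtain K1 where K1: "K1 \<ge> 0" "\<And>x. x \<in> {0..l} \<Longrightarrow> norm (Wp x) \<le> K1"
    using continuous_on_interval_bound[OF W(1)] by blast
  obtain K2 where K2: "K2 \<ge> 0" "\<And>x. x \<in> {0..l} \<Longrightarrow> norm (Wm x) \<le> K2"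
    using continuous_on_interval_bound[OF W(2)] by blast
  define K where "K = K1 + K2"
  have K: "0 \<le> K" "\<And>x. x \<in> {0..l} \<Longrightarrow> \<bar>Wp x\<bar> \<le> K" "\<And>x. x \<in> {0..l} \<Longrightarrow> \<bar>Wm x\<bar> \<le> K"
  proof -
    show "0 \<le> K" using K1(1) K2(1) by (simp add: K_def)
    show "\<bar>Wp x\<bar> \<le> K" if "x \<in> {0..l}" for x using K1(2)[OF that] K2(1) by (simp add: K_def)
    show "\<bar>Wm x\<bar> \<le> K" if "x \<in> {0..l}" for x using K2(2)[OF that] K1(1) by (simp add: K_def)
  qed
  have lsys: "linsys l (coupled Wp Wm s \<mu>) (2 * (K + M))" if "\<bar>s\<bar> \<le> 1" "\<bar>\<mu>\<bar> \<le> M" for s \<mu> M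
    by (rule linsys_coupled[OF l W K that])
  have "\<exists>E. \<exists>E'. E 0 = 0 \<and> E' 0 = b \<and> (\<bar>s\<bar> \<le> 1 \<longrightarrow> twice_deriv l E E' (\<lambda>x. coupled Wp Wm s \<mu> x (E x)))" for s \<mu> b
  proof (cases "\<bar>s\<bar> \<le> 1")
    case True
    then show ?thesis using linsys_exists[OF lsys[OF True order_refl, of \<mu>], of "\<lambda>x. 0" 0 b] by simp
  next
    case False
    then show ?thesis by (intro exI[of _ "\<lambda>x. 0"] exI[of _ "\<lambda>x. b"]) simp
  qed
  note ex = this
  define good where "good s \<mu> b e e' \<longleftrightarrow> e 0 = 0 \<and> e' 0 = b \<and>
    (\<bar>s\<bar> \<le> 1 \<longrightarrow> twice_deriv l e e' (\<lambda>x. coupled Wp Wm s \<mu> x (e x)))" for s \<mu> b e e'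
  define E where "E s \<mu> b = (SOME e. \<exists>e'. good s \<mu> b e e')" for s \<mu> b
  define E' where "E' s \<mu> b = (SOME e'. good s \<mu> b (E s \<mu> b) e')" for s \<mu> b
  have "\<exists>e'. good s \<mu> b (E s \<mu> b) e'" for s \<mu> b
  proof -
    have "\<exists>e e'. good s \<mu> b e e'" unfolding good_def by (rule ex)
    from someI_ex[OF this] show ?thesis unfolding E_def .
  qed
  then have gd: "good s \<mu> b (E s \<mu> b) (E' s \<mu> b)" for s \<mu> b
    unfolding E'_def by (rule someI_ex)
  have E0: "E s \<mu> b 0 = 0" and E0': "E' s \<mu> b 0 = b" for s \<mu> b
    using gd[of s \<mu> b] by (simp_all add: good_def)
  have E: "twice_deriv l (E s \<mu> b) (E' s \<mu> b) (\<lambda>x. coupled Wp Wm s \<mu> x (E s \<mu> b x))" if "\<bar>s\<bar> \<le> 1" for s \<mu> b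
    using gd[of s \<mu> b] that by (simp add: good_def)
  have ll: "l \<in> {0..l}" "0 \<in> {0..l}" using l by auto
  define D where "D s \<mu> = fst (E s \<mu> (1,0) l) * snd (E s \<mu> (0,1) l) - fst (E s \<mu> (0,1) l) * snd (E s \<mu> (1,0) l)" for s \<mu>
  have Ebd: "\<exists>M\<ge>0. \<forall>x\<in>{0..l}. norm (E s \<mu> b x) \<le> M" if "\<bar>s\<bar> \<le> 1" for s \<mu> b
    by (rule continuous_on_interval_bound[OF twice_deriv_continuous(1)[OF E[OF that]]])
  have cont_s: "continuous (at t within {0..1}) (\<lambda>s. E s \<mu> b l)" if t: "t \<in> {0..1}" for t \<mu> b
  proof -
    obtain M where M: "M \<ge> 0" "\<And>x. x \<in> {0..l} \<Longrightarrow> norm (E t \<mu> b x) \<le> M" using Ebd[of t \<mu> b] t by auto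
    show ?thesis
    proof (rule continuous_within_of_linear_bound)
      fix s :: real assume s: "s \<in> {0..1}"
      have "norm (E s \<mu> b l - E t \<mu> b l) \<le> growth_const (2 * (K + \<bar>\<mu>\<bar>)) l * ((\<bar>s - t\<bar> * (2 * (K + \<bar>\<mu>\<bar>))) * M)"
      proof (rule linsys_parameter[where A = "coupled Wp Wm s \<mu>" and B = "coupled Wp Wm t \<mu>" and Y = "E s \<mu> b" and Z = "E t \<mu> b" and Y' = "E' s \<mu> b" and Z' = "E' t \<mu> b", OF lsys E E])
        fix x and v :: "real \<times> real" assume "x \<in> {0..l}"
        then show "norm (coupled Wp Wm s \<mu> x v - coupled Wp Wm t \<mu> x v) \<le> (\<bar>s - t\<bar> * (2 * (K + \<bar>\<mu>\<bar>))) * norm v"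
          unfolding coupled_diff by (intro coupled_bound K)
      qed (use s t E0 E0' K M ll in auto)
      then show "norm (E s \<mu> b l - E t \<mu> b l) \<le> (growth_const (2 * (K + \<bar>\<mu>\<bar>)) l * (2 * (K + \<bar>\<mu>\<bar>)) * M) * \<bar>s - t\<bar>"
        by (simp add: mult_ac)
    qed
  qed
  have par_\<mu>: "norm (E 1 \<mu> b x - E 1 \<nu> b x) \<le> growth_const (2 * (K + R)) l * ((2 * \<bar>\<mu> - \<nu>\<bar>) * M)"
    if "\<bar>\<mu>\<bar> \<le> R" "\<And>x. x \<in> {0..l} \<Longrightarrow> norm (E 1 \<nu> b x) \<le> M" "x \<in> {0..l}" for \<mu> \<nu> b R M x
  proof (rule linsys_parameter[where A = "coupled Wp Wm 1 \<mu>" and B = "coupled Wp Wm 1 \<nu>" and Y = "E 1 \<mu> b" and Z = "E 1 \<nu> b" and Y' = "E' 1 \<mu> b" and Z' = "E' 1 \<nu> b", OF lsys E E])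
    fix x and v :: "real \<times> real" assume "x \<in> {0..l}"
    show "norm (coupled Wp Wm 1 \<mu> x v - coupled Wp Wm 1 \<nu> x v) \<le> (2 * \<bar>\<mu> - \<nu>\<bar>) * norm v"
      unfolding coupled_diff using coupled_bound[of "\<lambda>_. 0" x 0 "\<lambda>_. 0" 1 "\<mu> - \<nu>" v] by simp
  qed (use that E0 E0' in auto)
  have cont_\<mu>: "continuous (at \<nu> within {0..R}) (\<lambda>\<mu>. E 1 \<mu> b l)" if "\<nu> \<in> {0..R}" for \<nu> b R
  proof -
    obtain M where M: "M \<ge> 0" "\<And>x. x \<in> {0..l} \<Longrightarrow> norm (E 1 \<nu> b x) \<le> M" using Ebd[of 1 \<nu> b] by auto
    show ?thesis
    proof (rule continuous_within_of_linear_bound)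
      fix \<mu> :: real assume "\<mu> \<in> {0..R}"
      then show "norm (E 1 \<mu> b l - E 1 \<nu> b l) \<le> (growth_const (2 * (K + R)) l * 2 * M) * \<bar>\<mu> - \<nu>\<bar>"
        using par_\<mu>[of \<mu> R \<nu> b M l] M ll by (simp add: mult_ac)
    qed
  qed
  have zero: "\<exists>z z'. twice_deriv l z z' (\<lambda>x. coupled Wp Wm s \<mu> x (z x)) \<and> z 0 = 0 \<and> z l = 0 \<and> z' 0 \<noteq> 0"
    if s: "\<bar>s\<bar> \<le> 1" and D: "D s \<mu> = 0" for s \<mu>
  proof -
    define u1 v1 u2 v2 where "u1 = fst (E s \<mu> (1,0) l)" and "v1 = snd (E s \<mu> (1,0) l)"
      and "u2 = fst (E s \<mu> (0,1) l)" and "v2 = snd (E s \<mu> (0,1) l)"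
    have D0: "u1 * v2 = u2 * v1" using D by (simp add: D_def u1_def v1_def u2_def v2_def)
    obtain a b where ab: "(a, b) \<noteq> (0, 0)" "a * u1 + b * u2 = 0" "a * v1 + b * v2 = 0"
    proof (cases "v2 = 0 \<and> v1 = 0")
      case False
      then show ?thesis using that[of v2 "- v1"] D0 by (auto simp: algebra_simps)
    next
      case True
      show ?thesis
      proof (cases "u1 = 0 \<and> u2 = 0")
        case False
        then show ?thesis using that[of u2 "- u1"] True by (auto simp: algebra_simps)
      qed (use that[of 1 0] True in auto)
    qed
    show ?thesis
    proof (intro exI conjI)
      show "twice_deriv l (\<lambda>x. a *\<^sub>R E s \<mu> (1,0) x + b *\<^sub>R E s \<mu> (0,1) x) (\<lambda>x. a *\<^sub>R E' s \<mu> (1,0) x + b *\<^sub>R E' s \<mu> (0,1) x)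
        (\<lambda>x. coupled Wp Wm s \<mu> x (a *\<^sub>R E s \<mu> (1,0) x + b *\<^sub>R E s \<mu> (0,1) x))"
        by (rule twice_deriv_cong[OF twice_deriv_lincomb[OF E[OF s] E[OF s]]]) (simp add: coupled_def algebra_simps)
      show "a *\<^sub>R E s \<mu> (1,0) l + b *\<^sub>R E s \<mu> (0,1) l = 0"
        using ab by (simp add: prod_eq_iff u1_def u2_def v1_def v2_def)
      show "a *\<^sub>R E' s \<mu> (1,0) 0 + b *\<^sub>R E' s \<mu> (0,1) 0 \<noteq> 0"
        using ab(1) by (simp add: E0' zero_prod_def)
    qed (simp add: E0)
  qed
  have comp: "twice_deriv l (\<lambda>x. fst (z x)) (\<lambda>x. fst (z' x)) (\<lambda>x. - (s * (Wp x * fst (z x) + \<mu> * snd (z x))))"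
    "twice_deriv l (\<lambda>x. snd (z x)) (\<lambda>x. snd (z' x)) (\<lambda>x. - (s * (Wm x * snd (z x) - \<mu> * fst (z x))))"
    if "twice_deriv l z z' (\<lambda>x. coupled Wp Wm s \<mu> x (z x))" for z z' s \<mu>
    using twice_deriv_bounded_linear[OF that bounded_linear_fst] twice_deriv_bounded_linear[OF that bounded_linear_snd]
    by (simp_all add: coupled_def)
  have goal: ?thesis if \<mu>: "0 < \<mu>" and D: "D 1 \<mu> = 0" for \<mu>
  proof -
    obtain z z' where z: "twice_deriv l z z' (\<lambda>x. coupled Wp Wm 1 \<mu> x (z x))" "z 0 = 0" "z l = 0" "z' 0 \<noteq> 0"
      using zero[OF _ D] by auto
    have nz: "\<exists>x\<in>{0..l}. fst (z x) \<noteq> 0 \<or> snd (z x) \<noteq> 0"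
    proof (rule ccontr)
      assume "\<not> ?thesis"
      then have "z x = 0" if "x \<in> {0..l}" for x using that by (auto simp: prod_eq_iff)
      moreover have "twice_deriv l (\<lambda>x. 0::real\<times>real) (\<lambda>x. 0) (\<lambda>x. 0)" by (auto simp: twice_deriv_def)
      ultimately have "z' 0 = 0" using twice_deriv_derivative_unique[OF l z(1) _ _ ll(2)] by blast
      then show False using z(4) by simp
    qed
    have "twice_deriv l (\<lambda>x. fst (z x)) (\<lambda>x. fst (z' x)) (\<lambda>x. - (Wp x * fst (z x)) - \<mu> * snd (z x))"
      by (rule twice_deriv_cong[OF comp(1)[OF z(1)]]) simp
    moreover have "twice_deriv l (\<lambda>x. snd (z x)) (\<lambda>x. snd (z' x)) (\<lambda>x. - (Wm x * snd (z x)) + \<mu> * fst (z x))"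
      by (rule twice_deriv_cong[OF comp(2)[OF z(1)]]) simp
    ultimately show ?thesis using \<mu> nz z(2,3)
      by (intro exI[of _ \<mu>] conjI exI[of _ "\<lambda>x. fst (z x)"] exI[of _ "\<lambda>x. snd (z x)"] exI[of _ "\<lambda>x. fst (z' x)"] exI[of _ "\<lambda>x. snd (z' x)"]) simp_all
  qed
  \<comment> \<open>for \<open>\<mu> > K\<close>, pairing the two equations crosswise leaves a definite quadratic form\<close>
  define \<mu>1 where "\<mu>1 = 2 * K + 1"
  have nonvanish: "D s \<mu>1 \<noteq> 0" if s: "0 < s" "s \<le> 1" for s
  proof
    assume "D s \<mu>1 = 0"
    then obtain z z' where z: "twice_deriv l z z' (\<lambda>x. coupled Wp Wm s \<mu>1 x (z x))" "z 0 = 0" "z l = 0" "z' 0 \<noteq> 0"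
      using zero[of s \<mu>1] s by auto
    define u v where "u x = fst (z x)" and "v x = snd (z x)" for x
    note tu = comp(1)[OF z(1), folded u_def v_def] and tv = comp(2)[OF z(1), folded u_def v_def]
    note cu = twice_deriv_continuous(1)[OF tu] and cv = twice_deriv_continuous(1)[OF tv]
    define e where "e x = \<mu>1 * (u x * u x + v x * v x) - (Wm x - Wp x) * (u x * v x)" for x
    have "integral {0..l} (\<lambda>x. (- (s * (Wp x * u x + \<mu>1 * v x))) * v x - u x * (- (s * (Wm x * v x - \<mu>1 * u x)))) = 0"
      using green_identity[OF l tu tv] z(2,3) by (simp add: integral_unique u_def v_def)
    moreover have "(\<lambda>x. (- (s * (Wp x * u x + \<mu>1 * v x))) * v x - u x * (- (s * (Wm x * v x - \<mu>1 * u x)))) = (\<lambda>x. (- s) * e x)"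
      by (simp add: fun_eq_iff e_def algebra_simps)
    ultimately have e0: "integral {0..l} e = 0" using s by simp
    have ce: "continuous_on {0..l} e" unfolding e_def by (intro continuous_intros cu cv W)
    have low: "(u x * u x + v x * v x) / 2 \<le> e x" if x: "x \<in> {0..l}" for x
    proof -
      have "(Wm x - Wp x) * (u x * v x) \<le> \<bar>Wm x - Wp x\<bar> * \<bar>u x * v x\<bar>"
        by (metis abs_ge_self abs_mult)
      also have "\<dots> \<le> (2 * K) * ((u x * u x + v x * v x) / 2)"
      proof (rule mult_mono)
        show "\<bar>Wm x - Wp x\<bar> \<le> 2 * K" using K(2,3)[OF x] by linarith
        show "\<bar>u x * v x\<bar> \<le> (u x * u x + v x * v x) / 2"
          using sum_squares_bound[of "u x" "v x"] sum_squares_bound[of "u x" "- v x"]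
          by (simp add: power2_eq_square abs_le_iff)
      qed (use K in auto)
      also have "\<dots> = K * (u x * u x + v x * v x)" by simp
      finally have "e x \<ge> (K + 1) * (u x * u x + v x * v x)" unfolding e_def \<mu>1_def by (simp add: algebra_simps)
      moreover have "(K + 1) * (u x * u x + v x * v x) \<ge> (1/2) * (u x * u x + v x * v x)"
        using K by (intro mult_right_mono) auto
      ultimately show ?thesis by simp
    qed
    have "e x = 0" if "x \<in> {0..l}" for x
    proof -
      have "0 \<le> e x" if "x \<in> {0..l}" for x using low[OF that] by (smt (verit) divide_nonneg_nonneg zero_le_square)
      then show ?thesis using integral_eq_0_iff[of 0 l e] ce e0 l that by auto
    qed
    then have "z x = 0" if "x \<in> {0..l}" for x
    proof -
      have "u x * u x + v x * v x \<le> 0" using low[OF that] \<open>\<And>x. x \<in> {0..l} \<Longrightarrow> e x = 0\<close>[OF that] by simp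
      then have "u x = 0 \<and> v x = 0" by (simp only: sum_squares_le_zero_iff)
      then show ?thesis by (simp add: prod_eq_iff u_def v_def)
    qed
    moreover have "twice_deriv l (\<lambda>x. 0::real\<times>real) (\<lambda>x. 0) (\<lambda>x. 0)" by (auto simp: twice_deriv_def)
    ultimately have "z' 0 = 0" using twice_deriv_derivative_unique[OF l z(1) _ _ ll(2)] by blast
    then show False using z(4) by simp
  qed
  \<comment> \<open>for \<open>s = 0\<close> solutions are affine\<close>
  have E00: "E 0 \<mu>1 b l = l *\<^sub>R b" for b
  proof (rule linsys_unique(1)[OF lsys[of 0 \<mu>1 "\<bar>\<mu>1\<bar>"] E, where r = "\<lambda>x. 0" and p' = "\<lambda>x. b" and s' = "\<lambda>x. 0"])
    show "twice_deriv l (\<lambda>x. x *\<^sub>R b) (\<lambda>x. b) (\<lambda>x. 0)"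
      unfolding twice_deriv_def
      by (auto intro!: derivative_eq_intros simp: has_vector_derivative_def)
  qed (use l in \<open>simp_all add: E0 E0' coupled_def zero_prod_def ll\<close>)
  have D0: "D 0 \<mu>1 > 0" using l by (simp add: D_def E00)
  have D1: "D 1 \<mu>1 > 0"
  proof (rule ccontr)
    assume "\<not> D 1 \<mu>1 > 0"
    moreover have "continuous_on {0..1} (\<lambda>s. D s \<mu>1)"
      unfolding continuous_on_eq_continuous_within D_def
      by (intro ballI continuous_intros cont_s) auto
    ultimately obtain s where "0 \<le> s" "s \<le> 1" "D s \<mu>1 = 0"
      using IVT2'[of "\<lambda>s. D s \<mu>1" 1 0 0] D0 by auto
    then show False using nonvanish[of s] D0 by (cases "s = 0") auto
  qed
  obtain Q where Q: "q l = - Q" "Q > 0" using q(4) by (metis neg_0_less_iff_less minus_minus)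
  have small: "\<exists>\<mu>. 0 < \<mu> \<and> \<mu> < \<mu>1 \<and> D 1 \<mu> < 0"
  proof -
    have b1: "E 1 0 (1,0) x = (q x, 0)" if x: "x \<in> {0..l}" for x
    proof (rule linsys_unique(1)[OF lsys[of 1 0 0] E, where r = "\<lambda>x. 0" and p' = "\<lambda>x. (q' x, 0)" and s' = "\<lambda>x. (- (Wp x *\<^sub>R q x), 0)", OF _ _ _ _ _ _ _ _ x])
      show "twice_deriv l (\<lambda>x. (q x, 0)) (\<lambda>x. (q' x, 0)) (\<lambda>x. (- (Wp x *\<^sub>R q x), 0::real))"
        unfolding twice_deriv_def by (auto intro!: has_vector_derivative_Pair twice_derivD[OF q(1), unfolded real_scaleR_def] has_vector_derivative_const)
    qed (simp_all add: E0 E0' coupled_def q zero_prod_def)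
    have b2: "E 1 0 (0,1) x = (0, p x)" if x: "x \<in> {0..l}" for x
    proof (rule linsys_unique(1)[OF lsys[of 1 0 0] E, where r = "\<lambda>x. 0" and p' = "\<lambda>x. (0, p' x)" and s' = "\<lambda>x. (0, - (Wm x *\<^sub>R p x))", OF _ _ _ _ _ _ _ _ x])
      show "twice_deriv l (\<lambda>x. (0, p x)) (\<lambda>x. (0, p' x)) (\<lambda>x. (0::real, - (Wm x *\<^sub>R p x)))"
        unfolding twice_deriv_def by (auto intro!: has_vector_derivative_Pair twice_derivD[OF p(1), unfolded real_scaleR_def] has_vector_derivative_const)
    qed (simp_all add: E0 E0' coupled_def p zero_prod_def)
    obtain M1 where M1: "M1 \<ge> 0" "\<And>x. x \<in> {0..l} \<Longrightarrow> norm (E 1 0 (1,0) x) \<le> M1" using Ebd[of 1 0 "(1,0)"] by auto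
    obtain M2 where M2: "M2 \<ge> 0" "\<And>x. x \<in> {0..l} \<Longrightarrow> norm (E 1 0 (0,1) x) \<le> M2" using Ebd[of 1 0 "(0,1)"] by auto
    define G where "G = growth_const (2 * (K + 1)) l"
    have G: "G > 0" by (simp add: G_def growth_const_def)
    define C where "C = G * (2 * (M1 + M2)) + 1"
    have C: "C > 0" using G M1 M2 by (simp add: C_def add_nonneg_pos)
    have near: "norm (E 1 \<mu> (1,0) x - (q x, 0)) \<le> C * \<mu>" "norm (E 1 \<mu> (0,1) x - (0, p x)) \<le> C * \<mu>"
      if \<mu>: "0 < \<mu>" "\<mu> \<le> 1" and x: "x \<in> {0..l}" for \<mu> x
    proof -
      have le: "G * ((2 * \<bar>\<mu> - 0\<bar>) * M) \<le> C * \<mu>" if "M \<le> M1 + M2" for M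
      proof -
        have "G * (2 * M) \<le> C" using that G unfolding C_def by (smt (verit) mult_left_mono)
        then have "(G * (2 * M)) * \<mu> \<le> C * \<mu>" using \<mu> by (intro mult_right_mono) auto
        then show ?thesis using \<mu> by (simp add: mult_ac)
      qed
      show "norm (E 1 \<mu> (1,0) x - (q x, 0)) \<le> C * \<mu>"
        unfolding b1[OF x, symmetric]
        by (rule order_trans[OF par_\<mu>[of \<mu> 1 0 "(1,0)" M1 x] le[of M1, unfolded G_def]]) (use M1 M2 \<mu> x in auto)
      show "norm (E 1 \<mu> (0,1) x - (0, p x)) \<le> C * \<mu>"
        unfolding b2[OF x, symmetric]
        by (rule order_trans[OF par_\<mu>[of \<mu> 1 0 "(0,1)" M2 x] le[of M2, unfolded G_def]]) (use M1 M2 \<mu> x in auto)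
    qed
    obtain KW where AW: "linsys l (\<lambda>x v :: real. - (Wp x *\<^sub>R v)) KW" using linsys_scaleR[OF l W(1)] by blast
    have "nondeg l (\<lambda>x v :: real. - (Wp x *\<^sub>R v))" by (rule nondeg_scaleR[OF l W(1) q(1-3)]) (use q(4) in simp)
    from dirichlet_bound[OF AW this] obtain B where B: "B > 0"
      and DB: "\<And>u p s e x. twice_deriv l u p s \<Longrightarrow> (\<And>x. x \<in> {0..l} \<Longrightarrow> norm (s x - - (Wp x *\<^sub>R u x)) \<le> e) \<Longrightarrow>
        norm (u 0) \<le> e \<Longrightarrow> norm (u l) \<le> e \<Longrightarrow> x \<in> {0..l} \<Longrightarrow> norm (u x :: real) \<le> B * e" by metis
    obtain P where P: "P \<ge> 0" "\<And>x. x \<in> {0..l} \<Longrightarrow> norm (p x) \<le> P"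
      using continuous_on_interval_bound[OF twice_deriv_continuous(1)[OF p(1)]] by blast
    define J where "J = integral {0..l} (\<lambda>x. h x * p x)"
    define N where "N = l * (B * (2 * C) * P) + 1"
    have N: "N > 0" using l B C P by (simp add: N_def add_nonneg_pos)
    \<comment> \<open>\<open>\<mu>\<close> keeps \<open>u1 l\<close> near \<open>q l\<close> and the integral of \<open>U p\<close> near \<open>J > 0\<close>\<close>
    define \<mu> where "\<mu> = min (min 1 (K + 1/2)) (min (Q / (2 * C)) (J / (2 * N)))"
    have J: "J > 0" using pos by (simp add: J_def)
    have \<mu>: "0 < \<mu>" "\<mu> \<le> 1" "\<mu> < \<mu>1" "2 * C * \<mu> \<le> Q" "N * \<mu> < J"
    proof -
      show "0 < \<mu>" using K Q C N J by (simp add: \<mu>_def)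
      show "\<mu> \<le> 1" by (simp add: \<mu>_def)
      have "\<mu> \<le> K + 1/2" by (simp add: \<mu>_def)
      then show "\<mu> < \<mu>1" using K by (simp add: \<mu>1_def)
      have "\<mu> \<le> Q / (2 * C)" by (simp add: \<mu>_def)
      then show "2 * C * \<mu> \<le> Q" using C by (simp add: field_simps)
      have "\<mu> \<le> J / (2 * N)" by (simp add: \<mu>_def)
      then have "2 * (N * \<mu>) \<le> J" using N by (simp add: field_simps)
      then show "N * \<mu> < J" using J N \<open>0 < \<mu>\<close> by linarith
    qed
    define u1 v1 u2 v2 where "u1 x = fst (E 1 \<mu> (1,0) x)" and "v1 x = snd (E 1 \<mu> (1,0) x)"
      and "u2 x = fst (E 1 \<mu> (0,1) x)" and "v2 x = snd (E 1 \<mu> (0,1) x)" for x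
    have cl: "\<bar>u1 x - q x\<bar> \<le> C * \<mu>" "\<bar>v1 x\<bar> \<le> C * \<mu>" "\<bar>u2 x\<bar> \<le> C * \<mu>" "\<bar>v2 x - p x\<bar> \<le> C * \<mu>" if "x \<in> {0..l}" for x
    proof -
      have f: "\<bar>fst w\<bar> \<le> norm w" "\<bar>snd w\<bar> \<le> norm w" for w :: "real \<times> real"
        using norm_fst_le[of "fst w" "snd w"] norm_snd_le[of "snd w" "fst w"] by simp_all
      show "\<bar>u1 x - q x\<bar> \<le> C * \<mu>" "\<bar>v1 x\<bar> \<le> C * \<mu>" "\<bar>u2 x\<bar> \<le> C * \<mu>" "\<bar>v2 x - p x\<bar> \<le> C * \<mu>"
        using near[OF \<mu>(1,2) that] f[of "E 1 \<mu> (1,0) x - (q x, 0)"] f[of "E 1 \<mu> (0,1) x - (0, p x)"]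
        unfolding u1_def v1_def u2_def v2_def by simp_all
    qed
    have u1l: "u1 l \<le> - (Q / 2)" using cl(1)[OF ll(1)] \<mu>(4) Q by (simp add: abs_le_iff)
    define \<kappa> where "\<kappa> = u2 l / u1 l"
    have \<kappa>: "\<bar>\<kappa>\<bar> \<le> 1" "\<kappa> * u1 l = u2 l"
    proof -
      have "\<bar>u2 l\<bar> \<le> \<bar>u1 l\<bar>" using cl(3)[OF ll(1)] u1l \<mu>(4) Q by linarith
      moreover have n: "u1 l \<noteq> 0" using u1l Q by auto
      ultimately show "\<bar>\<kappa>\<bar> \<le> 1" unfolding \<kappa>_def abs_divide by (subst divide_le_eq_1_pos) simp_all
      show "\<kappa> * u1 l = u2 l" using n by (simp add: \<kappa>_def)
    qed
    \<comment> \<open>the combination near \<open>(0, p)\<close> whose first component vanishes at \<open>l\<close>\<close>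
    define Z where "Z x = 1 *\<^sub>R E 1 \<mu> (0,1) x + (- \<kappa>) *\<^sub>R E 1 \<mu> (1,0) x" for x
    define Z' where "Z' x = 1 *\<^sub>R E' 1 \<mu> (0,1) x + (- \<kappa>) *\<^sub>R E' 1 \<mu> (1,0) x" for x
    have tZ: "twice_deriv l Z Z' (\<lambda>x. coupled Wp Wm 1 \<mu> x (Z x))"
      unfolding Z_def Z'_def
      by (rule twice_deriv_cong[OF twice_deriv_lincomb[OF E E]]) (simp_all add: coupled_def algebra_simps)
    \<comment> \<open>the first component is of order \<open>\<mu>\<close>; rescaled, it solves \<open>L_+ U = V\<close>\<close>
    define U V where "U x = fst (Z x) / \<mu>" and "V x = snd (Z x)" for x
    have fZ: "fst (Z x) = \<mu> * U x" for x using \<mu> by (simp add: U_def)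
    have "twice_deriv l (\<lambda>x. (1/\<mu>) *\<^sub>R fst (Z x)) (\<lambda>x. (1/\<mu>) *\<^sub>R fst (Z' x)) (\<lambda>x. (1/\<mu>) *\<^sub>R - (1 * (Wp x * fst (Z x) + \<mu> * snd (Z x))))"
      by (rule twice_deriv_bounded_linear[OF comp(1)[OF tZ] bounded_linear_scaleR_right])
    then have tU0: "twice_deriv l U (\<lambda>x. fst (Z' x) / \<mu>) (\<lambda>x. (1/\<mu>) *\<^sub>R - (1 * (Wp x * fst (Z x) + \<mu> * snd (Z x))))"
      by (simp add: U_def[abs_def])
    have tU: "twice_deriv l U (\<lambda>x. fst (Z' x) / \<mu>) (\<lambda>x. - (Wp x * U x) - V x)"
      by (rule twice_deriv_cong[OF tU0]) (use \<mu>(1) in \<open>simp add: fZ V_def[symmetric] add_divide_distrib diff_divide_distrib\<close>)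
    have tV: "twice_deriv l V (\<lambda>x. snd (Z' x)) (\<lambda>x. - (Wm x * V x) + \<mu> * (\<mu> * U x))"
      unfolding V_def[abs_def] by (rule twice_deriv_cong[OF comp(2)[OF tZ]]) (simp add: fZ)
    have U0: "U 0 = 0" "U l = 0" "V 0 = 0"
      using \<kappa>(2) by (simp_all add: U_def V_def Z_def E0 u1_def u2_def)
    have Vp: "\<bar>V x - p x\<bar> \<le> 2 * C * \<mu>" if x: "x \<in> {0..l}" for x
    proof -
      have "\<bar>\<kappa> * v1 x\<bar> \<le> 1 * (C * \<mu>)" unfolding abs_mult using \<kappa>(1) cl(2)[OF x] by (intro mult_mono) auto
      moreover have "V x - p x = (v2 x - p x) - \<kappa> * v1 x" by (simp add: V_def Z_def v1_def v2_def)
      ultimately show ?thesis using cl(4)[OF x] by linarith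
    qed
    have Uh: "\<bar>U x - h x\<bar> \<le> B * (2 * C * \<mu>)" if x: "x \<in> {0..l}" for x
    proof -
      have "norm (U x - h x) \<le> B * (2 * C * \<mu>)"
      proof (rule DB[OF twice_deriv_diff[OF tU h(1)] _ _ _ x])
        fix x assume "x \<in> {0..l}"
        from Vp[OF this] show "norm ((- (Wp x * U x) - V x) - (- (Wp x *\<^sub>R h x) - p x) - - (Wp x *\<^sub>R (U x - h x))) \<le> 2 * C * \<mu>"
          by (simp add: algebra_simps abs_minus_commute)
      qed (use U0 h C \<mu> in auto)
      then show ?thesis by simp
    qed
    note cU = twice_deriv_continuous(1)[OF tU] and cV = twice_deriv_continuous(1)[OF tV]
      and cp = twice_deriv_continuous(1)[OF p(1)] and chh = twice_deriv_continuous(1)[OF h(1)]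
    have "norm (integral {0..l} (\<lambda>x. (U x - h x) * p x)) \<le> integral {0..l} (\<lambda>x. B * (2 * C * \<mu>) * P)"
    proof (rule integral_norm_bound_integral)
      fix x assume x: "x \<in> {0..l}"
      show "norm ((U x - h x) * p x) \<le> B * (2 * C * \<mu>) * P"
        using Uh[OF x] P(2)[OF x] P(1) B C \<mu> by (simp add: abs_mult mult_mono)
    qed (auto intro!: integrable_continuous_interval continuous_intros cU cp chh)
    also have "\<dots> = (l * (B * (2 * C) * P)) * \<mu>" using l by simp
    also have "\<dots> \<le> N * \<mu>" using \<mu> by (intro mult_right_mono) (auto simp: N_def)
    also have "\<dots> < J" by (rule \<mu>(5))
    finally have close: "norm (integral {0..l} (\<lambda>x. (U x - h x) * p x)) < J" .
    have "integral {0..l} (\<lambda>x. U x * p x) = integral {0..l} (\<lambda>x. (U x - h x) * p x + h x * p x)"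
      by (rule integral_cong) (simp add: algebra_simps)
    also have "\<dots> = integral {0..l} (\<lambda>x. (U x - h x) * p x) + J"
      unfolding J_def by (intro Henstock_Kurzweil_Integration.integral_add integrable_continuous_interval continuous_intros cU cp chh)
    finally have IU: "0 < integral {0..l} (\<lambda>x. U x * p x)" using close by simp
    \<comment> \<open>the second component pairs with the kernel function \<open>p\<close> only through its end value\<close>
    have "integral {0..l} (\<lambda>x. (- (Wm x * V x) + \<mu> * (\<mu> * U x)) * p x - V x * - (Wm x *\<^sub>R p x)) = - (V l * p' l)"
      using green_identity[OF l tV p(1)] U0 p by (simp add: integral_unique)
    moreover have "(\<lambda>x. (- (Wm x * V x) + \<mu> * (\<mu> * U x)) * p x - V x * - (Wm x *\<^sub>R p x)) = (\<lambda>x. \<mu>\<^sup>2 * (U x * p x))"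
      by (simp add: fun_eq_iff algebra_simps power2_eq_square)
    ultimately have "\<mu>\<^sup>2 * integral {0..l} (\<lambda>x. U x * p x) = - (V l * p' l)" by simp
    moreover have "0 < \<mu>\<^sup>2 * integral {0..l} (\<lambda>x. U x * p x)" using IU \<mu>(1) by simp
    ultimately have "V l * p' l < 0" by linarith
    then have "0 < V l" using p(5) by (simp add: mult_less_0_iff)
    moreover have "D 1 \<mu> = u1 l * V l"
      using \<kappa>(2) by (simp add: D_def V_def Z_def u1_def u2_def algebra_simps)
    moreover have "u1 l < 0" using u1l Q by simp
    ultimately have "D 1 \<mu> < 0" by (simp add: mult_neg_pos)
    then show ?thesis using \<mu> by blast
  qed
  then obtain \<mu>0 where \<mu>0: "0 < \<mu>0" "\<mu>0 < \<mu>1" "D 1 \<mu>0 < 0" by blast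
  have "continuous_on {0..\<mu>1} (D 1)"
    unfolding continuous_on_eq_continuous_within D_def
    by (intro ballI continuous_intros cont_\<mu>) auto
  then have "continuous_on {\<mu>0..\<mu>1} (D 1)" by (rule continuous_on_subset) (use \<mu>0 in auto)
  then obtain \<mu> where "\<mu>0 \<le> \<mu>" "D 1 \<mu> = 0"
    using IVT'[of "D 1" \<mu>0 0 \<mu>1] \<mu>0 D1 by auto
  then show ?thesis using goal[of \<mu>] \<mu>0 by simp
qed

section \<open>Families of solutions of the nonlinear equation\<close>

text \<open>Solutions of the profile equation for a differentiable nonlinearity \<open>g\<close>; later \<open>g u = f(u\<^sup>2) u\<close>.\<close>

definition nlsol :: "real \<Rightarrow> (real \<Rightarrow> real) \<Rightarrow> real \<Rightarrow> (real \<Rightarrow> real) \<Rightarrow> (real \<Rightarrow> real) \<Rightarrow> bool" where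
  "nlsol l g \<beta> \<phi> \<phi>' \<longleftrightarrow> twice_deriv l \<phi> \<phi>' (\<lambda>x. - (g (\<phi> x) + \<beta> * \<phi> x))"

text \<open>The mean value theorem with uniform continuity of \<open>g'\<close> on a bounded interval around the values of \<open>\<phi>0\<close>.\<close>

lemma linearization_estimate:
  fixes g g' \<phi>0 :: "real \<Rightarrow> real"
  assumes g: "\<And>u. (g has_real_derivative g' u) (at u)" and c: "continuous_on UNIV g'"
    and \<phi>: "continuous_on {0..l} \<phi>0" and \<omega>: "0 < \<omega>"
  shows "\<exists>\<delta>>0. \<delta> \<le> 1 \<and> (\<forall>x\<in>{0..l}. \<forall>a b. \<bar>a - \<phi>0 x\<bar> \<le> \<delta> \<longrightarrow> \<bar>b - \<phi>0 x\<bar> \<le> \<delta> \<longrightarrow>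
     \<bar>g b - g a - g' (\<phi>0 x) * (b - a)\<bar> \<le> \<omega> * \<bar>b - a\<bar> \<and> \<bar>g' a - g' (\<phi>0 x)\<bar> \<le> \<omega>)"
proof -
  obtain R where R: "R \<ge> 0" "\<And>x. x \<in> {0..l} \<Longrightarrow> norm (\<phi>0 x) \<le> R"
    using continuous_on_interval_bound[OF \<phi>] by blast
  have "uniformly_continuous_on {-(R+1)..R+1} g'"
    by (intro compact_uniformly_continuous continuous_on_subset[OF c]) auto
  then obtain d where d: "d > 0" "\<And>u v. u \<in> {-(R+1)..R+1} \<Longrightarrow> v \<in> {-(R+1)..R+1} \<Longrightarrow> dist v u < d \<Longrightarrow> dist (g' v) (g' u) < \<omega>"
    using \<omega> unfolding uniformly_continuous_on_def by metis
  define \<delta> where "\<delta> = min 1 (d / 2)"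
  have \<delta>: "0 < \<delta>" "\<delta> \<le> 1" "\<delta> < d" using d(1) by (auto simp: \<delta>_def)
  have near: "\<bar>g' a - g' (\<phi>0 x)\<bar> \<le> \<omega>" if "x \<in> {0..l}" "\<bar>a - \<phi>0 x\<bar> \<le> \<delta>" for x a
    using d(2)[of "\<phi>0 x" a] R(2)[OF that(1)] that(2) \<delta> by (auto simp: dist_real_def abs_le_iff)
  have mv: "\<bar>g b - g a - g' (\<phi>0 x) * (b - a)\<bar> \<le> \<omega> * \<bar>b - a\<bar>"
    if x: "x \<in> {0..l}" and ab: "\<bar>a - \<phi>0 x\<bar> \<le> \<delta>" "\<bar>b - \<phi>0 x\<bar> \<le> \<delta>" "a < b" for x a b
  proof -
    obtain z where z: "a < z" "z < b" "g b - g a = (b - a) * g' z"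
      using MVT2[of a b g g'] ab(3) g by blast
    have "g b - g a - g' (\<phi>0 x) * (b - a) = (g' z - g' (\<phi>0 x)) * (b - a)"
      using z(3) by (simp add: algebra_simps)
    moreover have "\<bar>g' z - g' (\<phi>0 x)\<bar> \<le> \<omega>" by (rule near[OF x]) (use ab z in \<open>auto simp: abs_le_iff\<close>)
    ultimately show ?thesis by (simp add: abs_mult mult_right_mono)
  qed
  have "\<bar>g b - g a - g' (\<phi>0 x) * (b - a)\<bar> \<le> \<omega> * \<bar>b - a\<bar>"
    if x: "x \<in> {0..l}" and ab: "\<bar>a - \<phi>0 x\<bar> \<le> \<delta>" "\<bar>b - \<phi>0 x\<bar> \<le> \<delta>" for x a b
  proof (cases a b rule: linorder_cases)
    case less
    then show ?thesis using mv[OF x ab] by simp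
  next
    case greater
    have "\<bar>g a - g b - g' (\<phi>0 x) * (a - b)\<bar> \<le> \<omega> * \<bar>a - b\<bar>" using mv[OF x ab(2,1) greater] .
    moreover have "g a - g b - g' (\<phi>0 x) * (a - b) = - (g b - g a - g' (\<phi>0 x) * (b - a))" by (simp add: algebra_simps)
    ultimately show ?thesis by (simp only: abs_minus_cancel abs_minus_commute[of a b])
  qed simp
  then show ?thesis using \<delta> near by blast
qed

text \<open>The estimate of \<open>dirichlet_bound\<close> in scalar form, with zero boundary values.\<close>

definition dirichlet_estimate :: "real \<Rightarrow> (real \<Rightarrow> real) \<Rightarrow> real \<Rightarrow> bool" where
  "dirichlet_estimate l W C \<longleftrightarrow> (\<forall>u p s e. twice_deriv l u p s \<longrightarrow> (\<forall>x\<in>{0..l}. \<bar>s x + W x * u x\<bar> \<le> e) \<longrightarrow>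
     u 0 = 0 \<longrightarrow> u l = 0 \<longrightarrow> (\<forall>x\<in>{0..l}. \<bar>u x\<bar> \<le> C * e \<and> \<bar>p x\<bar> \<le> C * e))"

text \<open>An error term proportional to the solution itself is absorbed at its maximum if the factor is small.\<close>

lemma dirichlet_bound_absorb:
  fixes u W :: "real \<Rightarrow> real"
  assumes l: "0 < l" and C: "0 < C"
    and DB: "dirichlet_estimate l W C"
    and \<omega>: "0 \<le> \<omega>" "C * \<omega> \<le> 1/2" and t: "twice_deriv l u p s" and z: "u 0 = 0" "u l = 0"
    and b: "\<And>x. x \<in> {0..l} \<Longrightarrow> \<bar>s x + W x * u x\<bar> \<le> \<omega> * \<bar>u x\<bar> + e" and x: "x \<in> {0..l}"
  shows "\<bar>u x\<bar> \<le> 2 * C * e" "\<bar>p x\<bar> \<le> 2 * C * e"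
proof -
  have "continuous_on {0..l} (\<lambda>x. \<bar>u x\<bar>)" using twice_deriv_continuous(1)[OF t] by (intro continuous_intros)
  then obtain y where y: "y \<in> {0..l}" "\<And>x. x \<in> {0..l} \<Longrightarrow> \<bar>u x\<bar> \<le> \<bar>u y\<bar>"
    using continuous_attains_sup[of "{0..l}" "\<lambda>x. \<bar>u x\<bar>"] l by auto
  have "\<bar>s x + W x * u x\<bar> \<le> \<omega> * \<bar>u y\<bar> + e" if "x \<in> {0..l}" for x
    using b[OF that] mult_left_mono[OF y(2)[OF that] \<omega>(1)] by linarith
  then have bd: "\<bar>u x\<bar> \<le> C * (\<omega> * \<bar>u y\<bar> + e) \<and> \<bar>p x\<bar> \<le> C * (\<omega> * \<bar>u y\<bar> + e)" if "x \<in> {0..l}" for x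
    using DB t z that unfolding dirichlet_estimate_def by blast
  have half: "(C * \<omega>) * \<bar>u y\<bar> \<le> (1/2) * \<bar>u y\<bar>" using \<omega>(2) by (rule mult_right_mono) simp
  have eq: "C * (\<omega> * \<bar>u y\<bar> + e) = (C * \<omega>) * \<bar>u y\<bar> + C * e" by (simp add: algebra_simps)
  have uy: "\<bar>u y\<bar> \<le> 2 * (C * e)" using bd[OF y(1)] half unfolding eq by linarith
  show "\<bar>u x\<bar> \<le> 2 * C * e" using uy y(2)[OF x] by simp
  show "\<bar>p x\<bar> \<le> 2 * C * e" using bd[OF x] half uy unfolding eq by linarith
qed

text \<open>The end value as a function of the initial slope \<open>s\<close> is close to \<open>(s - c) q l\<close> near the slope \<open>c\<close> of \<open>\<phi>0\<close>, so it changes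
  sign between \<open>c - d\<close> and \<open>c + d\<close>, and still does for nearby \<open>\<beta>\<close>.\<close>

lemma shooting_family:
  fixes g g' \<phi>0 :: "real \<Rightarrow> real"
  assumes l: "0 < l" and g: "\<And>u. (g has_real_derivative g' u) (at u)" and cg: "continuous_on UNIV g'"
    and \<phi>: "nlsol l g \<beta>0 \<phi>0 \<phi>0'" "\<phi>0 0 = 0" "\<phi>0 l = 0"
    and q: "twice_deriv l q q' (\<lambda>x. - ((g' (\<phi>0 x) + \<beta>0) *\<^sub>R q x))" "q 0 = (0::real)" "q' 0 = 1" "q l \<noteq> 0"
    and \<delta>: "0 < \<delta>"
  shows "\<exists>e>0. \<forall>\<beta>. \<bar>\<beta> - \<beta>0\<bar> < e \<longrightarrow> (\<exists>\<phi> \<phi>'. nlsol l g \<beta> \<phi> \<phi>' \<and> \<phi> 0 = 0 \<and> \<phi> l = 0 \<and>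
     (\<forall>x\<in>{0..l}. \<bar>\<phi> x - \<phi>0 x\<bar> \<le> \<delta>))"
proof -
  note t0 = \<phi>(1)[unfolded nlsol_def]
  note c0 = twice_deriv_continuous(1)[OF t0]
  obtain R0 where R0: "R0 \<ge> 0" "\<And>x. x \<in> {0..l} \<Longrightarrow> norm (\<phi>0 x) \<le> R0"
    using continuous_on_interval_bound[OF c0] by blast
  define R where "R = R0 + 1"
  have R: "R \<ge> 1" "\<And>x. x \<in> {0..l} \<Longrightarrow> \<bar>\<phi>0 x\<bar> \<le> R - 1" using R0 by (auto simp: R_def)
  \<comment> \<open>cut off the nonlinearity to make it globally Lipschitz\<close>
  define cl where "cl u = max (-R) (min u R)" for u :: real
  have cl: "\<bar>cl u - cl v\<bar> \<le> \<bar>u - v\<bar>" "cl u \<in> {-R..R}" for u v using R by (auto simp: cl_def)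
  have cl_id: "cl u = u" if "\<bar>u\<bar> \<le> R" for u using that by (auto simp: cl_def)
  obtain Kg where Kg: "Kg \<ge> 0" "\<And>u. u \<in> {-R..R} \<Longrightarrow> norm (g' u) \<le> Kg"
    using continuous_on_interval_bound[of "-R" R g'] continuous_on_subset[OF cg] by blast
  have lip: "\<bar>g (cl u) - g (cl v)\<bar> \<le> Kg * \<bar>u - v\<bar>" for u v
  proof -
    have "norm (g (cl u) - g (cl v)) \<le> Kg * norm (cl u - cl v)"
      by (rule field_differentiable_bound[of "{-R..R}" g g'])
        (use g Kg cl in \<open>auto intro: has_field_derivative_at_within\<close>)
    also have "\<dots> \<le> Kg * \<bar>u - v\<bar>" using cl(1)[of u v] Kg(1) by (intro mult_left_mono) auto
    finally show ?thesis by simp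
  qed
  have contg: "continuous_on UNIV g" using g by (meson DERIV_continuous_on)
  define b0 where "b0 = \<bar>\<beta>0\<bar> + 1"
  define K where "K = Kg + b0"
  have K: "K \<ge> 0" using Kg by (simp add: K_def b0_def)
  define G where "G = growth_const K l"
  have G: "G > 0" by (simp add: G_def growth_const_def)
  define c where "c = \<phi>0' 0"
  define good where "good \<beta> s u p \<longleftrightarrow> u 0 = 0 \<and> p 0 = s \<and> twice_deriv l u p (\<lambda>x. - (g (cl (u x)) + \<beta> * u x))" for \<beta> s u p
  have ex: "\<exists>u p. good \<beta> s u p" for \<beta> s
    unfolding good_def
  proof (rule ode2_exists[where G = "\<lambda>x v. - (g (cl v) + \<beta> * v)"])
    have "continuous_on UNIV (\<lambda>v. - (g (cl v) + \<beta> * v))"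
      unfolding cl_def by (intro continuous_intros continuous_on_compose2[OF contg]) auto
    then have "continuous_on ({0..l} \<times> UNIV) (\<lambda>z. - (g (cl (snd z)) + \<beta> * snd z))"
      by (rule continuous_on_compose2) (auto intro!: continuous_intros)
    then show "continuous_on ({0..l} \<times> UNIV) (\<lambda>(x, y). - (g (cl y) + \<beta> * y))" by (simp add: case_prod_unfold)
    fix x y z :: real
    have "norm (- (g (cl y) + \<beta> * y) - - (g (cl z) + \<beta> * z)) = \<bar>(g (cl y) - g (cl z)) + \<beta> * (y - z)\<bar>"
      by (simp add: algebra_simps abs_minus_commute)
    also have "\<dots> \<le> Kg * \<bar>y - z\<bar> + \<bar>\<beta>\<bar> * \<bar>y - z\<bar>"
      using lip[of y z] abs_triangle_ineq[of "g (cl y) - g (cl z)" "\<beta> * (y - z)"] by (simp add: abs_mult)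
    finally show "norm (- (g (cl y) + \<beta> * y) - - (g (cl z) + \<beta> * z)) \<le> (Kg + \<bar>\<beta>\<bar>) * norm (y - z)"
      by (simp add: algebra_simps)
  qed (use l in simp)
  define u where "u \<beta> s = (SOME u. \<exists>p. good \<beta> s u p)" for \<beta> s
  define p where "p \<beta> s = (SOME p. good \<beta> s (u \<beta> s) p)" for \<beta> s
  have gd: "good \<beta> s (u \<beta> s) (p \<beta> s)" for \<beta> s
    unfolding p_def u_def using someI_ex[OF someI_ex[OF ex[of \<beta> s]]] .
  have u0: "u \<beta> s 0 = 0" "p \<beta> s 0 = s" and tu: "twice_deriv l (u \<beta> s) (p \<beta> s) (\<lambda>x. - (g (cl (u \<beta> s x)) + \<beta> * u \<beta> s x))" for \<beta> s
    using gd[of \<beta> s] by (auto simp: good_def)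
  have dep: "\<bar>u \<beta> s x - v x\<bar> \<le> G * (\<bar>s - r 0\<bar> + \<bar>\<beta> - \<gamma>\<bar> * M)"
    if \<beta>: "\<bar>\<beta> - \<beta>0\<bar> \<le> 1" and v: "twice_deriv l v r (\<lambda>x. - (g (cl (v x)) + \<gamma> * v x))" "v 0 = 0"
      and M: "\<And>x. x \<in> {0..l} \<Longrightarrow> \<bar>v x\<bar> \<le> M" and x: "x \<in> {0..l}" for \<beta> s v r \<gamma> M x
  proof -
    have M0: "0 \<le> M" using M[OF x] by (auto intro: order_trans[OF abs_ge_zero])
    have "norm (u \<beta> s x - v x) \<le> growth_const K l * (norm (u \<beta> s 0 - v 0) + norm (p \<beta> s 0 - r 0) + \<bar>\<beta> - \<gamma>\<bar> * M)"
    proof (rule gronwall2(1)[OF twice_deriv_diff[OF tu v(1)]])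
      fix x assume x: "x \<in> {0..l}"
      have "norm (- (g (cl (u \<beta> s x)) + \<beta> * u \<beta> s x) - - (g (cl (v x)) + \<gamma> * v x))
        = \<bar>(g (cl (u \<beta> s x)) - g (cl (v x))) + \<beta> * (u \<beta> s x - v x) + (\<beta> - \<gamma>) * v x\<bar>"
        unfolding real_norm_def by (subst abs_minus_cancel[symmetric]) (simp add: algebra_simps)
      also have "\<dots> \<le> \<bar>g (cl (u \<beta> s x)) - g (cl (v x))\<bar> + \<bar>\<beta>\<bar> * \<bar>u \<beta> s x - v x\<bar> + \<bar>\<beta> - \<gamma>\<bar> * \<bar>v x\<bar>"
        unfolding abs_mult[symmetric] by linarith
      also have "\<dots> \<le> Kg * \<bar>u \<beta> s x - v x\<bar> + b0 * \<bar>u \<beta> s x - v x\<bar> + \<bar>\<beta> - \<gamma>\<bar> * M"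
        using \<beta> by (intro add_mono mult_left_mono mult_right_mono lip M[OF x]) (auto simp: b0_def)
      finally show "norm (- (g (cl (u \<beta> s x)) + \<beta> * u \<beta> s x) - - (g (cl (v x)) + \<gamma> * v x)) \<le> K * norm (u \<beta> s x - v x) + \<bar>\<beta> - \<gamma>\<bar> * M"
        by (simp add: K_def algebra_simps)
    qed (use K M0 x in auto)
    then show ?thesis using u0 v(2) by (simp add: G_def)
  qed
  have t0cl: "twice_deriv l \<phi>0 \<phi>0' (\<lambda>x. - (g (cl (\<phi>0 x)) + \<beta>0 * \<phi>0 x))"
    by (rule twice_deriv_cong[OF t0]) (use R cl_id in fastforce)
  have dep0: "\<bar>u \<beta> s x - \<phi>0 x\<bar> \<le> G * (\<bar>s - c\<bar> + \<bar>\<beta> - \<beta>0\<bar> * R)" if "\<bar>\<beta> - \<beta>0\<bar> \<le> 1" "x \<in> {0..l}" for \<beta> s x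
    unfolding c_def by (rule dep[OF that(1) t0cl \<phi>(2) _ that(2)]) (use R in fastforce)
  have cW: "continuous_on {0..l} (\<lambda>x. g' (\<phi>0 x) + \<beta>0)"
    by (intro continuous_intros continuous_on_compose2[OF cg c0]) auto
  obtain KW where KW: "KW \<ge> 0" "\<And>x. x \<in> {0..l} \<Longrightarrow> norm (g' (\<phi>0 x) + \<beta>0) \<le> KW"
    using continuous_on_interval_bound[OF cW] by blast
  define H where "H = growth_const KW l"
  have H: "H > 0" by (simp add: H_def growth_const_def)
  define \<omega> where "\<omega> = \<bar>q l\<bar> / (2 * H * G)"
  have \<omega>: "\<omega> > 0" using q(4) H G by (simp add: \<omega>_def)
  obtain \<delta>1 where \<delta>1: "0 < \<delta>1" "\<delta>1 \<le> 1" and lin: "\<And>x a b. x \<in> {0..l} \<Longrightarrow> \<bar>a - \<phi>0 x\<bar> \<le> \<delta>1 \<Longrightarrow> \<bar>b - \<phi>0 x\<bar> \<le> \<delta>1 \<Longrightarrow>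
      \<bar>g b - g a - g' (\<phi>0 x) * (b - a)\<bar> \<le> \<omega> * \<bar>b - a\<bar>"
    using linearization_estimate[OF g cg c0 \<omega>] by metis
  define \<delta>2 where "\<delta>2 = min \<delta> \<delta>1"
  have \<delta>2: "\<delta>2 > 0" "\<delta>2 \<le> 1" "\<delta>2 \<le> \<delta>1" "\<delta>2 \<le> \<delta>" using \<delta> \<delta>1 by (auto simp: \<delta>2_def)
  define d where "d = \<delta>2 / (2 * G)"
  have d: "d > 0" "G * d = \<delta>2 / 2" using \<delta>2 G by (auto simp: d_def)
  have sign: "\<bar>u \<beta>0 s l - (s - c) * q l\<bar> \<le> \<bar>q l\<bar> / 2 * d" if s: "\<bar>s - c\<bar> = d" for s
  proof -
    have near: "\<bar>u \<beta>0 s x - \<phi>0 x\<bar> \<le> G * d" if "x \<in> {0..l}" for x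
      using dep0[of \<beta>0 x s] that s by simp
    have near1: "\<bar>u \<beta>0 s x - \<phi>0 x\<bar> \<le> \<delta>1" if "x \<in> {0..l}" for x
      using near[OF that] d \<delta>2 by linarith
    have uR: "cl (u \<beta>0 s x) = u \<beta>0 s x" if "x \<in> {0..l}" for x
      using near1[OF that] R(2)[OF that] \<delta>1 by (intro cl_id) linarith
    define k where "k x = (u \<beta>0 s x - \<phi>0 x) - (s - c) *\<^sub>R q x" for x
    have tk: "twice_deriv l k (\<lambda>x. (p \<beta>0 s x - \<phi>0' x) - (s - c) *\<^sub>R q' x)
      (\<lambda>x. (- (g (cl (u \<beta>0 s x)) + \<beta>0 * u \<beta>0 s x) - - (g (\<phi>0 x) + \<beta>0 * \<phi>0 x)) - (s - c) *\<^sub>R - ((g' (\<phi>0 x) + \<beta>0) *\<^sub>R q x))"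
      unfolding k_def
      by (intro twice_deriv_diff tu t0 twice_deriv_bounded_linear[OF q(1) bounded_linear_scaleR_right])
    have "norm (k l) \<le> growth_const KW l * (norm (k 0) + norm (p \<beta>0 s 0 - \<phi>0' 0 - (s - c) *\<^sub>R q' 0) + \<omega> * (G * d))"
    proof (rule gronwall2(1)[OF tk])
      fix x assume x: "x \<in> {0..l}"
      define v where "v = u \<beta>0 s x"
      have uv: "cl v = v" using uR[OF x] by (simp add: v_def)
      have e: "- (g v + \<beta>0 * v) - - (g (\<phi>0 x) + \<beta>0 * \<phi>0 x) - (s - c) * - ((g' (\<phi>0 x) + \<beta>0) * q x)
        = - ((g' (\<phi>0 x) + \<beta>0) * ((v - \<phi>0 x) - (s - c) * q x)) - (g v - g (\<phi>0 x) - g' (\<phi>0 x) * (v - \<phi>0 x))"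
        by (simp add: algebra_simps)
      have "\<bar>g v - g (\<phi>0 x) - g' (\<phi>0 x) * (v - \<phi>0 x)\<bar> \<le> \<omega> * \<bar>v - \<phi>0 x\<bar>"
        unfolding v_def using near1[OF x] \<delta>1 by (intro lin[OF x]) auto
      also have "\<dots> \<le> \<omega> * (G * d)" unfolding v_def using near[OF x] \<omega> by (intro mult_left_mono) auto
      finally have 1: "\<bar>g v - g (\<phi>0 x) - g' (\<phi>0 x) * (v - \<phi>0 x)\<bar> \<le> \<omega> * (G * d)" .
      have 2: "\<bar>(g' (\<phi>0 x) + \<beta>0) * ((v - \<phi>0 x) - (s - c) * q x)\<bar> \<le> KW * \<bar>k x\<bar>"
        unfolding abs_mult k_def v_def using KW(2)[OF x] by (auto intro!: mult_right_mono)
      show "norm (- (g (cl (u \<beta>0 s x)) + \<beta>0 * u \<beta>0 s x) - - (g (\<phi>0 x) + \<beta>0 * \<phi>0 x) - (s - c) *\<^sub>R - ((g' (\<phi>0 x) + \<beta>0) *\<^sub>R q x))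
        \<le> KW * norm (k x) + \<omega> * (G * d)"
        unfolding v_def[symmetric] uv real_scaleR_def e real_norm_def using 1 2 by linarith
    qed (use KW l \<omega> G d in auto)
    then have "\<bar>k l\<bar> \<le> H * (\<omega> * (G * d))" using u0 \<phi> q by (simp add: k_def H_def c_def)
    also have "\<dots> = \<bar>q l\<bar> / 2 * d" using H G by (simp add: \<omega>_def field_simps)
    finally show ?thesis using \<phi>(3) by (simp add: k_def)
  qed
  define b where "b s = u \<beta>0 s l" for s
  obtain M1 where M1: "M1 \<ge> 0" "\<And>x. x \<in> {0..l} \<Longrightarrow> norm (u \<beta>0 (c + d) x) \<le> M1"
    using continuous_on_interval_bound[OF twice_deriv_continuous(1)[OF tu]] by blast
  obtain M2 where M2: "M2 \<ge> 0" "\<And>x. x \<in> {0..l} \<Longrightarrow> norm (u \<beta>0 (c - d) x) \<le> M2"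
    using continuous_on_interval_bound[OF twice_deriv_continuous(1)[OF tu]] by blast
  define N where "N = G * (M1 + M2 + R + 1)"
  have N: "N > 0" using G M1 M2 R by (simp add: N_def)
  define e where "e = min 1 (min (\<delta>2 / (2 * N)) (\<bar>q l\<bar> * d / (4 * N)))"
  have e: "e > 0" "e \<le> 1" "N * e \<le> \<delta>2 / 2" "N * e \<le> \<bar>q l\<bar> * d / 4"
  proof -
    show "e > 0" using \<delta>2 N q(4) d by (simp add: e_def)
    show "e \<le> 1" by (simp add: e_def)
    have "e \<le> \<delta>2 / (2 * N)" "e \<le> \<bar>q l\<bar> * d / (4 * N)" by (simp_all add: e_def)
    then show "N * e \<le> \<delta>2 / 2" "N * e \<le> \<bar>q l\<bar> * d / 4" using N by (simp_all add: field_simps)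
  qed
  have solve: "\<exists>s. \<bar>s - c\<bar> \<le> d \<and> u \<beta> s l = 0" if \<beta>: "\<bar>\<beta> - \<beta>0\<bar> < e" for \<beta>
  proof -
    have \<beta>1: "\<bar>\<beta> - \<beta>0\<bar> \<le> 1" using \<beta> e by simp
    have shift: "\<bar>u \<beta> s l - u \<beta>0 s l\<bar> \<le> \<bar>q l\<bar> * d / 4" if "s = c + d \<or> s = c - d" for s
    proof -
      obtain M where M: "M \<le> M1 + M2 + R + 1" "0 \<le> M" "\<And>x. x \<in> {0..l} \<Longrightarrow> \<bar>u \<beta>0 s x\<bar> \<le> M"
      proof (cases "s = c + d")
        case True
        show ?thesis by (rule that[of M1]) (use M1 M2 R True in auto)
      next
        case False
        then have "s = c - d" using \<open>s = c + d \<or> s = c - d\<close> by simp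
        then show ?thesis by (intro that[of M2]) (use M1 M2 R in auto)
      qed
      have "\<bar>u \<beta> s l - u \<beta>0 s l\<bar> \<le> G * (\<bar>s - p \<beta>0 s 0\<bar> + \<bar>\<beta> - \<beta>0\<bar> * M)"
        by (rule dep[OF \<beta>1 tu u0(1) M(3)]) (use l in auto)
      also have "\<dots> = (G * M) * \<bar>\<beta> - \<beta>0\<bar>" by (simp add: u0)
      also have "\<dots> \<le> N * e" unfolding N_def using \<beta> M G by (intro mult_mono) auto
      finally show ?thesis using e(4) by simp
    qed
    have ul: "\<bar>u \<beta> s l - (s - c) * q l\<bar> \<le> 3/4 * (\<bar>q l\<bar> * d)" if "s = c + d \<or> s = c - d" for s
    proof -
      have "\<bar>s - c\<bar> = d" using that d by auto
      from sign[OF this] shift[OF that] show ?thesis by linarith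
    qed
    have cont: "continuous_on {c-d..c+d} (\<lambda>s. u \<beta> s l)"
      unfolding continuous_on_eq_continuous_within
    proof
      fix t
      show "continuous (at t within {c-d..c+d}) (\<lambda>s. u \<beta> s l)"
      proof (rule continuous_within_of_linear_bound)
        fix s
        obtain M where "\<And>x. x \<in> {0..l} \<Longrightarrow> norm (u \<beta> t x) \<le> M"
          using continuous_on_interval_bound[OF twice_deriv_continuous(1)[OF tu]] by blast
        then have "\<bar>u \<beta> s l - u \<beta> t l\<bar> \<le> G * (\<bar>s - p \<beta> t 0\<bar> + \<bar>\<beta> - \<beta>\<bar> * M)"
          by (intro dep[OF \<beta>1 tu u0(1)]) (use l in auto)
        then show "norm (u \<beta> s l - u \<beta> t l) \<le> G * \<bar>s - t\<bar>" by (simp add: u0)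
      qed
    qed
    have A: "\<bar>u \<beta> (c + d) l - d * q l\<bar> \<le> 3/4 * (\<bar>q l\<bar> * d)" "\<bar>u \<beta> (c - d) l + d * q l\<bar> \<le> 3/4 * (\<bar>q l\<bar> * d)"
      using ul[of "c + d"] ul[of "c - d"] by simp_all
    have qd: "\<bar>q l\<bar> * d > 0" using q(4) d by simp
    have "\<exists>s. c - d \<le> s \<and> s \<le> c + d \<and> u \<beta> s l = 0"
    proof (cases "q l > 0")
      case True
      then have e: "d * q l = \<bar>q l\<bar> * d" by simp
      have "u \<beta> (c - d) l \<le> 0" "0 \<le> u \<beta> (c + d) l" using A qd unfolding e by linarith+
      then show ?thesis using d cont by (intro IVT') auto
    next
      case False
      then have e: "d * q l = - (\<bar>q l\<bar> * d)" by simp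
      have "0 \<le> u \<beta> (c - d) l" "u \<beta> (c + d) l \<le> 0" using A qd unfolding e by linarith+
      then show ?thesis using d cont by (intro IVT2') auto
    qed
    then show ?thesis by (auto simp: abs_le_iff algebra_simps)
  qed
  show ?thesis
  proof (intro exI[of _ e] conjI allI impI)
    show "0 < e" by (rule e(1))
    fix \<beta> assume \<beta>: "\<bar>\<beta> - \<beta>0\<bar> < e"
    then have \<beta>1: "\<bar>\<beta> - \<beta>0\<bar> \<le> 1" using e by simp
    obtain s where s: "\<bar>s - c\<bar> \<le> d" "u \<beta> s l = 0" using solve[OF \<beta>] by blast
    have near: "\<bar>u \<beta> s x - \<phi>0 x\<bar> \<le> \<delta>2" if x: "x \<in> {0..l}" for x
    proof -
      have "\<bar>u \<beta> s x - \<phi>0 x\<bar> \<le> G * (\<bar>s - c\<bar> + \<bar>\<beta> - \<beta>0\<bar> * R)" by (rule dep0[OF \<beta>1 x])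
      also have "\<dots> = G * \<bar>s - c\<bar> + (G * R) * \<bar>\<beta> - \<beta>0\<bar>" by (simp add: algebra_simps)
      also have "\<dots> \<le> G * d + N * e" unfolding N_def using s \<beta> G M1 M2 R by (intro add_mono mult_mono) auto
      finally show ?thesis using d(2) e(3) by simp
    qed
    have "cl (u \<beta> s x) = u \<beta> s x" if x: "x \<in> {0..l}" for x
      using near[OF that] R(2)[OF that] \<delta>2 by (intro cl_id) linarith
    then have "nlsol l g \<beta> (u \<beta> s) (p \<beta> s)"
      unfolding nlsol_def by (intro twice_deriv_cong[OF tu]) simp
    moreover have "\<forall>x\<in>{0..l}. \<bar>u \<beta> s x - \<phi>0 x\<bar> \<le> \<delta>" using near \<delta>2(4) by (meson order_trans)
    ultimately show "\<exists>\<phi> \<phi>'. nlsol l g \<beta> \<phi> \<phi>' \<and> \<phi> 0 = 0 \<and> \<phi> l = 0 \<and> (\<forall>x\<in>{0..l}. \<bar>\<phi> x - \<phi>0 x\<bar> \<le> \<delta>)"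
      using u0(1) s(2) by blast
  qed
qed

lemma tendsto_zero_at_open:
  fixes N :: "real \<Rightarrow> real"
  assumes S: "open S" "b \<in> S" and nn: "\<And>c. 0 \<le> N c"
    and N: "\<And>\<epsilon>. 0 < \<epsilon> \<Longrightarrow> \<exists>d>0. \<forall>c\<in>S. 0 < \<bar>c - b\<bar> \<longrightarrow> \<bar>c - b\<bar> < d \<longrightarrow> N c \<le> M * \<epsilon>"
  shows "(N \<longlongrightarrow> 0) (at b)"
proof (rule tendstoI)
  fix e :: real assume e: "0 < e"
  define \<epsilon> where "\<epsilon> = e / (2 * (\<bar>M\<bar> + 1))"
  have \<epsilon>: "\<epsilon> > 0" using e by (simp add: \<epsilon>_def)
  have "M * \<epsilon> \<le> (\<bar>M\<bar> + 1) * \<epsilon>" using \<epsilon> by (intro mult_right_mono) auto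
  also have "\<dots> = e / 2" by (simp add: \<epsilon>_def field_simps)
  finally have M: "M * \<epsilon> < e" using e by simp
  obtain d where d: "d > 0" "\<forall>c\<in>S. 0 < \<bar>c - b\<bar> \<longrightarrow> \<bar>c - b\<bar> < d \<longrightarrow> N c \<le> M * \<epsilon>" using N[OF \<epsilon>] by blast
  have "eventually (\<lambda>c. c \<in> S) (at b)" using S by (rule eventually_at_in_open')
  moreover have "eventually (\<lambda>c. c \<noteq> b \<and> dist c b < d) (at b)"
    using d(1) by (auto simp: eventually_at)
  ultimately show "eventually (\<lambda>c. dist (N c) 0 < e) (at b)"
  proof eventually_elim
    case (elim c)
    then have "N c \<le> M * \<epsilon>" using d(2) by (auto simp: dist_real_def)
    then show ?case using M nn[of c] by (simp add: dist_real_def)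
  qed
qed

text \<open>All estimates apply the Dirichlet bound for the linearization to differences: of two solutions (uniqueness and Lipschitz
  dependence on \<open>\<beta>\<close>), of a difference quotient and the solution \<open>G\<close> of the linearized problem (differentiability), and of two
  such \<open>G\<close> (continuity of the derivative). Together with the equations these bounds control two derivatives.\<close>

lemma dirichlet_family_exists:
  fixes g g' \<phi>0 :: "real \<Rightarrow> real"
  assumes l: "0 < l" and g: "\<And>u. (g has_real_derivative g' u) (at u)" and cg: "continuous_on UNIV g'"
    and \<phi>: "nlsol l g \<beta>0 \<phi>0 \<phi>0'" "\<phi>0 0 = 0" "\<phi>0 l = 0"
    and q: "twice_deriv l q q' (\<lambda>x. - ((g' (\<phi>0 x) + \<beta>0) *\<^sub>R q x))" "q 0 = (0::real)" "q' 0 = 1" "q l \<noteq> 0"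
  shows "\<exists>e \<delta> F F'. 0 < e \<and> 0 < \<delta> \<and>
    (\<forall>\<beta>\<in>ball \<beta>0 e. nlsol l g \<beta> (F \<beta>) (F' \<beta>) \<and> F \<beta> 0 = 0 \<and> F \<beta> l = 0) \<and>
    (\<forall>x\<in>{0..l}. F \<beta>0 x = \<phi>0 x) \<and>
    (\<forall>\<beta>\<in>ball \<beta>0 e. \<forall>\<phi> \<phi>'. nlsol l g \<beta> \<phi> \<phi>' \<longrightarrow> \<phi> 0 = 0 \<longrightarrow> \<phi> l = 0 \<longrightarrow>
       (\<forall>x\<in>{0..l}. \<bar>\<phi> x - \<phi>0 x\<bar> \<le> \<delta>) \<longrightarrow> (\<forall>x\<in>{0..l}. \<phi> x = F \<beta> x)) \<and>
    C1_map_into (Dir_dom l) (H2_norm l) (ball \<beta>0 e) F"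
proof -
  note c0 = twice_deriv_continuous(1)[OF \<phi>(1)[unfolded nlsol_def]]
  have contg: "continuous_on UNIV g" using g by (meson DERIV_continuous_on)
  define W where "W x = g' (\<phi>0 x) + \<beta>0" for x
  have cW: "continuous_on {0..l} W" unfolding W_def
    by (intro continuous_intros continuous_on_compose2[OF cg c0]) auto
  obtain KW where KW: "KW \<ge> 0" "\<And>x. x \<in> {0..l} \<Longrightarrow> \<bar>W x\<bar> \<le> KW"
    using continuous_on_interval_bound[OF cW] by auto
  obtain R0 where R0: "R0 \<ge> 0" "\<And>x. x \<in> {0..l} \<Longrightarrow> \<bar>\<phi>0 x\<bar> \<le> R0"
    using continuous_on_interval_bound[OF c0] by auto
  define R where "R = R0 + 1"
  have R: "R > 0" using R0 by (simp add: R_def)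
  obtain KA where A: "linsys l (\<lambda>x v :: real. - (W x *\<^sub>R v)) KA" using linsys_scaleR[OF l cW] by blast
  have "nondeg l (\<lambda>x v :: real. - (W x *\<^sub>R v))" unfolding W_def
    by (rule nondeg_scaleR[OF l cW[unfolded W_def] q])
  from dirichlet_bound[OF A this] obtain C where C: "C > 0"
    and DB0: "\<And>u p s e x. twice_deriv l u p s \<Longrightarrow> (\<And>x. x \<in> {0..l} \<Longrightarrow> norm (s x - - (W x *\<^sub>R u x)) \<le> e) \<Longrightarrow>
      norm (u 0 :: real) \<le> e \<Longrightarrow> norm (u l) \<le> e \<Longrightarrow> x \<in> {0..l} \<Longrightarrow> norm (u x) \<le> C * e \<and> norm (p x) \<le> C * e" by metis
  have DB: "dirichlet_estimate l W C"
    unfolding dirichlet_estimate_def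
  proof (intro allI impI ballI)
    fix u p s :: "real \<Rightarrow> real" and e x
    assume t: "twice_deriv l u p s" and b: "\<forall>x\<in>{0..l}. \<bar>s x + W x * u x\<bar> \<le> e" and z: "u 0 = 0" "u l = 0" and x: "x \<in> {0..l}"
    have "0 \<le> e" using b x by (meson abs_ge_zero order_trans)
    then have "norm (u x) \<le> C * e \<and> norm (p x) \<le> C * e"
      by (intro DB0[OF t _ _ _ x]) (use b z in auto)
    then show "\<bar>u x\<bar> \<le> C * e \<and> \<bar>p x\<bar> \<le> C * e" by simp
  qed
  note absorb = dirichlet_bound_absorb[OF l C DB]
  \<comment> \<open>the coefficient perturbations below add up to at most \<open>2 \<omega>\<close>, which \<open>absorb\<close> can take\<close>
  define \<omega> where "\<omega> = 1 / (8 * C)"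
  have \<omega>: "\<omega> > 0" using C by (simp add: \<omega>_def)
  obtain \<delta> where \<delta>: "0 < \<delta>" "\<delta> \<le> 1" and lin: "\<And>x a b. x \<in> {0..l} \<Longrightarrow> \<bar>a - \<phi>0 x\<bar> \<le> \<delta> \<Longrightarrow> \<bar>b - \<phi>0 x\<bar> \<le> \<delta> \<Longrightarrow>
      \<bar>g b - g a - g' (\<phi>0 x) * (b - a)\<bar> \<le> \<omega> * \<bar>b - a\<bar> \<and> \<bar>g' a - g' (\<phi>0 x)\<bar> \<le> \<omega>"
    using linearization_estimate[OF g cg c0 \<omega>] by metis
  obtain e0 where e0: "e0 > 0" "\<And>\<beta>. \<bar>\<beta> - \<beta>0\<bar> < e0 \<Longrightarrow> \<exists>\<phi> \<phi>'. nlsol l g \<beta> \<phi> \<phi>' \<and> \<phi> 0 = 0 \<and> \<phi> l = 0 \<and>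
     (\<forall>x\<in>{0..l}. \<bar>\<phi> x - \<phi>0 x\<bar> \<le> \<delta>)"
    using shooting_family[OF l g cg \<phi> q \<delta>(1)] by blast
  define e where "e = min e0 \<omega>"
  have e: "e > 0" "e \<le> e0" "e \<le> \<omega>" using e0 \<omega> by (auto simp: e_def)
  \<comment> \<open>\<open>near\<close> singles out the solutions among which uniqueness holds\<close>
  define near where "near \<beta> \<phi> \<phi>' \<longleftrightarrow> nlsol l g \<beta> \<phi> \<phi>' \<and> \<phi> 0 = 0 \<and> \<phi> l = 0 \<and> (\<forall>x\<in>{0..l}. \<bar>\<phi> x - \<phi>0 x\<bar> \<le> \<delta>)" for \<beta> \<phi> \<phi>'
  have small: "\<bar>\<beta> - \<beta>0\<bar> \<le> \<omega>" if "\<beta> \<in> ball \<beta>0 e" for \<beta>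
    using that e by (auto simp: dist_real_def)
  have w2: "0 \<le> 2 * \<omega>" "C * (2 * \<omega>) \<le> 1/2" using C by (auto simp: \<omega>_def)
  have pair: "\<bar>v x - u x\<bar> \<le> 2 * C * (R * \<bar>\<gamma> - \<beta>\<bar>)"
    if u: "near \<beta> u u'" and v: "near \<gamma> v v'" and \<beta>: "\<beta> \<in> ball \<beta>0 e" and x: "x \<in> {0..l}" for \<beta> \<gamma> u u' v v' x
  proof -
    have tu: "twice_deriv l u u' (\<lambda>x. - (g (u x) + \<beta> * u x))" "u 0 = 0" "u l = 0" "\<And>x. x \<in> {0..l} \<Longrightarrow> \<bar>u x - \<phi>0 x\<bar> \<le> \<delta>"
      using u by (auto simp: near_def nlsol_def)
    have tv: "twice_deriv l v v' (\<lambda>x. - (g (v x) + \<gamma> * v x))" "v 0 = 0" "v l = 0" "\<And>x. x \<in> {0..l} \<Longrightarrow> \<bar>v x - \<phi>0 x\<bar> \<le> \<delta>"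
      using v by (auto simp: near_def nlsol_def)
    show ?thesis
    proof (rule absorb(1)[OF w2 twice_deriv_diff[OF tv(1) tu(1)]])
      fix x assume x: "x \<in> {0..l}"
      have eq: "- (g (v x) + \<gamma> * v x) - - (g (u x) + \<beta> * u x) + W x * (v x - u x)
        = - (g (v x) - g (u x) - g' (\<phi>0 x) * (v x - u x)) - (\<gamma> - \<beta>) * v x - (\<beta> - \<beta>0) * (v x - u x)"
        by (simp add: W_def algebra_simps)
      have 1: "\<bar>g (v x) - g (u x) - g' (\<phi>0 x) * (v x - u x)\<bar> \<le> \<omega> * \<bar>v x - u x\<bar>" using lin[OF x tu(4)[OF x] tv(4)[OF x]] by blast
      have "\<bar>v x\<bar> \<le> R" using tv(4)[OF x] R0(2)[OF x] \<delta>(2) unfolding R_def by linarith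
      then have 2: "\<bar>(\<gamma> - \<beta>) * v x\<bar> \<le> \<bar>\<gamma> - \<beta>\<bar> * R" unfolding abs_mult by (intro mult_left_mono) auto
      have 3: "\<bar>(\<beta> - \<beta>0) * (v x - u x)\<bar> \<le> \<omega> * \<bar>v x - u x\<bar>" unfolding abs_mult by (intro mult_right_mono small[OF \<beta>]) auto
      show "\<bar>- (g (v x) + \<gamma> * v x) - - (g (u x) + \<beta> * u x) + W x * (v x - u x)\<bar> \<le> 2 * \<omega> * \<bar>v x - u x\<bar> + R * \<bar>\<gamma> - \<beta>\<bar>"
        unfolding eq using 1 2 3 by (simp add: mult.commute[of R])
    qed (use tu tv x in auto)
  qed
  define F where "F \<beta> = (SOME \<phi>. \<exists>\<phi>'. near \<beta> \<phi> \<phi>')" for \<beta>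
  define F' where "F' \<beta> = (SOME \<phi>'. near \<beta> (F \<beta>) \<phi>')" for \<beta>
  have nF: "near \<beta> (F \<beta>) (F' \<beta>)" if "\<beta> \<in> ball \<beta>0 e" for \<beta>
  proof -
    have "\<exists>\<phi> \<phi>'. near \<beta> \<phi> \<phi>'" unfolding near_def by (rule e0(2)) (use that e in \<open>auto simp: dist_real_def\<close>)
    from someI_ex[OF someI_ex[OF this]] show ?thesis by (simp add: F_def F'_def)
  qed
  have tF: "twice_deriv l (F \<beta>) (F' \<beta>) (\<lambda>x. - (g (F \<beta> x) + \<beta> * F \<beta> x))" and zF: "F \<beta> 0 = 0" "F \<beta> l = 0"
    and dF: "\<And>x. x \<in> {0..l} \<Longrightarrow> \<bar>F \<beta> x - \<phi>0 x\<bar> \<le> \<delta>" if "\<beta> \<in> ball \<beta>0 e" for \<beta>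
    using nF[OF that] by (auto simp: near_def nlsol_def)
  have bF: "\<bar>F \<beta> x\<bar> \<le> R" if "\<beta> \<in> ball \<beta>0 e" "x \<in> {0..l}" for \<beta> x
    using dF[OF that] R0(2)[OF that(2)] \<delta>(2) unfolding R_def by linarith
  have uniq: "\<phi> x = F \<beta> x" if "\<beta> \<in> ball \<beta>0 e" "near \<beta> \<phi> \<phi>'" "x \<in> {0..l}" for \<beta> \<phi> \<phi>' x
    using pair[OF nF[OF that(1)] that(2) that(1,3)] by simp
  have n0: "near \<beta>0 \<phi>0 \<phi>0'" using \<phi> \<delta> by (simp add: near_def)
  have b0: "\<beta>0 \<in> ball \<beta>0 e" using e by simp
  define Wb where "Wb \<beta> x = g' (F \<beta> x) + \<beta>" for \<beta> x
  have WbW: "\<bar>Wb \<beta> x - W x\<bar> \<le> 2 * \<omega>" if "\<beta> \<in> ball \<beta>0 e" "x \<in> {0..l}" for \<beta> x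
  proof -
    have "\<bar>g' (F \<beta> x) - g' (\<phi>0 x)\<bar> \<le> \<omega>" using lin[OF that(2) dF[OF that] dF[OF that]] by blast
    then show ?thesis using small[OF that(1)] unfolding Wb_def W_def by linarith
  qed
  have cF: "continuous_on {0..l} (F \<beta>)" if "\<beta> \<in> ball \<beta>0 e" for \<beta> using twice_deriv_continuous(1)[OF tF[OF that]] .
  have cWb: "continuous_on {0..l} (Wb \<beta>)" if "\<beta> \<in> ball \<beta>0 e" for \<beta>
    unfolding Wb_def by (intro continuous_intros continuous_on_compose2[OF cg cF[OF that]]) auto
  \<comment> \<open>the coefficient \<open>Wb \<beta>\<close> differs from \<open>W\<close> by at most \<open>2 \<omega>\<close>, so the bound for \<open>W\<close> holds along the whole family\<close>
  define B where "B = 2 * C + (KW + 2 * \<omega>) * (2 * C) + 1"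
  have B: "B > 0" "2 * C \<le> B" using C KW(1) \<omega> by (auto simp: B_def add_pos_nonneg intro!: add_pos_nonneg)
  have wp: "\<bar>k x\<bar> \<le> 2 * C * e2" "\<bar>k x\<bar> \<le> B * e2" "\<bar>k' x\<bar> \<le> B * e2" "\<bar>s x\<bar> \<le> B * e2"
    if \<beta>: "\<beta> \<in> ball \<beta>0 e" and k: "twice_deriv l k k' s" "k 0 = 0" "k l = 0"
      and b: "\<And>x. x \<in> {0..l} \<Longrightarrow> \<bar>s x + Wb \<beta> x * k x\<bar> \<le> e2" and x: "x \<in> {0..l}" for \<beta> k k' s e2 x
  proof -
    have e2: "0 \<le> e2" using b[OF x] by (auto intro: order_trans[OF abs_ge_zero])
    have "\<bar>s x + W x * k x\<bar> \<le> 2 * \<omega> * \<bar>k x\<bar> + e2" if x: "x \<in> {0..l}" for x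
    proof -
      have "\<bar>(Wb \<beta> x - W x) * k x\<bar> \<le> 2 * \<omega> * \<bar>k x\<bar>" unfolding abs_mult by (intro mult_right_mono WbW[OF \<beta> x]) auto
      moreover have "s x + W x * k x = (s x + Wb \<beta> x * k x) - (Wb \<beta> x - W x) * k x" by (simp add: algebra_simps)
      ultimately show ?thesis using b[OF x] by linarith
    qed
    from absorb[OF w2 k this x] have 1: "\<bar>k x\<bar> \<le> 2 * C * e2" "\<bar>k' x\<bar> \<le> 2 * C * e2" by blast+
    then show "\<bar>k x\<bar> \<le> 2 * C * e2" by simp
    show "\<bar>k x\<bar> \<le> B * e2" "\<bar>k' x\<bar> \<le> B * e2" using 1 mult_right_mono[OF B(2) e2] by linarith+
    have "\<bar>Wb \<beta> x\<bar> \<le> KW + 2 * \<omega>" using KW(2)[OF x] WbW[OF \<beta> x] by linarith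
    then have "\<bar>Wb \<beta> x * k x\<bar> \<le> (KW + 2 * \<omega>) * (2 * C * e2)"
      unfolding abs_mult using 1 by (intro mult_mono) auto
    then have "\<bar>s x\<bar> \<le> (KW + 2 * \<omega>) * (2 * C * e2) + e2" using b[OF x] by linarith
    also have "\<dots> \<le> B * e2" using e2 C by (simp add: B_def algebra_simps)
    finally show "\<bar>s x\<bar> \<le> B * e2" .
  qed
  have "\<exists>G G'. twice_deriv l G G' (\<lambda>x. - (Wb \<beta> x *\<^sub>R G x) + - F \<beta> x) \<and> G 0 = 0 \<and> G l = 0" if \<beta>: "\<beta> \<in> ball \<beta>0 e" for \<beta>
  proof -
    obtain Kb where Ab: "linsys l (\<lambda>x v :: real. - (Wb \<beta> x *\<^sub>R v)) Kb" using linsys_scaleR[OF l cWb[OF \<beta>]] by blast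
    have nd: "nondeg l (\<lambda>x v :: real. - (Wb \<beta> x *\<^sub>R v))"
      unfolding nondeg_def
    proof (intro allI impI ballI)
      fix u p :: "real \<Rightarrow> real" and x
      assume u: "twice_deriv l u p (\<lambda>x. - (Wb \<beta> x *\<^sub>R u x))" "u 0 = 0" "u l = 0" and x: "x \<in> {0..l}"
      have "\<bar>u x\<bar> \<le> 2 * C * 0" by (rule wp(1)[OF \<beta> u _ x]) simp
      then show "u x = 0" by simp
    qed
    show ?thesis using dirichlet_solve[OF Ab nd, of "\<lambda>x. - F \<beta> x" 0 0] cF[OF \<beta>] by (simp add: continuous_on_minus)
  qed
  then obtain G G' where G0: "\<And>\<beta>. \<beta> \<in> ball \<beta>0 e \<Longrightarrow> twice_deriv l (G \<beta>) (G' \<beta>) (\<lambda>x. - (Wb \<beta> x *\<^sub>R G \<beta> x) + - F \<beta> x) \<and> G \<beta> 0 = 0 \<and> G \<beta> l = 0"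
    by metis
  have tG: "twice_deriv l (G \<beta>) (G' \<beta>) (\<lambda>x. - (Wb \<beta> x * G \<beta> x) - F \<beta> x)" and zG: "G \<beta> 0 = 0" "G \<beta> l = 0" if "\<beta> \<in> ball \<beta>0 e" for \<beta>
    using G0[OF that] by simp_all
  have bG: "\<bar>G \<beta> x\<bar> \<le> 2 * C * R" if \<beta>: "\<beta> \<in> ball \<beta>0 e" and x: "x \<in> {0..l}" for \<beta> x
    by (rule wp(1)[OF \<beta> tG[OF \<beta>] zG[OF \<beta>] _ x]) (use bF[OF \<beta>] in simp)
  have cG: "continuous_on {0..l} (G \<beta>)" if "\<beta> \<in> ball \<beta>0 e" for \<beta> using twice_deriv_continuous(1)[OF tG[OF that]] .
  have repF: "H2_rep l (F \<beta>) (F \<beta>) (F' \<beta>) (\<lambda>x. - (g (F \<beta> x) + \<beta> * F \<beta> x))" if "\<beta> \<in> ball \<beta>0 e" for \<beta>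
    by (rule H2_rep_twice_deriv[OF tF[OF that]])
      (auto intro!: continuous_intros continuous_on_compose2[OF contg] cF that)
  have repG: "H2_rep l (G \<beta>) (G \<beta>) (G' \<beta>) (\<lambda>x. - (Wb \<beta> x * G \<beta> x) - F \<beta> x)" if "\<beta> \<in> ball \<beta>0 e" for \<beta>
    by (rule H2_rep_twice_deriv[OF tG[OF that]]) (auto intro!: continuous_intros cF cG cWb that)
  have dirF: "F \<beta> \<in> Dir_dom l" if "\<beta> \<in> ball \<beta>0 e" for \<beta> using Dir_dom_iff[OF l repF[OF that]] zF[OF that] by simp
  have dirG: "G \<beta> \<in> Dir_dom l" if "\<beta> \<in> ball \<beta>0 e" for \<beta> using Dir_dom_iff[OF l repG[OF that]] zG[OF that] by simp
  define M where "M = 3 * sqrt l * (B * (6 * C * R))"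
  have nn: "0 \<le> H2_norm l w" for w :: "real \<Rightarrow> real" by (simp add: H2_norm_def)
  have FF: "\<bar>F c x - F b x\<bar> \<le> 2 * C * (R * \<bar>c - b\<bar>)" if "b \<in> ball \<beta>0 e" "c \<in> ball \<beta>0 e" "x \<in> {0..l}" for b c x
    by (rule pair[OF nF[OF that(1)] nF[OF that(2)] that(1,3)])
  have close: "\<exists>d>0. \<forall>c\<in>ball \<beta>0 e. 0 < \<bar>c - b\<bar> \<longrightarrow> \<bar>c - b\<bar> < d \<longrightarrow>
      H2_norm l (\<lambda>x. (1 / (c - b)) *\<^sub>R (F c x - F b x) - G b x) \<le> M * \<epsilon> \<and> H2_norm l (\<lambda>x. G c x - G b x) \<le> M * \<epsilon>"
    if b: "b \<in> ball \<beta>0 e" and \<epsilon>: "0 < \<epsilon>" for b \<epsilon>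
  proof -
    obtain d1 where d1: "0 < d1" and lin1: "\<And>x u v. x \<in> {0..l} \<Longrightarrow> \<bar>u - F b x\<bar> \<le> d1 \<Longrightarrow> \<bar>v - F b x\<bar> \<le> d1 \<Longrightarrow>
      \<bar>g v - g u - g' (F b x) * (v - u)\<bar> \<le> \<epsilon> * \<bar>v - u\<bar> \<and> \<bar>g' u - g' (F b x)\<bar> \<le> \<epsilon>"
      using linearization_estimate[OF g cg cF[OF b] \<epsilon>] by metis
    define d where "d = min \<epsilon> (d1 / (2 * C * R))"
    have d: "d > 0" "d \<le> \<epsilon>" "2 * C * (R * d) \<le> d1" using \<epsilon> d1 C R by (auto simp: d_def min_def field_simps)
    show ?thesis
    proof (intro exI[of _ d] conjI ballI impI)
      show "0 < d" by (rule d(1))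
      fix c assume c: "c \<in> ball \<beta>0 e" and cb: "0 < \<bar>c - b\<bar>" "\<bar>c - b\<bar> < d"
      have h: "\<bar>F c x - F b x\<bar> \<le> 2 * C * R * \<bar>c - b\<bar>" "\<bar>F c x - F b x\<bar> \<le> d1" "\<bar>F c x - F b x\<bar> \<le> 2 * C * R * \<epsilon>" if x: "x \<in> {0..l}" for x
      proof -
        show 1: "\<bar>F c x - F b x\<bar> \<le> 2 * C * R * \<bar>c - b\<bar>" using FF[OF b c x] by (simp add: mult_ac)
        have "2 * C * R * \<bar>c - b\<bar> \<le> 2 * C * R * d" using cb C R by (intro mult_left_mono) auto
        then show "\<bar>F c x - F b x\<bar> \<le> d1" using 1 d(3) by (simp add: mult_ac)
        have "2 * C * R * \<bar>c - b\<bar> \<le> 2 * C * R * \<epsilon>" using cb d C R by (intro mult_left_mono) auto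
        then show "\<bar>F c x - F b x\<bar> \<le> 2 * C * R * \<epsilon>" using 1 by linarith
      qed
      have lin2: "\<bar>g (F c x) - g (F b x) - g' (F b x) * (F c x - F b x)\<bar> \<le> \<epsilon> * \<bar>F c x - F b x\<bar>" "\<bar>g' (F c x) - g' (F b x)\<bar> \<le> \<epsilon>"
        if x: "x \<in> {0..l}" for x
        using lin1[OF x, of "F b x" "F c x"] lin1[OF x, of "F c x" "F c x"] h(2)[OF x] d1 by auto
      have CR: "C * R * \<epsilon> \<ge> 0" using C R \<epsilon> by simp
      define t where "t = 1 / (c - b)"
      have t: "t * (c - b) = 1" "\<bar>t\<bar> * \<bar>c - b\<bar> = 1" using cb by (auto simp: t_def)
      have rk: "H2_rep l (\<lambda>x. 1 *\<^sub>R (t *\<^sub>R (F c x - F b x) - G b x)) (\<lambda>x. 1 *\<^sub>R (t *\<^sub>R (F c x - F b x) - G b x))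
         (\<lambda>x. 1 *\<^sub>R (t *\<^sub>R (F' c x - F' b x) - G' b x))
         (\<lambda>x. 1 *\<^sub>R (t *\<^sub>R (- (g (F c x) + c * F c x) - - (g (F b x) + b * F b x)) - (- (Wb b x * G b x) - F b x)))"
        by (rule H2_rep_diff[OF H2_rep_diff[OF repF[OF c] repF[OF b]] repG[OF b]])
      have tk: "twice_deriv l (\<lambda>x. t *\<^sub>R (F c x - F b x) - G b x) (\<lambda>x. t *\<^sub>R (F' c x - F' b x) - G' b x)
         (\<lambda>x. t *\<^sub>R (- (g (F c x) + c * F c x) - - (g (F b x) + b * F b x)) - (- (Wb b x * G b x) - F b x))"
        by (intro twice_deriv_diff[OF twice_deriv_bounded_linear[OF twice_deriv_diff[OF tF[OF c] tF[OF b]] bounded_linear_scaleR_right] tG[OF b]])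
      have est: "\<bar>t *\<^sub>R (- (g (F c x) + c * F c x) - - (g (F b x) + b * F b x)) - (- (Wb b x * G b x) - F b x)
           + Wb b x * (t *\<^sub>R (F c x - F b x) - G b x)\<bar> \<le> 6 * C * R * \<epsilon>" if x: "x \<in> {0..l}" for x
      proof -
        have "t *\<^sub>R (- (g (F c x) + c * F c x) - - (g (F b x) + b * F b x)) - (- (Wb b x * G b x) - F b x)
           + Wb b x * (t *\<^sub>R (F c x - F b x) - G b x)
           = - (t * (g (F c x) - g (F b x) - g' (F b x) * (F c x - F b x))) - (t * (c - b)) * F c x + F b x"
          by (simp add: Wb_def algebra_simps)
        also have "\<dots> = - (t * (g (F c x) - g (F b x) - g' (F b x) * (F c x - F b x))) - (F c x - F b x)"
          unfolding t(1) by simp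
        also have "\<bar>\<dots>\<bar> \<le> \<bar>t\<bar> * \<bar>g (F c x) - g (F b x) - g' (F b x) * (F c x - F b x)\<bar> + \<bar>F c x - F b x\<bar>"
          unfolding abs_mult[symmetric] by linarith
        also have "\<dots> \<le> \<bar>t\<bar> * (\<epsilon> * (2 * C * R * \<bar>c - b\<bar>)) + 2 * C * R * \<epsilon>"
          using lin2(1)[OF x] h[OF x] \<epsilon>
          by (intro add_mono mult_left_mono) (auto intro: order_trans[OF _ mult_left_mono])
        also have "\<bar>t\<bar> * (\<epsilon> * (2 * C * R * \<bar>c - b\<bar>)) = (\<bar>t\<bar> * \<bar>c - b\<bar>) * (2 * C * R * \<epsilon>)" by (simp add: mult_ac)
        finally show ?thesis unfolding t(2) using CR by (simp add: mult.assoc)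
      qed
      have "H2_norm l (\<lambda>x. 1 *\<^sub>R (t *\<^sub>R (F c x - F b x) - G b x)) \<le> 3 * sqrt l * (B * (6 * C * R * \<epsilon>))"
        by (rule H2_norm_le_sup[OF l rk]; unfold real_norm_def scaleR_one; rule wp(2,3,4)[OF b tk _ _ est])
          (use zF[OF b] zF[OF c] zG[OF b] in simp_all)
      then show "H2_norm l (\<lambda>x. (1 / (c - b)) *\<^sub>R (F c x - F b x) - G b x) \<le> M * \<epsilon>"
        by (simp add: M_def t_def mult_ac)
      have rG: "H2_rep l (\<lambda>x. 1 *\<^sub>R (G c x - G b x)) (\<lambda>x. 1 *\<^sub>R (G c x - G b x)) (\<lambda>x. 1 *\<^sub>R (G' c x - G' b x))
         (\<lambda>x. 1 *\<^sub>R ((- (Wb c x * G c x) - F c x) - (- (Wb b x * G b x) - F b x)))"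
        by (rule H2_rep_diff[OF repG[OF c] repG[OF b]])
      have estG: "\<bar>(- (Wb c x * G c x) - F c x) - (- (Wb b x * G b x) - F b x) + Wb b x * (G c x - G b x)\<bar> \<le> 6 * C * R * \<epsilon>"
        if x: "x \<in> {0..l}" for x
      proof -
        have "(- (Wb c x * G c x) - F c x) - (- (Wb b x * G b x) - F b x) + Wb b x * (G c x - G b x)
          = - ((Wb c x - Wb b x) * G c x) - (F c x - F b x)" by (simp add: algebra_simps)
        also have "\<bar>\<dots>\<bar> \<le> \<bar>Wb c x - Wb b x\<bar> * \<bar>G c x\<bar> + \<bar>F c x - F b x\<bar>" unfolding abs_mult[symmetric] by linarith
        also have "\<dots> \<le> (2 * \<epsilon>) * (2 * C * R) + 2 * C * R * \<epsilon>"
        proof (intro add_mono mult_mono)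
          show "\<bar>Wb c x - Wb b x\<bar> \<le> 2 * \<epsilon>" using lin2(2)[OF x] cb d(2) unfolding Wb_def by linarith
        qed (use bG[OF c x] h[OF x] \<epsilon> in auto)
        finally show ?thesis by (simp add: algebra_simps)
      qed
      have "H2_norm l (\<lambda>x. 1 *\<^sub>R (G c x - G b x)) \<le> 3 * sqrt l * (B * (6 * C * R * \<epsilon>))"
        by (rule H2_norm_le_sup[OF l rG]; unfold real_norm_def scaleR_one; rule wp(2,3,4)[OF b twice_deriv_diff[OF tG[OF c] tG[OF b]] _ _ estG])
          (use zG[OF b] zG[OF c] in simp_all)
      then show "H2_norm l (\<lambda>x. G c x - G b x) \<le> M * \<epsilon>" by (simp add: M_def mult_ac)
    qed
  qed
  have C1: "C1_map_into (Dir_dom l) (H2_norm l) (ball \<beta>0 e) F"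
    unfolding C1_map_into_def
  proof (intro conjI ballI exI[of _ G])
    fix b assume b: "b \<in> ball \<beta>0 e"
    show "F b \<in> Dir_dom l" "G b \<in> Dir_dom l" using dirF dirG b by auto
    show "((\<lambda>c. H2_norm l (\<lambda>x. (1 / (c - b)) *\<^sub>R (F c x - F b x) - G b x)) \<longlongrightarrow> 0) (at b)"
      by (rule tendsto_zero_at_open[OF open_ball b nn, where M = M]) (use close[OF b] in meson)
    show "((\<lambda>c. H2_norm l (\<lambda>x. G c x - G b x)) \<longlongrightarrow> 0) (at b)"
      by (rule tendsto_zero_at_open[OF open_ball b nn, where M = M]) (use close[OF b] in meson)
  qed
  show ?thesis
  proof (rule exI[of _ e], rule exI[of _ \<delta>], rule exI[of _ F], rule exI[of _ F'], intro conjI)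
    show "\<forall>\<beta>\<in>ball \<beta>0 e. nlsol l g \<beta> (F \<beta>) (F' \<beta>) \<and> F \<beta> 0 = 0 \<and> F \<beta> l = 0"
      using nF by (auto simp: near_def)
    show "\<forall>x\<in>{0..l}. F \<beta>0 x = \<phi>0 x" using uniq[OF b0 n0] by simp
    show "\<forall>\<beta>\<in>ball \<beta>0 e. \<forall>\<phi> \<phi>'. nlsol l g \<beta> \<phi> \<phi>' \<longrightarrow> \<phi> 0 = 0 \<longrightarrow> \<phi> l = 0 \<longrightarrow>
       (\<forall>x\<in>{0..l}. \<bar>\<phi> x - \<phi>0 x\<bar> \<le> \<delta>) \<longrightarrow> (\<forall>x\<in>{0..l}. \<phi> x = F \<beta> x)"
    proof (intro ballI allI impI)
      fix \<beta> \<phi> \<phi>' x assume "\<beta> \<in> ball \<beta>0 e" "nlsol l g \<beta> \<phi> \<phi>'" "\<phi> 0 = 0" "\<phi> l = 0"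
        "\<forall>x\<in>{0..l}. \<bar>\<phi> x - \<phi>0 x\<bar> \<le> \<delta>" "x \<in> {0..l}"
      then show "\<phi> x = F \<beta> x" by (intro uniq[of \<beta> \<phi> \<phi>']) (simp_all add: near_def)
    qed
  qed (use e \<delta> C1 in auto)
qed

text \<open>Convergence in \<open>H2\<close> gives uniform convergence of the difference quotients \<open>D\<close> and of their derivatives \<open>D'\<close>. The
  equation of the quotients then passes to the limit in integrated form, which shows that the limit \<open>G\<close> is twice
  differentiable in the classical sense.\<close>

lemma family_derivative:
  fixes g g' \<phi>0 :: "real \<Rightarrow> real" and \<phi> :: "real \<Rightarrow> real \<Rightarrow> real"
  assumes l: "0 < l" and g: "\<And>u. (g has_real_derivative g' u) (at u)" and cg: "continuous_on UNIV g'"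
    and e: "0 < e" and C1: "C1_map_into (H2 l) (H2_norm l) (ball \<beta>0 e) \<phi>"
    and sol: "\<And>\<beta>. \<beta> \<in> ball \<beta>0 e \<Longrightarrow> nlsol l g \<beta> (\<phi> \<beta>) (\<phi>' \<beta>)"
    and \<phi>0: "\<And>x. x \<in> {0..l} \<Longrightarrow> \<phi> \<beta>0 x = \<phi>0 x"
  shows "\<exists>G G'. twice_deriv l G G' (\<lambda>x. - ((g' (\<phi>0 x) + \<beta>0) * G x) - \<phi>0 x) \<and>
    (\<forall>x\<in>{0..l}. ((\<lambda>\<beta>. \<phi> \<beta> x) has_real_derivative G x) (at \<beta>0)) \<and>
    (\<forall>x\<in>{0..l}. ((\<lambda>\<beta>. \<phi>' \<beta> x) has_real_derivative G' x) (at \<beta>0)) \<and>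
    ((\<lambda>\<beta>. mass l (\<phi> \<beta>)) has_real_derivative 2 * integral {0..l} (\<lambda>x. G x * \<phi>0 x)) (at \<beta>0) \<and>
    (\<forall>\<delta>>0. \<exists>d>0. d \<le> e \<and> (\<forall>\<beta>\<in>ball \<beta>0 d. \<forall>x\<in>{0..l}. \<bar>\<phi> \<beta> x - \<phi>0 x\<bar> \<le> \<delta>))"
proof -
  have b0: "\<beta>0 \<in> ball \<beta>0 e" using e by simp
  have contg: "continuous_on UNIV g" using g by (meson DERIV_continuous_on)
  have t\<phi>: "twice_deriv l (\<phi> \<beta>) (\<phi>' \<beta>) (\<lambda>x. - (g (\<phi> \<beta> x) + \<beta> * \<phi> \<beta> x))" if "\<beta> \<in> ball \<beta>0 e" for \<beta>
    using sol[OF that] by (simp add: nlsol_def)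
  have c\<phi>: "continuous_on {0..l} (\<phi> \<beta>)" if "\<beta> \<in> ball \<beta>0 e" for \<beta> using twice_deriv_continuous(1)[OF t\<phi>[OF that]] .
  have c0: "continuous_on {0..l} \<phi>0" by (rule continuous_on_eq[OF c\<phi>[OF b0]]) (rule \<phi>0)
  have rep: "H2_rep l (\<phi> \<beta>) (\<phi> \<beta>) (\<phi>' \<beta>) (\<lambda>x. - (g (\<phi> \<beta> x) + \<beta> * \<phi> \<beta> x))" if "\<beta> \<in> ball \<beta>0 e" for \<beta>
    by (rule H2_rep_twice_deriv[OF t\<phi>[OF that]])
      (auto intro!: continuous_intros continuous_on_compose2[OF contg] c\<phi> that)
  obtain Gw where Gw: "Gw \<beta>0 \<in> H2 l"
    and lim: "((\<lambda>c. H2_norm l (\<lambda>x. (1 / (c - \<beta>0)) *\<^sub>R (\<phi> c x - \<phi> \<beta>0 x) - Gw \<beta>0 x)) \<longlongrightarrow> 0) (at \<beta>0)"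
  proof -
    have "\<exists>G. (\<forall>b\<in>ball \<beta>0 e. G b \<in> H2 l) \<and>
          (\<forall>b\<in>ball \<beta>0 e. ((\<lambda>c. H2_norm l (\<lambda>x. (1 / (c - b)) *\<^sub>R (\<phi> c x - \<phi> b x) - G b x)) \<longlongrightarrow> 0) (at b)) \<and>
          (\<forall>b\<in>ball \<beta>0 e. ((\<lambda>c. H2_norm l (\<lambda>x. G c x - G b x)) \<longlongrightarrow> 0) (at b))"
      using C1 unfolding C1_map_into_def by (rule conjunct2)
    then obtain Gw where Gw: "(\<forall>b\<in>ball \<beta>0 e. Gw b \<in> H2 l) \<and>
          (\<forall>b\<in>ball \<beta>0 e. ((\<lambda>c. H2_norm l (\<lambda>x. (1 / (c - b)) *\<^sub>R (\<phi> c x - \<phi> b x) - Gw b x)) \<longlongrightarrow> 0) (at b)) \<and>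
          (\<forall>b\<in>ball \<beta>0 e. ((\<lambda>c. H2_norm l (\<lambda>x. Gw c x - Gw b x)) \<longlongrightarrow> 0) (at b))" by (rule exE)
    show ?thesis
      using Gw[THEN conjunct1, THEN bspec, OF b0] Gw[THEN conjunct2, THEN conjunct1, THEN bspec, OF b0] by (rule that)
  qed
  obtain G G' gg where repG: "H2_rep l (Gw \<beta>0) G G' gg" using H2_rep_exists[OF l Gw] by blast
  have cG: "continuous_on {0..l} G" "continuous_on {0..l} G'" using H2_repD(6,7)[OF repG] .
  \<comment> \<open>\<open>N\<close> bounds the error of the difference quotient, \<open>A\<close> the difference itself, both uniformly on the interval\<close>
  define N where "N c = (1 / sqrt l + sqrt l) * H2_norm l (\<lambda>x. (1 / (c - \<beta>0)) *\<^sub>R (\<phi> c x - \<phi> \<beta>0 x) - Gw \<beta>0 x)" for c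
  have N: "(N \<longlongrightarrow> 0) (at \<beta>0)" unfolding N_def using tendsto_mult_left[OF lim] by simp
  have inball: "eventually (\<lambda>c. c \<in> ball \<beta>0 e) (at \<beta>0)" by (rule eventually_at_in_open'[OF open_ball b0])
  define D where "D c x = (\<phi> c x - \<phi> \<beta>0 x) / (c - \<beta>0)" for c x
  define D' where "D' c x = (\<phi>' c x - \<phi>' \<beta>0 x) / (c - \<beta>0)" for c x
  have sob: "\<bar>D c x - G x\<bar> \<le> N c" "\<bar>D' c x - G' x\<bar> \<le> N c" if c: "c \<in> ball \<beta>0 e" and x: "x \<in> {0..l}" for c x
  proof -
    have r: "H2_rep l (\<lambda>x. 1 *\<^sub>R ((1 / (c - \<beta>0)) *\<^sub>R (\<phi> c x - \<phi> \<beta>0 x) - Gw \<beta>0 x))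
      (\<lambda>x. 1 *\<^sub>R ((1 / (c - \<beta>0)) *\<^sub>R (\<phi> c x - \<phi> \<beta>0 x) - G x))
      (\<lambda>x. 1 *\<^sub>R ((1 / (c - \<beta>0)) *\<^sub>R (\<phi>' c x - \<phi>' \<beta>0 x) - G' x))
      (\<lambda>x. 1 *\<^sub>R ((1 / (c - \<beta>0)) *\<^sub>R (- (g (\<phi> c x) + c * \<phi> c x) - - (g (\<phi> \<beta>0 x) + \<beta>0 * \<phi> \<beta>0 x)) - gg x))"
      by (rule H2_rep_diff[OF H2_rep_diff[OF rep[OF c] rep[OF b0]] repG])
    show "\<bar>D c x - G x\<bar> \<le> N c" "\<bar>D' c x - G' x\<bar> \<le> N c"
      using sobolev_embedding[OF l r x] by (simp_all add: D_def D'_def N_def)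
  qed
  have der: "((\<lambda>\<beta>. \<phi> \<beta> x) has_real_derivative G x) (at \<beta>0)" "((\<lambda>\<beta>. \<phi>' \<beta> x) has_real_derivative G' x) (at \<beta>0)"
    if x: "x \<in> {0..l}" for x
  proof -
    have "((\<lambda>c. D c x - G x) \<longlongrightarrow> 0) (at \<beta>0)"
      by (rule Lim_null_comparison[OF eventually_mono[OF inball] N]) (simp only: real_norm_def sob(1)[OF _ x])
    then show "((\<lambda>\<beta>. \<phi> \<beta> x) has_real_derivative G x) (at \<beta>0)"
      unfolding has_field_derivative_iff D_def using Lim_null[of "\<lambda>c. (\<phi> c x - \<phi> \<beta>0 x) / (c - \<beta>0)"] by blast
    have "((\<lambda>c. D' c x - G' x) \<longlongrightarrow> 0) (at \<beta>0)"
      by (rule Lim_null_comparison[OF eventually_mono[OF inball] N]) (simp only: real_norm_def sob(2)[OF _ x])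
    then show "((\<lambda>\<beta>. \<phi>' \<beta> x) has_real_derivative G' x) (at \<beta>0)"
      unfolding has_field_derivative_iff D'_def using Lim_null[of "\<lambda>c. (\<phi>' c x - \<phi>' \<beta>0 x) / (c - \<beta>0)"] by blast
  qed
  obtain MG where MG: "MG \<ge> 0" "\<And>x. x \<in> {0..l} \<Longrightarrow> \<bar>G x\<bar> \<le> MG"
    using continuous_on_interval_bound[OF cG(1)] by auto
  obtain R where R: "R \<ge> 0" "\<And>x. x \<in> {0..l} \<Longrightarrow> \<bar>\<phi>0 x\<bar> \<le> R"
    using continuous_on_interval_bound[OF c0] by auto
  define W where "W x = g' (\<phi>0 x) + \<beta>0" for x
  have cW: "continuous_on {0..l} W" unfolding W_def
    by (intro continuous_intros continuous_on_compose2[OF cg c0]) auto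
  obtain KW where KW: "KW \<ge> 0" "\<And>x. x \<in> {0..l} \<Longrightarrow> \<bar>W x\<bar> \<le> KW"
    using continuous_on_interval_bound[OF cW] by auto
  define A where "A c = \<bar>c - \<beta>0\<bar> * (MG + N c)" for c
  have A: "(A \<longlongrightarrow> 0) (at \<beta>0)" unfolding A_def by (auto intro!: tendsto_eq_intros N)
  have \<phi>D: "\<phi> c x - \<phi>0 x = (c - \<beta>0) * D c x" if "c \<noteq> \<beta>0" "x \<in> {0..l}" for c x
    using that \<phi>0 by (simp add: D_def)
  have DM: "\<bar>D c x\<bar> \<le> MG + N c" if "c \<in> ball \<beta>0 e" "x \<in> {0..l}" for c x
    using sob(1)[OF that] MG(2)[OF that(2)] by linarith
  have diffA: "\<bar>\<phi> c x - \<phi>0 x\<bar> \<le> A c" if "c \<in> ball \<beta>0 e" "c \<noteq> \<beta>0" "x \<in> {0..l}" for c x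
    unfolding \<phi>D[OF that(2,3)] abs_mult A_def using DM[OF that(1,3)] by (intro mult_left_mono) auto
  have ev: "eventually (\<lambda>c. c \<in> ball \<beta>0 e \<and> c \<noteq> \<beta>0 \<and> N c < \<epsilon> \<and> A c < \<epsilon>) (at \<beta>0)" if "\<epsilon> > 0" for \<epsilon>
    using inball order_tendstoD(2)[OF N that] order_tendstoD(2)[OF A that] eventually_neq_at_within[of \<beta>0 \<beta>0 UNIV]
    by eventually_elim auto
  \<comment> \<open>the equation passes to the limit in integrated form\<close>
  define r where "r x = - (W x * G x) - \<phi>0 x" for x
  have cr: "continuous_on {0..l} r" unfolding r_def by (intro continuous_intros cW cG c0)
  have int: "G' x = G' 0 + integral {0..x} r" if x: "x \<in> {0..l}" for x
  proof -
    define E where "E = \<bar>G' x - G' 0 - integral {0..x} r\<bar>"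
    have E: "E \<le> (2 + l * (MG + 2 + KW)) * \<epsilon>" if \<epsilon>: "0 < \<epsilon>" "\<epsilon> \<le> 1" for \<epsilon>
    proof -
      obtain \<delta> where \<delta>: "0 < \<delta>" and lin: "\<And>x a b. x \<in> {0..l} \<Longrightarrow> \<bar>a - \<phi>0 x\<bar> \<le> \<delta> \<Longrightarrow> \<bar>b - \<phi>0 x\<bar> \<le> \<delta> \<Longrightarrow>
          \<bar>g b - g a - g' (\<phi>0 x) * (b - a)\<bar> \<le> \<epsilon> * \<bar>b - a\<bar>"
        using linearization_estimate[OF g cg c0 \<epsilon>(1)] by metis
      have "min \<delta> \<epsilon> > 0" using \<delta> \<epsilon> by simp
      from eventually_happens[OF ev[OF this]] obtain c where c: "c \<in> ball \<beta>0 e" "c \<noteq> \<beta>0" "N c < \<epsilon>" "A c < \<delta>" "A c < \<epsilon>"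
        by auto
      define t where "t = 1 / (c - \<beta>0)"
      have t: "t * (c - \<beta>0) = 1" using c by (simp add: t_def)
      define s where "s x = t *\<^sub>R (- (g (\<phi> c x) + c * \<phi> c x) - - (g (\<phi> \<beta>0 x) + \<beta>0 * \<phi> \<beta>0 x))" for x
      have tD: "twice_deriv l (D c) (D' c) s"
        using twice_deriv_bounded_linear[OF twice_deriv_diff[OF t\<phi>[OF c(1)] t\<phi>[OF b0]] bounded_linear_scaleR_right, of t]
        by (simp add: D_def[abs_def] D'_def[abs_def] s_def[abs_def] t_def)
      have cs: "continuous_on {0..l} s" unfolding s_def
        by (intro continuous_intros continuous_on_compose2[OF contg] c\<phi> c b0) auto
      have sr: "\<bar>s y - r y\<bar> \<le> (MG + 2 + KW) * \<epsilon>" if y: "y \<in> {0..l}" for y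
      proof -
        have a1: "\<bar>\<phi> c y - \<phi>0 y\<bar> \<le> A c" by (rule diffA[OF c(1,2) y])
        have "s y - r y = - (t * (g (\<phi> c y) - g (\<phi>0 y) - g' (\<phi>0 y) * (\<phi> c y - \<phi>0 y)))
           - g' (\<phi>0 y) * (t * (\<phi> c y - \<phi>0 y)) - \<beta>0 * (t * (\<phi> c y - \<phi>0 y)) - (t * (c - \<beta>0)) * \<phi> c y + W y * G y + \<phi>0 y"
          by (simp add: s_def r_def \<phi>0[OF y] algebra_simps)
        also have "t * (\<phi> c y - \<phi>0 y) = D c y" by (simp add: D_def t_def \<phi>0[OF y])
        also have "- (t * (g (\<phi> c y) - g (\<phi>0 y) - g' (\<phi>0 y) * (\<phi> c y - \<phi>0 y)))
           - g' (\<phi>0 y) * D c y - \<beta>0 * D c y - (t * (c - \<beta>0)) * \<phi> c y + W y * G y + \<phi>0 y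
           = - (t * (g (\<phi> c y) - g (\<phi>0 y) - g' (\<phi>0 y) * (\<phi> c y - \<phi>0 y))) - W y * (D c y - G y) - (\<phi> c y - \<phi>0 y)"
          unfolding t by (simp add: W_def algebra_simps)
        finally have eq: "\<bar>s y - r y\<bar> \<le> \<bar>t\<bar> * \<bar>g (\<phi> c y) - g (\<phi>0 y) - g' (\<phi>0 y) * (\<phi> c y - \<phi>0 y)\<bar> + \<bar>W y\<bar> * \<bar>D c y - G y\<bar> + \<bar>\<phi> c y - \<phi>0 y\<bar>"
          unfolding abs_mult[symmetric] by linarith
        have "\<bar>g (\<phi> c y) - g (\<phi>0 y) - g' (\<phi>0 y) * (\<phi> c y - \<phi>0 y)\<bar> \<le> \<epsilon> * \<bar>\<phi> c y - \<phi>0 y\<bar>"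
          by (rule lin[OF y]) (use a1 c \<delta> in auto)
        then have "\<bar>t\<bar> * \<bar>g (\<phi> c y) - g (\<phi>0 y) - g' (\<phi>0 y) * (\<phi> c y - \<phi>0 y)\<bar> \<le> \<bar>t\<bar> * (\<epsilon> * \<bar>\<phi> c y - \<phi>0 y\<bar>)"
          by (rule mult_left_mono) simp
        also have "\<dots> = \<epsilon> * \<bar>D c y\<bar>" by (simp add: D_def t_def \<phi>0[OF y] abs_divide)
        also have "\<dots> \<le> \<epsilon> * (MG + 1)" using DM[OF c(1) y] c(3) \<epsilon> by (intro mult_left_mono) auto
        finally have 1: "\<bar>t\<bar> * \<bar>g (\<phi> c y) - g (\<phi>0 y) - g' (\<phi>0 y) * (\<phi> c y - \<phi>0 y)\<bar> \<le> \<epsilon> * (MG + 1)" .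
        have 2: "\<bar>W y\<bar> * \<bar>D c y - G y\<bar> \<le> KW * \<epsilon>"
          using KW sob(1)[OF c(1) y] c(3) y by (intro mult_mono) auto
        have "(MG + 2 + KW) * \<epsilon> = \<epsilon> * (MG + 1) + KW * \<epsilon> + \<epsilon>" by (simp add: algebra_simps)
        then show ?thesis using eq 1 2 a1 c(5) by linarith
      qed
      have "(s has_integral D' c x - D' c 0) {0..x}"
        using x by (intro fundamental_theorem_of_calculus has_vector_derivative_within_subset[OF twice_derivD(2)[OF tD]]) auto
      then have Is: "integral {0..x} s = D' c x - D' c 0" by (rule integral_unique)
      have ii: "s integrable_on {0..x}" "r integrable_on {0..x}"
        using x by (auto intro!: integrable_continuous_interval continuous_on_subset[OF cs] continuous_on_subset[OF cr])
      have "norm (integral {0..x} (\<lambda>y. s y - r y)) \<le> integral {0..x} (\<lambda>y. (MG + 2 + KW) * \<epsilon>)"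
        using x sr ii by (intro integral_norm_bound_integral integrable_diff) auto
      also have "\<dots> = x * ((MG + 2 + KW) * \<epsilon>)" using x by simp
      also have "\<dots> \<le> l * ((MG + 2 + KW) * \<epsilon>)" using x MG(1) KW(1) \<epsilon> by (intro mult_right_mono) auto
      finally have "\<bar>integral {0..x} s - integral {0..x} r\<bar> \<le> l * ((MG + 2 + KW) * \<epsilon>)"
        using ii by (simp add: Henstock_Kurzweil_Integration.integral_diff)
      moreover have "\<bar>D' c x - G' x\<bar> \<le> \<epsilon>" "\<bar>D' c 0 - G' 0\<bar> \<le> \<epsilon>" using sob(2)[OF c(1) x] sob(2)[OF c(1), of 0] c(3) l by auto
      ultimately have "E \<le> 2 * \<epsilon> + l * ((MG + 2 + KW) * \<epsilon>)" unfolding E_def Is by linarith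
      then show ?thesis by (simp add: algebra_simps)
    qed
    have "E = 0"
    proof (rule ccontr)
      assume "E \<noteq> 0"
      then have E0: "E > 0" by (simp add: E_def)
      define P where "P = 2 + l * (MG + 2 + KW)"
      have P: "P > 0" using l MG KW by (simp add: P_def add_pos_nonneg)
      define \<epsilon> where "\<epsilon> = min 1 (E / (2 * P))"
      have "\<epsilon> > 0" "\<epsilon> \<le> 1" using E0 P by (auto simp: \<epsilon>_def)
      then have "E \<le> P * \<epsilon>" using E by (simp add: P_def)
      also have "\<dots> \<le> P * (E / (2 * P))" using P by (intro mult_left_mono) (auto simp: \<epsilon>_def)
      also have "\<dots> = E / 2" using P by simp
      finally show False using E0 by simp
    qed
    then show ?thesis by (simp add: E_def)
  qed
  have "primitive l G' r"
    using int L2_continuous[OF cr] unfolding primitive_def by blast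
  then have tG: "twice_deriv l G G' r"
    unfolding twice_deriv_def
    using derivative_of_primitive[OF H2_repD(3)[OF repG] cG(2)] derivative_of_primitive[OF _ cr] by blast
  have mass_eq: "mass l (\<phi> c) = integral {0..l} (\<lambda>x. (\<phi> c x)\<^sup>2)" if "c \<in> ball \<beta>0 e" for c
    unfolding mass_def by (intro integral_leb integrable_leb_continuous continuous_intros c\<phi> that)
  define I where "I = integral {0..l} (\<lambda>x. G x * \<phi>0 x)"
  define Q where "Q c = l * (N c * (2 * R + A c) + MG * A c)" for c
  have Q: "(Q \<longlongrightarrow> 0) (at \<beta>0)" unfolding Q_def by (auto intro!: tendsto_eq_intros N A)
  have "((\<lambda>c. (mass l (\<phi> c) - mass l (\<phi> \<beta>0)) / (c - \<beta>0) - 2 * I) \<longlongrightarrow> 0) (at \<beta>0)"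
  proof (rule Lim_null_comparison[OF _ Q])
    show "eventually (\<lambda>c. norm ((mass l (\<phi> c) - mass l (\<phi> \<beta>0)) / (c - \<beta>0) - 2 * I) \<le> Q c) (at \<beta>0)"
      using ev[OF zero_less_one]
    proof eventually_elim
      case (elim c)
      then have c: "c \<in> ball \<beta>0 e" "c \<noteq> \<beta>0" by auto
      have cD: "continuous_on {0..l} (D c)" unfolding D_def using c
        by (intro continuous_intros c\<phi> b0) auto
      have N0: "0 \<le> N c" using sob(1)[OF c(1), of 0] l by auto
      have A0: "0 \<le> A c" using diffA[OF c, of 0] l by auto
      have "mass l (\<phi> c) - mass l (\<phi> \<beta>0) = integral {0..l} (\<lambda>x. (\<phi> c x)\<^sup>2 - (\<phi> \<beta>0 x)\<^sup>2)"
        unfolding mass_eq[OF c(1)] mass_eq[OF b0]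
        by (intro Henstock_Kurzweil_Integration.integral_diff[symmetric] integrable_continuous_interval continuous_intros c\<phi> c b0)
      also have "\<dots> = integral {0..l} (\<lambda>x. (c - \<beta>0) * (D c x * (\<phi> c x + \<phi>0 x)))"
      proof (rule integral_cong)
        fix x assume x: "x \<in> {0..l}"
        have "(\<phi> c x)\<^sup>2 - (\<phi> \<beta>0 x)\<^sup>2 = (\<phi> c x - \<phi>0 x) * (\<phi> c x + \<phi>0 x)"
          using \<phi>0[OF x] by (simp add: power2_eq_square algebra_simps)
        then show "(\<phi> c x)\<^sup>2 - (\<phi> \<beta>0 x)\<^sup>2 = (c - \<beta>0) * (D c x * (\<phi> c x + \<phi>0 x))"
          unfolding \<phi>D[OF c(2) x] by (simp only: mult.assoc)
      qed
      also have "\<dots> = (c - \<beta>0) * integral {0..l} (\<lambda>x. D c x * (\<phi> c x + \<phi>0 x))" by simp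
      finally have "(mass l (\<phi> c) - mass l (\<phi> \<beta>0)) / (c - \<beta>0) - 2 * I
         = integral {0..l} (\<lambda>x. D c x * (\<phi> c x + \<phi>0 x)) - integral {0..l} (\<lambda>x. 2 * (G x * \<phi>0 x))"
        using c by (simp add: I_def)
      also have "\<dots> = integral {0..l} (\<lambda>x. D c x * (\<phi> c x + \<phi>0 x) - 2 * (G x * \<phi>0 x))"
        by (intro Henstock_Kurzweil_Integration.integral_diff[symmetric] integrable_continuous_interval continuous_intros cD cG c\<phi> c c0)
      also have "norm \<dots> \<le> integral {0..l} (\<lambda>x. N c * (2 * R + A c) + MG * A c)"
      proof (rule integral_norm_bound_integral)
        fix x assume x: "x \<in> {0..l}"
        have "D c x * (\<phi> c x + \<phi>0 x) - 2 * (G x * \<phi>0 x) = (D c x - G x) * (\<phi> c x + \<phi>0 x) + G x * (\<phi> c x - \<phi>0 x)"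
          by (simp add: algebra_simps)
        also have "\<bar>\<dots>\<bar> \<le> \<bar>D c x - G x\<bar> * \<bar>\<phi> c x + \<phi>0 x\<bar> + \<bar>G x\<bar> * \<bar>\<phi> c x - \<phi>0 x\<bar>"
          unfolding abs_mult[symmetric] by linarith
        also have "\<dots> \<le> N c * (2 * R + A c) + MG * A c"
          using sob(1)[OF c(1) x] diffA[OF c x] R(2)[OF x] MG x N0 A0
          by (intro add_mono mult_mono) auto
        finally show "norm (D c x * (\<phi> c x + \<phi>0 x) - 2 * (G x * \<phi>0 x)) \<le> N c * (2 * R + A c) + MG * A c" by simp
      qed (auto intro!: integrable_continuous_interval continuous_intros cD cG c\<phi> c c0)
      also have "\<dots> = Q c" using l by (simp add: Q_def)
      finally show ?case .
    qed
  qed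
  then have dm: "((\<lambda>\<beta>. mass l (\<phi> \<beta>)) has_real_derivative 2 * I) (at \<beta>0)"
    unfolding has_field_derivative_iff using Lim_null[of "\<lambda>c. (mass l (\<phi> c) - mass l (\<phi> \<beta>0)) / (c - \<beta>0)"] by blast
  have uni: "\<exists>d>0. d \<le> e \<and> (\<forall>\<beta>\<in>ball \<beta>0 d. \<forall>x\<in>{0..l}. \<bar>\<phi> \<beta> x - \<phi>0 x\<bar> \<le> \<delta>)" if \<delta>: "\<delta> > 0" for \<delta>
  proof -
    obtain d where d: "d > 0" "\<And>c. c \<noteq> \<beta>0 \<Longrightarrow> dist c \<beta>0 < d \<Longrightarrow> c \<in> ball \<beta>0 e \<and> A c < \<delta>"
      using ev[OF \<delta>] unfolding eventually_at by auto
    show ?thesis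
    proof (intro exI[of _ "min d e"] conjI ballI)
      fix c x assume c: "c \<in> ball \<beta>0 (min d e)" and x: "x \<in> {0..l}"
      show "\<bar>\<phi> c x - \<phi>0 x\<bar> \<le> \<delta>"
      proof (cases "c = \<beta>0")
        case True
        then show ?thesis using \<phi>0[OF x] \<delta> by simp
      next
        case False
        then have "c \<in> ball \<beta>0 e" "A c < \<delta>" using d(2)[of c] c by (auto simp: dist_commute)
        then show ?thesis using diffA[OF _ False x] by fastforce
      qed
    qed (use d e in auto)
  qed
  show ?thesis
    using tG der dm uni unfolding r_def W_def I_def by blast
qed

section \<open>Spectra and boundary value problems\<close>

lemma Dir_dom_rep:
  assumes l: "0 < l" and u: "u \<in> Dir_dom l"
  shows "\<exists>U V g. H2_rep l u U V g \<and> U 0 = 0 \<and> U l = 0"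
proof -
  have "u \<in> H2 l" using u by (simp add: Dir_dom_def)
  then obtain U V g where r: "H2_rep l u U V g" using H2_rep_exists[OF l] by blast
  then show ?thesis using Dir_dom_iff[OF l r] u by blast
qed

lemma schr_rep:
  assumes l: "0 < l" and r: "H2_rep l u U V g"
  shows "AE x in leb l. schr l W u x = - g x - W x *\<^sub>R U x"
  using H2_rep_weak_derivs(3)[OF l r] H2_repD(2)[OF r] by eventually_elim (simp add: schr_def)

text \<open>An element of the domain whose image is continuous has a classical solution as representative: its second weak
  derivative agrees almost everywhere with a continuous function.\<close>

lemma schr_regularity:
  fixes u R :: "real \<Rightarrow> 'v::euclidean_space"
  assumes l: "0 < l" and W: "continuous_on {0..l} W" and u: "u \<in> Dir_dom l"
    and R: "continuous_on {0..l} R" and eq: "AE x in leb l. schr l W u x = R x"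
  shows "\<exists>U V. twice_deriv l U V (\<lambda>x. - (W x *\<^sub>R U x) - R x) \<and> U 0 = 0 \<and> U l = 0 \<and> (AE x in leb l. u x = U x)"
proof -
  obtain U V g where r: "H2_rep l u U V g" and z: "U 0 = 0" "U l = 0" using Dir_dom_rep[OF l u] by blast
  have c: "continuous_on {0..l} (\<lambda>x. - (W x *\<^sub>R U x) - R x)"
    by (intro continuous_intros W R H2_repD(6)[OF r])
  have "AE x in leb l. g x = - (W x *\<^sub>R U x) - R x"
    using schr_rep[OF l r, of W] eq by eventually_elim (simp add: algebra_simps, metis add_diff_cancel_left' diff_add_cancel minus_minus uminus_add_conv_diff)
  from H2_rep_classical[OF H2_rep_AE[OF l r this L2_continuous[OF c]] c]
  show ?thesis using z H2_repD(2)[OF r] by blast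
qed

lemma schr_twice_deriv:
  fixes u :: "real \<Rightarrow> 'v::euclidean_space"
  assumes l: "0 < l" and t: "twice_deriv l u p s" and c: "continuous_on {0..l} s"
  shows "AE x in leb l. schr l W u x = - s x - W x *\<^sub>R u x"
  by (rule schr_rep[OF l H2_rep_twice_deriv[OF t c]]) simp

lemma Dir_dom_twice_deriv:
  fixes u :: "real \<Rightarrow> 'v::euclidean_space"
  assumes l: "0 < l" and t: "twice_deriv l u p s" and c: "continuous_on {0..l} s" and z: "u 0 = 0" "u l = 0"
  shows "u \<in> Dir_dom l"
  using Dir_dom_iff[OF l H2_rep_twice_deriv[OF t c]] z by simp

text \<open>A continuous function that is not identically zero has positive norm.\<close>

lemma not_boundedly_invertible:
  fixes u :: "real \<Rightarrow> 'v::euclidean_space"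
  assumes l: "0 < l" and u: "u \<in> D" and c: "continuous_on {0..l} u" and x: "x \<in> {0..l}" "u x \<noteq> 0"
    and T: "AE x in leb l. T u x = 0"
  shows "\<not> boundedly_invertible l D T"
proof
  assume "boundedly_invertible l D T"
  then obtain C where C: "L2_norm l u \<le> C * L2_norm l (T u)" using u unfolding boundedly_invertible_def by blast
  have "(\<integral>x. (norm (T u x))\<^sup>2 \<partial>leb l) = 0"
    by (rule integral_eq_zero_AE) (use T in \<open>eventually_elim, simp\<close>)
  then have "L2_norm l u \<le> 0" using C by (simp add: L2_norm_def)
  then have "(\<integral>x. (norm (u x))\<^sup>2 \<partial>leb l) \<le> 0" by (simp add: L2_norm_def)
  then have "(\<integral>x. (norm (u x))\<^sup>2 \<partial>leb l) = 0" by (intro antisym integral_nonneg_AE) auto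
  moreover have "integrable (leb l) (\<lambda>x. (norm (u x))\<^sup>2)" using L2_continuous[OF c] by (simp add: L2_def)
  ultimately have "AE x in leb l. (norm (u x))\<^sup>2 = 0" by (subst (asm) integral_nonneg_eq_0_iff_AE) auto
  then have "AE x in leb l. u x = 0" by eventually_elim simp
  then have "u x = 0" by (rule AE_eq_continuous[OF l c continuous_on_const _ x(1)])
  then show False using x by simp
qed

lemma kernel_in_Spec:
  fixes u :: "real \<Rightarrow> real"
  assumes l: "0 < l" and W: "continuous_on {0..l} W" and t: "twice_deriv l u p (\<lambda>x. - (W x *\<^sub>R u x))"
    and z: "u 0 = 0" "u l = 0" and x: "x \<in> {0..l}" "u x \<noteq> 0"
  shows "0 \<in> Spec l (schr l W)"
proof -
  define v where "v x = complex_of_real (u x)" for x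
  have tv: "twice_deriv l v (\<lambda>x. complex_of_real (p x)) (\<lambda>x. complex_of_real (- (W x *\<^sub>R u x)))"
    unfolding v_def by (rule twice_deriv_bounded_linear[OF t bounded_linear_of_real])
  have c: "continuous_on {0..l} (\<lambda>x. complex_of_real (- (W x *\<^sub>R u x)))"
    by (intro continuous_intros W twice_deriv_continuous(1)[OF t])
  have ae: "AE x in leb l. schr l W v x - 0 * v x = 0"
    using schr_twice_deriv[OF l tv c, of W] by eventually_elim (simp add: v_def scaleR_conv_of_real)
  have dv: "v \<in> Dir_dom l" by (rule Dir_dom_twice_deriv[OF l tv c]) (simp_all add: v_def z)
  have vx: "v x \<noteq> 0" using x(2) by (simp add: v_def)
  have "\<not> boundedly_invertible l (Dir_dom l) (\<lambda>(u :: real \<Rightarrow> complex) x. schr l W u x - 0 * u x)"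
    by (rule not_boundedly_invertible[where T = "\<lambda>(u :: real \<Rightarrow> complex) x. schr l W u x - 0 * u x",
          OF l dv twice_deriv_continuous(1)[OF tv] x(1) vx ae])
  then show ?thesis by (simp add: Spec_def)
qed

text \<open>As the potential is real, real and imaginary part of an eigenfunction for a real eigenvalue are solutions, and one of
  them is not zero.\<close>

lemma num_neg_eigenvalues_eq:
  assumes l: "0 < l" and W: "continuous_on {0..l} W"
  shows "num_neg_eigenvalues l (schr l W) = card (neg_eigs l W)"
proof -
  have "eigenvalue l (schr l W) (complex_of_real \<mu>) \<longleftrightarrow>
    (\<exists>u p. twice_deriv l u p (\<lambda>x. - ((W x + \<mu>) *\<^sub>R u x)) \<and> u 0 = (0::real) \<and> u l = 0 \<and> (\<exists>x\<in>{0..l}. u x \<noteq> 0))" for \<mu>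
  proof
    assume "eigenvalue l (schr l W) (complex_of_real \<mu>)"
    then obtain w where w: "w \<in> Dir_dom l" "\<not> (AE x in leb l. w x = 0)"
      and ev: "AE x in leb l. schr l W w x = complex_of_real \<mu> * w x" unfolding eigenvalue_def by blast
    have "AE x in leb l. schr l (\<lambda>x. W x + \<mu>) w x = 0"
      using ev by eventually_elim (simp add: schr_def scaleR_conv_of_real algebra_simps)
    moreover have "continuous_on {0..l} (\<lambda>x. W x + \<mu>)" by (intro continuous_intros W)
    ultimately obtain U V where U: "twice_deriv l U V (\<lambda>x. - ((W x + \<mu>) *\<^sub>R U x) - 0)" "U 0 = 0" "U l = 0" "AE x in leb l. w x = U x"
      using schr_regularity[OF l _ w(1) continuous_on_const, of "\<lambda>x. W x + \<mu>" 0] by blast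
    have "\<exists>x\<in>{0..l}. U x \<noteq> 0"
    proof (rule ccontr)
      assume "\<not> (\<exists>x\<in>{0..l}. U x \<noteq> 0)"
      then have "AE x in leb l. U x = 0" by (intro AE_lebI) auto
      then have "AE x in leb l. w x = 0" using U(4) by eventually_elim simp
      then show False using w(2) by simp
    qed
    then obtain x where x: "x \<in> {0..l}" "U x \<noteq> 0" by blast
    have "twice_deriv l (\<lambda>x. Re (U x)) (\<lambda>x. Re (V x)) (\<lambda>x. - ((W x + \<mu>) *\<^sub>R Re (U x)))"
      "twice_deriv l (\<lambda>x. Im (U x)) (\<lambda>x. Im (V x)) (\<lambda>x. - ((W x + \<mu>) *\<^sub>R Im (U x)))"
      using twice_deriv_bounded_linear[OF U(1) bounded_linear_Re] twice_deriv_bounded_linear[OF U(1) bounded_linear_Im]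
      by simp_all
    note parts = this
    show "\<exists>u p. twice_deriv l u p (\<lambda>x. - ((W x + \<mu>) *\<^sub>R u x)) \<and> u 0 = (0::real) \<and> u l = 0 \<and> (\<exists>x\<in>{0..l}. u x \<noteq> 0)"
    proof (cases "Re (U x) = 0")
      case False
      then show ?thesis using parts(1) U(2,3) x(1)
        by (intro exI[of _ "\<lambda>x. Re (U x)"] exI[of _ "\<lambda>x. Re (V x)"] conjI bexI[of _ x]) simp_all
    next
      case True
      then have "Im (U x) \<noteq> 0" using x(2) by (simp add: complex_eq_iff)
      then show ?thesis using parts(2) U(2,3) x(1)
        by (intro exI[of _ "\<lambda>x. Im (U x)"] exI[of _ "\<lambda>x. Im (V x)"] conjI bexI[of _ x]) simp_all
    qed
  next
    assume "\<exists>u p. twice_deriv l u p (\<lambda>x. - ((W x + \<mu>) *\<^sub>R u x)) \<and> u 0 = (0::real) \<and> u l = 0 \<and> (\<exists>x\<in>{0..l}. u x \<noteq> 0)"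
    then obtain u p x where t: "twice_deriv l u p (\<lambda>x. - ((W x + \<mu>) *\<^sub>R u x))" "u 0 = (0::real)" "u l = 0" "x \<in> {0..l}" "u x \<noteq> 0" by blast
    define v where "v x = complex_of_real (u x)" for x
    have tv: "twice_deriv l v (\<lambda>x. complex_of_real (p x)) (\<lambda>x. complex_of_real (- ((W x + \<mu>) *\<^sub>R u x)))"
      unfolding v_def by (rule twice_deriv_bounded_linear[OF t(1) bounded_linear_of_real])
    have c: "continuous_on {0..l} (\<lambda>x. complex_of_real (- ((W x + \<mu>) *\<^sub>R u x)))"
      by (intro continuous_intros W twice_deriv_continuous(1)[OF t(1)])
    have "AE x in leb l. schr l W v x = complex_of_real \<mu> * v x"
      using schr_twice_deriv[OF l tv c, of W] by eventually_elim (simp add: v_def scaleR_conv_of_real algebra_simps)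
    moreover have "\<not> (AE x in leb l. v x = 0)"
    proof
      assume "AE x in leb l. v x = 0"
      then have "v x = 0" by (rule AE_eq_continuous[OF l twice_deriv_continuous(1)[OF tv] continuous_on_const _ t(4)])
      then show False using t(5) by (simp add: v_def)
    qed
    moreover have "v \<in> Dir_dom l" by (rule Dir_dom_twice_deriv[OF l tv c]) (simp_all add: v_def t)
    ultimately show "eigenvalue l (schr l W) (complex_of_real \<mu>)" unfolding eigenvalue_def by blast
  qed
  then show ?thesis unfolding num_neg_eigenvalues_def neg_eigs_def by simp
qed

lemma primitive_Pair:
  assumes "primitive l U v" "primitive l U' v'"
  shows "primitive l (\<lambda>x. (U x, U' x)) (\<lambda>x. (v x, v' x))"
proof -
  have b: "bounded_linear (\<lambda>x. (x, 0))" "bounded_linear (\<lambda>x. (0, x))"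
    by (auto intro!: bounded_linear_Pair bounded_linear_ident bounded_linear_zero)
  show ?thesis
    using primitive_lincomb[OF primitive_bounded_linear[OF b(1) assms(1)] primitive_bounded_linear[OF b(2) assms(2)], of 1 1]
    by simp
qed

text \<open>Reduces square integrable right-hand sides to continuous ones: subtracting \<open>P\<close> with \<open>P'' = r\<close> from a solution of
  \<open>u'' = A u + r\<close> leaves the right-hand side \<open>A P\<close>.\<close>

lemma double_primitive:
  fixes r :: "real \<Rightarrow> 'v::euclidean_space"
  assumes l: "0 < l" and r: "r \<in> L2 l"
  obtains P V where "primitive l V r" "primitive l P V" "P 0 = 0"
    "\<And>x. x \<in> {0..l} \<Longrightarrow> norm (P x) \<le> l * sqrt l * L2_norm l r"
proof -
  define V where "V x = integral {0..x} r" for x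
  have pV: "primitive l V r" using r by (auto simp: primitive_def V_def)
  define P where "P x = integral {0..x} V" for x
  have pP: "primitive l P V" using primitive_L2[OF pV] by (auto simp: primitive_def P_def)
  have i: "integrable (leb l) r" "integrable (leb l) (\<lambda>x. norm (r x))" using L2_integrable[OF r] by auto
  have Vb: "norm (V x) \<le> sqrt l * L2_norm l r" if x: "x \<in> {0..l}" for x
  proof -
    have "norm (V x) \<le> integral {0..x} (\<lambda>x. norm (r x))" unfolding V_def
      using integrable_leb_subinterval(2)[OF i(1), of 0 x] integrable_leb_subinterval(2)[OF i(2), of 0 x] x
      by (intro integral_norm_bound_integral) auto
    also have "\<dots> \<le> integral {0..l} (\<lambda>x. norm (r x))"
      using integrable_leb_subinterval(2)[OF i(2), of 0 x] integrable_leb_subinterval(2)[OF i(2), of 0 l] x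
      by (intro integral_subset_le) auto
    also have "\<dots> = (\<integral>x. norm (r x) \<partial>leb l)" by (rule integral_leb[OF i(2), symmetric])
    also have "\<dots> \<le> sqrt l * L2_norm l r" by (rule L1_le_L2[OF l r])
    finally show ?thesis .
  qed
  have "norm (P x) \<le> l * sqrt l * L2_norm l r" if x: "x \<in> {0..l}" for x
  proof -
    have "norm (P x) \<le> integral {0..x} (\<lambda>_. sqrt l * L2_norm l r)" unfolding P_def
      using Vb x integrable_leb_subinterval(2)[OF L2_integrable[OF primitive_L2[OF pV]], of 0 x]
      by (intro integral_norm_bound_integral) auto
    also have "\<dots> = x * (sqrt l * L2_norm l r)" using x by simp
    also have "\<dots> \<le> l * (sqrt l * L2_norm l r)" using x l by (intro mult_right_mono) auto
    finally show ?thesis by simp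
  qed
  then show ?thesis using that[OF pV pP] by (simp add: P_def)
qed

lemma dirichlet_L2_solve:
  fixes A :: "real \<Rightarrow> 'v::euclidean_space \<Rightarrow> 'v"
  assumes A: "linsys l A K" and nd: "nondeg l A" and r: "r \<in> L2 l"
  shows "\<exists>z z'. primitive l z z' \<and> primitive l z' (\<lambda>x. A x (z x) + r x) \<and> z 0 = 0 \<and> z l = 0"
proof -
  have l: "0 < l" by (rule linsysD(1)[OF A])
  obtain P V where P: "primitive l V r" "primitive l P V" "P 0 = 0"
    using double_primitive[OF l r] by metis
  have cP: "continuous_on {0..l} (\<lambda>x. A x (P x))" by (rule linsys_continuous[OF A primitive_continuous[OF P(2)]])
  obtain Y Y' where Y: "twice_deriv l Y Y' (\<lambda>x. A x (Y x) + A x (P x))" "Y 0 = 0" "Y l = - P l"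
    using dirichlet_solve[OF A nd cP, of 0 "- P l"] by blast
  note cY = twice_deriv_continuous[OF Y(1)]
  have pY: "primitive l Y Y'" by (rule primitive_of_derivative[OF twice_derivD(1)[OF Y(1)] cY(2)])
  have pY': "primitive l Y' (\<lambda>x. A x (Y x) + A x (P x))"
    by (rule primitive_of_derivative[OF twice_derivD(2)[OF Y(1)]], assumption) (intro continuous_intros linsys_continuous[OF A cY(1)] cP)
  have 1: "primitive l (\<lambda>x. Y x + P x) (\<lambda>x. Y' x + V x)" using primitive_lincomb[OF pY P(2), of 1 1] by simp
  have 2: "primitive l (\<lambda>x. Y' x + V x) (\<lambda>x. (A x (Y x) + A x (P x)) + r x)" using primitive_lincomb[OF pY' P(1), of 1 1] by simp
  have L: "(\<lambda>x. A x (Y x + P x) + r x) \<in> L2 l"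
    using L2_lincomb[OF L2_continuous[OF linsys_continuous[OF A primitive_continuous[OF 1]]] r, of 1 1] by simp
  have "primitive l (\<lambda>x. Y' x + V x) (\<lambda>x. A x (Y x + P x) + r x)"
    by (rule primitive_cong[OF 2 refl _ L]) (use l in \<open>simp_all add: linear_add[OF linsysD(3)[OF A]]\<close>)
  then show ?thesis using 1 Y P(3) by (intro exI[of _ "\<lambda>x. Y x + P x"] exI[of _ "\<lambda>x. Y' x + V x"]) simp
qed

lemma dirichlet_L2_bound:
  fixes A :: "real \<Rightarrow> 'v::euclidean_space \<Rightarrow> 'v"
  assumes A: "linsys l A K" and nd: "nondeg l A"
  shows "\<exists>C\<ge>0. \<forall>z z' r. r \<in> L2 l \<longrightarrow> primitive l z z' \<longrightarrow> primitive l z' (\<lambda>x. A x (z x) + r x) \<longrightarrow>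
    z 0 = 0 \<longrightarrow> z l = 0 \<longrightarrow> (\<forall>x\<in>{0..l}. norm (z x) \<le> C * L2_norm l r)"
proof -
  have l: "0 < l" by (rule linsysD(1)[OF A])
  have K: "0 \<le> K" by (rule linsysD(2)[OF A])
  obtain C where C: "C > 0" and DB: "\<And>u p s e x. twice_deriv l u p s \<Longrightarrow> (\<And>x. x \<in> {0..l} \<Longrightarrow> norm (s x - A x (u x)) \<le> e) \<Longrightarrow>
     norm (u 0) \<le> e \<Longrightarrow> norm (u l) \<le> e \<Longrightarrow> x \<in> {0..l} \<Longrightarrow> norm (u x) \<le> C * e"
    using dirichlet_bound[OF A nd] by metis
  define B where "B = (C * (K + 1) + 1) * (l * sqrt l)"
  show ?thesis
  proof (intro exI[of _ B] conjI allI impI ballI)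
    show "0 \<le> B" using C K l by (simp add: B_def)
    fix z z' :: "real \<Rightarrow> 'v" and r x
    assume r: "r \<in> L2 l" and z: "primitive l z z'" "primitive l z' (\<lambda>x. A x (z x) + r x)" "z 0 = 0" "z l = 0" and x: "x \<in> {0..l}"
    obtain P V where P: "primitive l V r" "primitive l P V" "P 0 = 0"
      and Pb: "\<And>x. x \<in> {0..l} \<Longrightarrow> norm (P x) \<le> l * sqrt l * L2_norm l r"
      using double_primitive[OF l r] by metis
    define m where "m = l * sqrt l * L2_norm l r"
    have m: "0 \<le> m" using l by (simp add: m_def)
    define Y where "Y x = z x - P x" for x
    have 1: "primitive l Y (\<lambda>x. z' x - V x)" unfolding Y_def by (rule primitive_diff[OF z(1) P(2)])
    have 2: "primitive l (\<lambda>x. z' x - V x) (\<lambda>x. A x (z x))" using primitive_diff[OF z(2) P(1)] by simp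
    have c: "continuous_on {0..l} (\<lambda>x. A x (z x))" by (rule linsys_continuous[OF A primitive_continuous[OF z(1)]])
    have tY: "twice_deriv l Y (\<lambda>x. z' x - V x) (\<lambda>x. A x (z x))"
      unfolding twice_deriv_def
      using derivative_of_primitive[OF 1 primitive_continuous[OF 2]] derivative_of_primitive[OF 2 c] by blast
    have "norm (Y x) \<le> C * ((K + 1) * m)"
    proof (rule DB[OF tY _ _ _ x])
      fix y assume y: "y \<in> {0..l}"
      have "A y (z y) - A y (Y y) = A y (P y)"
        using linear_diff[OF linsysD(3)[OF A y], of "z y" "Y y"] by (simp add: Y_def)
      then have "norm (A y (z y) - A y (Y y)) \<le> K * norm (P y)" using linsysD(4)[OF A y] by simp
      also have "\<dots> \<le> K * m" unfolding m_def by (intro mult_left_mono Pb y K)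
      finally show "norm (A y (z y) - A y (Y y)) \<le> (K + 1) * m" using m by (simp add: algebra_simps)
    next
      show "norm (Y 0) \<le> (K + 1) * m" using z P m K by (simp add: Y_def)
      have "norm (Y l) \<le> m" using Pb[of l] z l by (simp add: Y_def m_def)
      also have "\<dots> \<le> (K + 1) * m" using m K by (simp add: algebra_simps)
      finally show "norm (Y l) \<le> (K + 1) * m" .
    qed
    then have "norm (z x) \<le> C * ((K + 1) * m) + m"
      using Pb[OF x] norm_triangle_sub[of "z x" "P x"] by (simp add: Y_def m_def norm_minus_commute)
    then show "norm (z x) \<le> B * L2_norm l r" by (simp add: B_def m_def algebra_simps)
  qed
qed

text \<open>The equation \<open>N w = \<mu> w\<close> solved for second derivatives, as \<open>w'' = linearized W_+ W_- \<mu> x w\<close>.\<close>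

definition linearized :: "(real \<Rightarrow> real) \<Rightarrow> (real \<Rightarrow> real) \<Rightarrow> complex \<Rightarrow> real \<Rightarrow> complex \<times> complex \<Rightarrow> complex \<times> complex" where
  "linearized Wp Wm \<mu> x z = (- (Wp x *\<^sub>R fst z) - \<mu> * snd z, - (Wm x *\<^sub>R snd z) + \<mu> * fst z)"

lemma linsys_linearized:
  assumes l: "0 < l" and W: "continuous_on {0..l} Wp" "continuous_on {0..l} Wm"
  shows "\<exists>K. linsys l (linearized Wp Wm \<mu>) K"
proof -
  obtain K1 where K1: "K1 \<ge> 0" "\<And>x. x \<in> {0..l} \<Longrightarrow> \<bar>Wp x\<bar> \<le> K1"
    using continuous_on_interval_bound[OF W(1)] by auto
  obtain K2 where K2: "K2 \<ge> 0" "\<And>x. x \<in> {0..l} \<Longrightarrow> \<bar>Wm x\<bar> \<le> K2"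
    using continuous_on_interval_bound[OF W(2)] by auto
  define K where "K = (K1 + cmod \<mu>) + (K2 + cmod \<mu>)"
  have "linsys l (linearized Wp Wm \<mu>) K"
    unfolding linsys_def
  proof (intro conjI ballI allI)
    show "0 < l" by fact
    show "0 \<le> K" using K1 K2 by (simp add: K_def)
    fix x assume x: "x \<in> {0..l}"
    show "linear (linearized Wp Wm \<mu> x)"
      by (intro linearI) (auto simp: linearized_def algebra_simps)
    fix z :: "complex \<times> complex"
    have f: "norm (fst z) \<le> norm z" "norm (snd z) \<le> norm z"
      using norm_fst_le[of "fst z" "snd z"] norm_snd_le[of "snd z" "fst z"] by simp_all
    have "norm (linearized Wp Wm \<mu> x z) \<le> norm (- (Wp x *\<^sub>R fst z) - \<mu> * snd z) + norm (- (Wm x *\<^sub>R snd z) + \<mu> * fst z)"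
      unfolding linearized_def by (rule norm_Pair_le)
    also have "norm (- (Wp x *\<^sub>R fst z) - \<mu> * snd z) \<le> norm (Wp x *\<^sub>R fst z) + norm (\<mu> * snd z)"
      using norm_triangle_ineq4[of "- (Wp x *\<^sub>R fst z)" "\<mu> * snd z"] by simp
    also have "\<dots> \<le> K1 * norm z + cmod \<mu> * norm z"
      unfolding norm_scaleR norm_mult using f K1 x by (intro add_mono mult_mono) auto
    also have "norm (- (Wm x *\<^sub>R snd z) + \<mu> * fst z) \<le> norm (Wm x *\<^sub>R snd z) + norm (\<mu> * fst z)"
      using norm_triangle_ineq[of "- (Wm x *\<^sub>R snd z)" "\<mu> * fst z"] by simp
    also have "\<dots> \<le> K2 * norm z + cmod \<mu> * norm z"
      unfolding norm_scaleR norm_mult using f K2 x by (intro add_mono mult_mono) auto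
    finally show "norm (linearized Wp Wm \<mu> x z) \<le> K * norm z" by (simp add: K_def algebra_simps)
  next
    have "continuous_on ({0..l} \<times> (UNIV :: (complex \<times> complex) set)) (\<lambda>z. Wp (fst z))"
      "continuous_on ({0..l} \<times> (UNIV :: (complex \<times> complex) set)) (\<lambda>z. Wm (fst z))"
      by (rule continuous_on_compose2[OF W(1)] continuous_on_compose2[OF W(2)]; auto intro!: continuous_intros)+
    then show "continuous_on ({0..l} \<times> UNIV) (\<lambda>(x, v). linearized Wp Wm \<mu> x v)"
      unfolding linearized_def case_prod_unfold by (intro continuous_intros)
  qed
  then show ?thesis by blast
qed

text \<open>Solving for second derivatives turns the resolvent equation into a Dirichlet problem with right-hand side in \<open>L2\<close>,
  to which the Fredholm alternative of finite dimensional shooting applies.\<close>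

lemma N_boundedly_invertible:
  assumes l: "0 < l" and W: "continuous_on {0..l} (W_plus f \<beta> \<phi>)" "continuous_on {0..l} (W_minus f \<beta> \<phi>)"
    and nd: "nondeg l (linearized (W_plus f \<beta> \<phi>) (W_minus f \<beta> \<phi>) \<mu>)"
  shows "boundedly_invertible l (N_dom l) (\<lambda>w x. N_op f l \<beta> \<phi> w x - (\<mu> * fst (w x), \<mu> * snd (w x)))"
proof -
  define Wp Wm where "Wp = W_plus f \<beta> \<phi>" and "Wm = W_minus f \<beta> \<phi>"
  define A where "A = linearized Wp Wm \<mu>"
  note W = W[folded Wp_def Wm_def] and nd = nd[folded Wp_def Wm_def A_def]
  obtain K where A: "linsys l A K" unfolding A_def using linsys_linearized[OF l W] by blast
  define T where "T w x = N_op f l \<beta> \<phi> w x - (\<mu> * fst (w x), \<mu> * snd (w x))" for w x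
  have T: "T w x = (- schr l Wm (\<lambda>y. snd (w y)) x - \<mu> * fst (w x), schr l Wp (\<lambda>y. fst (w y)) x - \<mu> * snd (w x))" for w x
    by (simp add: T_def N_op_def Wp_def Wm_def)
  have onto: "\<exists>w\<in>N_dom l. AE x in leb l. T w x = h x" if h: "h \<in> L2 l" for h
  proof -
    define r where "r x = (- snd (h x), fst (h x))" for x
    have "bounded_linear (\<lambda>h :: complex \<times> complex. (- snd h, fst h))"
      by (intro bounded_linear_Pair bounded_linear_minus bounded_linear_fst bounded_linear_snd)
    from L2_bounded_linear[OF this h] have r: "r \<in> L2 l" by (simp add: r_def[abs_def])
    obtain z z' where z: "primitive l z z'" "primitive l z' (\<lambda>x. A x (z x) + r x)" "z 0 = 0" "z l = 0"
      using dirichlet_L2_solve[OF A nd r] by blast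
    have rep: "H2_rep l z z z' (\<lambda>x. A x (z x) + r x)"
      using z primitive_continuous[OF z(1)] by (auto simp: H2_rep_def measurable_leb_continuous)
    note rf = H2_rep_bounded_linear[OF bounded_linear_fst rep] and rs = H2_rep_bounded_linear[OF bounded_linear_snd rep]
    have "z \<in> N_dom l" using Dir_dom_iff[OF l rf] Dir_dom_iff[OF l rs] z by (simp add: N_dom_def)
    moreover have "AE x in leb l. T z x = h x"
      using schr_rep[OF l rf, of Wp] schr_rep[OF l rs, of Wm]
      by eventually_elim (simp add: T A_def linearized_def r_def)
    ultimately show ?thesis by blast
  qed
  obtain C where C: "C \<ge> 0" and bd: "\<And>z z' r x. r \<in> L2 l \<Longrightarrow> primitive l z z' \<Longrightarrow> primitive l z' (\<lambda>x. A x (z x) + r x) \<Longrightarrow>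
    z 0 = 0 \<Longrightarrow> z l = 0 \<Longrightarrow> x \<in> {0..l} \<Longrightarrow> norm (z x) \<le> C * L2_norm l r"
  proof -
    obtain C where "C \<ge> 0" "\<forall>z z' r. r \<in> L2 l \<longrightarrow> primitive l z z' \<longrightarrow> primitive l z' (\<lambda>x. A x (z x) + r x) \<longrightarrow>
      z 0 = 0 \<longrightarrow> z l = 0 \<longrightarrow> (\<forall>x\<in>{0..l}. norm (z x) \<le> C * L2_norm l r)"
      using dirichlet_L2_bound[OF A nd] by (elim exE conjE)
    then show ?thesis by (intro that[of C]) simp_all
  qed
  have est: "L2_norm l w \<le> sqrt l * C * L2_norm l (T w)" if w: "w \<in> N_dom l" for w
  proof -
    have wd: "(\<lambda>x. fst (w x)) \<in> Dir_dom l" "(\<lambda>x. snd (w x)) \<in> Dir_dom l" using w by (auto simp: N_dom_def)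
    obtain U1 V1 g1 where r1: "H2_rep l (\<lambda>x. fst (w x)) U1 V1 g1" and z1: "U1 0 = 0" "U1 l = 0" using Dir_dom_rep[OF l wd(1)] by blast
    obtain U2 V2 g2 where r2: "H2_rep l (\<lambda>x. snd (w x)) U2 V2 g2" and z2: "U2 0 = 0" "U2 l = 0" using Dir_dom_rep[OF l wd(2)] by blast
    define z where "z x = (U1 x, U2 x)" for x
    define r where "r x = (g1 x, g2 x) - A x (z x)" for x
    have pz: "primitive l z (\<lambda>x. (V1 x, V2 x))" unfolding z_def
      by (rule primitive_Pair[OF H2_repD(3)[OF r1] H2_repD(3)[OF r2]])
    have pV: "primitive l (\<lambda>x. (V1 x, V2 x)) (\<lambda>x. (g1 x, g2 x))"
      by (rule primitive_Pair[OF H2_repD(4)[OF r1] H2_repD(4)[OF r2]])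
    have r: "r \<in> L2 l" unfolding r_def
      by (intro L2_diff primitiveD(1)[OF pV] L2_continuous linsys_continuous[OF A] primitive_continuous[OF pz])
    have "primitive l (\<lambda>x. (V1 x, V2 x)) (\<lambda>x. A x (z x) + r x)" using pV by (simp add: r_def)
    from bd[OF r pz this] have zb: "norm (z x) \<le> C * L2_norm l r" if "x \<in> {0..l}" for x
      using that z1 z2 by (simp add: z_def zero_prod_def)
    have mw: "(\<lambda>x. fst (w x)) \<in> borel_measurable (leb l)" "(\<lambda>x. snd (w x)) \<in> borel_measurable (leb l)"
      using H2_repD(1)[OF r1] H2_repD(1)[OF r2] .
    have "(\<lambda>x. (fst (w x), snd (w x))) \<in> borel_measurable (leb l)" by (rule borel_measurable_Pair[OF mw])
    then have mw2: "w \<in> borel_measurable (leb l)" by simp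
    have aez: "AE x in leb l. w x = z x"
      using H2_repD(2)[OF r1] H2_repD(2)[OF r2] by eventually_elim (simp add: z_def prod_eq_iff)
    have "L2_norm l w = L2_norm l z"
      using aez mw2 L2_measurable[OF primitive_L2[OF pz]] by (intro L2_norm_cong)
    also have "\<dots> \<le> sqrt l * (C * L2_norm l r)"
      using l primitive_L2[OF pz] zb C by (intro L2_norm_le_sup AE_lebI) auto
    also have "L2_norm l r = L2_norm l (T w)"
    proof -
      have mT: "T w \<in> borel_measurable (leb l)"
      proof -
        have [measurable]: "Wp \<in> borel_measurable (leb l)" "Wm \<in> borel_measurable (leb l)"
          by (rule measurable_leb_continuous[OF W(1)], rule measurable_leb_continuous[OF W(2)])
        note [measurable] = mw L2_measurable[OF H2_rep_weak_derivs(5)[OF l r1]] L2_measurable[OF H2_rep_weak_derivs(5)[OF l r2]]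
        have "(\<lambda>x. (- schr l Wm (\<lambda>y. snd (w y)) x - \<mu> * fst (w x), schr l Wp (\<lambda>y. fst (w y)) x - \<mu> * snd (w x))) \<in> borel_measurable (leb l)"
          unfolding schr_def by (intro borel_measurable_Pair) measurable
        moreover have "T w = (\<lambda>x. (- schr l Wm (\<lambda>y. snd (w y)) x - \<mu> * fst (w x), schr l Wp (\<lambda>y. fst (w y)) x - \<mu> * snd (w x)))"
          by (rule ext) (rule T)
        ultimately show ?thesis by (simp only:)
      qed
      have "AE x in leb l. norm (r x) = norm (T w x)"
        using schr_rep[OF l r1, of Wp] schr_rep[OF l r2, of Wm] H2_repD(2)[OF r1] H2_repD(2)[OF r2]
      proof eventually_elim
        case (elim x)
        have "T w x = (snd (r x), - fst (r x))"
          using elim by (simp add: T r_def A_def linearized_def z_def)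
        then show ?case by (simp add: norm_prod_def add.commute)
      qed
      then have "(\<integral>x. (norm (r x))\<^sup>2 \<partial>leb l) = (\<integral>x. (norm (T w x))\<^sup>2 \<partial>leb l)"
        using mT L2_measurable[OF r] by (intro integral_cong_AE) auto
      then show ?thesis by (simp add: L2_norm_def)
    qed
    finally show ?thesis by (simp add: mult.assoc)
  qed
  show ?thesis
    unfolding boundedly_invertible_def T_def[symmetric] using onto est by blast
qed

lemma eigenfunction_in_Spec_N:
  assumes l: "0 < l" and W: "continuous_on {0..l} (W_plus f \<beta> \<phi>)" "continuous_on {0..l} (W_minus f \<beta> \<phi>)"
    and u: "twice_deriv l u u' (\<lambda>x. - (W_plus f \<beta> \<phi> x * u x) - \<mu> * v x)" "u 0 = 0" "u l = 0"
    and v: "twice_deriv l v v' (\<lambda>x. - (W_minus f \<beta> \<phi> x * v x) + \<mu> * u x)" "v 0 = 0" "v l = 0"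
    and x: "x \<in> {0..l}" "u x \<noteq> 0 \<or> v x \<noteq> (0::real)"
  shows "complex_of_real \<mu> \<in> Spec_N f l \<beta> \<phi>"
proof -
  note cu = twice_deriv_continuous(1)[OF u(1)] and cv = twice_deriv_continuous(1)[OF v(1)]
  define w where "w x = (complex_of_real (u x), complex_of_real (v x))" for x
  note tu = twice_deriv_bounded_linear[OF u(1) bounded_linear_of_real[where 'a = complex]]
  note tv = twice_deriv_bounded_linear[OF v(1) bounded_linear_of_real[where 'a = complex]]
  have c1: "continuous_on {0..l} (\<lambda>x. complex_of_real (- (W_plus f \<beta> \<phi> x * u x) - \<mu> * v x))"
    "continuous_on {0..l} (\<lambda>x. complex_of_real (- (W_minus f \<beta> \<phi> x * v x) + \<mu> * u x))"
    by (intro continuous_intros W cu cv)+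
  have "w \<in> N_dom l"
    unfolding N_dom_def w_def using Dir_dom_twice_deriv[OF l tu c1(1)] Dir_dom_twice_deriv[OF l tv c1(2)] u v by simp
  moreover have "AE x in leb l. N_op f l \<beta> \<phi> w x - (complex_of_real \<mu> * fst (w x), complex_of_real \<mu> * snd (w x)) = 0"
    using schr_twice_deriv[OF l tu c1(1), of "W_plus f \<beta> \<phi>"] schr_twice_deriv[OF l tv c1(2), of "W_minus f \<beta> \<phi>"]
    by eventually_elim (simp add: N_op_def w_def scaleR_conv_of_real zero_prod_def)
  moreover have "continuous_on {0..l} w" unfolding w_def by (intro continuous_intros cu cv)
  moreover have "w x \<noteq> 0" using x by (auto simp: w_def zero_prod_def)
  ultimately have "\<not> boundedly_invertible l (N_dom l)
      (\<lambda>w x. N_op f l \<beta> \<phi> w x - (complex_of_real \<mu> * fst (w x), complex_of_real \<mu> * snd (w x)))"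
    using not_boundedly_invertible[where T = "\<lambda>w x. N_op f l \<beta> \<phi> w x - (complex_of_real \<mu> * fst (w x), complex_of_real \<mu> * snd (w x))",
        OF l _ _ x(1)] by blast
  then show ?thesis by (simp add: Spec_N_def)
qed

text \<open>Splits a complex solution into its four real components.\<close>

lemma nondeg_linearized:
  fixes \<phi> Wp Wm :: "real \<Rightarrow> real"
  assumes l: "0 < l" and W: "continuous_on {0..l} Wp" "continuous_on {0..l} Wm"
    and nonneg: "\<And>u p s. twice_deriv l u p s \<Longrightarrow> continuous_on {0..l} s \<Longrightarrow> u 0 = 0 \<Longrightarrow> u l = 0 \<Longrightarrow>
        0 \<le> integral {0..l} (\<lambda>x. - (s x + Wm x * u x) * u x)"
    and nonneg_perp: "\<And>u p s. twice_deriv l u p s \<Longrightarrow> continuous_on {0..l} s \<Longrightarrow> u 0 = 0 \<Longrightarrow> u l = 0 \<Longrightarrow>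
        integral {0..l} (\<lambda>x. u x * \<phi> x) = 0 \<Longrightarrow> 0 \<le> integral {0..l} (\<lambda>x. - (s x + Wp x * u x) * u x)"
    and \<phi>: "twice_deriv l \<phi> \<phi>' (\<lambda>x. - (Wm x * \<phi> x))" "\<phi> 0 = 0" "\<phi> l = 0"
    and \<mu>: "0 < Re \<mu>"
  shows "nondeg l (linearized Wp Wm \<mu>)"
  unfolding nondeg_def
proof (intro allI impI ballI)
  fix z p :: "real \<Rightarrow> complex \<times> complex" and x
  assume t: "twice_deriv l z p (\<lambda>x. linearized Wp Wm \<mu> x (z x))" and z: "z 0 = 0" "z l = 0" and x: "x \<in> {0..l}"
  define a b c d where "a x = Re (fst (z x))" and "b x = Im (fst (z x))" and "c x = Re (snd (z x))" and "d x = Im (snd (z x))" for x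
  note tf = twice_deriv_bounded_linear[OF t bounded_linear_fst] and ts = twice_deriv_bounded_linear[OF t bounded_linear_snd]
  note bl = bounded_linear_Re bounded_linear_Im
  have "a x = 0 \<and> b x = 0 \<and> c x = 0 \<and> d x = 0"
  proof (rule no_unstable_eigenfunction[where a = a and b = b and c = c and d = d and x = x and n = "Im \<mu>", OF l W nonneg nonneg_perp \<phi> \<mu>])
    show "twice_deriv l a (\<lambda>x. Re (fst (p x))) (\<lambda>x. - (Wp x * a x) - (Re \<mu> * c x - Im \<mu> * d x))"
      using twice_deriv_bounded_linear[OF tf bl(1)] by (simp add: a_def[abs_def] c_def[abs_def] d_def[abs_def] linearized_def)
    show "twice_deriv l b (\<lambda>x. Im (fst (p x))) (\<lambda>x. - (Wp x * b x) - (Re \<mu> * d x + Im \<mu> * c x))"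
      using twice_deriv_bounded_linear[OF tf bl(2)] by (simp add: b_def[abs_def] c_def[abs_def] d_def[abs_def] linearized_def)
    show "twice_deriv l c (\<lambda>x. Re (snd (p x))) (\<lambda>x. - (Wm x * c x) + (Re \<mu> * a x - Im \<mu> * b x))"
      using twice_deriv_bounded_linear[OF ts bl(1)] by (simp add: a_def[abs_def] b_def[abs_def] c_def[abs_def] linearized_def)
    show "twice_deriv l d (\<lambda>x. Im (snd (p x))) (\<lambda>x. - (Wm x * d x) + (Re \<mu> * b x + Im \<mu> * a x))"
      using twice_deriv_bounded_linear[OF ts bl(2)] by (simp add: a_def[abs_def] b_def[abs_def] d_def[abs_def] linearized_def)
  qed (use z x in \<open>simp_all add: a_def b_def c_def d_def\<close>)
  then show "z x = 0" by (simp add: a_def b_def c_def d_def prod_eq_iff complex_eq_iff)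
qed

section \<open>The nonlinearity\<close>

definition nonlin :: "(real \<Rightarrow> real) \<Rightarrow> real \<Rightarrow> real" where
  "nonlin f u = f (u\<^sup>2) * u"

text \<open>The derivative of \<open>nonlin f\<close>, written so that \<open>W_plus\<close> at \<open>\<phi>\<close> is \<open>nonlin' f \<phi> + \<beta>\<close>.\<close>

definition nonlin' :: "(real \<Rightarrow> real) \<Rightarrow> real \<Rightarrow> real" where
  "nonlin' f u = 2 * deriv_on {0..} f (u\<^sup>2) * u\<^sup>2 + f (u\<^sup>2)"

lemma C_on_3_deriv:
  fixes f :: "real \<Rightarrow> real"
  assumes "C_on 3 {0..} f"
  shows "\<And>y. 0 \<le> y \<Longrightarrow> (f has_vector_derivative deriv_on {0..} f y) (at y within {0..})"
    "continuous_on {0..} (deriv_on {0..} f)" "continuous_on {0..} f"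
proof -
  have d: "f differentiable_on {0..}" "deriv_on {0..} f differentiable_on {0..}"
    using assms by (simp_all add: eval_nat_numeral)
  show "(f has_vector_derivative deriv_on {0..} f y) (at y within {0..})" if "0 \<le> y" for y
    using d(1) that unfolding differentiable_on_def deriv_on_def by (simp add: vector_derivative_works)
  show "continuous_on {0..} (deriv_on {0..} f)" "continuous_on {0..} f"
    using d by (auto intro: differentiable_imp_continuous_on)
qed

text \<open>The chain rule applies although \<open>f\<close> has only a one-sided derivative at \<open>0\<close>, since squares stay in \<open>{0..}\<close>.\<close>

lemma nonlin_derivative:
  assumes f: "C_on 3 {0..} f"
  shows "(nonlin f has_real_derivative nonlin' f u) (at u)"
proof -
  have im: "(\<lambda>u::real. u\<^sup>2) ` UNIV \<subseteq> {0..}" by auto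
  have "((\<lambda>u. u\<^sup>2) has_vector_derivative 2 * u) (at u)"
    unfolding has_real_derivative_iff_has_vector_derivative[symmetric] by (auto intro!: derivative_eq_intros)
  from vector_diff_chain_within[OF this has_vector_derivative_within_subset[OF C_on_3_deriv(1)[OF f] im]]
  have "((\<lambda>u. f (u\<^sup>2)) has_real_derivative 2 * u * deriv_on {0..} f (u\<^sup>2)) (at u)"
    by (simp add: o_def has_real_derivative_iff_has_vector_derivative)
  from DERIV_mult[OF this DERIV_ident]
  show ?thesis by (simp add: nonlin_def[abs_def] nonlin'_def algebra_simps power2_eq_square)
qed

lemma continuous_nonlin':
  assumes f: "C_on 3 {0..} f"
  shows "continuous_on UNIV (nonlin' f)"
  unfolding nonlin'_def
  by (intro continuous_intros continuous_on_compose2[OF C_on_3_deriv(2)[OF f]] continuous_on_compose2[OF C_on_3_deriv(3)[OF f]]) auto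

lemma W_plus_eq: "W_plus f \<beta> \<phi> x = nonlin' f (\<phi> x) + \<beta>"
  by (simp add: W_plus_def nonlin'_def)

lemma nonlin_W_minus: "nonlin f (\<phi> x) + \<beta> * \<phi> x = W_minus f \<beta> \<phi> x * \<phi> x"
  by (simp add: W_minus_def nonlin_def algebra_simps)

lemma continuous_W:
  assumes f: "C_on 3 {0..} f" and \<phi>: "continuous_on {0..l} \<phi>"
  shows "continuous_on {0..l} (W_plus f \<beta> \<phi>)" "continuous_on {0..l} (W_minus f \<beta> \<phi>)"
proof -
  show "continuous_on {0..l} (W_plus f \<beta> \<phi>)"
    unfolding W_plus_eq[abs_def] by (intro continuous_intros continuous_on_compose2[OF continuous_nonlin'[OF f] \<phi>]) auto
  show "continuous_on {0..l} (W_minus f \<beta> \<phi>)"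
    unfolding W_minus_def by (intro continuous_intros continuous_on_compose2[OF C_on_3_deriv(3)[OF f]] \<phi>) auto
qed

lemma C_on_2_twice_deriv:
  fixes u :: "real \<Rightarrow> real"
  assumes "C_on 2 {0..l} u"
  shows "twice_deriv l u (deriv_on {0..l} u) (deriv_on {0..l} (deriv_on {0..l} u))"
proof -
  have d: "u differentiable_on {0..l}" "deriv_on {0..l} u differentiable_on {0..l}"
    using assms by (simp_all add: eval_nat_numeral)
  then show ?thesis
    unfolding twice_deriv_def differentiable_on_def deriv_on_def by (simp add: vector_derivative_works)
qed

lemma deriv_on_eq:
  fixes u :: "real \<Rightarrow> real"
  assumes l: "0 < l" and d: "(u has_vector_derivative p) (at x within {0..l})" and x: "x \<in> {0..l}"
  shows "deriv_on {0..l} u x = p"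
  unfolding deriv_on_def using l d x
  by (metis atLeastAtMost_iff box_real(2) vector_derivative_within_cbox)

lemma is_solution_nlsol:
  assumes "is_solution f l \<beta> \<phi>"
  shows "nlsol l (nonlin f) \<beta> \<phi> (deriv_on {0..l} \<phi>)"
proof -
  have "twice_deriv l \<phi> (deriv_on {0..l} \<phi>) (deriv_on {0..l} (deriv_on {0..l} \<phi>))"
    using assms by (intro C_on_2_twice_deriv) (simp add: is_solution_def)
  then show ?thesis unfolding nlsol_def
  proof (rule twice_deriv_cong)
    fix x assume "x \<in> {0..l}"
    then have "deriv_on {0..l} (deriv_on {0..l} \<phi>) x + f ((\<phi> x)\<^sup>2) * \<phi> x + \<beta> * \<phi> x = 0"
      using assms unfolding is_solution_def by blast
    then show "deriv_on {0..l} (deriv_on {0..l} \<phi>) x = - (nonlin f (\<phi> x) + \<beta> * \<phi> x)"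
      unfolding nonlin_def by linarith
  qed
qed

lemma C_on_2_of_twice_deriv:
  fixes u :: "real \<Rightarrow> real"
  assumes l: "0 < l" and t: "twice_deriv l u p s"
  shows "\<And>x. x \<in> {0..l} \<Longrightarrow> deriv_on {0..l} u x = p x"
    and "\<And>x. x \<in> {0..l} \<Longrightarrow> deriv_on {0..l} (deriv_on {0..l} u) x = s x"
    and "continuous_on {0..l} s \<Longrightarrow> C_on 2 {0..l} u"
proof -
  show d1: "deriv_on {0..l} u x = p x" if "x \<in> {0..l}" for x
    by (rule deriv_on_eq[OF l twice_derivD(1)[OF t that] that])
  have dd: "(deriv_on {0..l} u has_vector_derivative s x) (at x within {0..l})" if "x \<in> {0..l}" for x
    by (rule has_vector_derivative_transform[OF that _ twice_derivD(2)[OF t that]]) (simp add: d1)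
  show d2: "deriv_on {0..l} (deriv_on {0..l} u) x = s x" if "x \<in> {0..l}" for x
    by (rule deriv_on_eq[OF l dd[OF that] that])
  assume cs: "continuous_on {0..l} s"
  have "continuous_on {0..l} (deriv_on {0..l} (deriv_on {0..l} u))"
    by (rule continuous_on_eq[OF cs]) (simp add: d2)
  moreover have "u differentiable_on {0..l}"
    unfolding differentiable_on_def using twice_derivD(1)[OF t] by (meson differentiableI_vector)
  moreover have "deriv_on {0..l} u differentiable_on {0..l}"
    unfolding differentiable_on_def using dd by (meson differentiableI_vector)
  ultimately show "C_on 2 {0..l} u" by (simp add: eval_nat_numeral)
qed

lemma nlsol_is_solution:
  assumes f: "C_on 3 {0..} f" and l: "0 < l" and n: "nlsol l (nonlin f) \<beta> \<phi> \<phi>'"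
  shows "is_solution f l \<beta> \<phi>"
proof -
  note t = n[unfolded nlsol_def]
  have "continuous_on {0..l} (\<lambda>x. - (nonlin f (\<phi> x) + \<beta> * \<phi> x))" unfolding nonlin_W_minus
    by (intro continuous_intros twice_deriv_continuous[OF t] continuous_W[OF f])
  from C_on_2_of_twice_deriv(2,3)[OF l t] this show ?thesis
    by (simp add: is_solution_def nonlin_def)
qed

text \<open>Translation invariance of the profile equation.\<close>

lemma solution_derivative_solves_linearization:
  assumes f: "C_on 3 {0..} f" and t: "twice_deriv l \<phi> \<phi>' (\<lambda>x. - (nonlin f (\<phi> x) + \<beta> * \<phi> x))"
  shows "twice_deriv l \<phi>' (\<lambda>x. - (nonlin f (\<phi> x) + \<beta> * \<phi> x)) (\<lambda>x. - (W_plus f \<beta> \<phi> x *\<^sub>R \<phi>' x))"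
  unfolding twice_deriv_def
proof (intro ballI conjI)
  fix x assume x: "x \<in> {0..l}"
  show "(\<phi>' has_vector_derivative - (nonlin f (\<phi> x) + \<beta> * \<phi> x)) (at x within {0..l})" by (rule twice_derivD(2)[OF t x])
  have d: "(\<phi> has_real_derivative \<phi>' x) (at x within {0..l})" by (rule twice_deriv_real(1)[OF t x order_refl order_refl])
  have "((\<lambda>x. nonlin f (\<phi> x)) has_real_derivative nonlin' f (\<phi> x) * \<phi>' x) (at x within {0..l})"
    by (rule DERIV_chain2[OF nonlin_derivative[OF f] d])
  from DERIV_minus[OF DERIV_add[OF this DERIV_cmult[OF d, of \<beta>]]]
  show "((\<lambda>x. - (nonlin f (\<phi> x) + \<beta> * \<phi> x)) has_vector_derivative - (W_plus f \<beta> \<phi> x *\<^sub>R \<phi>' x)) (at x within {0..l})"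
    by (simp add: has_real_derivative_iff_has_vector_derivative W_plus_eq algebra_simps)
qed

text \<open>The energy \<open>\<phi>'\<^sup>2 + 2 \<Gamma>(\<phi>)\<close> with \<open>\<Gamma>' = k\<close> is constant, and \<open>\<Gamma>\<close> takes the same value at both ends.\<close>

lemma energy_conservation:
  fixes \<phi> k :: "real \<Rightarrow> real"
  assumes l: "0 < l" and k: "continuous_on UNIV k" and t: "twice_deriv l \<phi> \<phi>' (\<lambda>x. - k (\<phi> x))" and bc: "\<phi> l = \<phi> 0"
  shows "(\<phi>' l)\<^sup>2 = (\<phi>' 0)\<^sup>2"
proof -
  note c = twice_deriv_continuous(1)[OF t]
  obtain R where R: "R \<ge> 0" "\<And>x. x \<in> {0..l} \<Longrightarrow> \<bar>\<phi> x\<bar> \<le> R"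
    using continuous_on_interval_bound[OF c] by auto
  define \<Gamma> where "\<Gamma> u = integral {-R..u} k" for u
  have d\<Gamma>: "(\<Gamma> has_vector_derivative k u) (at u within {-R..R})" if "u \<in> {-R..R}" for u
    unfolding \<Gamma>_def by (rule integral_has_vector_derivative[OF continuous_on_subset[OF k] that]) simp
  have im: "\<phi> ` {0..l} \<subseteq> {-R..R}" 
  proof (rule image_subsetI)
    fix x assume "x \<in> {0..l}"
    from R(2)[OF this] show "\<phi> x \<in> {-R..R}" by (simp add: abs_le_iff)
  qed
  have "((\<lambda>x. 2 * \<phi>' x * - k (\<phi> x) + 2 * (\<phi>' x * k (\<phi> x))) has_integral ((\<phi>' l)\<^sup>2 + 2 * \<Gamma> (\<phi> l)) - ((\<phi>' 0)\<^sup>2 + 2 * \<Gamma> (\<phi> 0))) {0..l}"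
  proof (rule fundamental_theorem_of_calculus)
    fix x assume x: "x \<in> {0..l}"
    have "\<phi> x \<in> {-R..R}" by (rule subsetD[OF im imageI[OF x]])
    from vector_diff_chain_within[OF twice_derivD(1)[OF t x] has_vector_derivative_within_subset[OF d\<Gamma>[OF this] im]]
    have 1: "((\<lambda>x. \<Gamma> (\<phi> x)) has_real_derivative \<phi>' x * k (\<phi> x)) (at x within {0..l})"
      by (simp add: o_def has_real_derivative_iff_has_vector_derivative)
    have 2: "(\<phi>' has_real_derivative - k (\<phi> x)) (at x within {0..l})" by (rule twice_deriv_real(2)[OF t x order_refl order_refl])
    show "((\<lambda>x. (\<phi>' x)\<^sup>2 + 2 * \<Gamma> (\<phi> x)) has_vector_derivative 2 * \<phi>' x * - k (\<phi> x) + 2 * (\<phi>' x * k (\<phi> x))) (at x within {0..l})"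
      unfolding has_real_derivative_iff_has_vector_derivative[symmetric] using 1 2
      by (auto intro!: derivative_eq_intros)
  qed (use l in simp)
  then have "((\<lambda>x. 0) has_integral ((\<phi>' l)\<^sup>2 + 2 * \<Gamma> (\<phi> l)) - ((\<phi>' 0)\<^sup>2 + 2 * \<Gamma> (\<phi> 0))) {0..l}" by (simp add: algebra_simps)
  from has_integral_unique[OF this has_integral_0] show ?thesis using bc by simp
qed

section \<open>The derivative of the mass and stability\<close>

text \<open>\<open>G\<close> and \<open>u\<close> solve the same inhomogeneous equation. Hence \<open>G - u = (G(0) / \<phi>'(0)) \<phi>' + \<gamma> q\<close>, and Green's identity gives
  \<open>\<integral> (u - G) \<phi> = u'(l) G(l) - u'(0) G(0)\<close>. Green's identity with \<open>\<phi>'\<close> also yields the symmetries \<open>u'(0) = - \<sigma> u'(l)\<close> and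
  \<open>q'(l) = - \<sigma>\<close>, which express everything by \<open>G(0)\<close>, \<open>G(l)\<close>, \<open>G'(l)\<close> and \<open>q(l)\<close>.\<close>

lemma boundary_correction:
  fixes Wp \<phi> \<phi>' \<phi>'' q u G :: "real \<Rightarrow> real"
  assumes l: "0 < l" and W: "continuous_on {0..l} Wp"
    and \<phi>': "twice_deriv l \<phi>' \<phi>'' (\<lambda>x. - (Wp x *\<^sub>R \<phi>' x))"
    and \<phi>: "\<And>x. x \<in> {0..l} \<Longrightarrow> (\<phi> has_vector_derivative \<phi>' x) (at x within {0..l})" "\<phi> 0 = 0" "\<phi> l = 0"
    and \<phi>'': "\<phi>'' 0 = 0" "\<phi>'' l = 0"
    and \<sigma>: "\<sigma> * \<sigma> = 1" "\<phi>' l = - \<sigma> * \<phi>' 0" "\<phi>' 0 \<noteq> 0"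
    and q: "twice_deriv l q q' (\<lambda>x. - (Wp x *\<^sub>R q x))" "q 0 = 0" "q' 0 = 1" "q l \<noteq> 0"
    and u: "twice_deriv l u u' (\<lambda>x. - (Wp x * u x) - \<phi> x)" "u 0 = 0" "u l = 0"
    and G: "twice_deriv l G G' (\<lambda>x. - (Wp x * G x) - \<phi> x)"
  shows "integral {0..l} (\<lambda>x. u x * \<phi> x) = integral {0..l} (\<lambda>x. G x * \<phi> x)
    + (\<sigma> * G 0 + G l) * ((G 0 + \<sigma> * G l) / q l + G' l)"
proof -
  define c where "c = \<phi>' 0"
  have c: "c \<noteq> 0" "\<phi>' l = - \<sigma> * c" using \<sigma> by (auto simp: c_def)
  have c\<phi>: "continuous_on {0..l} \<phi>" using \<phi>(1) by (rule continuous_on_vector_derivative)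
  note cont = c\<phi> twice_deriv_continuous(1)[OF \<phi>'] twice_deriv_continuous(1)[OF u(1)] twice_deriv_continuous(1)[OF G] W
  have \<sigma>0: "\<sigma> \<noteq> 0" using \<sigma>(1) by auto
  \<comment> \<open>the Wronskian of \<open>q\<close> and \<open>\<phi>'\<close> is constant\<close>
  have "((\<lambda>x. 0) has_integral (q' l * \<phi>' l - q l * \<phi>'' l) - (q' 0 * \<phi>' 0 - q 0 * \<phi>'' 0)) {0..l}"
    using green_identity[OF l q(1) \<phi>'] by (simp add: algebra_simps)
  from has_integral_unique[OF this has_integral_0] have "q' l * (- \<sigma> * c) = c"
    using q \<phi>'' c by (simp add: c_def)
  then have "(q' l * \<sigma>) * c = (-1) * c" by (simp add: algebra_simps)
  then have "q' l * \<sigma> = -1" using c(1) by (simp only: mult_cancel_right) simp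
  then have "q' l * (\<sigma> * \<sigma>) = - \<sigma>" by (simp flip: mult.assoc)
  then have q'l: "q' l = - \<sigma>" using \<sigma>(1) by simp
  \<comment> \<open>the integrand is the derivative of \<open>- \<phi>\<^sup>2 / 2\<close>, which vanishes at both ends\<close>
  have "u' 0 = - \<sigma> * u' l"
  proof -
    have "((\<lambda>x. - (\<phi> x * \<phi>' x)) has_integral (u' l * \<phi>' l - u l * \<phi>'' l) - (u' 0 * \<phi>' 0 - u 0 * \<phi>'' 0)) {0..l}"
      using green_identity[OF l u(1) \<phi>'] by (simp add: algebra_simps)
    moreover have "((\<lambda>x. - (\<phi> x * \<phi>' x)) has_integral (- (\<phi> l)\<^sup>2 / 2) - (- (\<phi> 0)\<^sup>2 / 2)) {0..l}"
    proof (rule fundamental_theorem_of_calculus)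
      fix x assume "x \<in> {0..l}"
      from \<phi>(1)[OF this] show "((\<lambda>x. - (\<phi> x)\<^sup>2 / 2) has_vector_derivative - (\<phi> x * \<phi>' x)) (at x within {0..l})"
        unfolding has_real_derivative_iff_has_vector_derivative[symmetric] by (auto intro!: derivative_eq_intros)
    qed (use l in simp)
    ultimately have "(u' l * \<phi>' l - u l * \<phi>'' l) - (u' 0 * \<phi>' 0 - u 0 * \<phi>'' 0) = (- (\<phi> l)\<^sup>2 / 2) - (- (\<phi> 0)\<^sup>2 / 2)"
      by (rule has_integral_unique)
    then have "u' l * (- \<sigma> * c) = u' 0 * c" using u \<phi>'' \<phi> c by (simp add: c_def)
    then have "u' 0 * c = (- \<sigma> * u' l) * c" by (simp add: algebra_simps)
    then show ?thesis using c(1) by (simp only: mult_cancel_right) simp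
  qed
  note u'0 = this
  \<comment> \<open>\<open>G - u\<close> solves the homogeneous equation and so is a combination of \<open>\<phi>'\<close> and \<open>q\<close>\<close>
  define \<gamma> where "\<gamma> = (G l + \<sigma> * G 0) / q l"
  have "twice_deriv l (\<lambda>x. (G x - u x) - ((G 0 / c) *\<^sub>R \<phi>' x + \<gamma> *\<^sub>R q x)) (\<lambda>x. (G' x - u' x) - ((G 0 / c) *\<^sub>R \<phi>'' x + \<gamma> *\<^sub>R q' x))
     (\<lambda>x. ((- (Wp x * G x) - \<phi> x) - (- (Wp x * u x) - \<phi> x)) - ((G 0 / c) *\<^sub>R - (Wp x *\<^sub>R \<phi>' x) + \<gamma> *\<^sub>R - (Wp x *\<^sub>R q x)))"
    by (intro twice_deriv_diff twice_deriv_lincomb G u \<phi>' q)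
  then have tw: "twice_deriv l (\<lambda>x. (G x - u x) - ((G 0 / c) *\<^sub>R \<phi>' x + \<gamma> *\<^sub>R q x)) (\<lambda>x. (G' x - u' x) - ((G 0 / c) *\<^sub>R \<phi>'' x + \<gamma> *\<^sub>R q' x))
     (\<lambda>x. - (Wp x *\<^sub>R ((G x - u x) - ((G 0 / c) *\<^sub>R \<phi>' x + \<gamma> *\<^sub>R q x))))"
    by (rule twice_deriv_cong) (simp add: algebra_simps)
  have z0: "(G 0 - u 0) - ((G 0 / c) *\<^sub>R \<phi>' 0 + \<gamma> *\<^sub>R q 0) = 0" using u q c by (simp add: c_def)
  have zl: "(G l - u l) - ((G 0 / c) *\<^sub>R \<phi>' l + \<gamma> *\<^sub>R q l) = 0" using u q c by (simp add: \<gamma>_def)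
  have "nondeg l (\<lambda>x v :: real. - (Wp x *\<^sub>R v))" by (rule nondeg_scaleR[OF l W q])
  then have zero: "(G x - u x) - ((G 0 / c) *\<^sub>R \<phi>' x + \<gamma> *\<^sub>R q x) = 0" if "x \<in> {0..l}" for x
    using tw z0 zl that unfolding nondeg_def by blast
  have t0: "twice_deriv l (\<lambda>x. 0::real) (\<lambda>x. 0) (\<lambda>x. 0)" by (auto simp: twice_deriv_def)
  have "(G' l - u' l) - ((G 0 / c) *\<^sub>R \<phi>'' l + \<gamma> *\<^sub>R q' l) = 0"
    by (rule twice_deriv_derivative_unique[OF l tw t0 zero]) (use l in simp_all)
  then have G'l: "G' l = u' l - \<sigma> * \<gamma>" using \<phi>'' q'l by (simp add: algebra_simps)
  have "integral {0..l} (\<lambda>x. u x * \<phi> x - G x * \<phi> x) = (u' l * G l - u l * G' l) - (u' 0 * G 0 - u 0 * G' 0)"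
  proof -
    have "((\<lambda>x. u x * \<phi> x - G x * \<phi> x) has_integral (u' l * G l - u l * G' l) - (u' 0 * G 0 - u 0 * G' 0)) {0..l}"
      using green_identity[OF l u(1) G] by (simp add: algebra_simps)
    then show ?thesis by (rule integral_unique)
  qed
  also have "\<dots> = (\<sigma> * G 0 + G l) * u' l" using u u'0 by (simp add: algebra_simps)
  also have "u' l = (G 0 + \<sigma> * G l) / q l + G' l"
  proof -
    have "\<sigma> * \<gamma> = (\<sigma> * G l + (\<sigma> * \<sigma>) * G 0) / q l" by (simp add: \<gamma>_def algebra_simps)
    then show ?thesis using G'l \<sigma>(1) by (simp add: algebra_simps)
  qed
  finally have "integral {0..l} (\<lambda>x. u x * \<phi> x - G x * \<phi> x) = (\<sigma> * G 0 + G l) * ((G 0 + \<sigma> * G l) / q l + G' l)" .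
  moreover have "integral {0..l} (\<lambda>x. u x * \<phi> x - G x * \<phi> x) = integral {0..l} (\<lambda>x. u x * \<phi> x) - integral {0..l} (\<lambda>x. G x * \<phi> x)"
    by (intro Henstock_Kurzweil_Integration.integral_diff integrable_continuous_interval continuous_intros cont)
  ultimately show ?thesis by simp
qed

text \<open>\<open>P = 1\<close> makes \<open>q\<close> change sign once, with \<open>q l < 0\<close>, and \<open>Q = 0\<close> makes \<open>\<phi>\<close> free of interior zeros. Dividing \<open>\<phi>\<close> by its
  initial slope makes it positive without changing the sign of the integral of \<open>u \<phi>\<close>.\<close>

lemma spectral_stability_criterion:
  fixes f \<phi> u q :: "real \<Rightarrow> real"
  assumes l: "0 < l" and W: "continuous_on {0..l} (W_plus f \<beta> \<phi>)" "continuous_on {0..l} (W_minus f \<beta> \<phi>)"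
    and \<phi>: "twice_deriv l \<phi> \<phi>' (\<lambda>x. - (W_minus f \<beta> \<phi> x *\<^sub>R \<phi> x))" "\<phi> 0 = 0" "\<phi> l = 0" "\<phi>' 0 \<noteq> 0"
    and q: "twice_deriv l q q' (\<lambda>x. - (W_plus f \<beta> \<phi> x *\<^sub>R q x))" "q 0 = 0" "q' 0 = 1" "q l \<noteq> 0"
    and P: "card (neg_eigs l (W_plus f \<beta> \<phi>)) = 1" and Q: "card (neg_eigs l (W_minus f \<beta> \<phi>)) = 0"
    and u: "twice_deriv l u u' (\<lambda>x. - (W_plus f \<beta> \<phi> x * u x) - \<phi> x)" "u 0 = 0" "u l = 0"
  shows "0 < integral {0..l} (\<lambda>x. u x * \<phi> x) \<Longrightarrow> spectrally_unstable f l \<beta> \<phi>"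
    and "integral {0..l} (\<lambda>x. u x * \<phi> x) < 0 \<Longrightarrow> spectrally_stable f l \<beta> \<phi>"
proof -
  define c where "c = \<phi>' 0"
  have c: "c \<noteq> 0" using \<phi> by (simp add: c_def)
  define p where "p x = (1 / c) *\<^sub>R \<phi> x" for x
  define p' where "p' x = (1 / c) *\<^sub>R \<phi>' x" for x
  have tp0: "twice_deriv l p p' (\<lambda>x. (1 / c) *\<^sub>R - (W_minus f \<beta> \<phi> x *\<^sub>R \<phi> x))"
    unfolding p_def[abs_def] p'_def[abs_def] by (rule twice_deriv_bounded_linear[OF \<phi>(1) bounded_linear_scaleR_right])
  have tp: "twice_deriv l p p' (\<lambda>x. - (W_minus f \<beta> \<phi> x *\<^sub>R p x))"
    by (rule twice_deriv_cong[OF tp0]) (simp add: p_def)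
  have p: "p 0 = 0" "p' 0 = 1" "p l = 0" using \<phi> c by (simp_all add: p_def p'_def c_def)
  have ql: "q l < 0" using sturm_oscillation(1)[OF l W(1) q(1-3)] q(4) P by simp
  have pl: "p' l < 0" using sturm_oscillation(2)[OF l W(2) tp p(1,2)] p(3) Q by simp
  show "spectrally_unstable f l \<beta> \<phi>" if pos: "0 < integral {0..l} (\<lambda>x. u x * \<phi> x)"
  proof -
    define h where "h x = (1 / c) *\<^sub>R u x" for x
    have "twice_deriv l h (\<lambda>x. (1 / c) *\<^sub>R u' x) (\<lambda>x. (1 / c) *\<^sub>R (- (W_plus f \<beta> \<phi> x * u x) - \<phi> x))"
      unfolding h_def[abs_def] by (rule twice_deriv_bounded_linear[OF u(1) bounded_linear_scaleR_right])
    then have th: "twice_deriv l h (\<lambda>x. (1 / c) *\<^sub>R u' x) (\<lambda>x. - (W_plus f \<beta> \<phi> x *\<^sub>R h x) - p x)"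
      by (rule twice_deriv_cong) (simp add: h_def p_def algebra_simps diff_divide_distrib)
    have "(\<lambda>x. h x * p x) = (\<lambda>x. (1 / (c * c)) * (u x * \<phi> x))" by (simp add: h_def p_def fun_eq_iff)
    then have "integral {0..l} (\<lambda>x. h x * p x) = (1 / (c * c)) * integral {0..l} (\<lambda>x. u x * \<phi> x)" by simp
    also have "\<dots> > 0" using pos c by (intro mult_pos_pos) (auto simp: zero_less_mult_iff)
    finally have "0 < integral {0..l} (\<lambda>x. h x * p x)" .
    moreover have "h 0 = 0" "h l = 0" using u by (simp_all add: h_def)
    ultimately obtain \<mu> where \<mu>: "\<mu> > 0" and "\<exists>u v u' v'. twice_deriv l u u' (\<lambda>x. - (W_plus f \<beta> \<phi> x * u x) - \<mu> * v x) \<and>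
      twice_deriv l v v' (\<lambda>x. - (W_minus f \<beta> \<phi> x * v x) + \<mu> * u x) \<and>
      u 0 = 0 \<and> u l = 0 \<and> v 0 = 0 \<and> v l = 0 \<and> (\<exists>x\<in>{0..l}. u x \<noteq> 0 \<or> v x \<noteq> 0)"
      using unstable_eigenfunction_exists[OF l W q(1-3) ql tp p pl th] by blast
    then have "complex_of_real \<mu> \<in> Spec_N f l \<beta> \<phi>"
      using eigenfunction_in_Spec_N[OF l W] by blast
    then show ?thesis using \<mu> unfolding spectrally_unstable_def by (intro bexI[of _ "complex_of_real \<mu>"]) simp_all
  qed
  show "spectrally_stable f l \<beta> \<phi>" if neg: "integral {0..l} (\<lambda>x. u x * \<phi> x) < 0"
  proof -
    have ppos: "\<forall>x. 0 < x \<and> x < l \<longrightarrow> 0 < p x"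
      using sturm_oscillation(4)[OF l W(2) tp p(1,2) p(3) Q] .
    obtain d where d: "0 < d" "d < l" "q d = 0" "\<forall>x. 0 < x \<and> x < d \<longrightarrow> 0 < q x" "\<forall>x. d < x \<and> x \<le> l \<longrightarrow> q x < 0"
      using sturm_oscillation(3)[OF l W(1) q(1-3) q(4) P] by blast
    note nonneg = form_nonneg_positive_solution[OF l W(2) tp p(2) ppos]
    note perp = form_nonneg_on_complement[OF l W(1) q(1,3) d u(1)[folded real_scaleR_def] u(2,3) twice_deriv_continuous(1)[OF \<phi>(1)] neg]
    have "\<mu> \<notin> Spec_N f l \<beta> \<phi>" if \<mu>: "0 < Re \<mu>" for \<mu>
    proof -
      have "nondeg l (linearized (W_plus f \<beta> \<phi>) (W_minus f \<beta> \<phi>) \<mu>)"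
        by (rule nondeg_linearized[OF l W nonneg perp \<phi>(1)[unfolded real_scaleR_def] \<phi>(2,3) \<mu>])
      from N_boundedly_invertible[OF l W this] show ?thesis by (simp add: Spec_N_def)
    qed
    then show ?thesis unfolding spectrally_stable_def spectrally_unstable_def by blast
  qed
qed

lemma is_q_twice_deriv:
  assumes "is_q f l \<beta> \<phi> q"
  shows "twice_deriv l q (deriv_on {0..l} q) (\<lambda>x. - (W_plus f \<beta> \<phi> x *\<^sub>R q x))"
proof (rule twice_deriv_cong)
  show "twice_deriv l q (deriv_on {0..l} q) (deriv_on {0..l} (deriv_on {0..l} q))"
    using assms by (intro C_on_2_twice_deriv) (simp add: is_q_def)
  fix x assume "x \<in> {0..l}"
  then have "- deriv_on {0..l} (deriv_on {0..l} q) x - W_plus f \<beta> \<phi> x * q x = 0" using assms unfolding is_q_def by blast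
  then show "deriv_on {0..l} (deriv_on {0..l} q) x = - (W_plus f \<beta> \<phi> x *\<^sub>R q x)" by simp
qed

lemma twice_deriv_is_q:
  assumes l: "0 < l" and c: "continuous_on {0..l} (W_plus f \<beta> \<phi>)"
    and q: "twice_deriv l q q' (\<lambda>x. - (W_plus f \<beta> \<phi> x *\<^sub>R q x))" "q 0 = (0::real)" "q' 0 = 1"
  shows "is_q f l \<beta> \<phi> q"
proof -
  note d = C_on_2_of_twice_deriv[OF l q(1)]
  have "continuous_on {0..l} (\<lambda>x. - (W_plus f \<beta> \<phi> x *\<^sub>R q x))"
    by (intro continuous_intros c twice_deriv_continuous(1)[OF q(1)])
  moreover have "deriv_on {0..l} q 0 = 1" using d(1)[of 0] q(3) l by simp
  ultimately show ?thesis using d q(2) by (simp add: is_q_def)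
qed

lemma Dirichlet_family_is_family: "Dirichlet_family f l \<beta>0 \<phi>0 e \<phi> \<Longrightarrow> family f l \<beta>0 \<phi>0 e \<phi>"
proof -
  assume F: "Dirichlet_family f l \<beta>0 \<phi>0 e \<phi>"
  then have "C1_map_into (Dir_dom l) (H2_norm l) (ball \<beta>0 e) \<phi>" by (simp add: Dirichlet_family_def)
  then have "C1_map_into (H2 l) (H2_norm l) (ball \<beta>0 e) \<phi>"
    unfolding C1_map_into_def Dir_dom_def Int_iff by (elim conjE exE) (intro conjI exI; assumption | blast)
  then show "family f l \<beta>0 \<phi>0 e \<phi>" using F by (simp add: Dirichlet_family_def family_def)
qed

text \<open>The end slopes of the profile have equal modulus by conservation of energy, and the sign of
  their ratio is the sign statement of \<open>sturm_oscillation\<close> for \<open>L_-\<close>, whose kernel contains the profile.\<close>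

lemma profile_end_slopes:
  fixes \<phi> :: "real \<Rightarrow> real"
  assumes f: "C_on 3 {0..} f" and l: "0 < l" and t: "nlsol l (nonlin f) \<beta> \<phi> \<phi>'"
    and bc: "\<phi> 0 = 0" "\<phi> l = 0" and x: "x \<in> {0..l}" "\<phi> x \<noteq> 0"
  shows "\<phi>' 0 \<noteq> 0" and "\<phi>' l = - ((-1) ^ card (neg_eigs l (W_minus f \<beta> \<phi>))) * \<phi>' 0"
proof -
  note c\<phi> = twice_deriv_continuous(1)[OF t[unfolded nlsol_def]]
  note W = continuous_W(2)[OF f c\<phi>, of \<beta>]
  have tW: "twice_deriv l \<phi> \<phi>' (\<lambda>x. - (W_minus f \<beta> \<phi> x *\<^sub>R \<phi> x))"
    using t by (simp add: nlsol_def nonlin_W_minus)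
  obtain K where K: "linsys l (\<lambda>x v :: real. - (W_minus f \<beta> \<phi> x *\<^sub>R v)) K" using linsys_scaleR[OF l W] by blast
  have t0: "twice_deriv l (\<lambda>x. 0::real) (\<lambda>x. 0) (\<lambda>x. 0)" by (auto simp: twice_deriv_def)
  show n0: "\<phi>' 0 \<noteq> 0"
  proof
    assume "\<phi>' 0 = 0"
    then have "\<phi> x = 0"
      using linsys_unique(1)[OF K tW t0, where r = "\<lambda>x. 0" and x = x] bc x(1) by simp
    then show False using x by simp
  qed
  define c where "c = \<phi>' 0"
  have c: "c \<noteq> 0" using n0 by (simp add: c_def)
  define p where "p x = (1 / c) *\<^sub>R \<phi> x" for x
  define p' where "p' x = (1 / c) *\<^sub>R \<phi>' x" for x
  have "twice_deriv l p p' (\<lambda>x. (1 / c) *\<^sub>R - (W_minus f \<beta> \<phi> x *\<^sub>R \<phi> x))"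
    unfolding p_def[abs_def] p'_def[abs_def] by (rule twice_deriv_bounded_linear[OF tW bounded_linear_scaleR_right])
  then have tp: "twice_deriv l p p' (\<lambda>x. - (W_minus f \<beta> \<phi> x *\<^sub>R p x))"
    by (rule twice_deriv_cong) (simp add: p_def)
  have p: "p 0 = 0" "p' 0 = 1" "p l = 0" using bc c by (simp_all add: p_def p'_def c_def)
  have pos: "0 < (-1) ^ Suc (card (neg_eigs l (W_minus f \<beta> \<phi>))) * p' l"
    by (rule sturm_oscillation(2)[OF l W tp p])
  have "continuous_on UNIV (\<lambda>u. nonlin f u + \<beta> * u)"
    by (intro continuous_intros continuous_at_imp_continuous_on ballI DERIV_isCont[OF nonlin_derivative[OF f]])
  from energy_conservation[OF l this t[unfolded nlsol_def]] bc have "(\<phi>' l)\<^sup>2 = (\<phi>' 0)\<^sup>2" by simp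
  then have "\<phi>' l = c \<or> \<phi>' l = - c" by (simp add: c_def power2_eq_iff)
  then have "p' l = 1 \<or> p' l = - 1" using c by (auto simp: p'_def)
  moreover define \<sigma> where "\<sigma> = (-1::real) ^ card (neg_eigs l (W_minus f \<beta> \<phi>))"
  have "\<sigma> = 1 \<or> \<sigma> = -1" by (simp add: \<sigma>_def minus_one_power_iff)
  ultimately have "p' l = - \<sigma>" using pos by (auto simp: \<sigma>_def)
  then have "\<phi>' l = - \<sigma> * c" using c by (simp add: p'_def field_simps)
  then show "\<phi>' l = - ((-1) ^ card (neg_eigs l (W_minus f \<beta> \<phi>))) * \<phi>' 0" by (simp add: \<sigma>_def c_def)
qed

theorem proposition5p6:
  fixes f :: "real \<Rightarrow> real" and l \<beta>0 :: real and \<phi>0 :: "real \<Rightarrow> real"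
  assumes f_C3: "C_on 3 {0..} f"
    and l_pos: "0 < l"
    and phi0_sol: "is_solution f l \<beta>0 \<phi>0"
    and phi0_bc: "\<phi>0 0 = 0" "\<phi>0 l = 0"
    and phi0_nontrivial: "\<exists>x\<in>{0..l}. \<phi>0 x \<noteq> 0"
    and zero_notin_spec: "0 \<notin> Spec l (L_minus f l \<beta>0 \<phi>0) \<inter> Spec l (L_plus f l \<beta>0 \<phi>0)"
  shows
    "(\<exists>e \<phi>h. Dirichlet_family f l \<beta>0 \<phi>0 e \<phi>h \<and>
        (\<forall>e' \<phi>'. Dirichlet_family f l \<beta>0 \<phi>0 e' \<phi>' \<longrightarrow>
           (\<exists>d>0. d \<le> e \<and> d \<le> e' \<and> (\<forall>\<beta>\<in>ball \<beta>0 d. \<forall>x\<in>{0..l}. \<phi>' \<beta> x = \<phi>h \<beta> x))))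
     \<and> (\<phi>0 \<in> Dir_dom l \<and> (AE x in leb l. L_minus f l \<beta>0 \<phi>0 \<phi>0 x = 0))
     \<and> (\<exists>u. u \<in> Dir_dom l \<and> (AE x in leb l. L_plus f l \<beta>0 \<phi>0 u x = \<phi>0 x) \<and>
          (\<forall>w\<in>Dir_dom l. (AE x in leb l. L_plus f l \<beta>0 \<phi>0 w x = \<phi>0 x) \<longrightarrow>
             (AE x in leb l. w x = u x)) \<and>
          (\<forall>e \<phi>h. Dirichlet_family f l \<beta>0 \<phi>0 e \<phi>h \<longrightarrow>
             (\<lambda>\<beta>. mass l (\<phi>h \<beta>)) field_differentiable at \<beta>0 \<and>
             (\<integral>x. u x * \<phi>0 x \<partial>leb l) = rhs_A l \<beta>0 \<phi>h) \<and>
          (\<forall>e \<phi> q. family f l \<beta>0 \<phi>0 e \<phi> \<and> is_q f l \<beta>0 \<phi>0 q \<longrightarrow>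
             (\<lambda>\<beta>. mass l (\<phi> \<beta>)) field_differentiable at \<beta>0 \<and>
             (\<lambda>\<beta>. \<phi> \<beta> 0) field_differentiable at \<beta>0 \<and>
             (\<lambda>\<beta>. \<phi> \<beta> l) field_differentiable at \<beta>0 \<and>
             (\<lambda>\<beta>. deriv_on {0..l} (\<phi> \<beta>) l) field_differentiable at \<beta>0 \<and>
             q l \<noteq> 0 \<and>
             (\<integral>x. u x * \<phi>0 x \<partial>leb l) = rhs_B l \<beta>0 (num_Q f l \<beta>0 \<phi>0) q \<phi>))
     \<and> (num_P f l \<beta>0 \<phi>0 = 1 \<and> num_Q f l \<beta>0 \<phi>0 = 0 \<longrightarrow>
          (\<forall>e \<phi>h. Dirichlet_family f l \<beta>0 \<phi>0 e \<phi>h \<longrightarrow>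
             (rhs_A l \<beta>0 \<phi>h > 0 \<longrightarrow> spectrally_unstable f l \<beta>0 \<phi>0) \<and>
             (rhs_A l \<beta>0 \<phi>h < 0 \<longrightarrow> spectrally_stable f l \<beta>0 \<phi>0)) \<and>
          (\<forall>e \<phi> q. family f l \<beta>0 \<phi>0 e \<phi> \<and> is_q f l \<beta>0 \<phi>0 q \<longrightarrow>
             (rhs_B l \<beta>0 (num_Q f l \<beta>0 \<phi>0) q \<phi> > 0 \<longrightarrow> spectrally_unstable f l \<beta>0 \<phi>0) \<and>
             (rhs_B l \<beta>0 (num_Q f l \<beta>0 \<phi>0) q \<phi> < 0 \<longrightarrow> spectrally_stable f l \<beta>0 \<phi>0)))"
proof -
  define \<phi>0' where "\<phi>0' = deriv_on {0..l} \<phi>0"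
  note l = l_pos
  have n: "nlsol l (nonlin f) \<beta>0 \<phi>0 \<phi>0'" unfolding \<phi>0'_def by (rule is_solution_nlsol[OF phi0_sol])
  note t = n[unfolded nlsol_def]
  note c\<phi> = twice_deriv_continuous(1)[OF t]
  note W = continuous_W[OF f_C3 c\<phi>, of \<beta>0]
  have tW: "twice_deriv l \<phi>0 \<phi>0' (\<lambda>x. - (W_minus f \<beta>0 \<phi>0 x *\<^sub>R \<phi>0 x))"
    using t by (simp add: nonlin_W_minus)
  have cs: "continuous_on {0..l} (\<lambda>x. - (W_minus f \<beta>0 \<phi>0 x *\<^sub>R \<phi>0 x))" by (intro continuous_intros W c\<phi>)
  obtain x0 where x0: "x0 \<in> {0..l}" "\<phi>0 x0 \<noteq> 0" using phi0_nontrivial by blast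
  note slopes = profile_end_slopes[OF f_C3 l n phi0_bc x0]
  \<comment> \<open>as the profile lies in the kernel of \<open>L_-\<close>, the assumption says that \<open>L_+\<close> is invertible\<close>
  have "0 \<in> Spec l (L_minus f l \<beta>0 \<phi>0)" by (rule kernel_in_Spec[OF l W(2) tW phi0_bc x0])
  then have nspec: "0 \<notin> Spec l (L_plus f l \<beta>0 \<phi>0)" using zero_notin_spec by blast
  have ql: "q l \<noteq> 0" if q: "twice_deriv l q q' (\<lambda>x. - (W_plus f \<beta>0 \<phi>0 x *\<^sub>R q x))" "q 0 = 0" "q' 0 = 1"
    for q q' :: "real \<Rightarrow> real"
  proof
    assume z: "q l = 0"
    have "q x = 0" if x: "x \<in> {0..l}" for x
      using kernel_in_Spec[OF l W(1) q(1,2) z x] nspec by blast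
    moreover have "twice_deriv l (\<lambda>x. 0::real) (\<lambda>x. 0) (\<lambda>x. 0)" by (auto simp: twice_deriv_def)
    ultimately have "q' 0 = 0"
      using twice_deriv_derivative_unique[OF l q(1), where u' = "\<lambda>x. 0" and p' = "\<lambda>x. 0" and s' = "\<lambda>x. 0" and x = 0] l by simp
    then show False using q(3) by simp
  qed
  obtain K where K: "linsys l (\<lambda>x v :: real. - (W_plus f \<beta>0 \<phi>0 x *\<^sub>R v)) K" using linsys_scaleR[OF l W(1)] by blast
  obtain q0 q0' where tq0: "twice_deriv l q0 q0' (\<lambda>x. - (W_plus f \<beta>0 \<phi>0 x *\<^sub>R q0 x))"
      and q0: "q0 0 = (0::real)" "q0' 0 = 1"
    using linsys_exists[OF K continuous_on_const[where c = 0], of 0 1] by (auto simp del: real_scaleR_def)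
  note ql0 = ql[OF tq0 q0]
  have q0_is: "is_q f l \<beta>0 \<phi>0 q0" by (rule twice_deriv_is_q[OF l W(1) tq0 q0])
  have nd: "nondeg l (\<lambda>x v :: real. - (W_plus f \<beta>0 \<phi>0 x *\<^sub>R v))" by (rule nondeg_scaleR[OF l W(1) tq0 q0 ql0])
  have "continuous_on {0..l} (\<lambda>x. - \<phi>0 x)" by (intro continuous_intros c\<phi>)
  from dirichlet_solve[OF K nd this, of 0 0]
  obtain u u' where "twice_deriv l u u' (\<lambda>x. - (W_plus f \<beta>0 \<phi>0 x *\<^sub>R u x) + - \<phi>0 x)" and u0: "u 0 = 0" "u l = 0" by blast
  then have tu: "twice_deriv l u u' (\<lambda>x. - (W_plus f \<beta>0 \<phi>0 x * u x) - \<phi>0 x)" by simp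
  note cu = twice_deriv_continuous(1)[OF tu]
  have csu: "continuous_on {0..l} (\<lambda>x. - (W_plus f \<beta>0 \<phi>0 x * u x) - \<phi>0 x)" by (intro continuous_intros W c\<phi> cu)
  have Iu: "(\<integral>x. u x * \<phi>0 x \<partial>leb l) = integral {0..l} (\<lambda>x. u x * \<phi>0 x)"
    by (intro integral_leb integrable_leb_continuous continuous_intros cu c\<phi>)

  have solvable: "u \<in> Dir_dom l" "AE x in leb l. L_plus f l \<beta>0 \<phi>0 u x = \<phi>0 x"
    using Dir_dom_twice_deriv[OF l tu csu u0] schr_twice_deriv[OF l tu csu, of "W_plus f \<beta>0 \<phi>0"] by simp_all
  have unique: "AE x in leb l. w x = u x" if w: "w \<in> Dir_dom l" "AE x in leb l. L_plus f l \<beta>0 \<phi>0 w x = \<phi>0 x" for w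
  proof -
    obtain U V where U: "twice_deriv l U V (\<lambda>x. - (W_plus f \<beta>0 \<phi>0 x *\<^sub>R U x) - \<phi>0 x)" "U 0 = 0" "U l = 0"
        and wU: "AE x in leb l. w x = U x"
      using schr_regularity[OF l W(1) w(1) c\<phi> w(2)] by blast
    have "twice_deriv l (\<lambda>x. U x - u x) (\<lambda>x. V x - u' x) (\<lambda>x. - (W_plus f \<beta>0 \<phi>0 x *\<^sub>R (U x - u x)))"
      by (rule twice_deriv_cong[OF twice_deriv_diff[OF U(1) tu]]) (simp add: algebra_simps)
    then have "U x - u x = 0" if "x \<in> {0..l}" for x
      using nd U u0 that unfolding nondeg_def by (metis diff_self)
    then have "AE x in leb l. U x = u x" by (intro AE_lebI) simp
    with wU show ?thesis by eventually_elim simp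
  qed

  have Qeq: "num_Q f l \<beta>0 \<phi>0 = card (neg_eigs l (W_minus f \<beta>0 \<phi>0))"
    and Peq: "num_P f l \<beta>0 \<phi>0 = card (neg_eigs l (W_plus f \<beta>0 \<phi>0))"
    by (rule num_neg_eigenvalues_eq[OF l W(2)], rule num_neg_eigenvalues_eq[OF l W(1)])
  define \<sigma> where "\<sigma> = (-1::real) ^ num_Q f l \<beta>0 \<phi>0"
  have \<sigma>: "\<sigma> * \<sigma> = 1" "\<phi>0' l = - \<sigma> * \<phi>0' 0"
    using slopes(2) by (simp_all add: \<sigma>_def Qeq flip: power_add)
  note g = nonlin_derivative[OF f_C3]
  note cg = continuous_nonlin'[OF f_C3]

  have fam: "\<exists>G G'. twice_deriv l G G' (\<lambda>x. - ((nonlin' f (\<phi>0 x) + \<beta>0) * G x) - \<phi>0 x) \<and>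
    (\<forall>x\<in>{0..l}. ((\<lambda>\<beta>. \<phi> \<beta> x) has_real_derivative G x) (at \<beta>0)) \<and>
    (\<forall>x\<in>{0..l}. ((\<lambda>\<beta>. deriv_on {0..l} (\<phi> \<beta>) x) has_real_derivative G' x) (at \<beta>0)) \<and>
    ((\<lambda>\<beta>. mass l (\<phi> \<beta>)) has_real_derivative 2 * integral {0..l} (\<lambda>x. G x * \<phi>0 x)) (at \<beta>0) \<and>
    (\<forall>\<delta>>0. \<exists>d>0. d \<le> e \<and> (\<forall>\<beta>\<in>ball \<beta>0 d. \<forall>x\<in>{0..l}. \<bar>\<phi> \<beta> x - \<phi>0 x\<bar> \<le> \<delta>))"
    if "family f l \<beta>0 \<phi>0 e \<phi>" for e \<phi>
    by (rule family_derivative[OF l g cg, where \<phi> = \<phi> and \<phi>' = "\<lambda>\<beta>. deriv_on {0..l} (\<phi> \<beta>)"])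
      (use that in \<open>auto simp: family_def intro: is_solution_nlsol\<close>)

  have B: "(\<lambda>\<beta>. mass l (\<phi> \<beta>)) field_differentiable at \<beta>0 \<and>
      (\<lambda>\<beta>. \<phi> \<beta> 0) field_differentiable at \<beta>0 \<and>
      (\<lambda>\<beta>. \<phi> \<beta> l) field_differentiable at \<beta>0 \<and>
      (\<lambda>\<beta>. deriv_on {0..l} (\<phi> \<beta>) l) field_differentiable at \<beta>0 \<and>
      q l \<noteq> 0 \<and> (\<integral>x. u x * \<phi>0 x \<partial>leb l) = rhs_B l \<beta>0 (num_Q f l \<beta>0 \<phi>0) q \<phi>"
    if F: "family f l \<beta>0 \<phi>0 e \<phi>" and q: "is_q f l \<beta>0 \<phi>0 q" for e \<phi> q
  proof -
    obtain G G' where G: "twice_deriv l G G' (\<lambda>x. - ((nonlin' f (\<phi>0 x) + \<beta>0) * G x) - \<phi>0 x)"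
      and d: "\<forall>x\<in>{0..l}. ((\<lambda>\<beta>. \<phi> \<beta> x) has_real_derivative G x) (at \<beta>0)"
        "\<forall>x\<in>{0..l}. ((\<lambda>\<beta>. deriv_on {0..l} (\<phi> \<beta>) x) has_real_derivative G' x) (at \<beta>0)"
      and m: "((\<lambda>\<beta>. mass l (\<phi> \<beta>)) has_real_derivative 2 * integral {0..l} (\<lambda>x. G x * \<phi>0 x)) (at \<beta>0)"
      using fam[OF F] by blast
    have G: "twice_deriv l G G' (\<lambda>x. - (W_plus f \<beta>0 \<phi>0 x * G x) - \<phi>0 x)"
      using G by (simp add: W_plus_eq)
    have e: "((\<lambda>\<beta>. \<phi> \<beta> 0) has_real_derivative G 0) (at \<beta>0)" "((\<lambda>\<beta>. \<phi> \<beta> l) has_real_derivative G l) (at \<beta>0)"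
      "((\<lambda>\<beta>. deriv_on {0..l} (\<phi> \<beta>) l) has_real_derivative G' l) (at \<beta>0)"
      using d l by simp_all
    note tq = is_q_twice_deriv[OF q]
    have q': "q 0 = 0" "deriv_on {0..l} q 0 = 1" using q by (simp_all add: is_q_def)
    have "integral {0..l} (\<lambda>x. u x * \<phi>0 x) = integral {0..l} (\<lambda>x. G x * \<phi>0 x)
      + (\<sigma> * G 0 + G l) * ((G 0 + \<sigma> * G l) / q l + G' l)"
      by (rule boundary_correction[OF l W(1) solution_derivative_solves_linearization[OF f_C3 t] twice_derivD(1)[OF t]
          phi0_bc _ _ \<sigma> slopes(1) tq q' ql[OF tq q'] tu u0 G]) (simp_all add: phi0_bc nonlin_def)
    then have "(\<integral>x. u x * \<phi>0 x \<partial>leb l) = rhs_B l \<beta>0 (num_Q f l \<beta>0 \<phi>0) q \<phi>"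
      using DERIV_imp_deriv[OF m] e[THEN DERIV_imp_deriv] by (simp add: rhs_B_def Iu \<sigma>_def)
    then show ?thesis using m e ql[OF tq q'] unfolding field_differentiable_def by blast
  qed

  have A: "(\<lambda>\<beta>. mass l (\<phi>h \<beta>)) field_differentiable at \<beta>0 \<and> (\<integral>x. u x * \<phi>0 x \<partial>leb l) = rhs_A l \<beta>0 \<phi>h"
    if F: "Dirichlet_family f l \<beta>0 \<phi>0 e \<phi>h" for e \<phi>h
  proof -
    have z: "deriv (\<lambda>\<beta>. \<phi>h \<beta> y) \<beta>0 = 0" if y: "y = 0 \<or> y = l" for y
    proof (rule DERIV_imp_deriv)
      have z: "\<beta> \<in> ball \<beta>0 e \<Longrightarrow> \<phi>h \<beta> y = 0" for \<beta> using F y unfolding Dirichlet_family_def by blast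
      have "\<beta>0 \<in> ball \<beta>0 e" using F by (simp add: Dirichlet_family_def)
      from has_field_derivative_transform_within_open[OF DERIV_const[of 0] open_ball this] z
      show "((\<lambda>\<beta>. \<phi>h \<beta> y) has_real_derivative 0) (at \<beta>0)" by fastforce
    qed
    have "rhs_B l \<beta>0 (num_Q f l \<beta>0 \<phi>0) q0 \<phi>h = rhs_A l \<beta>0 \<phi>h"
      using z by (simp add: rhs_B_def rhs_A_def)
    then show ?thesis using B[OF Dirichlet_family_is_family[OF F] q0_is] by simp
  qed

  have stab: "(r > 0 \<longrightarrow> spectrally_unstable f l \<beta>0 \<phi>0) \<and> (r < 0 \<longrightarrow> spectrally_stable f l \<beta>0 \<phi>0)"
    if PQ: "num_P f l \<beta>0 \<phi>0 = 1" "num_Q f l \<beta>0 \<phi>0 = 0" and r: "(\<integral>x. u x * \<phi>0 x \<partial>leb l) = r" for r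
    using spectral_stability_criterion[OF l W tW phi0_bc slopes(1) tq0 q0 ql0 PQ(1)[unfolded Peq] PQ(2)[unfolded Qeq] tu u0] r Iu by simp

  have exist: "\<exists>e \<phi>h. Dirichlet_family f l \<beta>0 \<phi>0 e \<phi>h \<and>
        (\<forall>e' \<phi>'. Dirichlet_family f l \<beta>0 \<phi>0 e' \<phi>' \<longrightarrow>
           (\<exists>d>0. d \<le> e \<and> d \<le> e' \<and> (\<forall>\<beta>\<in>ball \<beta>0 d. \<forall>x\<in>{0..l}. \<phi>' \<beta> x = \<phi>h \<beta> x)))"
  proof -
    have "twice_deriv l q0 q0' (\<lambda>x. - ((nonlin' f (\<phi>0 x) + \<beta>0) *\<^sub>R q0 x))" using tq0 by (simp add: W_plus_eq)
    from dirichlet_family_exists[OF l g cg n phi0_bc this q0 ql0]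
    obtain e \<delta> F F' where e: "0 < e" "0 < \<delta>"
      and F: "\<forall>\<beta>\<in>ball \<beta>0 e. nlsol l (nonlin f) \<beta> (F \<beta>) (F' \<beta>) \<and> F \<beta> 0 = 0 \<and> F \<beta> l = 0"
        "\<forall>x\<in>{0..l}. F \<beta>0 x = \<phi>0 x"
      and uniq: "\<forall>\<beta>\<in>ball \<beta>0 e. \<forall>\<phi> \<phi>'. nlsol l (nonlin f) \<beta> \<phi> \<phi>' \<longrightarrow> \<phi> 0 = 0 \<longrightarrow> \<phi> l = 0 \<longrightarrow>
         (\<forall>x\<in>{0..l}. \<bar>\<phi> x - \<phi>0 x\<bar> \<le> \<delta>) \<longrightarrow> (\<forall>x\<in>{0..l}. \<phi> x = F \<beta> x)"
      and C1: "C1_map_into (Dir_dom l) (H2_norm l) (ball \<beta>0 e) F"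
      by blast
    have DF: "Dirichlet_family f l \<beta>0 \<phi>0 e F"
      unfolding Dirichlet_family_def using e F C1 nlsol_is_solution[OF f_C3 l] by blast
    have "\<exists>d>0. d \<le> e \<and> d \<le> e' \<and> (\<forall>\<beta>\<in>ball \<beta>0 d. \<forall>x\<in>{0..l}. \<phi>' \<beta> x = F \<beta> x)"
      if D': "Dirichlet_family f l \<beta>0 \<phi>0 e' \<phi>'" for e' \<phi>'
    proof -
      obtain d where d: "d > 0" "d \<le> e'" "\<forall>\<beta>\<in>ball \<beta>0 d. \<forall>x\<in>{0..l}. \<bar>\<phi>' \<beta> x - \<phi>0 x\<bar> \<le> \<delta>"
        using fam[OF Dirichlet_family_is_family[OF D']] e(2) by blast
      have "\<forall>x\<in>{0..l}. \<phi>' \<beta> x = F \<beta> x" if b: "\<beta> \<in> ball \<beta>0 (min d e)" for \<beta>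
      proof -
        have b': "\<beta> \<in> ball \<beta>0 d" "\<beta> \<in> ball \<beta>0 e" "\<beta> \<in> ball \<beta>0 e'" using b d(2) by auto
        have s: "is_solution f l \<beta> (\<phi>' \<beta>)" "\<phi>' \<beta> 0 = 0" "\<phi>' \<beta> l = 0"
          using D' b'(3) unfolding Dirichlet_family_def by blast+
        show ?thesis using uniq b'(2) is_solution_nlsol[OF s(1)] s(2,3) d(3) b'(1) by blast
      qed
      then show ?thesis using d e by (intro exI[of _ "min d e"]) auto
    qed
    then show ?thesis using DF by blast
  qed

  have ker: "\<phi>0 \<in> Dir_dom l" "AE x in leb l. L_minus f l \<beta>0 \<phi>0 \<phi>0 x = 0"
    using Dir_dom_twice_deriv[OF l tW cs phi0_bc] schr_twice_deriv[OF l tW cs, of "W_minus f \<beta>0 \<phi>0"] by simp_all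
  show ?thesis
  proof (intro conjI impI allI)
    show "\<exists>e \<phi>h. Dirichlet_family f l \<beta>0 \<phi>0 e \<phi>h \<and>
        (\<forall>e' \<phi>'. Dirichlet_family f l \<beta>0 \<phi>0 e' \<phi>' \<longrightarrow>
           (\<exists>d>0. d \<le> e \<and> d \<le> e' \<and> (\<forall>\<beta>\<in>ball \<beta>0 d. \<forall>x\<in>{0..l}. \<phi>' \<beta> x = \<phi>h \<beta> x)))" by (rule exist)
    show "\<phi>0 \<in> Dir_dom l" "AE x in leb l. L_minus f l \<beta>0 \<phi>0 \<phi>0 x = 0" by (rule ker)+
    show "\<exists>u. u \<in> Dir_dom l \<and> (AE x in leb l. L_plus f l \<beta>0 \<phi>0 u x = \<phi>0 x) \<and>
          (\<forall>w\<in>Dir_dom l. (AE x in leb l. L_plus f l \<beta>0 \<phi>0 w x = \<phi>0 x) \<longrightarrow>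
             (AE x in leb l. w x = u x)) \<and>
          (\<forall>e \<phi>h. Dirichlet_family f l \<beta>0 \<phi>0 e \<phi>h \<longrightarrow>
             (\<lambda>\<beta>. mass l (\<phi>h \<beta>)) field_differentiable at \<beta>0 \<and>
             (\<integral>x. u x * \<phi>0 x \<partial>leb l) = rhs_A l \<beta>0 \<phi>h) \<and>
          (\<forall>e \<phi> q. family f l \<beta>0 \<phi>0 e \<phi> \<and> is_q f l \<beta>0 \<phi>0 q \<longrightarrow>
             (\<lambda>\<beta>. mass l (\<phi> \<beta>)) field_differentiable at \<beta>0 \<and>
             (\<lambda>\<beta>. \<phi> \<beta> 0) field_differentiable at \<beta>0 \<and>
             (\<lambda>\<beta>. \<phi> \<beta> l) field_differentiable at \<beta>0 \<and>
             (\<lambda>\<beta>. deriv_on {0..l} (\<phi> \<beta>) l) field_differentiable at \<beta>0 \<and>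
             q l \<noteq> 0 \<and>
             (\<integral>x. u x * \<phi>0 x \<partial>leb l) = rhs_B l \<beta>0 (num_Q f l \<beta>0 \<phi>0) q \<phi>)"
    proof (rule exI[of _ u], intro conjI ballI allI impI)
      show "u \<in> Dir_dom l" "AE x in leb l. L_plus f l \<beta>0 \<phi>0 u x = \<phi>0 x" by (rule solvable)+
    next
      fix w assume "w \<in> Dir_dom l" "AE x in leb l. L_plus f l \<beta>0 \<phi>0 w x = \<phi>0 x"
      then show "AE x in leb l. w x = u x" by (rule unique)
    qed (use A B in blast)+
  qed (use A B stab in blast)+
qed

end
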